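(* Let $\overline{\varepsilon}\in\mathbb{R}$, $\hbar>0$, and let $v^{\rm out}=\{V_k^{\rm out}\}_{k=1}^\infty$, $v^{\rm in}=\{V_k^{\rm in}\}_{k=1}^\infty$ be two specializations, defining a Jack measure $M(v^{\rm out},v^{\rm in})$, which satisfy $\max(|V_k^{\rm out}|,|V_k^{\rm in}|)\le Ar^k$ for all $k$, for some $A>0$ and $0<r<1$. Let $f_\lambda(c\,|\,\overline{\varepsilon},\hbar)$ be the random anisotropic partition profile of $\lambda$ sampled from $M(v^{\rm out},v^{\rm in})$, and let $T^\uparrow_\ell(\overline{\varepsilon},\hbar)$ be the associated random variables defined in the context. Let $n\in\{1,2,3,\ldots\}$, $\vec\ell=(\ell_1,\ldots,\ell_n)\in\mathbb{Z}_+^n$ and $\|\vec\ell\|_1=\ell_1+\cdots+\ell_n$. (1) The joint moments are polynomials in $\overline{\varepsilon}$ and $\hbar$: $$\mathbb{E}\big[T^\uparrow_{\ell_1}(\overline{\varepsilon},\hbar)\cdots T^\uparrow_{\ell_n}(\overline{\varepsilon},\hbar)\big]=\sum_{q=0}^{\frac12\|\vec\ell\|_1}\sum_{m=0}^{\|\vec\ell\|_1}Y_{n,q,m}(\ell_1,\ldots,\ell_n|v^{\rm out},v^{\rm in})\,\hbar^q\,\overline{\varepsilon}^m,$$ where $Y_{n,q,m}(\ell_1,\ldots,\ell_n|v^{\rm out},v^{\rm in})=\sum_{\vec\gamma}\mathfrak W(\vec\gamma|v^{\rm out},v^{\rm in})$ is finite, the sum being over all ribbon paths $\vec\gamma$ on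 $n$ sites of lengths $\ell_1,\ldots,\ell_n$ with $q$ pairings and $m$ slides. (2) The joint cumulants are polynomials in $\overline{\varepsilon}$ and $\hbar$: $$\kappa_n\big(T^\uparrow_{\ell_1}(\overline{\varepsilon},\hbar),\ldots,T^\uparrow_{\ell_n}(\overline{\varepsilon},\hbar)\big)=\sum_{g=0}^{\frac12\|\vec\ell\|_1-n+1}\sum_{m=0}^{\|\vec\ell\|_1}W_{n,g,m}(\ell_1,\ldots,\ell_n|v^{\rm out},v^{\rm in})\,\hbar^{n-1+g}\,\overline{\varepsilon}^m,$$ where $W_{n,g,m}(\ell_1,\ldots,\ell_n|v^{\rm out},v^{\rm in})=\sum_{\vec\gamma}\mathfrak W(\vec\gamma|v^{\rm out},v^{\rm in})$ is finite, the sum being over all connected ribbon paths $\vec\gamma$ on $n$ sites of lengths $\ell_1,\ldots,\ell_n$ with $n-1+g$ pairings and $m$ slides.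
   Context: Parameters. Given $\overline{\varepsilon}\in\mathbb{R}$ and $\hbar>0$, let $\varepsilon_2<0<\varepsilon_1$ be the unique reals with $\varepsilon_1+\varepsilon_2=\overline{\varepsilon}$, $-\varepsilon_1\varepsilon_2=\hbar$. Jack polynomials. A partition is a weakly decreasing sequence $\lambda_1\ge\lambda_2\ge\cdots\ge0$ of integers with finite sum $|\lambda|$. On $\mathbb{C}[\rho_1,\rho_2,\ldots]$ let $\langle\cdot,\cdot\rangle_\hbar$ (conjugate-linear in the left entry) be the inner product for which the monomials $\rho_1^{d_1}\rho_2^{d_2}\cdots$ are orthogonal with squared norm $\prod_k(\hbar k)^{d_k}d_k!$. The Jack polynomial $P_\lambda(\rho_1,\rho_2,\ldots|\overline{\varepsilon},\hbar)$ is, up to a scalar, Macdonald's Jack symmetric function with parameter $\alpha=\varepsilon_1/(-\varepsilon_2)$, with power sums $p_k=\rho_k/(-\varepsilon_2)$. Put $P^{\rm norm}_\lambda=P_\lambda/\|P_\lambda\|_\hbar$. Jack measures. A specialization is a sequence of complex numbers $\{V_k\}_{k\ge1}$ (evaluation $\rho_k\mapsto V_k$). If $\sum_k\overline{V_k^{\rm out}}V_k^{\rm in}/k<\infty$ and $\overline{P_\lambda^{\rm norm}(V^{\rm out}_1,V_2^{\rm out},\ldots|\overline{\varepsilon},\hbar)}\,P_\lambda^{\rm norm}(V^{\rm in}_1,V_2^{\rm in},\ldots|\overline{\varepsilon},\hbar)\ge0$ for every $\lambda$, the Jack measure $M(v^{\rm out},v^{\rm in})$ is the probability measure on all partitions with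 $\mathrm{Prob}(\lambda)=\overline{P_\lambda^{\rm norm}(V^{\rm out})}P_\lambda^{\rm norm}(V^{\rm in})\exp(-\frac1\hbar\sum_k\overline{V_k^{\rm out}}V_k^{\rm in}/k)$. Profiles and $T^\uparrow_\ell$. The anisotropic profile $f_\lambda(c|\overline{\varepsilon},\hbar)$ is the piecewise-linear function of $c\in\mathbb{R}$ with slopes $\pm1$ such that $\{(c,y):|c|\le y\le f_\lambda(c|\overline{\varepsilon},\hbar)\}$ is tiled by $|\lambda|$ rectangles with side lengths $-\varepsilon_2\sqrt2$, $\varepsilon_1\sqrt2$, one for each $(i,j)$ with $1\le j\le\lambda_i$: the rectangle of $(i,j)$ has lowest corner with $c$-coordinate $\varepsilon_2(i-1)+\varepsilon_1(j-1)$ and sides given by the vectors $(\varepsilon_2,-\varepsilon_2)$ and $(\varepsilon_1,\varepsilon_1)$. The numbers $T^\uparrow_\ell(\overline{\varepsilon},\hbar)|_\lambda$, $\ell\ge0$, are defined (by expansion at $u=\infty$) by $\sum_{\ell\ge0}u^{-\ell-1}T^\uparrow_\ell(\overline{\varepsilon},\hbar)|_\lambda=\exp(\int_{-\infty}^{+\infty}\log[\frac1{u-c}]\frac12f_\lambda''(c|\overline{\varepsilon},\hbar)dc)$, with $f''_\lambda$ the distributional second derivative. Ribbon paths. A sliding path $\gamma$ of length $\ell$ is a sequence of vertices $(0,j_0),(1,j_1),\ldots,(\ell,j_\ell)$ with $j_i\in\mathbb{Z}_{\ge0}$ and $j_0=j_\ell=0$. Its $i$th step is $e_i=(1,j_i-j_{i-1})$;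 it is a slide of height $j_i$ if $j_i=j_{i-1}$, and otherwise a jump of degree $\deg(e_i)=j_i-j_{i-1}\ne0$. Given sliding paths $\gamma_1,\ldots,\gamma_n$, a pairing of size $k\ge1$ is a pair $(e_{i;a},e_{i';a'})$, with $e_{i;a}$ the $i$th step of $\gamma_a$ and $e_{i';a'}$ the $i'$th step of $\gamma_{a'}$, such that $\deg(e_{i;a})=-k$, $\deg(e_{i';a'})=+k$, and either $a<a'$ or ($a=a'$ and $i<i'$). A ribbon path $\vec\gamma=(\gamma_1,\ldots,\gamma_n;p_1,\ldots,p_q)$ on $n$ sites of lengths $\ell_1,\ldots,\ell_n$ consists of $n$ sliding paths $\gamma_a$ of length $\ell_a$ and a set of $q\ge0$ pairings such that each step lies in at most one pairing. It is connected if the graph on $\{1,\ldots,n\}$ with an edge joining $a$ and $a'$ for each pairing between a step of $\gamma_a$ and a step of $\gamma_{a'}$ is connected. Its number of slides is the total over all sites. Its weight is $$\mathfrak W(\vec\gamma|v^{\rm out},v^{\rm in})=\prod_{p}\mathrm{size}(p)\prod_{e\text{ slide}}\mathrm{height}(e)\prod_{e\text{ unpaired jump},\,\deg e<0}\overline{V^{\rm out}_{-\deg e}}\prod_{e\text{ unpaired jump},\,\deg e>0}V^{\rm in}_{\deg e}.$$ $\kappa_n$ denotes the $n$th joint cumulant. Upper summation limits that are not integers are read as their integer parts, and empty sums are $0$. *)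

theory Defs
  imports
    "HOL-Analysis.Analysis"
    "HOL-Library.Poly_Mapping"
    "HOL-Library.Disjoint_Sets"
    "HOL-Library.Nonpos_Ints"
begin

section \<open>Parameters\<close>

definition eps_pair :: "real \<Rightarrow> real \<Rightarrow> real \<times> real" where
  "eps_pair e h = (THE (e1, e2). e2 < 0 \<and> 0 < e1 \<and> e1 + e2 = e \<and> - e1 * e2 = h)"

definition eps1 :: "real \<Rightarrow> real \<Rightarrow> real" where
  "eps1 e h = fst (eps_pair e h)"

definition eps2 :: "real \<Rightarrow> real \<Rightarrow> real" where
  "eps2 e h = snd (eps_pair e h)"


section \<open>Partitions\<close>

text \<open>Rows and columns are numbered from 0: \<open>row l i\<close> is the \<open>(i + 1)\<close>-st part.\<close>

typedef int_partition = "{l :: nat \<Rightarrow> nat. antimono l \<and> finite {i. l i \<noteq> 0}}"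
  morphisms row Abs_int_partition
  by (rule exI[of _ "\<lambda>_. 0"]) (auto simp: antimono_def)

definition boxes :: "int_partition \<Rightarrow> (nat \<times> nat) set" where
  "boxes l = {(i, j). j < row l i}"

definition psize :: "int_partition \<Rightarrow> nat" where
  "psize l = (\<Sum>i | row l i \<noteq> 0. row l i)"

definition dominated :: "int_partition \<Rightarrow> int_partition \<Rightarrow> bool" where
  "dominated m l \<longleftrightarrow> psize m = psize l \<and> (\<forall>k. (\<Sum>i<k. row m i) \<le> (\<Sum>i<k. row l i))"


section \<open>Polynomials and Jack polynomials\<close>

text \<open>Polynomials in variables indexed by \<open>nat\<close>; an exponent vector \<open>d\<close> stands for the product
  of the \<open>k\<close>-th variables to the powers \<open>lookup d k\<close>. Polynomials in \<open>\<rho>\<close> (or in power sums)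
  do not involve the variable with index 0.\<close>

type_synonym cpoly = "(nat \<Rightarrow>\<^sub>0 nat) \<Rightarrow>\<^sub>0 complex"

definition const :: "complex \<Rightarrow> cpoly" where
  "const c = Poly_Mapping.single 0 c"

definition monom_power :: "nat \<Rightarrow> nat \<Rightarrow> cpoly" where
  "monom_power i k = Poly_Mapping.single (Poly_Mapping.single i k) 1"

definition rho_polys :: "cpoly set" where
  "rho_polys = {P. \<forall>d \<in> Poly_Mapping.keys P. 0 \<notin> Poly_Mapping.keys d}"

definition psubst :: "(nat \<Rightarrow> cpoly) \<Rightarrow> cpoly \<Rightarrow> cpoly" where
  "psubst g P = (\<Sum>d \<in> Poly_Mapping.keys P. const (Poly_Mapping.lookup P d) *
     (\<Prod>k \<in> Poly_Mapping.keys d. g k ^ Poly_Mapping.lookup d k))"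

definition evalp :: "(nat \<Rightarrow> complex) \<Rightarrow> cpoly \<Rightarrow> complex" where
  "evalp V P = (\<Sum>d \<in> Poly_Mapping.keys P. Poly_Mapping.lookup P d *
     (\<Prod>k \<in> Poly_Mapping.keys d. V k ^ Poly_Mapping.lookup d k))"

definition monom_sqnorm :: "real \<Rightarrow> (nat \<Rightarrow>\<^sub>0 nat) \<Rightarrow> real" where
  "monom_sqnorm h d = (\<Prod>k \<in> Poly_Mapping.keys d.
     (h * real k) ^ Poly_Mapping.lookup d k * fact (Poly_Mapping.lookup d k))"

definition inner_h :: "real \<Rightarrow> cpoly \<Rightarrow> cpoly \<Rightarrow> complex" where
  "inner_h h P Q = (\<Sum>d \<in> Poly_Mapping.keys P.
     cnj (Poly_Mapping.lookup P d) * Poly_Mapping.lookup Q d * complex_of_real (monom_sqnorm h d))"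

definition norm_h :: "real \<Rightarrow> cpoly \<Rightarrow> real" where
  "norm_h h P = sqrt (Re (inner_h h P P))"

text \<open>The symmetric polynomial in \<open>N\<close> variables given by a polynomial in the power sums.\<close>

definition in_vars :: "nat \<Rightarrow> cpoly \<Rightarrow> cpoly" where
  "in_vars N P = psubst (\<lambda>k. \<Sum>i<N. monom_power i k) P"

text \<open>The monomial symmetric polynomial in \<open>N\<close> variables (0 if there are more than \<open>N\<close> parts).\<close>

definition monomial_sym :: "nat \<Rightarrow> int_partition \<Rightarrow> cpoly" where
  "monomial_sym N m =
     (\<Sum>b | Poly_Mapping.keys b \<subseteq> {..<N} \<and> (\<exists>s. bij s \<and> Poly_Mapping.lookup b = row m \<circ> s).
        Poly_Mapping.single b 1)"

text \<open>Macdonald's characterization: triangularity in the monomial basis with respect to dominance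
  order, and orthogonality for the scalar product with squared norms
  \<open>z_d \<alpha> ^ (number of parts)\<close> of the power sum products, which is \<open>monom_sqnorm \<alpha> d\<close>.
  Symmetric functions are compatible families of symmetric polynomials, so an identity between
  them is an identity for every number \<open>N\<close> of variables. Jack functions have real
  coefficients, so the conjugation in \<open>inner_h\<close> is immaterial here.\<close>

definition jack_family :: "real \<Rightarrow> (int_partition \<Rightarrow> cpoly) \<Rightarrow> bool" where
  "jack_family \<alpha> P \<longleftrightarrow>
     (\<forall>l. P l \<in> rho_polys \<and>
        (\<exists>u. \<forall>N. in_vars N (P l) =
           monomial_sym N l + (\<Sum>m | dominated m l \<and> m \<noteq> l. const (u m) * monomial_sym N m))) \<and>
     (\<forall>l m. l \<noteq> m \<longrightarrow> inner_h \<alpha> (P l) (P m) = 0)"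

definition jack_sym :: "real \<Rightarrow> int_partition \<Rightarrow> cpoly" where
  "jack_sym \<alpha> = (THE P. jack_family \<alpha> P)"

definition jack_poly :: "real \<Rightarrow> real \<Rightarrow> int_partition \<Rightarrow> cpoly" where
  "jack_poly e h l =
     psubst (\<lambda>k. const (complex_of_real (1 / (- eps2 e h))) * monom_power k 1)
       (jack_sym (eps1 e h / (- eps2 e h)) l)"

definition jack_normalized :: "real \<Rightarrow> real \<Rightarrow> int_partition \<Rightarrow> cpoly" where
  "jack_normalized e h l = const (complex_of_real (1 / norm_h h (jack_poly e h l))) * jack_poly e h l"


section \<open>Jack measures\<close>

text \<open>A specialization is a function \<open>V\<close> on \<open>nat\<close> of which only the values at indices
  \<open>k \<ge> 1\<close> are used.\<close>

definition jack_weight ::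
  "real \<Rightarrow> real \<Rightarrow> (nat \<Rightarrow> complex) \<Rightarrow> (nat \<Rightarrow> complex) \<Rightarrow> int_partition \<Rightarrow> complex" where
  "jack_weight e h Vout Vin l =
     cnj (evalp Vout (jack_normalized e h l)) * evalp Vin (jack_normalized e h l)"

definition defines_jack_measure ::
  "real \<Rightarrow> real \<Rightarrow> (nat \<Rightarrow> complex) \<Rightarrow> (nat \<Rightarrow> complex) \<Rightarrow> bool" where
  "defines_jack_measure e h Vout Vin \<longleftrightarrow>
     summable (\<lambda>k. cnj (Vout (Suc k)) * Vin (Suc k) / of_nat (Suc k)) \<and>
     (\<forall>l. jack_weight e h Vout Vin l \<in> \<real>\<^sub>\<ge>\<^sub>0)"

definition jack_prob ::
  "real \<Rightarrow> real \<Rightarrow> (nat \<Rightarrow> complex) \<Rightarrow> (nat \<Rightarrow> complex) \<Rightarrow> int_partition \<Rightarrow> complex" where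
  "jack_prob e h Vout Vin l = jack_weight e h Vout Vin l *
     exp (- (1 / complex_of_real h) *
       suminf (\<lambda>k. cnj (Vout (Suc k)) * Vin (Suc k) / of_nat (Suc k)))"

text \<open>If \<open>defines_jack_measure\<close> holds, the masses \<open>jack_prob\<close> are nonnegative reals.\<close>

definition jack_measure ::
  "real \<Rightarrow> real \<Rightarrow> (nat \<Rightarrow> complex) \<Rightarrow> (nat \<Rightarrow> complex) \<Rightarrow> int_partition measure" where
  "jack_measure e h Vout Vin =
     density (count_space UNIV) (\<lambda>l. ennreal (Re (jack_prob e h Vout Vin l)))"


section \<open>Anisotropic profiles\<close>

text \<open>The rectangle of the box in row \<open>i\<close> and column \<open>j\<close> (from 0) is spanned by
  \<open>(e2, - e2)\<close> and \<open>(e1, e1)\<close> from its lowest corner; being part of a tiling of a region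
  above the graph of \<open>\<bar>c\<bar>\<close>, the lowest corner lies at
  \<open>i (e2, - e2) + j (e1, e1)\<close>.\<close>

definition box_rect :: "real \<Rightarrow> real \<Rightarrow> nat \<times> nat \<Rightarrow> (real \<times> real) set" where
  "box_rect e h = (\<lambda>(i, j).
     {(eps2 e h * (real i + s) + eps1 e h * (real j + t),
       - eps2 e h * (real i + s) + eps1 e h * (real j + t)) | s t.
       0 \<le> s \<and> s \<le> 1 \<and> 0 \<le> t \<and> t \<le> 1})"

definition piecewise_slopes_pm1 :: "(real \<Rightarrow> real) \<Rightarrow> bool" where
  "piecewise_slopes_pm1 f \<longleftrightarrow> continuous_on UNIV f \<and>
     (\<exists>S. finite S \<and> (\<forall>c. c \<notin> S \<longrightarrow>
        (f has_real_derivative 1) (at c) \<or> (f has_real_derivative - 1) (at c)))"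

text \<open>The region always contains the graph of \<open>\<bar>c\<bar>\<close>, also where there are no boxes
  above it; this part of the region is degenerate and is therefore listed separately.\<close>

definition profile :: "real \<Rightarrow> real \<Rightarrow> int_partition \<Rightarrow> real \<Rightarrow> real" where
  "profile e h l = (THE f. piecewise_slopes_pm1 f \<and>
     {(c, y). \<bar>c\<bar> \<le> y \<and> y \<le> f c} = {(c, y). y = \<bar>c\<bar>} \<union> (\<Union>b \<in> boxes l. box_rect e h b))"

definition smooth_compact_support :: "(real \<Rightarrow> real) \<Rightarrow> bool" where
  "smooth_compact_support g \<longleftrightarrow>
     (\<forall>k. (deriv ^^ k) g differentiable_on UNIV) \<and> bounded {x. g x \<noteq> 0}"

text \<open>The distributional second derivative of a function that is affine between finitely many
  points is a finite sum of point masses; \<open>w c\<close> is the mass at \<open>c\<close>, and integrals against it are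
  the corresponding finite sums.\<close>

definition distr_second_deriv :: "(real \<Rightarrow> real) \<Rightarrow> (real \<Rightarrow> real) \<Rightarrow> bool" where
  "distr_second_deriv f w \<longleftrightarrow> finite {c. w c \<noteq> 0} \<and>
     (\<forall>g. smooth_compact_support g \<longrightarrow>
        (LINT c|lborel. f c * deriv (deriv g) c) = (\<Sum>c | w c \<noteq> 0. w c * g c))"

definition profile_dd :: "real \<Rightarrow> real \<Rightarrow> int_partition \<Rightarrow> real \<Rightarrow> real" where
  "profile_dd e h l = (THE w. distr_second_deriv (profile e h l) w)"

text \<open>The masses of the second derivative of a profile are \<open>2\<close> and \<open>- 2\<close>, so the choice of
  branch of the logarithm has no influence on the exponential.\<close>

definition T_generating :: "real \<Rightarrow> real \<Rightarrow> int_partition \<Rightarrow> complex \<Rightarrow> complex" where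
  "T_generating e h l u = exp (\<Sum>c | profile_dd e h l c \<noteq> 0.
     Ln (1 / (u - complex_of_real c)) * complex_of_real (1 / 2 * profile_dd e h l c))"

definition T_up :: "real \<Rightarrow> real \<Rightarrow> int_partition \<Rightarrow> nat \<Rightarrow> real" where
  "T_up e h l = (THE T. \<forall>\<^sub>F u in at_infinity.
     (\<lambda>k. complex_of_real (T k) / u ^ (k + 1)) sums T_generating e h l u)"


section \<open>Joint cumulants\<close>

definition joint_moment :: "'a measure \<Rightarrow> nat set \<Rightarrow> (nat \<Rightarrow> 'a \<Rightarrow> real) \<Rightarrow> real" where
  "joint_moment M B X = (LINT x|M. (\<Prod>a\<in>B. X a x))"

definition joint_cumulant :: "'a measure \<Rightarrow> nat \<Rightarrow> (nat \<Rightarrow> 'a \<Rightarrow> real) \<Rightarrow> real" where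
  "joint_cumulant M n X = (\<Sum>\<pi> | partition_on {..<n} \<pi>.
     (- 1) ^ (card \<pi> - 1) * fact (card \<pi> - 1) * (\<Prod>B\<in>\<pi>. joint_moment M B X))"


section \<open>Ribbon paths\<close>

text \<open>A sliding path is the list of its heights. Sites, and steps within a site, are numbered
  from 0; a step is a pair of a site and a position, step \<open>i\<close> joining the vertices \<open>i\<close> and
  \<open>i + 1\<close>.\<close>

type_synonym sliding_path = "nat list"
type_synonym step = "nat \<times> nat"
type_synonym ribbon_path = "sliding_path list \<times> (step \<times> step) set"

definition is_sliding_path :: "nat \<Rightarrow> sliding_path \<Rightarrow> bool" where
  "is_sliding_path len js \<longleftrightarrow> length js = len + 1 \<and> js ! 0 = 0 \<and> js ! len = 0"

definition steps :: "sliding_path list \<Rightarrow> step set" where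
  "steps gs = {(a, i). a < length gs \<and> Suc i < length (gs ! a)}"

definition deg :: "sliding_path list \<Rightarrow> step \<Rightarrow> int" where
  "deg gs = (\<lambda>(a, i). int (gs ! a ! Suc i) - int (gs ! a ! i))"

definition height :: "sliding_path list \<Rightarrow> step \<Rightarrow> nat" where
  "height gs = (\<lambda>(a, i). gs ! a ! Suc i)"

definition slides :: "sliding_path list \<Rightarrow> step set" where
  "slides gs = {x \<in> steps gs. deg gs x = 0}"

definition is_pairing :: "sliding_path list \<Rightarrow> nat \<Rightarrow> step \<times> step \<Rightarrow> bool" where
  "is_pairing gs k = (\<lambda>(x, y). k \<ge> 1 \<and> x \<in> steps gs \<and> y \<in> steps gs \<and>
     deg gs x = - int k \<and> deg gs y = int k \<and>
     (fst x < fst y \<or> fst x = fst y \<and> snd x < snd y))"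

definition pairing_size :: "sliding_path list \<Rightarrow> step \<times> step \<Rightarrow> nat" where
  "pairing_size gs p = (THE k. is_pairing gs k p)"

definition is_ribbon_path :: "nat list \<Rightarrow> ribbon_path \<Rightarrow> bool" where
  "is_ribbon_path ls = (\<lambda>(gs, ps).
     length gs = length ls \<and> (\<forall>a < length ls. is_sliding_path (ls ! a) (gs ! a)) \<and>
     (\<forall>p \<in> ps. \<exists>k. is_pairing gs k p) \<and>
     (\<forall>p \<in> ps. \<forall>p' \<in> ps. p \<noteq> p' \<longrightarrow> {fst p, snd p} \<inter> {fst p', snd p'} = {}))"

definition ribbon_paths :: "nat list \<Rightarrow> nat \<Rightarrow> nat \<Rightarrow> ribbon_path set" where
  "ribbon_paths ls q m =
     {(gs, ps). is_ribbon_path ls (gs, ps) \<and> card ps = q \<and> card (slides gs) = m}"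

definition site_edges :: "ribbon_path \<Rightarrow> (nat \<times> nat) set" where
  "site_edges = (\<lambda>(gs, ps). (\<lambda>(x, y). (fst x, fst y)) ` ps)"

definition connected_ribbon :: "ribbon_path \<Rightarrow> bool" where
  "connected_ribbon g \<longleftrightarrow> (\<forall>a < length (fst g). \<forall>b < length (fst g).
     (a, b) \<in> (site_edges g \<union> (site_edges g)\<inverse>)\<^sup>*)"

definition paired :: "(step \<times> step) set \<Rightarrow> step set" where
  "paired ps = fst ` ps \<union> snd ` ps"

definition ribbon_weight ::
  "(nat \<Rightarrow> complex) \<Rightarrow> (nat \<Rightarrow> complex) \<Rightarrow> ribbon_path \<Rightarrow> complex" where
  "ribbon_weight Vout Vin = (\<lambda>(gs, ps).
     (\<Prod>p\<in>ps. of_nat (pairing_size gs p)) *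
     (\<Prod>x\<in>slides gs. of_nat (height gs x)) *
     (\<Prod>x\<in>{x \<in> steps gs - paired ps. deg gs x < 0}. cnj (Vout (nat (- deg gs x)))) *
     (\<Prod>x\<in>{x \<in> steps gs - paired ps. deg gs x > 0}. Vin (nat (deg gs x))))"

definition Y_coeff ::
  "nat list \<Rightarrow> nat \<Rightarrow> nat \<Rightarrow> (nat \<Rightarrow> complex) \<Rightarrow> (nat \<Rightarrow> complex) \<Rightarrow> complex" where
  "Y_coeff ls q m Vout Vin = (\<Sum>\<^sub>\<infinity>g \<in> ribbon_paths ls q m. ribbon_weight Vout Vin g)"

definition connected_ribbon_paths :: "nat list \<Rightarrow> nat \<Rightarrow> nat \<Rightarrow> ribbon_path set" where
  "connected_ribbon_paths ls g m = {x \<in> ribbon_paths ls (length ls - 1 + g) m. connected_ribbon x}"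

definition W_coeff ::
  "nat list \<Rightarrow> nat \<Rightarrow> nat \<Rightarrow> (nat \<Rightarrow> complex) \<Rightarrow> (nat \<Rightarrow> complex) \<Rightarrow> complex" where
  "W_coeff ls g m Vout Vin = (\<Sum>\<^sub>\<infinity>x \<in> connected_ribbon_paths ls g m. ribbon_weight Vout Vin x)"

end

theory Submission
  imports Defs
begin

text \<open>
  The Nazarov--Sklyanin Lax operator \<open>L\<close> acts on polynomials in \<open>\<rho>\<^sub>1, \<rho>\<^sub>2, \<dots>\<close> and \<open>w\<close>: it multiplies by
  \<open>\<rho>\<^sub>k\<close> and lowers the power of \<open>w\<close> by \<open>k\<close>, or applies \<open>\<hbar> k \<partial>/\<partial>\<rho>\<^sub>k\<close> and raises it by \<open>k\<close>, or multiplies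
  \<open>w\<^sup>j\<close> by \<open>\<epsilon> j\<close>. Substituting power sums in \<open>N + 1\<close> variables for the \<open>\<rho>\<^sub>k\<close> and the last variable for \<open>w\<close>
  turns \<open>L\<close> into a Dunkl-type operator that is triangular with explicit diagonal. Hence the entry
  at \<open>w\<^sup>0, w\<^sup>0\<close> of \<open>L\<^sup>l\<close> is triangular on monomial symmetric functions; as it is also self-adjoint and
  its eigenvalues separate partitions, the Jack polynomials diagonalize it, and comparing generating
  functions identifies the eigenvalue with \<open>T\<^sup>\<up>\<close>.

  By the Cauchy identity the moments of the Jack measure are therefore matrix elements of products
  of these entries, applied to the exponential reproducing kernel. Expanding a power of \<open>L\<close> over the
  powers of \<open>w\<close> gives sliding paths. Moving the derivatives to the right, where the kernel is an
  eigenvector, pairs each of them with a multiplication or leaves it unpaired: this is the sum over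
  ribbon paths. The heights of a ribbon path are bounded by the total degree of its unpaired jumps, whence the
  geometric bounds on the specializations give absolute convergence.

  The weight of a ribbon path is multiplicative over its connected components. Both the cumulants and
  the connected sums are therefore determined by the moments of subfamilies through the same
  recursion over the component of a fixed site.
\<close>

text \<open>\<open>jack_sym\<close>, \<open>profile\<close>, \<open>profile_dd\<close> and
  \<open>T_up\<close> are definite descriptions, so each of them needs existence and uniqueness
  before it can be used. Dominance is only a partial order: triangularity says nothing about the
  inner product of the vectors of two incomparable partitions. This is where separation of the
  eigenvalues enters, and it is proved by recovering the profile from the zeros and poles of the
  generating function of the eigenvalues. Write a = - \<open>eps2\<close> and b =
  \<open>eps1\<close>, so that ab = \<hbar> and b - a = \<epsilon>. The operator is triangular in
  the power sums p_k with coefficients a, b, b - a; the substitution p_k = \<rho>_k / a turns these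
  into 1, \<hbar>, \<epsilon>, and the norm with parameter b / a into the one with parameter
  \<hbar>. Everything is done weight by weight. The kernel enters only through its homogeneous
  parts, so polynomials suffice until the weights are summed. An unpaired derivative lowers the
  weight of the kernel, hence only shifts the summation index; the sum over all weights then
  produces one common factor for all ribbon paths, the inverse of the normalization of the
  measure.\<close>

abbreviation lookup :: "('a \<Rightarrow>\<^sub>0 'b::zero) \<Rightarrow> 'a \<Rightarrow> 'b" where "lookup \<equiv> Poly_Mapping.lookup"
abbreviation keys :: "('a \<Rightarrow>\<^sub>0 'b::zero) \<Rightarrow> 'a set" where "keys \<equiv> Poly_Mapping.keys"
abbreviation single :: "'a \<Rightarrow> 'b \<Rightarrow> ('a \<Rightarrow>\<^sub>0 'b::zero)" where "single \<equiv> Poly_Mapping.single"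

section \<open>Linear maps and substitutions on polynomials\<close>

lemma const_0 [simp]: "const 0 = 0" by (simp add: const_def)
lemma const_1 [simp]: "const 1 = 1" by (simp add: const_def)
lemma const_add: "const (a + b) = const a + const b" by (simp add: const_def single_add)
lemma const_minus: "const (- a) = - const a" by (simp add: const_def single_uminus)
lemma const_diff: "const (a - b) = const a - const b" by (simp add: const_def single_diff)
lemma const_mult: "const (a * b) = const a * const b" by (simp add: const_def mult_single)
lemma const_power: "const (a ^ n) = const a ^ n" by (induction n) (simp_all add: const_mult)
lemma const_of_nat: "const (of_nat n) = of_nat n" by (simp add: const_def)
lemma const_sum: "const (sum f A) = (\<Sum>x\<in>A. const (f x))"
  by (induction A rule: infinite_finite_induct) (simp_all add: const_add)
lemma const_prod: "const (prod f A) = (\<Prod>x\<in>A. const (f x))"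
  by (induction A rule: infinite_finite_induct) (simp_all add: const_mult)
lemma const_eq_iff [simp]: "const a = const b \<longleftrightarrow> a = b"
  by (metis const_def lookup_single_eq)
lemma const_mult_single: "const a * single d c = single d (a * c)"
  by (simp add: const_def mult_single)
lemma lookup_const_mult [simp]: "lookup (const c * f) d = c * lookup f d"
proof -
  have "const c * f = Poly_Mapping.map ((*) c) f"
    by (simp add: const_def mult_map_scale_conv_mult)
  then show ?thesis by (simp add: Poly_Mapping.map.rep_eq when_def)
qed
lemma lookup_const: "lookup (const c) d = (if d = 0 then c else 0)"
  by (simp add: const_def lookup_single when_def)

lemma poly_sum_singles: "(\<Sum>d\<in>keys f. single d (lookup f d)) = f"
proof (rule poly_mapping_eqI)
  fix x
  have "lookup (\<Sum>d\<in>keys f. single d (lookup f d)) x = (\<Sum>d\<in>keys f. if d = x then lookup f d else 0)"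
    by (simp add: lookup_sum lookup_single when_def)
  also have "\<dots> = lookup f x" by (simp add: in_keys_iff)
  finally show "lookup (\<Sum>d\<in>keys f. single d (lookup f d)) x = lookup f x" .
qed

lemma cpoly_induct [case_names single add]:
  fixes f :: "'a \<Rightarrow>\<^sub>0 'b::comm_monoid_add"
  assumes "\<And>d c. P (single d c)" "\<And>f g. P f \<Longrightarrow> P g \<Longrightarrow> P (f + g)"
  shows "P f"
proof -
  have "P (\<Sum>d\<in>A. single d (lookup f d))" if "finite A" for A
    using that
  proof induction
    case empty
    then show ?case using assms(1)[of undefined 0] by simp
  qed (use assms in auto)
  then show ?thesis by (metis poly_sum_singles finite_keys)
qed

definition lin :: "((nat \<Rightarrow>\<^sub>0 nat) \<Rightarrow> cpoly) \<Rightarrow> cpoly \<Rightarrow> cpoly" where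
  "lin \<phi> f = (\<Sum>d\<in>keys f. const (lookup f d) * \<phi> d)"

text \<open>Two polynomials have different supports; extending both sums to a common finite index
  set makes additivity a termwise statement. The same device serves below for monomials, gradings
  and norms.\<close>

lemma lin_superset: "finite A \<Longrightarrow> keys f \<subseteq> A \<Longrightarrow> lin \<phi> f = (\<Sum>d\<in>A. const (lookup f d) * \<phi> d)"
  unfolding lin_def by (rule sum.mono_neutral_left) (auto simp: in_keys_iff)

lemma lin_add: "lin \<phi> (f + g) = lin \<phi> f + lin \<phi> g"
proof -
  let ?A = "keys f \<union> keys g"
  have "lin \<phi> (f + g) = (\<Sum>d\<in>?A. const (lookup (f + g) d) * \<phi> d)"
    by (rule lin_superset) (simp_all add: keys_add)
  also have "\<dots> = lin \<phi> f + lin \<phi> g"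
    by (simp add: lin_superset[of ?A] lookup_add const_add distrib_right sum.distrib)
  finally show ?thesis .
qed

lemma lin_0 [simp]: "lin \<phi> 0 = 0" by (simp add: lin_def)
lemma lin_single [simp]: "lin \<phi> (single d c) = const c * \<phi> d"
  by (cases "c = 0") (simp_all add: lin_def)
lemma lin_sum: "lin \<phi> (sum f A) = (\<Sum>x\<in>A. lin \<phi> (f x))"
  by (induction A rule: infinite_finite_induct) (simp_all add: lin_add)
lemma lin_const_mult: "lin \<phi> (const c * f) = const c * lin \<phi> f"
  by (induction f rule: cpoly_induct)
     (simp_all add: const_mult_single const_mult mult.assoc distrib_left lin_add)
lemma lin_minus: "lin \<phi> (- f) = - lin \<phi> f"
  using lin_const_mult[of \<phi> "-1" f] by (simp add: const_minus)
lemma lin_diff: "lin \<phi> (f - g) = lin \<phi> f - lin \<phi> g"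
  using lin_add[of \<phi> f "- g"] by (simp add: lin_minus)

definition mono_at :: "(nat \<Rightarrow> cpoly) \<Rightarrow> (nat \<Rightarrow>\<^sub>0 nat) \<Rightarrow> cpoly" where
  "mono_at g d = (\<Prod>k\<in>keys d. g k ^ lookup d k)"

lemma mono_at_superset: "finite A \<Longrightarrow> keys d \<subseteq> A \<Longrightarrow> mono_at g d = (\<Prod>k\<in>A. g k ^ lookup d k)"
  unfolding mono_at_def by (rule prod.mono_neutral_left) (auto simp: in_keys_iff)

lemma mono_at_add: "mono_at g (d + d') = mono_at g d * mono_at g d'"
proof -
  let ?A = "keys d \<union> keys d'"
  have "mono_at g (d + d') = (\<Prod>k\<in>?A. g k ^ lookup (d + d') k)"
    by (rule mono_at_superset) (simp_all add: keys_add)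
  then show ?thesis
    by (simp add: mono_at_superset[of ?A] lookup_add power_add prod.distrib)
qed

lemma mono_at_0 [simp]: "mono_at g 0 = 1" by (simp add: mono_at_def)
lemma mono_at_single [simp]: "mono_at g (single k n) = g k ^ n"
  by (cases "n = 0") (simp_all add: mono_at_def)

lemma psubst_lin: "psubst g = lin (mono_at g)"
  by (rule ext) (simp add: psubst_def lin_def mono_at_def)

lemma psubst_add: "psubst g (P + Q) = psubst g P + psubst g Q" by (simp add: psubst_lin lin_add)
lemma psubst_diff: "psubst g (P - Q) = psubst g P - psubst g Q" by (simp add: psubst_lin lin_diff)
lemma psubst_0 [simp]: "psubst g 0 = 0" by (simp add: psubst_lin)
lemma psubst_sum: "psubst g (sum f A) = (\<Sum>x\<in>A. psubst g (f x))" by (simp add: psubst_lin lin_sum)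
lemma psubst_const_mult: "psubst g (const c * P) = const c * psubst g P"
  by (simp add: psubst_lin lin_const_mult)
lemma psubst_const [simp]: "psubst g (const c) = const c"
  by (metis const_def lin_single mono_at_0 mult.right_neutral psubst_lin)
lemma psubst_1 [simp]: "psubst g 1 = 1" by (metis const_1 psubst_const)
lemma psubst_var [simp]: "psubst g (monom_power k n) = g k ^ n"
  by (simp add: psubst_lin monom_power_def)

lemma psubst_mult: "psubst g (P * Q) = psubst g P * psubst g Q"
proof (induction P rule: cpoly_induct)
  case (single d c)
  show ?case
  proof (induction Q rule: cpoly_induct)
    case (single d' c')
    show ?case by (simp add: psubst_lin mult_single mono_at_add const_mult mult_ac)
  qed (simp add: psubst_add distrib_left)
qed (simp add: psubst_add distrib_right)

lemma psubst_power: "psubst g (P ^ n) = psubst g P ^ n"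
  by (induction n) (simp_all add: psubst_mult)
lemma psubst_prod: "psubst g (prod f A) = (\<Prod>x\<in>A. psubst g (f x))"
  by (induction A rule: infinite_finite_induct) (simp_all add: psubst_mult)
lemma psubst_psubst: "psubst g (psubst g' P) = psubst (\<lambda>k. psubst g (g' k)) P"
  unfolding psubst_def[of g' P]
  by (simp add: psubst_sum psubst_mult psubst_prod psubst_power) (simp add: psubst_def)
lemma psubst_cong: "(\<And>d k. d \<in> keys P \<Longrightarrow> k \<in> keys d \<Longrightarrow> g k = g' k) \<Longrightarrow> psubst g P = psubst g' P"
  unfolding psubst_def by (intro sum.cong prod.cong arg_cong2[where f="(*)"]) auto

text \<open>Evaluation is substitution of constants, so its ring homomorphism laws are inherited
  from \<open>psubst\<close>.\<close>

lemma const_evalp: "const (evalp V P) = psubst (\<lambda>k. const (V k)) P"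
  by (simp add: evalp_def psubst_def const_sum const_mult const_prod const_power)

lemma evalp_add: "evalp V (P + Q) = evalp V P + evalp V Q"
  by (metis const_add const_eq_iff const_evalp psubst_add)
lemma evalp_mult: "evalp V (P * Q) = evalp V P * evalp V Q"
  by (metis const_mult const_eq_iff const_evalp psubst_mult)
lemma evalp_const [simp]: "evalp V (const c) = c"
  by (metis const_eq_iff const_evalp psubst_const)
lemma evalp_0 [simp]: "evalp V 0 = 0" by (simp add: evalp_def)
lemma evalp_sum: "evalp V (sum f A) = (\<Sum>x\<in>A. evalp V (f x))"
  by (induction A rule: infinite_finite_induct) (simp_all add: evalp_add)
lemma evalp_var [simp]: "evalp V (monom_power k n) = V k ^ n"
  by (metis const_eq_iff const_evalp const_power psubst_var)
lemma evalp_single: "evalp V (single d c) = c * (\<Prod>k\<in>keys d. V k ^ lookup d k)"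
  by (cases "c = 0") (simp_all add: evalp_def)

section \<open>Multiplication by variables and partial derivatives\<close>

abbreviation var :: "nat \<Rightarrow> cpoly" where "var k \<equiv> monom_power k (Suc 0)"

lemma monom_power_conv: "monom_power k n = var k ^ n"
proof (induction n)
  case (Suc n)
  have "monom_power k (Suc n) = var k * monom_power k n"
    by (simp add: monom_power_def mult_single flip: single_add)
  with Suc show ?case by simp
qed (simp add: monom_power_def)

lemma var_mult_monom_power: "var k * monom_power k n = monom_power k (Suc n)"
  by (simp add: monom_power_def mult_single flip: single_add)

text \<open>Subtraction of exponent vectors is truncated, so divisibility of the monomial has to be
  tested separately.\<close>

lemma lookup_single_mult:
  "lookup (single e c * f) d = (if \<exists>x. d = e + x then c * lookup f (d - e) else 0)"
  for e d :: "nat \<Rightarrow>\<^sub>0 nat" and f :: cpoly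
proof (induction f rule: cpoly_induct)
  case (single d' c')
  have "d = e + d' \<longleftrightarrow> (\<exists>x. d = e + x) \<and> d - e = d'" by auto
  then show ?case by (auto simp: mult_single lookup_single when_def)
next
  case (add f g)
  then show ?case by (auto simp: distrib_left lookup_add)
qed

lemma exists_add_single: "(\<exists>x. d = single k n + x) \<longleftrightarrow> n \<le> lookup d k" for d :: "nat \<Rightarrow>\<^sub>0 nat"
proof
  assume "\<exists>x. d = single k n + x"
  then show "n \<le> lookup d k" by (auto simp: lookup_add)
next
  assume *: "n \<le> lookup d k"
  have "d = single k n + (d - single k n)"
    by (rule poly_mapping_eqI) (use * in \<open>auto simp: lookup_add lookup_minus lookup_single when_def\<close>)
  then show "\<exists>x. d = single k n + x" ..
qed

lemma exists_single_add: "lookup d k \<noteq> 0 \<Longrightarrow> \<exists>x. d = single k (1::nat) + x" for d :: "nat \<Rightarrow>\<^sub>0 nat"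
  by (subst exists_add_single) simp

lemma lookup_monom_power_mult:
  "lookup (monom_power k n * f) d = (if n \<le> lookup d k then lookup f (d - single k n) else 0)"
  by (simp add: monom_power_def lookup_single_mult exists_add_single)

definition dd :: "nat \<Rightarrow> cpoly \<Rightarrow> cpoly" where
  "dd k = lin (\<lambda>d. single (d - single k 1) (of_nat (lookup d k)))"

lemma dd_add: "dd k (f + g) = dd k f + dd k g" by (simp add: dd_def lin_add)
lemma dd_0 [simp]: "dd k 0 = 0" by (simp add: dd_def)
lemma dd_sum: "dd k (sum f A) = (\<Sum>x\<in>A. dd k (f x))" by (simp add: dd_def lin_sum)
lemma dd_const_mult: "dd k (const c * f) = const c * dd k f" by (simp add: dd_def lin_const_mult)
lemma dd_single: "dd k (single d c) = single (d - single k 1) (of_nat (lookup d k) * c)"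
  by (simp add: dd_def const_mult_single mult.commute)
lemma dd_const [simp]: "dd k (const c) = 0" by (simp add: const_def dd_single)

text \<open>Coefficientwise the derivative looks one exponent up, which avoids the truncated
  subtraction in its definition; most later facts about \<open>dd\<close> start from this
  form.\<close>

lemma lookup_dd: "lookup (dd k f) d = of_nat (lookup d k + 1) * lookup f (d + single k 1)"
proof (induction f rule: cpoly_induct)
  case (single d' c)
  have "lookup d' k = 0 \<or> (d' - single k 1 = d \<longleftrightarrow> d' = d + single k 1)"
  proof (cases "lookup d' k = 0")
    case False
    then have "\<exists>x. d' = single k 1 + x" by (rule exists_single_add)
    then show ?thesis by (auto simp: add.commute)
  qed simp
  then show ?case by (auto simp: dd_single lookup_single when_def lookup_add)
qed (simp_all add: dd_add lookup_add distrib_left)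

lemma dd_mult: "dd k (f * g) = dd k f * g + f * dd k g"
proof (induction f rule: cpoly_induct)
  case (single d c)
  show ?case
  proof (induction g rule: cpoly_induct)
    case (single d' c')
    have 1: "(d + d') - single k 1 = (d - single k 1) + d'" if nz: "lookup d k \<noteq> 0"
    proof -
      obtain x where "d = single k 1 + x" using exists_single_add[OF nz] by blast
      then show ?thesis by (simp add: add.assoc)
    qed
    have 2: "(d + d') - single k 1 = d + (d' - single k 1)" if nz: "lookup d' k \<noteq> 0"
    proof -
      obtain x where "d' = single k 1 + x" using exists_single_add[OF nz] by blast
      then show ?thesis by (metis add.left_commute add_diff_cancel_left')
    qed
    have "dd k (single d c * single d' c') = single (d + d' - single k 1) (of_nat (lookup d k) * (c * c')) +
       single (d + d' - single k 1) (of_nat (lookup d' k) * (c * c'))"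
      by (simp add: mult_single dd_single lookup_add ring_distribs flip: single_add)
    moreover have "single (d + d' - single k 1) (of_nat (lookup d k) * (c * c')) = dd k (single d c) * single d' c'"
      using 1 by (cases "lookup d k = 0") (simp_all add: dd_single mult_single mult.assoc)
    moreover have "single (d + d' - single k 1) (of_nat (lookup d' k) * (c * c')) = single d c * dd k (single d' c')"
      using 2 by (cases "lookup d' k = 0") (simp_all add: dd_single mult_single mult.left_commute)
    ultimately show ?case by simp
  qed (simp add: dd_add distrib_left distrib_right add_ac)
qed (simp add: dd_add distrib_left distrib_right add_ac)

lemma dd_var: "dd k (var j) = (if j = k then 1 else 0)"
  by (simp add: monom_power_def dd_single lookup_single when_def)

lemma dd_commute: "dd j (dd k f) = dd k (dd j f)"
  by (rule poly_mapping_eqI) (auto simp: lookup_dd lookup_add lookup_single when_def add_ac)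

section \<open>The weight grading and the inner product\<close>

text \<open>The variable k stands for a power sum of degree k, so this grading becomes the ordinary
  total degree after \<open>in_vars\<close>.\<close>

definition wt :: "(nat \<Rightarrow>\<^sub>0 nat) \<Rightarrow> nat" where
  "wt d = (\<Sum>k\<in>keys d. k * lookup d k)"

lemma wt_superset: "finite A \<Longrightarrow> keys d \<subseteq> A \<Longrightarrow> wt d = (\<Sum>k\<in>A. k * lookup d k)"
  unfolding wt_def by (rule sum.mono_neutral_left) (auto simp: in_keys_iff)

lemma wt_add: "wt (d + d') = wt d + wt d'"
proof -
  let ?A = "keys d \<union> keys d'"
  have "wt (d + d') = (\<Sum>k\<in>?A. k * lookup (d + d') k)"
    by (rule wt_superset) (simp_all add: keys_add)
  then show ?thesis
    by (simp add: wt_superset[of ?A] lookup_add distrib_left sum.distrib)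
qed

lemma wt_0 [simp]: "wt 0 = 0" by (simp add: wt_def)
lemma wt_single [simp]: "wt (single k n) = k * n" by (cases "n = 0") (simp_all add: wt_def)

text \<open>The variable with index 0 is excluded because a monomial containing it has squared norm
  0; without it the inner product is definite.\<close>

definition hom :: "nat \<Rightarrow> cpoly set" where
  "hom n = {f \<in> rho_polys. \<forall>d\<in>keys f. wt d = n}"

lemma hom_iff: "f \<in> hom n \<longleftrightarrow> (\<forall>d. lookup f d \<noteq> 0 \<longrightarrow> lookup d 0 = 0 \<and> wt d = n)"
  by (auto simp: hom_def rho_polys_def in_keys_iff)

lemma hom_0 [simp]: "0 \<in> hom n" by (simp add: hom_iff)
lemma hom_add: "f \<in> hom n \<Longrightarrow> g \<in> hom n \<Longrightarrow> f + g \<in> hom n"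
  unfolding hom_iff lookup_add by (metis add.right_neutral)
lemma hom_sum: "(\<And>x. x \<in> A \<Longrightarrow> f x \<in> hom n) \<Longrightarrow> sum f A \<in> hom n"
  by (induction A rule: infinite_finite_induct) (simp_all add: hom_add)
lemma hom_const_mult: "f \<in> hom n \<Longrightarrow> const c * f \<in> hom n"
  by (simp add: hom_iff)
lemma hom_diff: "f \<in> hom n \<Longrightarrow> g \<in> hom n \<Longrightarrow> f - g \<in> hom n"
  using hom_add[of f n "const (-1) * g"] hom_const_mult[of g n "-1"] by (simp add: const_minus)
lemma hom_rho: "f \<in> hom n \<Longrightarrow> f \<in> rho_polys" by (simp add: hom_def)
lemma const_hom: "const c \<in> hom 0" by (simp add: hom_iff lookup_const)

lemma hom_var_mult:
  assumes "f \<in> hom n" "k \<ge> 1" shows "var k * f \<in> hom (n + k)"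
  unfolding hom_iff
proof (intro allI impI)
  fix d assume "lookup (var k * f) d \<noteq> 0"
  then have *: "1 \<le> lookup d k" "lookup f (d - single k 1) \<noteq> 0"
    by (auto simp: lookup_monom_power_mult split: if_splits)
  then obtain x where x: "d = single k 1 + x" using exists_single_add[of d k] by auto
  with * assms show "lookup d 0 = 0 \<and> wt d = n + k"
    by (auto simp: hom_iff lookup_add wt_add lookup_single when_def)
qed

text \<open>For k > n the derivative vanishes, and 0 belongs to every \<open>hom\<close>, so the
  truncated difference does no harm.\<close>

lemma hom_dd:
  assumes "f \<in> hom n" shows "dd k f \<in> hom (n - k)"
  unfolding hom_iff
proof (intro allI impI)
  fix d assume "lookup (dd k f) d \<noteq> 0"
  then have "lookup f (d + single k 1) \<noteq> 0" by (auto simp: lookup_dd)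
  with assms have "lookup (d + single k 1) 0 = 0 \<and> wt (d + single k 1) = n" by (auto simp: hom_iff)
  then show "lookup d 0 = 0 \<and> wt d = n - k"
    by (auto simp: lookup_add wt_add lookup_single when_def)
qed

lemma hom_0_const: assumes "f \<in> hom 0" shows "f = const (lookup f 0)"
proof (rule poly_mapping_eqI)
  fix d
  show "lookup f d = lookup (const (lookup f 0)) d"
  proof (cases "lookup f d = 0")
    case True then show ?thesis by (auto simp: lookup_const)
  next
    case False
    then have "lookup d 0 = 0" "wt d = 0" using assms by (auto simp: hom_iff)
    then have "k \<in> keys d \<Longrightarrow> k = 0 \<or> lookup d k = 0" for k by (auto simp: wt_def)
    then have "keys d = {}" using \<open>lookup d 0 = 0\<close> by (metis all_not_in_conv in_keys_iff)
    then have "d = 0" by simp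
    then show ?thesis by (simp add: lookup_const)
  qed
qed

section \<open>The inner product and the adjoint of multiplication by a variable\<close>

lemma inner_superset: "finite A \<Longrightarrow> keys P \<subseteq> A \<Longrightarrow> inner_h h P Q = 
   (\<Sum>d\<in>A. cnj (lookup P d) * lookup Q d * complex_of_real (monom_sqnorm h d))"
  unfolding inner_h_def by (rule sum.mono_neutral_left) (auto simp: in_keys_iff)

lemma inner_add_left: "inner_h h (P + P') Q = inner_h h P Q + inner_h h P' Q"
proof -
  let ?A = "keys P \<union> keys P'"
  have "inner_h h (P + P') Q = (\<Sum>d\<in>?A. cnj (lookup (P + P') d) * lookup Q d * complex_of_real (monom_sqnorm h d))"
    by (rule inner_superset) (simp_all add: keys_add)
  then show ?thesis by (simp add: inner_superset[of ?A] lookup_add distrib_right sum.distrib)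
qed
lemma inner_add_right: "inner_h h P (Q + Q') = inner_h h P Q + inner_h h P Q'"
  by (simp add: inner_h_def lookup_add distrib_left distrib_right sum.distrib)
lemma inner_const_right: "inner_h h P (const c * Q) = c * inner_h h P Q"
  by (simp add: inner_h_def sum_distrib_left) (simp add: mult_ac)
lemma inner_cnj: "inner_h h Q P = cnj (inner_h h P Q)"
proof -
  let ?A = "keys P \<union> keys Q"
  show ?thesis by (simp add: inner_superset[of ?A] mult_ac)
qed
lemma inner_const_left: "inner_h h (const c * P) Q = cnj c * inner_h h P Q"
  by (metis complex_cnj_mult inner_cnj inner_const_right)
lemma inner_0 [simp]: "inner_h h 0 Q = 0" "inner_h h P 0 = 0" by (simp_all add: inner_h_def)
lemma inner_sum_right: "inner_h h P (sum f A) = (\<Sum>x\<in>A. inner_h h P (f x))"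
  by (induction A rule: infinite_finite_induct) (simp_all add: inner_add_right)
lemma inner_sum_left: "inner_h h (sum f A) Q = (\<Sum>x\<in>A. inner_h h (f x) Q)"
  by (induction A rule: infinite_finite_induct) (simp_all add: inner_add_left)
lemma inner_diff_right: "inner_h h P (Q - Q') = inner_h h P Q - inner_h h P Q'"
  using inner_add_right[of h P Q "const (-1) * Q'"] inner_const_right[of h P "-1" Q']
  by (simp add: const_minus)
lemma inner_diff_left: "inner_h h (P - P') Q = inner_h h P Q - inner_h h P' Q"
  using inner_add_left[of h P "const (-1) * P'" Q] inner_const_left[of h "-1" P' Q]
  by (simp add: const_minus)

lemma sqnorm_superset: "finite A \<Longrightarrow> keys d \<subseteq> A \<Longrightarrow>
   monom_sqnorm h d = (\<Prod>k\<in>A. (h * real k) ^ lookup d k * fact (lookup d k))"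
  unfolding monom_sqnorm_def by (rule prod.mono_neutral_left) (auto simp: in_keys_iff)

lemma sqnorm_pos: "h > 0 \<Longrightarrow> lookup d 0 = 0 \<Longrightarrow> monom_sqnorm h d > 0"
  unfolding monom_sqnorm_def
  by (intro prod_pos mult_pos_pos zero_less_power) (auto simp: in_keys_iff intro!: Nat.gr0I)

lemma sqnorm_add_single:
  "monom_sqnorm h (d + single k 1) = h * real k * real (lookup d k + 1) * monom_sqnorm h d"
proof -
  let ?A = "insert k (keys d)"
  have fin: "finite ?A" by simp
  have sub: "keys (d + single k 1) \<subseteq> ?A" using keys_add[of d "single k 1"] by auto
  have "monom_sqnorm h (d + single k 1)
      = (\<Prod>j\<in>?A. (h * real j) ^ lookup (d + single k 1) j * fact (lookup (d + single k 1) j))"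
    by (rule sqnorm_superset[OF fin sub])
  also have "\<dots> = (h * real k) ^ (lookup d k + 1) * fact (lookup d k + 1) *
      (\<Prod>j\<in>?A - {k}. (h * real j) ^ lookup d j * fact (lookup d j))"
    by (subst prod.remove[OF fin, of k]) (auto simp: lookup_add lookup_single when_def intro!: prod.cong)
  also have "\<dots> = h * real k * real (lookup d k + 1) * (\<Prod>j\<in>?A. (h * real j) ^ lookup d j * fact (lookup d j))"
    by (subst prod.remove[OF fin, of k "\<lambda>j. (h * real j) ^ lookup d j * fact (lookup d j)"])
      (auto simp: algebra_simps)
  also have "(\<Prod>j\<in>?A. (h * real j) ^ lookup d j * fact (lookup d j)) = monom_sqnorm h d"
    by (rule sqnorm_superset[symmetric]) auto
  finally show ?thesis .
qed

lemma inner_single_left: "inner_h h (single d c) Q = cnj c * lookup Q d * complex_of_real (monom_sqnorm h d)"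
  by (cases "c = 0") (simp_all add: inner_h_def)

text \<open>One more factor \<rho>_k multiplies the squared norm by h k (d_k + 1), and d_k + 1 is
  exactly the factor that the derivative produces. Thus multiplication by \<rho>_k and h k times the
  k-th derivative are adjoint to each other.\<close>

lemma inner_dd: "inner_h h P (var k * Q) = of_real (h * real k) * inner_h h (dd k P) Q"
proof (induction P rule: cpoly_induct)
  case (single d c)
  show ?case
  proof (cases "lookup d k = 0")
    case True
    then show ?thesis by (simp add: inner_single_left lookup_monom_power_mult dd_single)
  next
    case False
    then obtain x where x: "d = x + single k 1" using exists_single_add[of d k] by (auto simp: add.commute)
    show ?thesis
      by (simp only: x sqnorm_add_single inner_single_left lookup_monom_power_mult dd_single)
         (simp add: lookup_add algebra_simps)
  qed
qed (simp_all add: inner_add_left dd_add distrib_left)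

lemma inner_pos:
  assumes "h > 0" "P \<in> rho_polys" "P \<noteq> 0"
  shows "inner_h h P P \<in> \<real>" "Re (inner_h h P P) > 0"
proof -
  have eq: "inner_h h P P = of_real (\<Sum>d\<in>keys P. (cmod (lookup P d))\<^sup>2 * monom_sqnorm h d)"
    unfolding inner_h_def of_real_sum
    by (rule sum.cong) (simp_all add: complex_norm_square mult.commute of_real_power[symmetric] del: of_real_power)
  show "inner_h h P P \<in> \<real>" by (simp add: eq)
  have "(\<Sum>d\<in>keys P. (cmod (lookup P d))\<^sup>2 * monom_sqnorm h d) > 0"
  proof (rule sum_pos)
    show "keys P \<noteq> {}" using assms(3) by simp
    fix d assume d: "d \<in> keys P"
    then have "lookup d 0 = 0" using assms(2) by (auto simp: rho_polys_def in_keys_iff)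
    with d assms(1) show "(cmod (lookup P d))\<^sup>2 * monom_sqnorm h d > 0"
      by (intro mult_pos_pos sqnorm_pos) (auto simp: in_keys_iff)
  qed simp
  then show "Re (inner_h h P P) > 0" by (simp add: eq)
qed

lemma inner_eq_0: "h > 0 \<Longrightarrow> P \<in> rho_polys \<Longrightarrow> inner_h h P P = 0 \<Longrightarrow> P = 0"
  using inner_pos[of h P] by force


section \<open>Exponent vectors up to permutation\<close>

text \<open>The multiset of positive exponents is the complete invariant of an exponent vector under
  permutations of the variables, that is, its underlying partition.\<close>

definition tp :: "(nat \<Rightarrow>\<^sub>0 nat) \<Rightarrow> nat multiset" where
  "tp d = image_mset (lookup d) (mset_set (keys d))"

definition tdeg :: "(nat \<Rightarrow>\<^sub>0 nat) \<Rightarrow> nat" where "tdeg d = (\<Sum>i\<in>keys d. lookup d i)"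

definition rowp :: "int_partition \<Rightarrow> (nat \<Rightarrow>\<^sub>0 nat)" where "rowp l = Abs_poly_mapping (row l)"

lemma finite_row: "finite {i. row l i \<noteq> 0}" and antimono_row: "antimono (row l)"
  using row[of l] by auto

lemma lookup_rowp [simp]: "lookup (rowp l) = row l"
  using finite_row[of l] by (simp add: rowp_def)

lemma keys_rowp: "keys (rowp l) = {i. row l i \<noteq> 0}" by (auto simp: in_keys_iff)

lemma rowp_inject: "rowp l = rowp m \<Longrightarrow> l = m"
  by (metis lookup_rowp row_inject)

lemma psize_tdeg: "psize l = tdeg (rowp l)"
  by (simp add: psize_def tdeg_def keys_rowp)

lemma tdeg_superset: "finite A \<Longrightarrow> keys d \<subseteq> A \<Longrightarrow> tdeg d = (\<Sum>k\<in>A. lookup d k)"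
  unfolding tdeg_def by (rule sum.mono_neutral_left) (auto simp: in_keys_iff)

lemma tdeg_add: "tdeg (d + d') = tdeg d + tdeg d'"
proof -
  let ?A = "keys d \<union> keys d'"
  have "tdeg (d + d') = (\<Sum>k\<in>?A. lookup (d + d') k)"
    by (rule tdeg_superset) (simp_all add: keys_add)
  then show ?thesis
    by (simp add: tdeg_superset[of ?A] lookup_add sum.distrib)
qed

lemma tdeg_0 [simp]: "tdeg 0 = 0" by (simp add: tdeg_def)
lemma tdeg_single [simp]: "tdeg (single k n) = n" by (cases "n = 0") (simp_all add: tdeg_def)

lemma tdeg_tp: "tdeg d = sum_mset (tp d)"
  by (simp add: tdeg_def tp_def sum_unfold_sum_mset)

lemma lookup_le_tdeg: "lookup d i \<le> tdeg d"
proof (cases "i \<in> keys d")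
  case True then show ?thesis unfolding tdeg_def by (intro member_le_sum) auto
qed (simp add: in_keys_iff)

lemma tp_superset:
  assumes "finite A" "keys d \<subseteq> A"
  shows "image_mset (lookup d) (mset_set A) = tp d + replicate_mset (card (A - keys d)) 0"
proof -
  have "mset_set A = mset_set (keys d) + mset_set (A - keys d)"
    using assms by (metis Un_Diff_cancel disjoint_iff finite_Diff finite_keys finite_subset
        mset_set_Union Diff_iff sup.absorb2)
  moreover have "image_mset (lookup d) (mset_set (A - keys d)) = image_mset (\<lambda>_. 0) (mset_set (A - keys d))"
    by (rule image_mset_cong) (use assms in \<open>auto simp: in_keys_iff\<close>)
  ultimately show ?thesis by (simp add: tp_def image_mset_const_eq)
qed

lemma card_keys_tp: "card (keys d) = size (tp d)" by (simp add: tp_def)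

text \<open>Padding both multisets with zeros up to the size of \<open>A\<close> makes them images
  of the same finite set. With \<open>A\<close> an initial segment this gives a permutation of the N
  variables in play.\<close>

lemma tp_eq_permutes:
  assumes "tp d = tp d'" "finite A" "keys d \<subseteq> A" "keys d' \<subseteq> A"
  obtains p where "p permutes A" "lookup d = lookup d' \<circ> p"
proof -
  have "card (A - keys d) = card (A - keys d')"
    using assms by (simp add: card_Diff_subset card_keys_tp finite_subset)
  then have "image_mset (lookup d) (mset_set A) = image_mset (lookup d') (mset_set A)"
    using assms by (simp add: tp_superset)
  then obtain p where p: "p permutes A" "\<forall>x\<in>A. lookup d x = lookup d' (p x)"
    using image_mset_eq_implies_permutes[OF assms(2)] by blast
  have "lookup d x = lookup d' (p x)" for x
  proof (cases "x \<in> A")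
    case False
    then have "x \<notin> keys d" "x \<notin> keys d'" using assms(3,4) by auto
    then show ?thesis using permutes_not_in[OF p(1) False] by (simp add: in_keys_iff)
  qed (use p in auto)
  with p(1) show ?thesis by (intro that) auto
qed

lemma bij_tp:
  assumes "bij s" "lookup d = lookup d' \<circ> s" shows "tp d = tp d'"
proof -
  have k: "keys d' = s ` keys d"
  proof (rule set_eqI)
    fix x
    obtain y where y: "x = s y" using assms(1) by (metis bij_pointE)
    show "x \<in> keys d' \<longleftrightarrow> x \<in> s ` keys d"
      using bij_is_inj[OF assms(1)] by (simp add: y inj_image_mem_iff in_keys_iff assms(2))
  qed
  have inj: "inj_on s (keys d)" using assms(1) by (meson bij_is_inj inj_on_subset subset_UNIV)
  have "tp d' = image_mset (lookup d') (image_mset s (mset_set (keys d)))"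
    by (simp add: tp_def k image_mset_mset_set[OF inj])
  then show ?thesis using assms(2) by (simp add: tp_def multiset.map_comp)
qed

lemma tp_eq_iff: "tp d = tp d' \<longleftrightarrow> (\<exists>s. bij s \<and> lookup d = lookup d' \<circ> s)"
proof
  assume "tp d = tp d'"
  then obtain p where "p permutes (keys d \<union> keys d')" "lookup d = lookup d' \<circ> p"
    using tp_eq_permutes[of d d' "keys d \<union> keys d'"] by auto
  then show "\<exists>s. bij s \<and> lookup d = lookup d' \<circ> s" using permutes_bij by blast
qed (use bij_tp in blast)

lemma size_filter_tp:
  assumes "A \<ge> 1"
  shows "size (filter_mset (\<lambda>x. x \<ge> A) (tp d)) = card {i. lookup d i \<ge> A}"
proof -
  have "{i \<in> keys d. A \<le> lookup d i} = {i. lookup d i \<ge> A}"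
    using assms by (auto simp: in_keys_iff)
  then show ?thesis by (simp add: tp_def filter_mset_image_mset)
qed

text \<open>Since rows decrease, those of length at least A form an initial segment, which is
  determined by its cardinality.\<close>

lemma row_ge_iff:
  assumes "A \<ge> 1"
  shows "row l i \<ge> A \<longleftrightarrow> i < card {i. row l i \<ge> A}"
proof -
  have fin: "finite {i. row l i \<ge> A}"
    by (rule finite_subset[OF _ finite_row[of l]]) (use assms in auto)
  show ?thesis
  proof
    assume "row l i \<ge> A"
    then have "row l j \<ge> A" if "j \<le> i" for j
      using antimonoD[OF antimono_row[of l] that] by linarith
    then have "{..i} \<subseteq> {i. row l i \<ge> A}" by auto
    from card_mono[OF fin this] show "i < card {i. row l i \<ge> A}" by simp
  next
    assume *: "i < card {i. row l i \<ge> A}"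
    show "row l i \<ge> A"
    proof (rule ccontr)
      assume "\<not> row l i \<ge> A"
      then have "j < i" if "row l j \<ge> A" for j
        using antimonoD[OF antimono_row[of l], of i j] that by linarith
      then have "{i. row l i \<ge> A} \<subseteq> {..<i}" by auto
      from card_mono[OF _ this] * show False by simp
    qed
  qed
qed

text \<open>The multiset determines, for every A \<ge> 1, how many rows have length at least A, and
  these numbers determine a decreasing sequence.\<close>

lemma tp_rowp_inject: assumes "tp (rowp l) = tp (rowp m)" shows "l = m"
proof -
  have "A \<le> row l i \<longleftrightarrow> A \<le> row m i" if "A \<ge> 1" for A i
  proof -
    have "card {i. A \<le> row l i} = card {i. A \<le> row m i}"
      using size_filter_tp[OF that, of "rowp l"] size_filter_tp[OF that, of "rowp m"] assms by simp
    then show ?thesis using row_ge_iff[OF that] by metis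
  qed
  then have "row l i = row m i" for i
    by (cases "row l i = 0"; cases "row m i = 0") (metis le_antisym le_refl less_one linorder_not_le)+
  then show ?thesis by (metis ext row_inject)
qed

lemma ex_rowp: "\<exists>l. tp (rowp l) = tp d"
proof -
  define xs where "xs = rev (sorted_list_of_multiset (tp d))"
  define f where "f i = (if i < length xs then xs ! i else 0)" for i
  have 0: "0 \<notin> set xs" by (auto simp: xs_def tp_def in_keys_iff)
  have sorted: "sorted (rev xs)" by (simp add: xs_def)
  have fin: "finite {i. f i \<noteq> 0}" by (rule finite_subset[of _ "{..<length xs}"]) (auto simp: f_def)
  have "antimono f"
  proof (rule antimonoI)
    fix i j :: nat assume "i \<le> j"
    then show "f j \<le> f i" using sorted_rev_nth_mono[OF sorted, of i j] by (auto simp: f_def)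
  qed
  then have row: "row (Abs_int_partition f) = f" using fin by (simp add: Abs_int_partition_inverse)
  have keys: "keys (rowp (Abs_int_partition f)) = {..<length xs}"
  proof (rule set_eqI)
    fix i
    have "i < length xs \<Longrightarrow> xs ! i \<noteq> 0" using 0 nth_mem by metis
    then show "i \<in> keys (rowp (Abs_int_partition f)) \<longleftrightarrow> i \<in> {..<length xs}"
      by (auto simp: keys_rowp row f_def)
  qed
  have "tp (rowp (Abs_int_partition f)) = image_mset f (mset_set {..<length xs})"
    by (simp add: tp_def keys row)
  also have "\<dots> = image_mset (\<lambda>i. xs ! i) (mset_set {..<length xs})"
    by (rule image_mset_cong) (simp add: f_def)
  also have "\<dots> = mset xs"
    by (metis map_nth mset_map mset_set_upto_eq_mset_upto)
  also have "\<dots> = tp d" by (simp add: xs_def)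
  finally show ?thesis by blast
qed

text \<open>The partition obtained by sorting the exponents.\<close>

definition ip :: "(nat \<Rightarrow>\<^sub>0 nat) \<Rightarrow> int_partition" where "ip d = (SOME l. tp (rowp l) = tp d)"

lemma tp_ip [simp]: "tp (rowp (ip d)) = tp d"
  unfolding ip_def by (rule someI_ex[OF ex_rowp])

lemma ip_eq_iff: "ip d = l \<longleftrightarrow> tp d = tp (rowp l)"
  using tp_ip tp_rowp_inject by metis

lemma psize_ip: "psize (ip d) = tdeg d" by (simp add: psize_tdeg tdeg_tp)

lemma row_eq_0: assumes "i \<ge> psize l" shows "row l i = 0"
proof (rule ccontr)
  assume *: "row l i \<noteq> 0"
  then have "row l j \<noteq> 0" if "j \<le> i" for j
    using antimonoD[OF antimono_row[of l] that] by linarith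
  then have "{..i} \<subseteq> keys (rowp l)" by (auto simp: keys_rowp)
  then have "Suc i \<le> card (keys (rowp l))" using card_mono[OF finite_keys] by fastforce
  also have "\<dots> \<le> (\<Sum>i\<in>keys (rowp l). 1)" by simp
  also have "\<dots> \<le> psize l" unfolding psize_tdeg tdeg_def by (rule sum_mono) (auto simp: in_keys_iff)
  finally show False using assms by simp
qed

lemma keys_rowp_subset: "keys (rowp l) \<subseteq> {..<psize l}"
  by (auto simp: keys_rowp) (metis row_eq_0 not_le less_irrefl)

lemma finite_exponents: "finite {d :: nat \<Rightarrow>\<^sub>0 nat. keys d \<subseteq> {..<N} \<and> tdeg d \<le> n}"
proof -
  have "finite {f. \<forall>x. (x \<in> {..<N} \<longrightarrow> f x \<in> {..n}) \<and> (x \<notin> {..<N} \<longrightarrow> f x = 0)}"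
    by (rule finite_set_of_finite_funs) auto
  then have "finite (lookup ` {d :: nat \<Rightarrow>\<^sub>0 nat. keys d \<subseteq> {..<N} \<and> tdeg d \<le> n})"
  proof (rule finite_subset[rotated], intro image_subsetI)
    fix d :: "nat \<Rightarrow>\<^sub>0 nat" assume "d \<in> {d. keys d \<subseteq> {..<N} \<and> tdeg d \<le> n}"
    then have d: "keys d \<subseteq> {..<N}" "tdeg d \<le> n" by auto
    have "lookup d x = 0" if "x \<notin> {..<N}" for x
      using that d(1) in_keys_iff[of x d] by (meson subsetD)
    moreover have "lookup d x \<le> n" for x using lookup_le_tdeg[of d x] d(2) by simp
    ultimately show "lookup d \<in> {f. \<forall>x. (x \<in> {..<N} \<longrightarrow> f x \<in> {..n}) \<and> (x \<notin> {..<N} \<longrightarrow> f x = 0)}"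
      by auto
  qed
  then show ?thesis
    by (rule finite_imageD) (intro inj_onI poly_mapping_eqI, simp)
qed

lemma finite_psize: "finite {l. psize l = n}"
proof -
  have "rowp ` {l. psize l = n} \<subseteq> {d. keys d \<subseteq> {..<n} \<and> tdeg d \<le> n}"
  proof (rule image_subsetI)
    fix l assume "l \<in> {l. psize l = n}"
    then show "rowp l \<in> {d. keys d \<subseteq> {..<n} \<and> tdeg d \<le> n}"
      using keys_rowp_subset[of l] psize_tdeg[of l] by auto
  qed
  then have "finite (rowp ` {l. psize l = n})" using finite_exponents finite_subset by blast
  then show ?thesis by (rule finite_imageD) (auto intro: inj_onI rowp_inject)
qed

lemma dominated_refl [simp]: "dominated l l" by (simp add: dominated_def)
lemma dominated_trans: "dominated a b \<Longrightarrow> dominated b c \<Longrightarrow> dominated a c"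
  unfolding dominated_def by (metis order_trans)
lemma dominated_antisym: assumes "dominated a b" "dominated b a" shows "a = b"
proof -
  have s: "(\<Sum>i<k. row a i) = (\<Sum>i<k. row b i)" for k
    using assms unfolding dominated_def by (simp add: le_antisym)
  have "row a k = row b k" for k using s[of k] s[of "Suc k"] by simp
  then show ?thesis by (metis ext row_inject)
qed
lemma finite_dominated: "finite {m. dominated m l}"
  by (rule finite_subset[OF _ finite_psize[of "psize l"]]) (auto simp: dominated_def)

text \<open>The dominance order, stated without sorting the exponents.\<close>

definition dom :: "(nat \<Rightarrow>\<^sub>0 nat) \<Rightarrow> (nat \<Rightarrow>\<^sub>0 nat) \<Rightarrow> bool" where
  "dom d d' \<longleftrightarrow> tdeg d = tdeg d' \<and> (\<forall>J. finite J \<longrightarrow> (\<exists>J'. finite J' \<and> card J' \<le> card J \<and> sum (lookup d) J \<le> sum (lookup d') J'))"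

lemma dom_trans: "dom a b \<Longrightarrow> dom b c \<Longrightarrow> dom a c"
  unfolding dom_def by (metis (no_types, opaque_lifting) order_trans)

lemma dom_tp: assumes "tp d = tp d'" shows "dom d d'"
  unfolding dom_def
proof (intro conjI allI impI)
  show "tdeg d = tdeg d'" using assms by (simp add: tdeg_tp)
  fix J :: "nat set" assume J: "finite J"
  obtain s where s: "bij s" "lookup d = lookup d' \<circ> s" using assms by (auto simp: tp_eq_iff)
  have inj: "inj_on s J" using s(1) by (meson bij_is_inj inj_on_subset subset_UNIV)
  show "\<exists>J'. finite J' \<and> card J' \<le> card J \<and> sum (lookup d) J \<le> sum (lookup d') J'"
    by (rule exI[of _ "s ` J"]) (use J s inj in \<open>simp add: card_image sum.reindex\<close>)
qed

text \<open>Enlarge \<open>J\<close> to exactly k indices. Its largest index is then at least k - 1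
  and contributes at most the last term on the right; remove it and induct. This links the unsorted
  order \<open>dom\<close> with \<open>dominated\<close>.\<close>

lemma sum_row_le: 
  assumes "finite J" "card J \<le> k" shows "sum (row l) J \<le> (\<Sum>i<k. row l i)"
proof -
  obtain K where K: "finite K" "card K = k - card J" "K \<subseteq> UNIV - J"
    using infinite_arbitrarily_large[of "UNIV - J"] assms(1) by (metis finite_Diff2 infinite_UNIV_nat)
  define J' where "J' = J \<union> K"
  have J': "J \<subseteq> J'" "card J' = k" "finite J'"
  proof -
    have "J \<inter> K = {}" using K(3) by auto
    then show "J \<subseteq> J'" "card J' = k" "finite J'"
      using K(1,2) assms by (auto simp: J'_def card_Un_disjoint)
  qed
  have "sum (row l) J \<le> sum (row l) J'" using J' by (intro sum_mono2) auto
  also have "\<dots> \<le> (\<Sum>i<k. row l i)"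
    using J'(3,2)
  proof (induction k arbitrary: J')
    case (Suc k)
    define M where "M = Max J'"
    have M: "M \<in> J'" using Suc unfolding M_def by (metis Max_in card.empty nat.distinct(1))
    have "J' \<subseteq> {..M}" using Suc(2) by (auto simp: M_def)
    then have "k \<le> M" using Suc(3) card_mono[of "{..M}" J'] by simp
    then have "row l M \<le> row l k" using antimonoD[OF antimono_row] by blast
    moreover have "sum (row l) (J' - {M}) \<le> (\<Sum>i<k. row l i)"
      by (rule Suc.IH) (use Suc M in auto)
    ultimately show ?case using M Suc(2) by (simp add: sum.remove[of J' M])
  qed auto
  finally show ?thesis .
qed

lemma dom_rowp: assumes "dom (rowp m) (rowp l)" shows "dominated m l"
  unfolding dominated_def
proof (intro conjI allI)
  show "psize m = psize l" using assms by (simp add: dom_def psize_tdeg)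
  fix k
  obtain J' where "finite J'" "card J' \<le> k" "(\<Sum>i<k. row m i) \<le> sum (row l) J'"
    using assms unfolding dom_def by (metis card_lessThan finite_lessThan lookup_rowp)
  with sum_row_le[of J' k l] show "(\<Sum>i<k. row m i) \<le> (\<Sum>i<k. row l i)" by simp
qed

lemma dom_ip: "dom d d' \<Longrightarrow> dominated (ip d) (ip d')"
  by (intro dom_rowp) (metis dom_tp dom_trans tp_ip)

lemma dom_antisym: "dom d d' \<Longrightarrow> dom d' d \<Longrightarrow> tp d = tp d'"
  by (metis dom_ip dominated_antisym tp_ip)

section \<open>Symmetric polynomials\<close>

lemma finite_orbit: "finite {b. keys b \<subseteq> {..<N} \<and> tp b = M}"
  by (rule finite_subset[OF _ finite_exponents[of N "sum_mset M"]]) (auto simp: tdeg_tp)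

lemma lookup_monomial_sym:
  "lookup (monomial_sym N m) d = (if keys d \<subseteq> {..<N} \<and> ip d = m then 1 else 0)"
proof -
  have "{b. keys b \<subseteq> {..<N} \<and> (\<exists>s. bij s \<and> lookup b = row m \<circ> s)} = {b. keys b \<subseteq> {..<N} \<and> tp b = tp (rowp m)}"
    by (simp add: tp_eq_iff)
  then have "lookup (monomial_sym N m) d = (\<Sum>b | keys b \<subseteq> {..<N} \<and> tp b = tp (rowp m). if b = d then 1 else 0)"
    by (simp add: monomial_sym_def lookup_sum lookup_single when_def)
  then show ?thesis by (simp add: finite_orbit ip_eq_iff)
qed

definition polys_in :: "nat set \<Rightarrow> cpoly set" where
  "polys_in A = {f. \<forall>d. lookup f d \<noteq> 0 \<longrightarrow> keys d \<subseteq> A}"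

lemma polys_inD: "f \<in> polys_in A \<Longrightarrow> d \<in> keys f \<Longrightarrow> k \<in> keys d \<Longrightarrow> k \<in> A"
  by (auto simp: polys_in_def in_keys_iff subset_iff)

lemma polys_inI: "(\<And>d k. d \<in> keys f \<Longrightarrow> k \<in> keys d \<Longrightarrow> k \<in> A) \<Longrightarrow> f \<in> polys_in A"
  by (auto simp: polys_in_def in_keys_iff)

lemma psubst_id: "psubst var P = P"
proof -
  have "mono_at var d = single d 1" for d
  proof -
    have "(\<Prod>k\<in>A. single (single k (n k)) (1::complex)) = single (\<Sum>k\<in>A. single k (n k)) 1" for A and n :: "nat \<Rightarrow> nat"
      by (induction A rule: infinite_finite_induct) (simp_all add: mult_single)
    then have "mono_at var d = single (\<Sum>k\<in>keys d. single k (lookup d k)) 1"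
      unfolding mono_at_def monom_power_conv[symmetric] unfolding monom_power_def by blast
    then show ?thesis by (simp add: poly_sum_singles)
  qed
  then show ?thesis
    using poly_sum_singles[of P] by (simp add: psubst_lin lin_def const_mult_single)
qed

text \<open>Substituting each variable for itself reproduces f and exhibits it as a ring expression
  in the variables of \<open>A\<close>, so a property need only be stable under the ring
  operations.\<close>

lemma cpoly_alg_induct [consumes 1, case_names const var add mult]:
  assumes "f \<in> polys_in A"
    and const: "\<And>c. Q (const c)" and var: "\<And>k. k \<in> A \<Longrightarrow> Q (var k)"
    and add: "\<And>f g. Q f \<Longrightarrow> Q g \<Longrightarrow> Q (f + g)" and mult: "\<And>f g. Q f \<Longrightarrow> Q g \<Longrightarrow> Q (f * g)"
  shows "Q f"
proof -
  have Q0: "Q 0" and Q1: "Q 1" using const[of 0] const[of 1] by auto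
  have sum: "Q (sum f A)" if "\<And>x. x \<in> A \<Longrightarrow> Q (f x)" for f :: "(nat \<Rightarrow>\<^sub>0 nat) \<Rightarrow> _" and A
    using that by (induction A rule: infinite_finite_induct) (auto simp: Q0 add)
  have prod: "Q (prod f A)" if "\<And>x. x \<in> A \<Longrightarrow> Q (f x)" for f :: "nat \<Rightarrow> _" and A
    using that by (induction A rule: infinite_finite_induct) (auto simp: Q1 mult)
  have pow: "Q (f ^ n)" if "Q f" for f n using that by (induction n) (auto simp: Q1 mult)
  have "Q (psubst var f)"
    unfolding psubst_def
    by (intro sum mult const prod pow var polys_inD[OF assms(1)])
  then show ?thesis by (simp only: psubst_id)
qed

lemma polys_in_0 [simp]: "0 \<in> polys_in A" by (simp add: polys_in_def)
lemma polys_in_const [simp]: "const c \<in> polys_in A" by (simp add: polys_in_def lookup_const)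
lemma polys_in_var [simp]: "k \<in> A \<Longrightarrow> var k \<in> polys_in A"
  by (simp add: polys_in_def monom_power_def lookup_single when_def)
lemma polys_in_add: "f \<in> polys_in A \<Longrightarrow> g \<in> polys_in A \<Longrightarrow> f + g \<in> polys_in A"
  by (rule polys_inI) (use keys_add[of f g] polys_inD in blast)
lemma polys_in_mult: assumes "f \<in> polys_in A" "g \<in> polys_in A" shows "f * g \<in> polys_in A"
proof (rule polys_inI)
  fix d k assume "d \<in> keys (f * g)" and k: "k \<in> keys d"
  then obtain a b where ab: "d = a + b" "a \<in> keys f" "b \<in> keys g" using keys_mult by blast
  have "k \<in> keys a \<or> k \<in> keys b" using keys_add[of a b] k ab(1) by auto
  then show "k \<in> A" using assms polys_inD ab by blast
qed
lemma polys_in_sum: "(\<And>x. x \<in> B \<Longrightarrow> f x \<in> polys_in A) \<Longrightarrow> sum f B \<in> polys_in A"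
  by (induction B rule: infinite_finite_induct) (simp_all add: polys_in_add)
lemma polys_in_1 [simp]: "1 \<in> polys_in A" using polys_in_const[of 1] by simp
lemma polys_in_power: "f \<in> polys_in A \<Longrightarrow> f ^ n \<in> polys_in A"
  by (induction n) (simp_all add: polys_in_mult)
lemma polys_in_prod: "(\<And>x. x \<in> B \<Longrightarrow> f x \<in> polys_in A) \<Longrightarrow> prod f B \<in> polys_in A"
  by (induction B rule: infinite_finite_induct) (simp_all add: polys_in_mult)
lemma polys_in_psubst: "(\<And>k. g k \<in> polys_in A) \<Longrightarrow> psubst g P \<in> polys_in A"
  unfolding psubst_def by (intro polys_in_sum polys_in_mult polys_in_prod polys_in_power) auto

lemma in_vars_polys_in: "in_vars N f \<in> polys_in {..<N}"
  unfolding in_vars_def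
  by (intro polys_in_psubst polys_in_sum, subst monom_power_conv) (simp add: polys_in_power)

section \<open>Total degree in the variables\<close>

definition tgr :: "nat \<Rightarrow> cpoly set" where
  "tgr n = {f. \<forall>d. lookup f d \<noteq> 0 \<longrightarrow> tdeg d = n}"

lemma tgrD: "f \<in> tgr n \<Longrightarrow> d \<in> keys f \<Longrightarrow> tdeg d = n"
  by (simp add: tgr_def in_keys_iff)
lemma tgrI: "(\<And>d. d \<in> keys f \<Longrightarrow> tdeg d = n) \<Longrightarrow> f \<in> tgr n"
  by (simp add: tgr_def in_keys_iff)
lemma tgr_0 [simp]: "0 \<in> tgr n" by (simp add: tgr_def)
lemma tgr_add: "f \<in> tgr n \<Longrightarrow> g \<in> tgr n \<Longrightarrow> f + g \<in> tgr n"
  by (rule tgrI) (use keys_add[of f g] tgrD in blast)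
lemma tgr_sum: "(\<And>x. x \<in> B \<Longrightarrow> f x \<in> tgr n) \<Longrightarrow> sum f B \<in> tgr n"
  by (induction B rule: infinite_finite_induct) (simp_all add: tgr_add)
lemma tgr_const: "const c \<in> tgr 0" by (simp add: tgr_def lookup_const)
lemma tgr_monom_power: "monom_power i k \<in> tgr k"
  by (simp add: tgr_def monom_power_def lookup_single when_def)
lemma tgr_mult: assumes "f \<in> tgr m" "g \<in> tgr n" shows "f * g \<in> tgr (m + n)"
proof (rule tgrI)
  fix d assume "d \<in> keys (f * g)"
  then obtain a b where "d = a + b" "a \<in> keys f" "b \<in> keys g" using keys_mult by blast
  then show "tdeg d = m + n" using assms tgrD by (simp add: tdeg_add)
qed
lemma tgr_power: "f \<in> tgr n \<Longrightarrow> f ^ k \<in> tgr (n * k)"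
proof (induction k)
  case (Suc k) then show ?case using tgr_mult[of f n "f ^ k" "n * k"] by simp
qed (use tgr_const[of 1] in simp)
lemma tgr_prod: "(\<And>x. x \<in> B \<Longrightarrow> f x \<in> tgr (n x)) \<Longrightarrow> prod f B \<in> tgr (sum n B)"
  by (induction B rule: infinite_finite_induct) (use tgr_const[of 1] in \<open>auto simp: tgr_mult\<close>)

lemma in_vars_tgr: assumes "f \<in> hom n" shows "in_vars N f \<in> tgr n"
  unfolding in_vars_def psubst_def
proof (rule tgr_sum)
  fix d assume d: "d \<in> keys f"
  have "(\<Prod>k\<in>keys d. (\<Sum>i<N. monom_power i k) ^ lookup d k) \<in> tgr (\<Sum>k\<in>keys d. k * lookup d k)"
    by (intro tgr_prod tgr_power tgr_sum tgr_monom_power)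
  moreover have "(\<Sum>k\<in>keys d. k * lookup d k) = n" using assms d by (auto simp: hom_def wt_def)
  ultimately show "const (lookup f d) * (\<Prod>k\<in>keys d. (\<Sum>i<N. monom_power i k) ^ lookup d k) \<in> tgr n"
    using tgr_mult[OF tgr_const] by fastforce
qed

lemma in_vars_add: "in_vars N (f + g) = in_vars N f + in_vars N g" by (simp add: in_vars_def psubst_add)
lemma in_vars_diff: "in_vars N (f - g) = in_vars N f - in_vars N g" by (simp add: in_vars_def psubst_diff)
lemma in_vars_0 [simp]: "in_vars N 0 = 0" by (simp add: in_vars_def)
lemma in_vars_const [simp]: "in_vars N (const c) = const c" by (simp add: in_vars_def)
lemma in_vars_sum: "in_vars N (sum f A) = (\<Sum>x\<in>A. in_vars N (f x))" by (simp add: in_vars_def psubst_sum)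
lemma in_vars_mult: "in_vars N (f * g) = in_vars N f * in_vars N g" by (simp add: in_vars_def psubst_mult)
lemma in_vars_const_mult: "in_vars N (const c * g) = const c * in_vars N g" by (simp add: in_vars_mult)
lemma in_vars_var: "in_vars N (var k) = (\<Sum>i<N. monom_power i k)" by (simp add: in_vars_def)

section \<open>Independence of the number of variables, and symmetry\<close>

definition trunc :: "nat \<Rightarrow> nat \<Rightarrow> cpoly" where "trunc N i = (if i < N then var i else 0)"

lemma lookup_psubst_trunc:
  "lookup (psubst (trunc N) f) d = (if keys d \<subseteq> {..<N} then lookup f d else 0)"
proof (induction f rule: cpoly_induct)
  case (single d' c)
  have "psubst (trunc N) (single d' c) = (if keys d' \<subseteq> {..<N} then single d' c else 0)"
  proof (cases "keys d' \<subseteq> {..<N}")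
    case True
    then have "psubst (trunc N) (single d' c) = psubst var (single d' c)"
      by (intro psubst_cong) (auto simp: trunc_def split: if_splits)
    with True show ?thesis by (simp add: psubst_id)
  next
    case False
    then obtain k where k: "k \<in> keys d'" "\<not> k < N" by auto
    then have "mono_at (trunc N) d' = 0"
      unfolding mono_at_def by (intro prod_zero) (auto intro!: bexI[of _ k] simp: trunc_def in_keys_iff)
    with False show ?thesis by (simp add: psubst_lin)
  qed
  then show ?case by (auto simp: lookup_single when_def)
qed (auto simp: psubst_add lookup_add)

lemma rho_polysD: "f \<in> rho_polys \<Longrightarrow> d \<in> keys f \<Longrightarrow> k \<in> keys d \<Longrightarrow> k \<noteq> 0"
  by (rule notI) (simp add: rho_polys_def)

text \<open>Setting the last variable to 0 maps each p_k with k \<ge> 1 to the power sum in one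
  variable less. It fails for p_0, the number of variables, which is why \<open>rho_polys\<close> is
  required.\<close>

lemma in_vars_trunc:
  assumes "f \<in> rho_polys" shows "psubst (trunc N) (in_vars (Suc N) f) = in_vars N f"
proof -
  have "psubst (trunc N) (in_vars (Suc N) f) = psubst (\<lambda>k. \<Sum>i<Suc N. trunc N i ^ k) f"
    by (simp only: in_vars_def psubst_psubst psubst_sum psubst_var)
  also have "\<dots> = in_vars N f"
    unfolding in_vars_def
  proof (rule psubst_cong)
    fix d k assume "d \<in> keys f" "k \<in> keys d"
    then have "k \<noteq> 0" using rho_polysD[OF assms] by blast
    then show "(\<Sum>i<Suc N. trunc N i ^ k) = (\<Sum>i<N. monom_power i k)"
      by (subst monom_power_conv) (simp add: trunc_def)
  qed
  finally show ?thesis .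
qed

lemma lookup_in_vars_stable:
  assumes "f \<in> rho_polys" "keys d \<subseteq> {..<N}" "N \<le> M"
  shows "lookup (in_vars M f) d = lookup (in_vars N f) d"
  using assms(3)
proof (induction M rule: dec_induct)
  case (step M)
  have "keys d \<subseteq> {..<M}" using assms(2) step by auto
  then have "lookup (in_vars (Suc M) f) d = lookup (psubst (trunc M) (in_vars (Suc M) f)) d"
    by (simp add: lookup_psubst_trunc)
  then show ?case using step assms(1) by (simp add: in_vars_trunc)
qed simp

lemma lookup_psubst_perm:
  assumes "bij p" shows "lookup (psubst (\<lambda>i. var (p i)) f) d = lookup f (Poly_Mapping.map_key p d)"
proof (induction f rule: cpoly_induct)
  case (single d' c)
  have inj: "inj p" using assms bij_is_inj by blast
  have "(\<Prod>k\<in>A. single (single (p k) (n k)) (1::complex)) = single (\<Sum>k\<in>A. single (p k) (n k)) 1" for A and n :: "nat \<Rightarrow> nat"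
    by (induction A rule: infinite_finite_induct) (simp_all add: mult_single)
  then have *: "mono_at (\<lambda>i. var (p i)) d' = single (\<Sum>k\<in>keys d'. single (p k) (lookup d' k)) 1"
    unfolding mono_at_def monom_power_conv[symmetric] unfolding monom_power_def by blast
  define e where "e = (\<Sum>k\<in>keys d'. single (p k) (lookup d' k))"
  have le: "lookup e (p j) = lookup d' j" for j
  proof -
    have "lookup e (p j) = (\<Sum>k\<in>keys d'. if k = j then lookup d' k else 0)"
      unfolding e_def lookup_sum lookup_single when_def using inj by (auto simp: inj_eq intro!: sum.cong)
    then show ?thesis by (simp add: in_keys_iff)
  qed
  have "e = d \<longleftrightarrow> (\<forall>j. lookup e (p j) = lookup d (p j))"
    using assms by (metis bij_pointE poly_mapping_eqI)
  also have "\<dots> \<longleftrightarrow> d' = Poly_Mapping.map_key p d"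
    by (simp add: le poly_mapping_eq_iff fun_eq_iff map_key.rep_eq[OF inj])
  finally show ?case
    by (simp add: psubst_lin * e_def[symmetric] const_mult_single lookup_single when_def)
qed (simp_all add: psubst_add lookup_add)

lemma in_vars_perm:
  assumes "p permutes {..<N}" shows "psubst (\<lambda>i. var (p i)) (in_vars N f) = in_vars N f"
proof -
  have "psubst (\<lambda>i. var (p i)) (in_vars N f) = psubst (\<lambda>k. \<Sum>i<N. monom_power (p i) k) f"
    by (simp add: in_vars_def psubst_psubst psubst_sum monom_power_conv[symmetric])
  also have "(\<lambda>k. \<Sum>i<N. monom_power (p i) k) = (\<lambda>k. \<Sum>i<N. monom_power i k)"
    using assms by (intro ext sum.permute[symmetric, unfolded o_def])
  finally show ?thesis by (simp add: in_vars_def)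
qed

lemma lookup_in_vars_sym:
  assumes "tp d = tp d'" "keys d \<subseteq> {..<N}" "keys d' \<subseteq> {..<N}"
  shows "lookup (in_vars N f) d = lookup (in_vars N f) d'"
proof -
  obtain p where p: "p permutes {..<N}" "lookup d = lookup d' \<circ> p"
    using tp_eq_permutes[OF assms(1) _ assms(2,3)] by auto
  have "lookup (in_vars N f) d' = lookup (in_vars N f) (Poly_Mapping.map_key p d')"
    by (metis in_vars_perm[OF p(1)] lookup_psubst_perm[OF permutes_bij[OF p(1)]])
  also have "Poly_Mapping.map_key p d' = d"
    by (simp add: poly_mapping_eq_iff map_key.rep_eq[OF permutes_inj[OF p(1)]] p(2))
  finally show ?thesis ..
qed

text \<open>The coefficient of f at the monomial symmetric function of m. A partition m has at most
  \<open>psize m\<close> parts, so that many variables are enough to see it.\<close>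

definition cf :: "cpoly \<Rightarrow> int_partition \<Rightarrow> complex" where
  "cf f m = lookup (in_vars (psize m) f) (rowp m)"

lemma lookup_in_vars:
  assumes "f \<in> rho_polys" "keys d \<subseteq> {..<N}"
  shows "lookup (in_vars N f) d = cf f (ip d)"
proof -
  let ?M = "max N (psize (ip d))"
  have "lookup (in_vars N f) d = lookup (in_vars ?M f) d"
    by (rule lookup_in_vars_stable[symmetric]) (use assms in auto)
  also have "\<dots> = lookup (in_vars ?M f) (rowp (ip d))"
    by (rule lookup_in_vars_sym) (use assms keys_rowp_subset[of "ip d"] in \<open>auto dest!: subsetD\<close>)
  also have "\<dots> = cf f (ip d)"
    unfolding cf_def by (rule lookup_in_vars_stable) (use assms keys_rowp_subset in auto)
  finally show ?thesis .
qed

text \<open>By symmetry and stability every coefficient depends only on the sorted exponents, so one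
  finite family of numbers serves for all N at once.\<close>

lemma in_vars_expansion:
  assumes "f \<in> rho_polys" "finite S" "\<And>m. cf f m \<noteq> 0 \<Longrightarrow> m \<in> S"
  shows "in_vars N f = (\<Sum>m\<in>S. const (cf f m) * monomial_sym N m)"
proof (rule poly_mapping_eqI)
  fix d
  show "lookup (in_vars N f) d = lookup (\<Sum>m\<in>S. const (cf f m) * monomial_sym N m) d"
  proof (cases "keys d \<subseteq> {..<N}")
    case True
    have "lookup (\<Sum>m\<in>S. const (cf f m) * monomial_sym N m) d = (\<Sum>m\<in>S. if ip d = m then cf f m else 0)"
      unfolding lookup_sum by (rule sum.cong) (use True in \<open>auto simp: lookup_monomial_sym\<close>)
    also have "\<dots> = cf f (ip d)" using assms(2) assms(3)[of "ip d"] by auto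
    finally show ?thesis using True assms(1) by (simp add: lookup_in_vars)
  next
    case False
    then have "lookup (in_vars N f) d = 0" using in_vars_polys_in[of N f] by (auto simp: polys_in_def)
    then show ?thesis using False by (simp add: lookup_sum lookup_monomial_sym)
  qed
qed

lemma cf_hom: "f \<in> hom n \<Longrightarrow> cf f m \<noteq> 0 \<Longrightarrow> psize m = n"
  using in_vars_tgr[of f n "psize m"] by (auto simp: cf_def tgr_def psize_tdeg)

lemma cf_sum: "cf (sum f A) m = (\<Sum>x\<in>A. cf (f x) m)" by (simp add: cf_def in_vars_sum lookup_sum)
lemma cf_diff: "cf (f - g) m = cf f m - cf g m" by (simp add: cf_def in_vars_diff lookup_minus)
lemma cf_const_mult: "cf (const c * f) m = c * cf f m" by (simp add: cf_def in_vars_const_mult)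

lemma cf_monomial_sym:
  assumes "\<And>N. in_vars N f = monomial_sym N m" shows "cf f l = (if l = m then 1 else 0)"
  using keys_rowp_subset[of l]
  by (simp add: cf_def assms lookup_monomial_sym ip_eq_iff)
    (use tp_rowp_inject in blast)

section \<open>The chain rule and injectivity\<close>

lemma dd_psubst:
  assumes "finite A" "P \<in> polys_in A"
  shows "dd i (psubst g P) = (\<Sum>k\<in>A. psubst g (dd k P) * dd i (g k))"
  using assms(2)
proof (induction P rule: cpoly_alg_induct)
  case (var k)
  then have "(\<Sum>j\<in>A. psubst g (dd j (var k)) * dd i (g j)) = (\<Sum>j\<in>A. if k = j then dd i (g j) else 0)"
    by (intro sum.cong) (auto simp: dd_var)
  then show ?case using var assms(1) by simp
next
  case (mult P Q)
  then show ?case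
    by (simp add: psubst_mult dd_mult psubst_add distrib_right sum.distrib sum_distrib_left sum_distrib_right distrib_left mult_ac)
qed (simp_all add: psubst_add dd_add distrib_right sum.distrib)

lemma dd_power: "dd k (f ^ Suc n) = of_nat (Suc n) * f ^ n * dd k f"
  by (induction n) (simp_all add: dd_mult algebra_simps)

lemma dd_monom_power: "dd k (monom_power i n) = (if i = k \<and> n > 0 then of_nat n * monom_power k (n - 1) else 0)"
proof (cases n)
  case 0
  have "monom_power i 0 = const 1" by (simp add: monom_power_def)
  with 0 show ?thesis by (simp del: const_1)
next
  case (Suc m)
  then show ?thesis
    by (simp add: monom_power_conv[of i "Suc m"] monom_power_conv[of k m] dd_power dd_var del: power_Suc)
qed

section \<open>Algebraic independence of the power sums\<close>

definition hle :: "nat \<Rightarrow> cpoly set" where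
  "hle n = {f. \<forall>d. lookup f d \<noteq> 0 \<longrightarrow> lookup d 0 = 0 \<and> wt d \<le> n}"

lemma hom_hle: "f \<in> hom n \<Longrightarrow> f \<in> hle n" by (auto simp: hle_def hom_iff)
lemma hle_rho: "f \<in> hle n \<Longrightarrow> f \<in> rho_polys" by (auto simp: hle_def rho_polys_def in_keys_iff)
lemma rho_hle: assumes "f \<in> rho_polys" shows "\<exists>n. f \<in> hle n"
proof
  show "f \<in> hle (\<Sum>d\<in>keys f. wt d)"
    unfolding hle_def
    by (use assms in \<open>auto simp: rho_polys_def in_keys_iff intro!: member_le_sum\<close>)
qed

lemma hle_dd: assumes "f \<in> hle n" "k \<ge> 1" shows "dd k f \<in> hle (n - 1)"
  unfolding hle_def
proof (intro CollectI allI impI)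
  fix d assume "lookup (dd k f) d \<noteq> 0"
  then have "lookup f (d + single k 1) \<noteq> 0" by (auto simp: lookup_dd)
  with assms(1) have "lookup (d + single k 1) 0 = 0 \<and> wt (d + single k 1) \<le> n" unfolding hle_def by blast
  with assms(2) show "lookup d 0 = 0 \<and> wt d \<le> n - 1" by (auto simp: lookup_add wt_add)
qed

lemma dd_hle_eq_0: assumes "f \<in> hle n" "k > n" shows "dd k f = 0"
proof (rule poly_mapping_eqI, rule ccontr)
  fix d assume "lookup (dd k f) d \<noteq> lookup 0 d"
  then have "lookup f (d + single k 1) \<noteq> 0" by (auto simp: lookup_dd)
  with assms(1) have "wt (d + single k 1) \<le> n" unfolding hle_def by blast
  with assms(2) show False by (simp add: wt_add)
qed

lemma hle_polys_in: assumes "f \<in> hle n" shows "f \<in> polys_in {1..n}"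
  unfolding polys_in_def
proof (intro CollectI allI impI subsetI)
  fix d k assume "lookup f d \<noteq> 0" "k \<in> keys d"
  with assms have 0: "lookup d 0 = 0" and w: "wt d \<le> n" by (auto simp: hle_def)
  have "k * lookup d k \<le> wt d" unfolding wt_def by (rule member_le_sum) (use \<open>k \<in> keys d\<close> in auto)
  moreover have "k * 1 \<le> k * lookup d k" using \<open>k \<in> keys d\<close> by (intro mult_le_mono2) (simp add: in_keys_iff Suc_le_eq)
  moreover have "k \<noteq> 0" using 0 \<open>k \<in> keys d\<close> by (metis in_keys_iff)
  ultimately show "k \<in> {1..n}" using w by (simp only: atLeastAtMost_iff mult_1_right) linarith
qed

text \<open>By the chain rule, since x_N d/dx_N sends p_k to k x_N^k. The result is a generating
  function of all derivatives of f in powers of x_N; it yields both injectivity and the derivative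
  part of the Lax operator.\<close>

lemma xdx_in_vars:
  assumes "f \<in> hle n"
  shows "var N * dd N (in_vars (Suc N) f) = (\<Sum>k=1..n. of_nat k * in_vars (Suc N) (dd k f) * monom_power N k)"
proof -
  have "dd N (in_vars (Suc N) f) = (\<Sum>k=1..n. in_vars (Suc N) (dd k f) * dd N (\<Sum>i<Suc N. monom_power i k))"
    unfolding in_vars_def by (rule dd_psubst) (use hle_polys_in[OF assms] in auto)
  also have "\<dots> = (\<Sum>k=1..n. in_vars (Suc N) (dd k f) * (of_nat k * monom_power N (k - 1)))"
  proof (rule sum.cong)
    fix k assume k: "k \<in> {1..n}"
    have "dd N (\<Sum>i<Suc N. monom_power i k) = of_nat k * monom_power N (k - 1)"
      using k by (simp add: dd_add dd_sum dd_monom_power)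
    then show "in_vars (Suc N) (dd k f) * dd N (\<Sum>i<Suc N. monom_power i k)
       = in_vars (Suc N) (dd k f) * (of_nat k * monom_power N (k - 1))" by simp
  qed simp
  finally have "var N * dd N (in_vars (Suc N) f) = (\<Sum>k=1..n. of_nat k * in_vars (Suc N) (dd k f) * (var N * monom_power N (k - 1)))"
    by (simp add: sum_distrib_left mult_ac)
  also have "\<dots> = (\<Sum>k=1..n. of_nat k * in_vars (Suc N) (dd k f) * monom_power N k)"
  proof (rule sum.cong)
    fix k :: nat assume "k \<in> {1..n}"
    then have "var N * monom_power N (k - 1) = monom_power N k"
      by (cases k) (auto simp: var_mult_monom_power)
    then show "of_nat k * in_vars (Suc N) (dd k f) * (var N * monom_power N (k - 1)) = of_nat k * in_vars (Suc N) (dd k f) * monom_power N k"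
      by simp
  qed simp
  finally show ?thesis .
qed

text \<open>If f vanishes in all numbers of variables, then so does \<open>xdx_in_vars\<close>, and
  comparing powers of x_N shows that every derivative of f vanishes in all numbers of variables. The
  derivatives have smaller weight, so they are 0 by induction; then f is constant, hence 0.\<close>

lemma in_vars_inj:
  assumes "f \<in> hle n" "\<And>N. in_vars N f = 0"
  shows "f = 0"
  using assms
proof (induction n arbitrary: f)
  have all_dd: "f = 0" if "f \<in> rho_polys" "\<And>N. in_vars N f = 0" "\<And>k. k \<ge> 1 \<Longrightarrow> dd k f = 0" for f
  proof -
    have "lookup f d = 0" if d0: "d \<noteq> 0" for d
    proof (rule ccontr)
      assume nz: "lookup f d \<noteq> 0"
      obtain k where k: "k \<in> keys d" using d0 by (metis ex_in_conv keys_eq_empty)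
      then obtain x where x: "d = single k 1 + x" using exists_single_add[of d k] by (auto simp: in_keys_iff)
      have "k \<noteq> 0" using k nz rho_polysD[OF \<open>f \<in> rho_polys\<close>, of d] by (simp add: in_keys_iff)
      then have "lookup (dd k f) x = 0" using \<open>\<And>k. k \<ge> 1 \<Longrightarrow> dd k f = 0\<close> by simp
      then have "of_nat (lookup x k + 1) * lookup f d = 0"
        using lookup_dd[of k f x] x by (simp add: add.commute)
      then have "of_nat (lookup x k + 1) = (0::complex)" using nz by simp
      then show False unfolding of_nat_eq_0_iff by simp
    qed
    then have "f = const (lookup f 0)" by (intro poly_mapping_eqI) (auto simp: lookup_const)
    then show ?thesis by (metis in_vars_const that(2))
  qed
  {
    case 0
    show ?case by (rule all_dd) (use 0 hle_rho dd_hle_eq_0 in auto)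
  next
    case (Suc n)
    have dd0: "dd k f = 0" if "k \<ge> 1" for k
      using that
    proof (induction k rule: less_induct)
      case (less k)
      show ?case
      proof (cases "k \<le> Suc n")
        case True
        have "lookup (in_vars N (dd k f)) d = 0" for N d
        proof (cases "keys d \<subseteq> {..<N}")
          case dN: True
          then have d0: "lookup d N = 0" by (auto simp: in_keys_iff subset_iff) 
          \<comment> \<open>The factor coming from \<open>dd j f\<close> contains x_N as well, so
            the coefficient at x_N^k receives contributions from all j \<le> k. Those with j < k
            vanish by the inner induction, and for j = k only the part free of x_N is left.\<close>
          let ?e = "d + single N k"
          have "0 = lookup (\<Sum>j=1..Suc n. of_nat j * in_vars (Suc N) (dd j f) * monom_power N j) ?e"
            using xdx_in_vars[OF Suc.prems(1), of N] Suc.prems(2) by simp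
          also have "\<dots> = (\<Sum>j=1..Suc n. lookup (monom_power N j * (const (of_nat j) * in_vars (Suc N) (dd j f))) ?e)"
            unfolding lookup_sum const_of_nat by (rule sum.cong) (simp_all add: mult_ac)
          also have "\<dots> = (\<Sum>j=1..Suc n. if j = k then of_nat k * lookup (in_vars (Suc N) (dd k f)) d else 0)"
          proof (rule sum.cong)
            fix j assume j: "j \<in> {1..Suc n}"
            consider "j < k" | "j = k" | "j > k" by linarith
            then show "lookup (monom_power N j * (const (of_nat j) * in_vars (Suc N) (dd j f))) ?e =
              (if j = k then of_nat k * lookup (in_vars (Suc N) (dd k f)) d else 0)"
            proof cases
              case 1 then show ?thesis using less.IH[of j] j by simp
            next
              case 2 then show ?thesis by (simp add: lookup_monom_power_mult lookup_add)
            next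
              case 3 then show ?thesis by (simp add: lookup_monom_power_mult lookup_add d0)
            qed
          qed simp
          also have "\<dots> = of_nat k * lookup (in_vars (Suc N) (dd k f)) d"
            using True less.prems by simp
          finally have "lookup (in_vars (Suc N) (dd k f)) d = 0" using less.prems by auto
          then show ?thesis
            using lookup_in_vars_stable[of "dd k f" d N "Suc N"] dN hle_rho[OF hle_dd[OF Suc.prems(1) less.prems]] by simp
        next
          case False
          then show ?thesis using in_vars_polys_in[of N "dd k f"] by (auto simp: polys_in_def)
        qed
        then have "in_vars N (dd k f) = 0" for N by (intro poly_mapping_eqI) simp
        then show ?thesis using Suc.IH hle_dd[OF Suc.prems(1) less.prems] by simp
      next
        case False
        then show ?thesis using dd_hle_eq_0[OF Suc.prems(1)] by simp
      qed
    qed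
    show ?case by (rule all_dd) (use Suc.prems hle_rho dd0 in auto)
  }
qed

lemma cf_inj:
  assumes "f \<in> rho_polys" "g \<in> rho_polys" "\<And>N. in_vars N f = in_vars N g" shows "f = g"
proof -
  have "f - g \<in> rho_polys"
    using assms(1,2) keys_diff[of f g] by (auto simp: rho_polys_def)
  then obtain n where "f - g \<in> hle n" using rho_hle by blast
  then have "f - g = 0" by (rule in_vars_inj) (simp add: in_vars_diff assms(3))
  then show ?thesis by simp
qed


section \<open>The Lax operator\<close>

text \<open>A family \<open>g\<close> of polynomials indexed by \<open>j \<le> D\<close> stands for \<open>\<Sum>j. g j * w ^ j\<close>. The truncation at \<open>D\<close> is
  harmless on families whose \<open>j\<close>-th member is homogeneous of weight \<open>D - j\<close>.\<close>

definition Lop :: "complex \<Rightarrow> complex \<Rightarrow> complex \<Rightarrow> nat \<Rightarrow> (nat \<Rightarrow> cpoly) \<Rightarrow> nat \<Rightarrow> cpoly" where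
  "Lop c1 c2 e D g j = (if j \<le> D then
     (\<Sum>i\<in>{j<..D}. const c1 * (var (i - j) * g i)) + const (e * of_nat j) * g j +
     (\<Sum>i<j. const (c2 * of_nat (j - i)) * dd (j - i) (g i)) else 0)"

definition init :: "cpoly \<Rightarrow> nat \<Rightarrow> cpoly" where "init f j = (if j = 0 then f else 0)"

text \<open>The coefficients stay general because two normalizations occur: a, b, b - a in the power
  sums, where the operator is triangular, and 1, h, e in the \<rho>_k, where paths are expanded.
  \<open>D\<close> is meant to be the weight of the argument.\<close>

definition Top :: "complex \<Rightarrow> complex \<Rightarrow> complex \<Rightarrow> nat \<Rightarrow> nat \<Rightarrow> cpoly \<Rightarrow> cpoly" where
  "Top c1 c2 e D l f = (Lop c1 c2 e D ^^ l) (init f) 0"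

definition graded :: "nat \<Rightarrow> (nat \<Rightarrow> cpoly) \<Rightarrow> bool" where
  "graded D g \<longleftrightarrow> (\<forall>j\<le>D. g j \<in> hom (D - j)) \<and> (\<forall>j>D. g j = 0)"

lemma graded_init: "f \<in> hom D \<Longrightarrow> graded D (init f)"
  by (auto simp: graded_def init_def)

lemma graded_Lop:
  assumes "graded D g" shows "graded D (Lop c1 c2 e D g)"
  unfolding graded_def
proof (intro conjI allI impI)
  fix j assume j: "j \<le> D"
  have 1: "const c1 * (var (i - j) * g i) \<in> hom (D - j)" if "i \<in> {j<..D}" for i
  proof (rule hom_const_mult)
    have "g i \<in> hom (D - i)" using assms that by (auto simp: graded_def)
    then have "var (i - j) * g i \<in> hom (D - i + (i - j))" using that by (intro hom_var_mult) auto
    then show "var (i - j) * g i \<in> hom (D - j)" using that by simp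
  qed
  have 2: "const (c2 * of_nat (j - i)) * dd (j - i) (g i) \<in> hom (D - j)" if "i < j" for i
  proof (rule hom_const_mult)
    have "g i \<in> hom (D - i)" using assms that j by (auto simp: graded_def)
    then have "dd (j - i) (g i) \<in> hom (D - i - (j - i))" by (rule hom_dd)
    then show "dd (j - i) (g i) \<in> hom (D - j)" using that j by simp
  qed
  have 3: "const (e * of_nat j) * g j \<in> hom (D - j)"
    using assms j by (auto simp: graded_def intro: hom_const_mult)
  show "Lop c1 c2 e D g j \<in> hom (D - j)"
    unfolding Lop_def using j 1 2 3 by (auto intro!: hom_add hom_sum)
qed (simp add: Lop_def)

lemma graded_Lop_pow: "f \<in> hom D \<Longrightarrow> graded D ((Lop c1 c2 e D ^^ l) (init f))"
  by (induction l) (simp_all add: graded_init graded_Lop)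

lemma Top_hom: "f \<in> hom D \<Longrightarrow> Top c1 c2 e D l f \<in> hom D"
  using graded_Lop_pow[of f D l c1 c2 e] by (auto simp: Top_def graded_def)

lemma Lop_add: "Lop c1 c2 e D (\<lambda>j. g j + g' j) = (\<lambda>j. Lop c1 c2 e D g j + Lop c1 c2 e D g' j)"
  by (rule ext) (simp add: Lop_def distrib_left dd_add sum.distrib)

lemma Lop_const_mult: "Lop c1 c2 e D (\<lambda>j. const c * g j) = (\<lambda>j. const c * Lop c1 c2 e D g j)"
  by (rule ext) (simp add: Lop_def distrib_left dd_const_mult sum_distrib_left mult.left_commute)

lemma Lop_pow_add: "(Lop c1 c2 e D ^^ l) (\<lambda>j. g j + g' j) = (\<lambda>j. (Lop c1 c2 e D ^^ l) g j + (Lop c1 c2 e D ^^ l) g' j)"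
  by (induction l) (simp_all add: Lop_add)

lemma Lop_pow_const_mult: "(Lop c1 c2 e D ^^ l) (\<lambda>j. const c * g j) = (\<lambda>j. const c * (Lop c1 c2 e D ^^ l) g j)"
  by (induction l) (simp_all add: Lop_const_mult)

lemma Top_add: "Top c1 c2 e D l (f + g) = Top c1 c2 e D l f + Top c1 c2 e D l g"
proof -
  have "init (f + g) = (\<lambda>j. init f j + init g j)" by (auto simp: init_def)
  then show ?thesis by (simp add: Top_def Lop_pow_add)
qed

lemma Top_const_mult: "Top c1 c2 e D l (const c * f) = const c * Top c1 c2 e D l f"
proof -
  have "init (const c * f) = (\<lambda>j. const c * init f j)" by (auto simp: init_def)
  then show ?thesis by (simp add: Top_def Lop_pow_const_mult)
qed

lemma Top_0 [simp]: "Top c1 c2 e D l 0 = 0" using Top_const_mult[of c1 c2 e D l 0 0] by simp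

lemma Top_sum: "Top c1 c2 e D l (sum f A) = (\<Sum>x\<in>A. Top c1 c2 e D l (f x))"
  by (induction A rule: infinite_finite_induct) (simp_all add: Top_add)

lemma triangle_swap:
  fixes F :: "nat \<Rightarrow> nat \<Rightarrow> 'a::comm_monoid_add"
  shows "(\<Sum>j\<le>D. \<Sum>i\<in>{j<..D}. F i j) = (\<Sum>i\<le>D. \<Sum>j<i. F i j)"
proof -
  have "(\<Sum>j\<le>D. \<Sum>i\<in>{j<..D}. F i j) = (\<Sum>j\<in>{..D}. \<Sum>i\<in>{i\<in>{..D}. j < i}. F i j)"
    by (intro sum.cong) auto
  also have "\<dots> = (\<Sum>i\<in>{..D}. \<Sum>j\<in>{j\<in>{..D}. j < i}. F i j)"
    by (rule sum.swap_restrict) auto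
  also have "\<dots> = (\<Sum>i\<le>D. \<Sum>j<i. F i j)" by (intro sum.cong) auto
  finally show ?thesis .
qed

lemma triangle_shift:
  fixes F :: "nat \<Rightarrow> nat \<Rightarrow> 'a::comm_monoid_add"
  shows "(\<Sum>i\<le>D. \<Sum>k=1..D - i. F i k) = (\<Sum>j\<le>D. \<Sum>i<j. F i (j - i))"
proof -
  have "(\<Sum>k=1..D - i. F i k) = (\<Sum>j\<in>{i<..D}. F i (j - i))" if "i \<le> D" for i
    by (rule sum.reindex_bij_witness[of _ "\<lambda>j. j - i" "\<lambda>k. k + i"]) (use that in auto)
  then have "(\<Sum>i\<le>D. \<Sum>k=1..D - i. F i k) = (\<Sum>i\<le>D. \<Sum>j\<in>{i<..D}. F i (j - i))" by simp
  also have "\<dots> = (\<Sum>j\<le>D. \<Sum>i<j. F i (j - i))" by (rule triangle_swap)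
  finally show ?thesis .
qed

text \<open>With the powers of w orthonormal, the part that lowers w by k and multiplies by \<rho>_k
  is the adjoint of the part that raises w by k and differentiates. By \<open>inner_dd\<close> this
  requires c2 = c1 h; the diagonal part requires e to be real.\<close>

lemma Lop_selfadjoint:
  assumes h: "c1 = of_real r1" "c2 = of_real (r1 * h)" "e = of_real r2"
  shows "(\<Sum>j\<le>D. inner_h h (u j) (Lop c1 c2 e D v j)) = (\<Sum>j\<le>D. inner_h h (Lop c1 c2 e D u j) (v j))"
proof -
  have "(\<Sum>j\<le>D. inner_h h (u j) (Lop c1 c2 e D v j)) =
     (\<Sum>j\<le>D. \<Sum>i\<in>{j<..D}. inner_h h (u j) (const c1 * (var (i - j) * v i))) + 
     (\<Sum>j\<le>D. inner_h h (u j) (const (e * of_nat j) * v j)) +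
     (\<Sum>j\<le>D. \<Sum>i<j. inner_h h (u j) (const (c2 * of_nat (j - i)) * dd (j - i) (v i)))"
    by (simp add: Lop_def inner_add_right inner_sum_right sum.distrib)
  also have "(\<Sum>j\<le>D. \<Sum>i\<in>{j<..D}. inner_h h (u j) (const c1 * (var (i - j) * v i))) =
     (\<Sum>j\<le>D. \<Sum>i<j. inner_h h (const (c2 * of_nat (j - i)) * dd (j - i) (u i)) (v j))"
  proof (subst triangle_swap, intro sum.cong refl)
    fix i j :: nat
    show "inner_h h (u i) (const c1 * (var (j - i) * v j)) = inner_h h (const (c2 * of_nat (j - i)) * dd (j - i) (u i)) (v j)"
      by (simp add: inner_const_right inner_const_left inner_dd h del: of_nat_diff)
  qed
  also have "(\<Sum>j\<le>D. \<Sum>i<j. inner_h h (u j) (const (c2 * of_nat (j - i)) * dd (j - i) (v i))) =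
     (\<Sum>j\<le>D. \<Sum>i\<in>{j<..D}. inner_h h (const c1 * (var (i - j) * u i)) (v j))"
  proof (subst triangle_swap, intro sum.cong refl)
    fix i j :: nat
    have "inner_h h (var (i - j) * u i) (v j) = cnj (of_real (h * real (i - j)) * inner_h h (dd (i - j) (v j)) (u i))"
      by (metis inner_cnj inner_dd)
    also have "\<dots> = of_real (h * real (i - j)) * inner_h h (u i) (dd (i - j) (v j))"
      by (metis complex_cnj_complex_of_real complex_cnj_mult inner_cnj)
    finally show "inner_h h (u i) (const (c2 * of_nat (i - j)) * dd (i - j) (v j)) = inner_h h (const c1 * (var (i - j) * u i)) (v j)"
      by (simp add: inner_const_right inner_const_left h del: of_nat_diff)
  qed
  also have "(\<Sum>j\<le>D. inner_h h (u j) (const (e * of_nat j) * v j)) = (\<Sum>j\<le>D. inner_h h (const (e * of_nat j) * u j) (v j))"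
    by (simp add: inner_const_right inner_const_left h)
  finally show ?thesis
    by (simp add: Lop_def inner_add_left inner_sum_left sum.distrib)
qed

lemma Top_selfadjoint:
  assumes h: "c1 = of_real r1" "c2 = of_real (r1 * h)" "e = of_real r2"
  shows "inner_h h f (Top c1 c2 e D l g) = inner_h h (Top c1 c2 e D l f) g"
proof -
  have "(\<Sum>j\<le>D. inner_h h (u j) ((Lop c1 c2 e D ^^ l) v j)) = (\<Sum>j\<le>D. inner_h h ((Lop c1 c2 e D ^^ l) u j) (v j))" for u v
  proof (induction l arbitrary: v)
    case (Suc l)
    have "(\<Sum>j\<le>D. inner_h h (u j) ((Lop c1 c2 e D ^^ Suc l) v j)) = (\<Sum>j\<le>D. inner_h h ((Lop c1 c2 e D ^^ l) u j) (Lop c1 c2 e D v j))"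
      using Suc.IH[of "Lop c1 c2 e D v"] by (simp add: funpow_swap1)
    then show ?case by (simp add: Lop_selfadjoint[OF h])
  qed simp
  from this[of "init f" "init g"] show ?thesis
    unfolding Top_def init_def[of f] init_def[of g]
    by (simp add: if_distrib[of "\<lambda>x. inner_h h x _"] if_distrib[of "inner_h h _"] if_distribR sum.delta cong: if_cong)
qed

section \<open>The Lax operator in finitely many variables\<close>

text \<open>The substitution \<open>\<rho>\<^sub>k = \<Sum>i\<le>N. x\<^sub>i ^ k\<close>, \<open>w = x\<^sub>N\<close>; \<open>Exch N i\<close> is the divided difference \<open>x\<^sub>i (1 - s) / (x\<^sub>N - x\<^sub>i)\<close>
  applied to its result, where \<open>s\<close> exchanges \<open>x\<^sub>i\<close> and \<open>x\<^sub>N\<close>.\<close>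

definition Phi :: "nat \<Rightarrow> nat \<Rightarrow> (nat \<Rightarrow> cpoly) \<Rightarrow> cpoly" where
  "Phi N D g = (\<Sum>j\<le>D. in_vars (Suc N) (g j) * monom_power N j)"

definition Exch :: "nat \<Rightarrow> nat \<Rightarrow> nat \<Rightarrow> (nat \<Rightarrow> cpoly) \<Rightarrow> cpoly" where
  "Exch N i D g = (\<Sum>j\<le>D. in_vars (Suc N) (g j) * (\<Sum>r<j. monom_power N r * monom_power i (j - r)))"

text \<open>The coefficients \<open>in_vars (Suc N) (g j)\<close> are symmetric, so the exchange
  acts only on x_N^j, and the geometric sum telescopes after multiplication by x_N - x_i.
  Triangularity is derived from this division-free relation alone.\<close>

lemma Exch_relation:
  assumes "i < N"
  shows "(var N - var i) * Exch N i D g =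
    var i * (Phi N D g - psubst (\<lambda>k. var (Transposition.transpose i N k)) (Phi N D g))"
proof -
  have p: "Transposition.transpose i N permutes {..<Suc N}" using assms by (intro permutes_swap_id) auto
  have sw: "psubst (\<lambda>k. var (Transposition.transpose i N k)) (Phi N D g) = (\<Sum>j\<le>D. in_vars (Suc N) (g j) * monom_power i j)"
    by (simp add: Phi_def psubst_sum psubst_mult in_vars_perm[OF p] monom_power_conv[symmetric])
  have geom: "(var N - var i) * (\<Sum>r<j. monom_power N r * monom_power i (j - r)) = var i * (monom_power N j - monom_power i j)" for j
  proof -
    have "monom_power N r * monom_power i (j - r) = var i * (var i ^ (j - Suc r) * var N ^ r)" if "r < j" for r
    proof -
      have "j - r = Suc (j - Suc r)" using that by simp
      then show ?thesis
        by (metis monom_power_conv mult.assoc mult.commute power_Suc)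
    qed
    then have "(\<Sum>r<j. monom_power N r * monom_power i (j - r)) = var i * (\<Sum>r<j. var i ^ (j - Suc r) * var N ^ r)"
      by (simp add: sum_distrib_left)
    then show ?thesis
      using power_diff_sumr2[of "var N" j "var i"]
      by (simp add: monom_power_conv[of N j] monom_power_conv[of i j] mult_ac)
  qed
  have "(var N - var i) * Exch N i D g = (\<Sum>j\<le>D. in_vars (Suc N) (g j) * ((var N - var i) * (\<Sum>r<j. monom_power N r * monom_power i (j - r))))"
    by (simp add: Exch_def sum_distrib_left mult.left_commute)
  also have "\<dots> = var i * (Phi N D g - psubst (\<lambda>k. var (Transposition.transpose i N k)) (Phi N D g))"
    unfolding geom sw by (simp add: Phi_def sum_distrib_left sum_subtractf[symmetric] right_diff_distrib mult_ac)
  finally show ?thesis .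
qed

text \<open>The diagonal coefficient b - a is what makes the pieces fit: its part b completes the
  derivative of the coefficients to x_N d/dx_N of the whole sum, and its part -a cancels the
  contribution of x_N itself to the power sums.\<close>

lemma Phi_Lop:
  assumes "graded D g" "e = b - a"
  shows "Phi N D (Lop a b e D g) =
    const b * (var N * dd N (Phi N D g)) + const a * (\<Sum>i<N. Exch N i D g)"
proof -
  let ?I = "in_vars (Suc N)" and ?x = "monom_power N"
  have xx: "?x i * ?x j = ?x (i + j)" for i j
    by (simp add: monom_power_conv[of N i] monom_power_conv[of N j] monom_power_conv[of N "i + j"] power_add)
  have "Phi N D (Lop a b e D g) =
     (\<Sum>j\<le>D. \<Sum>i\<in>{j<..D}. const a * ?I (var (i - j)) * ?I (g i) * ?x j) +
     (\<Sum>j\<le>D. const (e * of_nat j) * ?I (g j) * ?x j) +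
     (\<Sum>j\<le>D. \<Sum>i<j. const (b * of_nat (j - i)) * ?I (dd (j - i) (g i)) * ?x j)"
    by (simp add: Phi_def Lop_def in_vars_add in_vars_sum in_vars_mult distrib_right sum_distrib_right sum.distrib mult.assoc)
  also have "(\<Sum>j\<le>D. \<Sum>i\<in>{j<..D}. const a * ?I (var (i - j)) * ?I (g i) * ?x j)
     = const a * (\<Sum>j\<le>D. ?I (g j) * (\<Sum>r<j. ?I (var (j - r)) * ?x r))"
    by (subst triangle_swap) (simp add: sum_distrib_left mult_ac)
  also have "(\<Sum>j\<le>D. \<Sum>i<j. const (b * of_nat (j - i)) * ?I (dd (j - i) (g i)) * ?x j) = 
      const b * (\<Sum>j\<le>D. (var N * dd N (?I (g j))) * ?x j)"
  proof -
    have "(\<Sum>j\<le>D. \<Sum>i<j. const (b * of_nat (j - i)) * ?I (dd (j - i) (g i)) * ?x j)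
      = (\<Sum>j\<le>D. \<Sum>i<j. const b * (of_nat (j - i) * ?I (dd (j - i) (g i)) * ?x (i + (j - i))))"
      by (intro sum.cong refl) (simp add: const_mult const_of_nat mult.assoc del: of_nat_diff)
    also have "\<dots> = (\<Sum>i\<le>D. \<Sum>k=1..D - i. const b * (of_nat k * ?I (dd k (g i)) * ?x (i + k)))"
      by (rule triangle_shift[symmetric])
    also have "\<dots> = const b * (\<Sum>i\<le>D. (\<Sum>k=1..D - i. of_nat k * ?I (dd k (g i)) * ?x k) * ?x i)"
      by (simp add: sum_distrib_left sum_distrib_right mult_ac xx[symmetric])
    also have "\<dots> = const b * (\<Sum>j\<le>D. (var N * dd N (?I (g j))) * ?x j)"
      using assms(1) by (intro arg_cong2[of _ _ _ _ "(*)"] sum.cong refl)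
        (auto simp: graded_def xdx_in_vars[OF hom_hle])
    finally show ?thesis .
  qed
  \<comment> \<open>In p_(j-r) the summands x_i with i < N give the exchange terms, while x_N^(j-r)
    x_N^r = x_N^j occurs once for each of the j values of r.\<close>
  also have "const a * (\<Sum>j\<le>D. ?I (g j) * (\<Sum>r<j. ?I (var (j - r)) * ?x r)) =
     const a * (\<Sum>i<N. Exch N i D g) + (\<Sum>j\<le>D. const (a * of_nat j) * ?I (g j) * ?x j)"
  proof -
    have "(\<Sum>r<j. ?I (var (j - r)) * ?x r) = (\<Sum>i<N. \<Sum>r<j. ?x r * monom_power i (j - r)) + of_nat j * ?x j" for j
    proof -
      have "(\<Sum>r<j. ?I (var (j - r)) * ?x r) = (\<Sum>r<j. (\<Sum>i<N. ?x r * monom_power i (j - r)) + ?x (j - r) * ?x r)"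
        by (simp add: in_vars_var distrib_left sum_distrib_left mult.commute)
      also have "\<dots> = (\<Sum>r<j. \<Sum>i<N. ?x r * monom_power i (j - r)) + (\<Sum>r<j. ?x j)"
        by (simp add: sum.distrib xx)
      also have "(\<Sum>r<j. \<Sum>i<N. ?x r * monom_power i (j - r)) = (\<Sum>i<N. \<Sum>r<j. ?x r * monom_power i (j - r))"
        by (rule sum.swap)
      finally show ?thesis by simp
    qed
    then have "const a * (\<Sum>j\<le>D. ?I (g j) * (\<Sum>r<j. ?I (var (j - r)) * ?x r)) =
      const a * (\<Sum>j\<le>D. \<Sum>i<N. ?I (g j) * (\<Sum>r<j. ?x r * monom_power i (j - r))) + (\<Sum>j\<le>D. const a * (of_nat j * (?I (g j) * ?x j)))"
      by (simp add: distrib_left sum.distrib sum_distrib_left mult.left_commute)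
    also have "(\<Sum>j\<le>D. \<Sum>i<N. ?I (g j) * (\<Sum>r<j. ?x r * monom_power i (j - r))) = (\<Sum>i<N. Exch N i D g)"
      unfolding Exch_def by (rule sum.swap)
    finally show ?thesis by (simp add: const_mult const_of_nat mult.assoc)
  qed
  \<comment> \<open>Product rule: x_N d/dx_N also acts on the explicit power x_N^j and produces the
    factor j.\<close>
  also have "const b * (\<Sum>j\<le>D. (var N * dd N (?I (g j))) * ?x j) =
     const b * (var N * dd N (Phi N D g)) - (\<Sum>j\<le>D. const (b * of_nat j) * ?I (g j) * ?x j)"
  proof -
    have "var N * dd N (?I (g j) * ?x j) = (var N * dd N (?I (g j))) * ?x j + of_nat j * ?I (g j) * ?x j" for j
    proof (cases j)
      case (Suc k)
      have "var N * dd N (?x j) = of_nat j * (var N * ?x k)"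
        by (simp add: Suc dd_monom_power mult.left_commute)
      also have "\<dots> = of_nat j * ?x j" by (simp only: var_mult_monom_power Suc)
      finally have "var N * dd N (?x j) = of_nat j * ?x j" .
      then show ?thesis by (simp add: dd_mult distrib_left mult_ac)
    qed (simp add: dd_mult dd_monom_power mult_ac)
    then have "var N * dd N (Phi N D g) = (\<Sum>j\<le>D. (var N * dd N (?I (g j))) * ?x j) + (\<Sum>j\<le>D. of_nat j * ?I (g j) * ?x j)"
      by (simp add: Phi_def dd_sum sum_distrib_left sum.distrib)
    then show ?thesis by (simp add: distrib_left sum_distrib_left const_mult const_of_nat mult.assoc)
  qed
  also have "(\<Sum>j\<le>D. const (e * of_nat j) * ?I (g j) * ?x j) = 
     (\<Sum>j\<le>D. const (b * of_nat j) * ?I (g j) * ?x j) - (\<Sum>j\<le>D. const (a * of_nat j) * ?I (g j) * ?x j)"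
    by (simp add: assms(2) left_diff_distrib const_diff sum_subtractf)
  finally show ?thesis by simp
qed

section \<open>Triangularity\<close>

text \<open>Used with d free of x_N and x_i: all exponents other than those two are frozen.\<close>

definition q2 :: "(nat \<Rightarrow>\<^sub>0 nat) \<Rightarrow> nat \<Rightarrow> nat \<Rightarrow> nat \<Rightarrow> nat \<Rightarrow> (nat \<Rightarrow>\<^sub>0 nat)" where
  "q2 d N i m k = d + single N m + single i k"

lemma lookup_q2:
  assumes "i \<noteq> N" "lookup d N = 0" "lookup d i = 0"
  shows "lookup (q2 d N i m k) j = (if j = N then m else if j = i then k else lookup d j)"
  using assms by (auto simp: q2_def lookup_add lookup_single when_def)

lemma q2_eqI:
  assumes "i \<noteq> N" "lookup d N = 0" "lookup d i = 0"
    and "lookup d' N = m" "lookup d' i = k" "\<And>j. j \<noteq> N \<Longrightarrow> j \<noteq> i \<Longrightarrow> lookup d' j = lookup d j"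
  shows "d' = q2 d N i m k"
  by (rule poly_mapping_eqI) (use assms in \<open>auto simp: lookup_q2\<close>)

lemma exists_q2:
  assumes "i \<noteq> N"
  obtains d0 where "lookup d0 N = 0" "lookup d0 i = 0" "d = q2 d0 N i (lookup d N) (lookup d i)"
proof
  define d0 where "d0 = d - single N (lookup d N) - single i (lookup d i)"
  show 1: "lookup d0 N = 0" "lookup d0 i = 0" using assms
    by (auto simp: d0_def lookup_minus lookup_single when_def)
  show "d = q2 d0 N i (lookup d N) (lookup d i)"
    by (rule q2_eqI[OF assms 1]) (auto simp: d0_def lookup_minus lookup_single when_def)
qed

text \<open>Compare coefficients along the line of fixed total exponent t + s in x_N and x_i. The
  relation expresses the difference of neighbouring coefficients of E through those of P, and the
  coefficient at s = 0 is 0, which starts the recursion.\<close>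

lemma exchange_coeff:
  assumes rel: "(var N - var i) * E = var i * (P - psubst (\<lambda>k. var (Transposition.transpose i N k)) P)"
    and iN: "i \<noteq> N" and d0: "lookup d0 N = 0" "lookup d0 i = 0"
  shows "lookup E (q2 d0 N i t s) = (\<Sum>m\<in>{t<..t+s}. lookup P (q2 d0 N i m (t + s - m)) - lookup P (q2 d0 N i (t + s - m) m))"
proof -
  let ?q = "q2 d0 N i"
  have N_mult: "lookup (var N * F) (?q m k) = (if m = 0 then 0 else lookup F (?q (m - 1) k))" for F m k
  proof -
    have "?q m k - single N 1 = ?q (m - 1) k" if "m \<noteq> 0"
      by (rule q2_eqI[OF iN d0]) (use iN d0 in \<open>auto simp: lookup_minus lookup_q2 lookup_single when_def\<close>)
    then show ?thesis using iN d0 by (simp add: lookup_monom_power_mult lookup_q2)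
  qed
  have i_mult: "lookup (var i * F) (?q m k) = (if k = 0 then 0 else lookup F (?q m (k - 1)))" for F m k
  proof -
    have "?q m k - single i 1 = ?q m (k - 1)" if "k \<noteq> 0"
      by (rule q2_eqI[OF iN d0]) (use iN d0 in \<open>auto simp: lookup_minus lookup_q2 lookup_single when_def\<close>)
    then show ?thesis using iN d0 by (simp add: lookup_monom_power_mult lookup_q2)
  qed
  have sw: "lookup (psubst (\<lambda>k. var (Transposition.transpose i N k)) P) (?q m k) = lookup P (?q k m)" for m k
  proof -
    have "Poly_Mapping.map_key (Transposition.transpose i N) (?q m k) = ?q k m"
      by (rule q2_eqI[OF iN d0])
         (use iN d0 in \<open>auto simp: map_key.rep_eq lookup_q2 Transposition.transpose_def inj_transpose\<close>)
    then show ?thesis by (simp add: lookup_psubst_perm)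
  qed
  have R: "lookup ((var N - var i) * E) (?q m k) = (if k = 0 then 0 else lookup P (?q m (k - 1)) - lookup P (?q (k - 1) m))" for m k
    unfolding rel by (simp add: i_mult lookup_minus sw)
  have R': "lookup ((var N - var i) * E) (?q m k) = (if m = 0 then 0 else lookup E (?q (m - 1) k)) - (if k = 0 then 0 else lookup E (?q m (k - 1)))" for m k
    by (simp add: left_diff_distrib lookup_minus N_mult i_mult)
  show ?thesis
  proof (induction s arbitrary: t)
    case 0
    show ?case using R[of "Suc t" 0] R'[of "Suc t" 0] by simp
  next
    case (Suc s)
    have "lookup E (?q t (Suc s)) - lookup E (?q (Suc t) s) = lookup P (?q (Suc t) s) - lookup P (?q s (Suc t))"
      using R[of "Suc t" "Suc s"] R'[of "Suc t" "Suc s"] by simp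
    then have "lookup E (?q t (Suc s)) = lookup E (?q (Suc t) s) + (lookup P (?q (Suc t) s) - lookup P (?q s (Suc t)))"
      by (simp add: algebra_simps)
    also have "lookup E (?q (Suc t) s) = (\<Sum>m\<in>{Suc t<..t + Suc s}. lookup P (?q m (t + Suc s - m)) - lookup P (?q (t + Suc s - m) m))"
      using Suc.IH[of "Suc t"] by simp
    also have "{t<..t + Suc s} = insert (Suc t) {Suc t<..t + Suc s}" by auto
    ultimately show ?case by simp
  qed
qed

text \<open>The reflection m to t + s - m preserves the range t < m < s and reverses the sign of the
  summand, so these terms cancel. What remains has m at least as large as both t and s, hence only
  exponents spread further apart.\<close>

lemma exchange_coeff_upper:
  fixes F :: "nat \<Rightarrow> complex"
  shows "(\<Sum>m\<in>{t<..t+s}. F m - F (t + s - m)) = (\<Sum>m | t < m \<and> s \<le> m \<and> m \<le> t + s. F m - F (t + s - m))"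
proof -
  let ?A = "{m. t < m \<and> m < s}"
  have fin: "finite ?A" by (rule finite_subset[of _ "{..s}"]) auto
  have eq: "{t<..t+s} = {m. t < m \<and> s \<le> m \<and> m \<le> t + s} \<union> ?A" by auto
  have "(\<Sum>m\<in>?A. F (t + s - m)) = (\<Sum>m\<in>?A. F m)"
    by (rule sum.reindex_bij_witness[of _ "\<lambda>m. t + s - m" "\<lambda>m. t + s - m"]) auto
  moreover have "finite {m. t < m \<and> s \<le> m \<and> m \<le> t + s}" by (rule finite_subset[of _ "{..t+s}"]) auto
  ultimately show ?thesis using fin unfolding eq by (subst sum.union_disjoint) (auto simp: sum_subtractf)
qed

text \<open>If J contains only x_i, the larger exponent m now sits at x_N, so x_i is replaced by
  x_N; in the other cases J itself serves.\<close>

lemma dom_spread: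
  assumes iN: "i \<noteq> N" and d0: "lookup d0 N = 0" "lookup d0 i = 0"
    and m: "t \<le> m" "s \<le> m" "m \<le> t + s"
  shows "dom (q2 d0 N i t s) (q2 d0 N i m (t + s - m))"
  unfolding dom_def
proof (intro conjI allI impI)
  let ?d = "q2 d0 N i t s" and ?e = "q2 d0 N i m (t + s - m)"
  show "tdeg ?d = tdeg ?e" using m by (simp add: q2_def tdeg_add)
  fix J :: "nat set" assume J: "finite J"
  have off: "sum (lookup ?d) X = sum (lookup ?e) X" if "N \<notin> X" "i \<notin> X" for X
    by (rule sum.cong) (use that iN d0 in \<open>auto simp: lookup_q2\<close>)
  have ex: "lookup ?d N = t" "lookup ?d i = s" "lookup ?e N = m" "lookup ?e i = t + s - m"
    using iN d0 by (auto simp: lookup_q2)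
  show "\<exists>J'. finite J' \<and> card J' \<le> card J \<and> sum (lookup ?d) J \<le> sum (lookup ?e) J'"
  proof (cases "N \<in> J")
    case N: True
    show ?thesis
    proof (cases "i \<in> J")
      case True
      have "sum (lookup f) J = lookup f N + (lookup f i + sum (lookup f) (J - {N} - {i}))" for f :: "nat \<Rightarrow>\<^sub>0 nat"
        using J N True iN by (simp add: sum.remove[of J N] sum.remove[of "J - {N}" i])
      then show ?thesis using J m off[of "J - {N} - {i}"] by (intro exI[of _ J]) (simp add: ex)
    next
      case False
      have "sum (lookup f) J = lookup f N + sum (lookup f) (J - {N})" for f :: "nat \<Rightarrow>\<^sub>0 nat"
        using J N by (simp add: sum.remove[of J N])
      then show ?thesis using J m off[of "J - {N}"] False by (intro exI[of _ J]) (simp add: ex)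
    qed
  next
    case N: False
    show ?thesis
    proof (cases "i \<in> J")
      case True
      let ?J = "insert N (J - {i})"
      have "sum (lookup ?d) J = s + sum (lookup ?d) (J - {i})"
        using J True by (simp add: sum.remove[of J i] ex)
      moreover have "sum (lookup ?e) ?J = m + sum (lookup ?e) (J - {i})"
        using J N by (simp add: ex)
      moreover have "card ?J \<le> card J" using J True N card_Suc_Diff1[of J i] by simp
      ultimately show ?thesis using J m off[of "J - {i}"] N by (intro exI[of _ ?J]) simp
    next
      case False
      then show ?thesis using J off[of J] N by (intro exI[of _ J]) simp
    qed
  qed
qed

lemma tp_q2_swap:
  assumes iN: "i \<noteq> N" and d0: "lookup d0 N = 0" "lookup d0 i = 0"
  shows "tp (q2 d0 N i m k) = tp (q2 d0 N i k m)"
  unfolding tp_eq_iff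
  by (rule exI[of _ "Transposition.transpose i N"])
     (use assms in \<open>auto simp: fun_eq_iff lookup_q2 Transposition.transpose_def\<close>)

text \<open>The sum of the squared exponents is an invariant of the type. Writing m = t + u = s + v,
  it grows by 2uv > 0.\<close>

lemma tp_spread_neq:
  assumes iN: "i \<noteq> N" and d0: "lookup d0 N = 0" "lookup d0 i = 0"
    and m: "t < m" "s < m" "m \<le> t + s"
  shows "tp (q2 d0 N i t s) \<noteq> tp (q2 d0 N i m (t + s - m))"
proof
  let ?d = "q2 d0 N i t s" and ?e = "q2 d0 N i m (t + s - m)"
  assume eq: "tp ?d = tp ?e"
  let ?A = "insert N (insert i (keys d0))"
  have sq: "(\<Sum>j\<in>?A. (lookup (q2 d0 N i x y) j)\<^sup>2) = x\<^sup>2 + y\<^sup>2 + (\<Sum>j\<in>keys d0. (lookup d0 j)\<^sup>2)" for x y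
  proof -
    have "(\<Sum>j\<in>keys d0. (lookup (q2 d0 N i x y) j)\<^sup>2) = (\<Sum>j\<in>keys d0. (lookup d0 j)\<^sup>2)"
      by (rule sum.cong) (use assms in \<open>auto simp: lookup_q2 in_keys_iff\<close>)
    moreover have "N \<notin> keys d0" "i \<notin> keys d0" using d0 by (auto simp: in_keys_iff)
    ultimately show ?thesis using assms by (simp add: lookup_q2)
  qed
  have "(\<Sum>j\<in>?A. (lookup d j)\<^sup>2) = (\<Sum>x\<in>#tp d. x\<^sup>2)" if "keys d \<subseteq> ?A" for d
  proof -
    have "(\<Sum>j\<in>?A. (lookup d j)\<^sup>2) = (\<Sum>j\<in>keys d. (lookup d j)\<^sup>2)"
      by (rule sum.mono_neutral_right) (use that in \<open>auto simp: in_keys_iff\<close>)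
    then show ?thesis by (simp add: tp_def sum_unfold_sum_mset multiset.map_comp o_def)
  qed
  moreover have "keys (q2 d0 N i x y) \<subseteq> ?A" for x y
    using keys_add[of "d0 + single N x" "single i y"] keys_add[of d0 "single N x"] by (auto simp: q2_def split: if_splits)
  ultimately have "t\<^sup>2 + s\<^sup>2 = m\<^sup>2 + (t + s - m)\<^sup>2" using sq[of t s] sq[of m "t + s - m"] eq by (metis add_right_cancel)
  moreover obtain u where u: "m = t + u" "u > 0" using m(1) less_imp_add_positive by blast
  moreover obtain v where v: "m = s + v" "v > 0" using m(2) less_imp_add_positive by blast
  moreover obtain w where w: "t + s = m + w" using m(3) le_Suc_ex by blast
  ultimately have "t = v + w" "s = u + w" "m = u + v + w" "t\<^sup>2 + s\<^sup>2 = m\<^sup>2 + w\<^sup>2" by auto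
  then have "(v + w)\<^sup>2 + (u + w)\<^sup>2 = (u + v + w)\<^sup>2 + w\<^sup>2" by simp
  then have "u * v = 0" by (simp add: power2_eq_square algebra_simps)
  then show False using u(2) v(2) by simp
qed

text \<open>\<open>tv a b l k B\<close> is the coefficient, in the \<open>k\<close>-th power of the Lax operator applied to the monomial
  symmetric function of \<open>l\<close>, of each monomial of type \<open>l\<close> in which \<open>x\<^sub>N\<close> has exponent \<open>B\<close>; setting \<open>x\<^sub>N = 0\<close>
  selects \<open>B = 0\<close>.\<close>

fun tv :: "real \<Rightarrow> real \<Rightarrow> int_partition \<Rightarrow> nat \<Rightarrow> nat \<Rightarrow> real" where
  "tv a b l 0 B = 1"
| "tv a b l (Suc k) B = b * real B * tv a b l k B + a * (\<Sum>i | B < row l i. tv a b l k (row l i) - tv a b l k B)"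

text \<open>The image under \<open>Phi\<close> is symmetric only in the variables before x_N, so its
  leading coefficients may depend on the exponent of x_N; the second clause says that they depend on
  nothing else.\<close>

definition tri :: "nat \<Rightarrow> int_partition \<Rightarrow> (nat \<Rightarrow> complex) \<Rightarrow> cpoly \<Rightarrow> bool" where
  "tri N l \<tau> P \<longleftrightarrow> (\<forall>d. lookup P d \<noteq> 0 \<longrightarrow> dom d (rowp l)) \<and>
     (\<forall>d. keys d \<subseteq> {..<Suc N} \<and> tp d = tp (rowp l) \<longrightarrow> lookup P d = \<tau> (lookup d N))"

text \<open>A coefficient of E at d is a combination of coefficients of P at vectors that spread d,
  whence the support condition. If d has type l, strict spreads lie strictly above l and drop out,
  and only the exchange of the two exponents survives, which occurs when x_i has the larger
  one.\<close>

lemma tri_exchange: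
  assumes tri: "tri N l \<tau> P" and iN: "i < N"
    and rel: "(var N - var i) * E = var i * (P - psubst (\<lambda>k. var (Transposition.transpose i N k)) P)"
  shows "lookup E d \<noteq> 0 \<Longrightarrow> dom d (rowp l)"
    and "keys d \<subseteq> {..<Suc N} \<Longrightarrow> tp d = tp (rowp l) \<Longrightarrow>
       lookup E d = (if lookup d i > lookup d N then \<tau> (lookup d i) - \<tau> (lookup d N) else 0)"
proof -
  have iN': "i \<noteq> N" using iN by simp
  obtain d0 where d0: "lookup d0 N = 0" "lookup d0 i = 0" and d: "d = q2 d0 N i (lookup d N) (lookup d i)"
    using exists_q2[OF iN'] .
  define t s where "t = lookup d N" and "s = lookup d i"
  let ?q = "q2 d0 N i"
  define F where "F m = lookup P (?q m (t + s - m))" for m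
  let ?M = "{m. t < m \<and> s \<le> m \<and> m \<le> t + s}"
  have finM: "finite ?M" by (rule finite_subset[of _ "{..t+s}"]) auto
  have "lookup E d = (\<Sum>m\<in>{t<..t+s}. lookup P (?q m (t + s - m)) - lookup P (?q (t + s - m) m))"
    using exchange_coeff[OF rel iN' d0, of t s] d by (simp add: t_def s_def)
  also have "\<dots> = (\<Sum>m\<in>{t<..t+s}. F m - F (t + s - m))"
    by (rule sum.cong) (auto simp: F_def)
  also have "\<dots> = (\<Sum>m\<in>?M. F m - F (t + s - m))" by (rule exchange_coeff_upper)
  finally have E: "lookup E d = (\<Sum>m\<in>?M. F m - F (t + s - m))" .
  have d': "d = ?q t s" using d by (simp add: t_def s_def)
  have spread: "dom d (?q m (t + s - m))" "dom d (?q (t + s - m) m)" if "m \<in> ?M" for m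
  proof -
    show 1: "dom d (?q m (t + s - m))" unfolding d' by (rule dom_spread[OF iN' d0]) (use that in auto)
    show "dom d (?q (t + s - m) m)"
      using dom_trans[OF 1 dom_tp[OF tp_q2_swap[OF iN' d0]]] .
  qed
  {
    assume "lookup E d \<noteq> 0"
    then obtain m where m: "m \<in> ?M" "F m - F (t + s - m) \<noteq> 0" unfolding E by (metis (no_types, lifting) sum.neutral)
    then have "F m \<noteq> 0 \<or> F (t + s - m) \<noteq> 0" by auto
    moreover have "F (t + s - m) = lookup P (?q (t + s - m) m)" using m(1) by (simp add: F_def)
    ultimately obtain d' where "lookup P d' \<noteq> 0" "dom d d'"
      using spread[OF m(1)] by (auto simp: F_def)
    then show "dom d (rowp l)" using tri dom_trans unfolding tri_def by blast
  }
  {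
    assume kd: "keys d \<subseteq> {..<Suc N}" and tpd: "tp d = tp (rowp l)"
    \<comment> \<open>A vector e of strictly spread type dominates d. If P had a nonzero coefficient
      there, e would be dominated by l, hence by d, and antisymmetry would give both the same
      type.\<close>
    have zero: "F m - F (t + s - m) = 0" if m: "m \<in> ?M" "s < m" for m
    proof -
      have neq: "tp d \<noteq> tp (?q m (t + s - m))" unfolding d' by (rule tp_spread_neq[OF iN' d0]) (use m in auto)
      have "lookup P e = 0" if "dom d e" "tp e = tp (?q m (t + s - m))" for e
      proof (rule ccontr)
        assume "lookup P e \<noteq> 0"
        then have "dom e (rowp l)" using tri by (auto simp: tri_def)
        then have "dom e d" using dom_trans dom_tp tpd by metis
        with \<open>dom d e\<close> have "tp d = tp e" by (rule dom_antisym)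
        with neq that show False by simp
      qed
      note this[OF spread(1)[OF m(1)]] this[OF spread(2)[OF m(1)]]
      then show ?thesis using m(1) tp_q2_swap[OF iN' d0] by (simp add: F_def)
    qed
    show "lookup E d = (if lookup d i > lookup d N then \<tau> (lookup d i) - \<tau> (lookup d N) else 0)"
    proof (cases "s > t")
      case True
      have "lookup E d = (\<Sum>m\<in>?M. if m = s then F s - F t else 0)"
        unfolding E
      proof (rule sum.cong)
        fix m assume m: "m \<in> ?M"
        then have "m = s \<or> s < m" by auto
        then show "F m - F (t + s - m) = (if m = s then F s - F t else 0)" using zero[OF m] by auto
      qed simp
      also have "\<dots> = F s - F t" using True finM by simp
      also have "F t = \<tau> t"
      proof -
        have "lookup P d = \<tau> t" using tri kd tpd unfolding tri_def t_def by blast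
        then show ?thesis by (simp add: F_def d'[symmetric])
      qed
      also have "F s = \<tau> s"
      proof -
        have "keys (?q s t) \<subseteq> {..<Suc N}"
        proof
          fix j assume "j \<in> keys (?q s t)"
          then show "j \<in> {..<Suc N}" using kd iN d0 d'
            by (cases "j = N \<or> j = i") (auto simp: in_keys_iff lookup_q2 subset_iff dest: spec[of _ j])
        qed
        moreover have "tp (?q s t) = tp (rowp l)" using tp_q2_swap[OF iN' d0] tpd d' by metis
        ultimately show ?thesis using tri iN' d0 by (simp add: tri_def F_def lookup_q2)
      qed
      finally show ?thesis using True by (simp add: t_def s_def)
    next
      case False
      then have "lookup E d = 0" unfolding E by (intro sum.neutral) (use zero in auto)
      then show ?thesis using False by (simp add: t_def s_def)
    qed
  }
qed

lemma sum_row_tp: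
  assumes "tp d = tp (rowp l)" "keys d \<subseteq> {..<Suc N}"
  shows "(\<Sum>i<N. if lookup d i > lookup d N then f (lookup d i) else 0) = (\<Sum>i | lookup d N < row l i. f (row l i) :: 'a::comm_monoid_add)"
proof -
  let ?B = "lookup d N"
  have *: "(\<Sum>i | ?B < lookup e i. f (lookup e i)) = (\<Sum>x\<in>#filter_mset (\<lambda>x. ?B < x) (tp e). f x)" for e
  proof -
    have "{i. ?B < lookup e i} = {i \<in> keys e. ?B < lookup e i}" by (auto simp: in_keys_iff)
    then show ?thesis
      by (simp add: tp_def sum_unfold_sum_mset filter_mset_image_mset multiset.map_comp o_def)
  qed
  have "(\<Sum>i<N. if lookup d i > ?B then f (lookup d i) else 0) = (\<Sum>i\<in>{i\<in>{..<N}. ?B < lookup d i}. f (lookup d i))"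
    by (rule sum.inter_filter[symmetric]) simp
  also have "{i\<in>{..<N}. ?B < lookup d i} = {i. ?B < lookup d i}"
  proof -
    have "i < N" if "?B < lookup d i" for i
    proof -
      have "i \<in> keys d" using that by (auto simp: in_keys_iff)
      then have "i < Suc N" using assms(2) by auto
      then show ?thesis using that less_antisym by blast
    qed
    then show ?thesis by auto
  qed
  also have "(\<Sum>i | ?B < lookup d i. f (lookup d i)) = (\<Sum>i | ?B < row l i. f (row l i))"
    using *[of d] *[of "rowp l"] assms(1) by simp
  finally show ?thesis .
qed

text \<open>On leading coefficients x_N d/dx_N multiplies by the exponent B, and each exchange with
  a larger exponent contributes the difference of two values; together this is the recursion of
  \<open>tv\<close>.\<close>

lemma tri_Phi:
  assumes f: "f \<in> hom D" "\<And>N. in_vars N f = monomial_sym N l"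
  shows "tri N l (\<lambda>B. of_real (tv a b l k B)) (Phi N D ((Lop (of_real a) (of_real b) (of_real (b - a)) D ^^ k) (init f)))"
proof (induction k)
  case 0
  have "Phi N D (init f) = (\<Sum>j\<le>D. if j = 0 then in_vars (Suc N) f * monom_power N 0 else 0)"
    unfolding Phi_def init_def by (rule sum.cong) auto
  also have "\<dots> = monomial_sym (Suc N) l" by (simp add: f(2) monom_power_def)
  finally have "Phi N D (init f) = monomial_sym (Suc N) l" .
  then show ?case
    using dom_tp by (auto simp: tri_def lookup_monomial_sym ip_eq_iff split: if_splits)
next
  case (Suc k)
  define g where "g = (Lop (of_real a) (of_real b) (of_real (b - a)) D ^^ k) (init f)"
  define P where "P = Phi N D g"
  have gr: "graded D g" unfolding g_def by (rule graded_Lop_pow[OF f(1)])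
  have tri: "tri N l (\<lambda>B. of_real (tv a b l k B)) P" using Suc unfolding P_def g_def .
  let ?P' = "const (of_real b) * (var N * dd N P) + const (of_real a) * (\<Sum>i<N. Exch N i D g)"
  have P': "Phi N D ((Lop (of_real a) (of_real b) (of_real (b - a)) D ^^ Suc k) (init f)) = ?P'"
    using Phi_Lop[OF gr] by (simp add: g_def P_def)
  have xdx: "lookup (var N * dd N P) d = of_nat (lookup d N) * lookup P d" for d
  proof (cases "lookup d N = 0")
    case False
    then obtain x where x: "d = single N 1 + x" using exists_single_add by blast
    then show ?thesis by (simp add: lookup_monom_power_mult lookup_dd lookup_add add.commute)
  qed (simp add: lookup_monom_power_mult)
  note ex = tri_exchange[OF tri _ Exch_relation[of _ N D g, folded P_def]]
  have L: "lookup ?P' d = of_real b * of_nat (lookup d N) * lookup P d + of_real a * (\<Sum>i<N. lookup (Exch N i D g) d)" for d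
    by (simp add: lookup_add xdx lookup_sum)
  show ?case
    unfolding P' tri_def
  proof (intro conjI allI impI)
    fix d assume "lookup ?P' d \<noteq> 0"
    then have "lookup P d \<noteq> 0 \<or> (\<Sum>i<N. lookup (Exch N i D g) d) \<noteq> 0" unfolding L by auto
    then show "dom d (rowp l)"
    proof
      assume "lookup P d \<noteq> 0" then show ?thesis using tri by (simp add: tri_def)
    next
      assume "(\<Sum>i<N. lookup (Exch N i D g) d) \<noteq> 0"
      then obtain i where "i \<in> {..<N}" "lookup (Exch N i D g) d \<noteq> 0" using sum.not_neutral_contains_not_neutral by blast
      then show ?thesis using ex(1) by blast
    qed
  next
    fix d assume d: "keys d \<subseteq> {..<Suc N} \<and> tp d = tp (rowp l)"
    have "(\<Sum>i<N. lookup (Exch N i D g) d) = (\<Sum>i<N. if lookup d i > lookup d N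
       then of_real (tv a b l k (lookup d i)) - of_real (tv a b l k (lookup d N)) else 0)"
      by (rule sum.cong) (use ex(2) d in auto)
    also have "\<dots> = (\<Sum>i | lookup d N < row l i. of_real (tv a b l k (row l i)) - of_real (tv a b l k (lookup d N)))"
      using sum_row_tp[of d l N "\<lambda>x. of_real (tv a b l k x) - of_real (tv a b l k (lookup d N)) :: complex"] d by simp
    finally show "lookup ?P' d = of_real (tv a b l (Suc k) (lookup d N))"
      unfolding L using tri d by (simp add: tri_def)
  qed
qed

text \<open>With N = \<open>psize m\<close> the vector \<open>rowp m\<close> does not contain x_N,
  so its coefficient in \<open>Phi\<close> comes from the component at w^0 alone. This is the case B
  = 0 of the leading coefficient.\<close>

lemma cf_Top:
  fixes a b :: real and k :: nat
  assumes f: "f \<in> hom D" "\<And>N. in_vars N f = monomial_sym N l"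
  defines "T \<equiv> Top (of_real a) (of_real b) (of_real (b - a)) D k f"
  shows "cf T l = of_real (tv a b l k 0)" and "cf T m \<noteq> 0 \<Longrightarrow> dominated m l"
proof -
  define g where "g = (Lop (of_real a) (of_real b) (of_real (b - a)) D ^^ k) (init f)"
  have gr: "graded D g" unfolding g_def by (rule graded_Lop_pow[OF f(1)])
  have T: "T = g 0" by (simp add: T_def g_def Top_def)
  have rho: "g 0 \<in> rho_polys" using gr hom_rho by (auto simp: graded_def)
  have cf: "cf T m = lookup (Phi (psize m) D g) (rowp m)" for m
  proof -
    let ?N = "psize m"
    have z: "lookup (rowp m) ?N = 0" by (simp add: row_eq_0)
    have "lookup (Phi ?N D g) (rowp m) = (\<Sum>j\<le>D. lookup (monom_power ?N j * in_vars (Suc ?N) (g j)) (rowp m))"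
      by (simp add: Phi_def lookup_sum mult.commute)
    also have "\<dots> = (\<Sum>j\<le>D. if j = 0 then lookup (in_vars (Suc ?N) (g 0)) (rowp m) else 0)"
      by (rule sum.cong) (use z in \<open>auto simp: lookup_monom_power_mult\<close>)
    also have "\<dots> = lookup (in_vars ?N (g 0)) (rowp m)"
      using lookup_in_vars_stable[OF rho keys_rowp_subset, of m "Suc ?N"] by simp
    finally show ?thesis by (simp add: T cf_def)
  qed
  note tri = tri_Phi[OF f, of _ a b k, folded g_def]
  have "keys (rowp l) \<subseteq> {..<Suc (psize l)}" using keys_rowp_subset[of l] by auto
  then show "cf T l = of_real (tv a b l k 0)"
    using tri[of "psize l"] row_eq_0[of l "psize l"] by (simp add: cf tri_def)
  show "dominated m l" if "cf T m \<noteq> 0"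
    using tri[of "psize m"] that dom_rowp by (simp add: cf tri_def)
qed


section \<open>Profiles\<close>

text \<open>The square of the difference of the two numbers is e^2 + 4h, and their signs select the
  positive root.\<close>

lemma eps_pair_eq:
  fixes e h :: real
  assumes "h > 0"
  defines "s \<equiv> sqrt (e\<^sup>2 + 4 * h)"
  shows "eps_pair e h = ((e + s) / 2, (e - s) / 2)"
proof -
  have s2: "s\<^sup>2 = e\<^sup>2 + 4 * h" unfolding s_def using assms(1) by (simp add: add_nonneg_nonneg)
  have s: "s > \<bar>e\<bar>" unfolding s_def using assms(1) by (intro real_less_rsqrt) auto
  have uniq: "x = (e + s) / 2 \<and> y = (e - s) / 2" if "y < 0" "0 < x" "x + y = e" "- x * y = h" for x y
  proof -
    have "(x - y)\<^sup>2 = (x + y)\<^sup>2 + 4 * (- x * y)" by (simp add: power2_eq_square algebra_simps)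
    then have "(x - y)\<^sup>2 = s\<^sup>2" using that s2 by simp
    then have "x - y = s \<or> x - y = - s" by (simp add: power2_eq_iff)
    then have "x - y = s" using that(1,2) s by linarith
    then show ?thesis using that(3) by (auto simp: field_simps)
  qed
  have "- ((e + s) / 2) * ((e - s) / 2) = h" using s2 by (simp add: power2_eq_square algebra_simps)
  then show ?thesis
    unfolding eps_pair_def using s uniq
    by (intro the_equality) (auto simp: field_simps)
qed

lemma eps_props:
  assumes "h > 0"
  shows "eps2 e h < 0" "eps1 e h > 0" "eps1 e h + eps2 e h = e" "- eps1 e h * eps2 e h = h"
proof -
  define s where "s = sqrt (e\<^sup>2 + 4 * h)"
  have s2: "s\<^sup>2 = e\<^sup>2 + 4 * h" unfolding s_def using assms(1) by (simp add: add_nonneg_nonneg)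
  have s: "s > \<bar>e\<bar>" unfolding s_def using assms(1) by (intro real_less_rsqrt) auto
  have e: "eps1 e h = (e + s) / 2" "eps2 e h = (e - s) / 2"
    using eps_pair_eq[OF assms, of e] by (simp_all add: eps1_def eps2_def s_def)
  show "eps2 e h < 0" "eps1 e h > 0" "eps1 e h + eps2 e h = e" using s by (auto simp: e field_simps)
  show "- eps1 e h * eps2 e h = h" using s2 by (simp add: e power2_eq_square algebra_simps)
qed

text \<open>\<open>prof a b ms\<close> is the profile of the partition with column lengths \<open>ms\<close>, with
  \<open>a = - \<epsilon>\<^sub>2\<close> and \<open>b = \<epsilon>\<^sub>1\<close>: prepending a column shifts the old profile by \<open>(b, b)\<close>.\<close>

fun prof :: "real \<Rightarrow> real \<Rightarrow> nat list \<Rightarrow> real \<Rightarrow> real" where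
  "prof a b [] c = \<bar>c\<bar>"
| "prof a b (m # ms) c = \<bar>c + a * real m\<bar> - \<bar>c - b + a * real m\<bar> + prof a b ms (c - b)"

lemma prof_left:
  assumes "a > 0" "b > 0" "\<forall>x\<in>set ms. x \<le> m" "c \<le> - a * real m"
  shows "prof a b ms c = - c"
  using assms(3,4)
proof (induction ms arbitrary: c)
  case Nil
  moreover have "- a * real m \<le> 0" using assms(1) by simp
  ultimately have "c \<le> 0" by linarith
  then show ?case by simp
next
  case (Cons k ms)
  have "a * real k \<le> a * real m" using Cons.prems assms(1) by simp
  then have c: "c + a * real k \<le> 0" using Cons.prems by simp
  have "prof a b ms (c - b) = - (c - b)" using Cons assms(2) by simp
  then show ?case using c assms(2) by simp
qed

lemma prof_right: "c - b \<ge> - a * real m \<Longrightarrow> b > 0 \<Longrightarrow> prof a b (m # ms) c = b + prof a b ms (c - b)"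
  by simp

text \<open>Left of the highest corner of the first column, whose abscissa is b - a m, the shorter
  columns do not reach beyond it, so the boundary is the V with vertex (- a m, a m).\<close>

lemma prof_left2:
  assumes "a > 0" "b > 0" "\<forall>x\<in>set ms. x \<le> m" "c - b \<le> - a * real m"
  shows "prof a b (m # ms) c = \<bar>c + a * real m\<bar> + a * real m"
proof -
  have "prof a b ms (c - b) = - (c - b)" by (rule prof_left[OF assms])
  then show ?thesis using assms(4) by simp
qed

lemma prof_ge_abs:
  assumes "a > 0" "b > 0" shows "prof a b ms c \<ge> \<bar>c\<bar>"
proof (induction ms arbitrary: c)
  case (Cons m ms)
  have am: "a * real m \<ge> 0" using assms by simp
  have "\<bar>c - b\<bar> \<le> prof a b ms (c - b)" by (rule Cons)
  then show ?case using am assms(2) by (simp add: abs_if split: if_splits)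
qed simp

text \<open>Here s and t are the coordinates along the two side directions, measured in boxes. The
  cases s = 0 and t = 0 are the graph of the absolute value; otherwise a point lies below the
  profile when some column is long enough and far enough out. The induction removes the longest
  column and shifts t by 1.\<close>

lemma prof_region:
  assumes a: "a > 0" and b: "b > 0" and ms: "sorted_wrt (\<ge>) ms" and st: "s \<ge> 0" "t \<ge> 0"
  shows "a * s + b * t \<le> prof a b ms (b * t - a * s) \<longleftrightarrow>
    s = 0 \<or> t = 0 \<or> (\<exists>j<length ms. s \<le> real (ms ! j) \<and> t \<le> real j + 1)"
  using ms st
proof (induction ms arbitrary: t)
  case Nil
  have "a * s \<ge> 0" "b * t \<ge> 0" using a b Nil by simp_all
  then show ?case using a b by (auto simp: abs_if split: if_splits)
next
  case (Cons m ms)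
  have ms: "\<forall>x\<in>set ms. x \<le> m" "sorted_wrt (\<ge>) ms" using Cons.prems by auto
  have ex: "(\<exists>j<length (m # ms). s \<le> real ((m # ms) ! j) \<and> t \<le> real j + 1) \<longleftrightarrow>
    (s \<le> real m \<and> t \<le> 1) \<or> (\<exists>j<length ms. s \<le> real (ms ! j) \<and> t - 1 \<le> real j + 1)"
    unfolding Ex_less_Suc2 length_Cons by (simp add: algebra_simps)
  have deep: "s \<le> real m" if "\<exists>j<length ms. s \<le> real (ms ! j) \<and> t - 1 \<le> real j + 1"
    using that ms(1) by (metis nth_mem of_nat_le_iff order_trans)
  define y where "y = b * t - a * s"
  have as: "a * s \<ge> 0" "b * t \<ge> 0" using a b Cons.prems by simp_all
  have smul: "s \<le> real m \<longleftrightarrow> a * s \<le> a * real m" using a by simp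
  have tmul: "t \<le> 1 \<longleftrightarrow> b * t \<le> b" "1 \<le> t \<longleftrightarrow> b \<le> b * t" "t = 0 \<longleftrightarrow> b * t = 0" "s = 0 \<longleftrightarrow> a * s = 0" "t = 1 \<longleftrightarrow> b * t = b" using a b by auto
  show ?case
  proof (cases "y - b \<ge> - a * real m")
    case right: True
    have P: "prof a b (m # ms) y = b + prof a b ms (y - b)" by (rule prof_right[OF right b])
    show ?thesis
    proof (cases "t \<ge> 1")
      case True
      have "a * s + b * (t - 1) \<le> prof a b ms (b * (t - 1) - a * s) \<longleftrightarrow>
        s = 0 \<or> t - 1 = 0 \<or> (\<exists>j<length ms. s \<le> real (ms ! j) \<and> t - 1 \<le> real j + 1)"
        by (rule Cons.IH) (use Cons.prems ms True in auto)
      moreover have "b * (t - 1) - a * s = y - b" by (simp add: y_def algebra_simps)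
      ultimately have "a * s + b * t \<le> prof a b (m # ms) y \<longleftrightarrow> s = 0 \<or> t = 1 \<or> (\<exists>j<length ms. s \<le> real (ms ! j) \<and> t - 1 \<le> real j + 1)"
        unfolding P by (simp add: algebra_simps)
      moreover have "t = 1 \<Longrightarrow> s \<le> real m" using right by (simp add: y_def smul)
      ultimately show ?thesis unfolding ex y_def[symmetric] using True by auto
    next
      case False
      have "b * t < b" using False tmul(2) by linarith
      then have "s \<le> real m" using right unfolding smul y_def by linarith
      moreover have "a * s + b * t \<le> prof a b (m # ms) y"
        unfolding P using prof_ge_abs[OF a b, of "y - b" ms] False as tmul by (simp add: y_def abs_if split: if_splits)
      ultimately show ?thesis unfolding ex y_def[symmetric] using False by auto
    qed
  next
    case left: False
    have P: "prof a b (m # ms) y = \<bar>y + a * real m\<bar> + a * real m"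
      by (rule prof_left2[OF a b ms(1)]) (use left in simp)
    have am: "a * real m \<ge> 0" using a by simp
    have "a * s + b * t \<le> prof a b (m # ms) y \<longleftrightarrow> t = 0 \<or> s \<le> real m"
    proof -
      have "X + Y \<le> \<bar>Y - X + Z\<bar> + Z \<longleftrightarrow> Y = 0 \<or> X \<le> Z" if "X \<ge> 0" "Y \<ge> 0" "Z \<ge> 0" for X Y Z :: real
        using that by (auto simp: abs_if)
      from this[OF as am] show ?thesis unfolding P smul tmul(3) unfolding y_def .
    qed
    moreover have "s \<le> real m \<Longrightarrow> t \<le> 1" using left by (simp add: y_def smul tmul)
    moreover have "s = 0 \<Longrightarrow> s \<le> real m" by simp
    ultimately show ?thesis unfolding ex y_def[symmetric] using deep by blast
  qed
qed

lemma prof_continuous: "continuous_on UNIV (prof a b ms)"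
proof (induction ms)
  case (Cons m ms)
  have "continuous_on UNIV (\<lambda>c. prof a b ms (c - b))"
    by (rule continuous_on_compose2[OF Cons]) (auto intro!: continuous_intros)
  then show ?case by (auto intro!: continuous_intros)
qed (auto intro!: continuous_intros)

lemma abs_deriv: assumes "c + k \<noteq> 0"
  shows "((\<lambda>x::real. \<bar>x + k\<bar> + q) has_real_derivative 1) (at c) \<or> ((\<lambda>x. \<bar>x + k\<bar> + q) has_real_derivative - 1) (at c)"
proof (cases "c + k > 0")
  case True
  have "((\<lambda>x. x + k + q) has_real_derivative 1) (at c)" by (auto intro!: derivative_eq_intros)
  then have "((\<lambda>x. \<bar>x + k\<bar> + q) has_real_derivative 1) (at c)"
    by (rule has_field_derivative_transform_within_open[of _ _ _ "{-k<..}"]) (use True in auto)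
  then show ?thesis ..
next
  case False
  have "((\<lambda>x. - (x + k) + q) has_real_derivative - 1) (at c)" by (auto intro!: derivative_eq_intros)
  then have "((\<lambda>x. \<bar>x + k\<bar> + q) has_real_derivative - 1) (at c)"
    by (rule has_field_derivative_transform_within_open[of _ _ _ "{..<-k}"]) (use False assms in auto)
  then show ?thesis ..
qed

lemma prof_slopes:
  assumes a: "a > 0" and b: "b > 0" and ms: "sorted_wrt (\<ge>) ms"
  shows "piecewise_slopes_pm1 (prof a b ms)"
  unfolding piecewise_slopes_pm1_def
proof (intro conjI prof_continuous)
  show "\<exists>S. finite S \<and> (\<forall>c. c \<notin> S \<longrightarrow> (prof a b ms has_real_derivative 1) (at c) \<or> (prof a b ms has_real_derivative - 1) (at c))"
    using ms
  proof (induction ms)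
    case Nil
    show ?case using abs_deriv[of _ 0 0] by (intro exI[of _ "{0}"]) (auto simp: fun_eq_iff)
  next
    case (Cons m ms)
    then obtain S where S: "finite S" "\<And>c. c \<notin> S \<Longrightarrow> (prof a b ms has_real_derivative 1) (at c) \<or> (prof a b ms has_real_derivative - 1) (at c)" by auto
    let ?S = "{- a * real m, b - a * real m} \<union> (\<lambda>x. x + b) ` S"
    have ms: "\<forall>x\<in>set ms. x \<le> m" using Cons.prems by auto
    have "(prof a b (m # ms) has_real_derivative 1) (at c) \<or> (prof a b (m # ms) has_real_derivative - 1) (at c)" if c: "c \<notin> ?S" for c
    proof (cases "c > b - a * real m")
      case True
      have shift: "(prof a b (m # ms) has_real_derivative d) (at c)" if "(prof a b ms has_real_derivative d) (at (c - b))" for d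
      proof -
        have "((\<lambda>x. b + prof a b ms (x + - b)) has_real_derivative 0 + d) (at c)"
          by (intro DERIV_add DERIV_const) (use that in \<open>simp only: DERIV_shift diff_conv_add_uminus\<close>)
        then have "((\<lambda>x. b + prof a b ms (x - b)) has_real_derivative d) (at c)" by simp
        then show ?thesis
          by (rule has_field_derivative_transform_within_open[of _ _ _ "{b - a * real m<..}"]) (use True b in \<open>auto simp: prof_right simp del: prof.simps\<close>)
      qed
      have "c - b \<notin> S" using c by (metis UnI2 diff_add_cancel image_eqI)
      then show ?thesis using S(2) shift by blast
    next
      case False
      have "c + a * real m \<noteq> 0" using c by auto
      note d = abs_deriv[OF this, of "a * real m"]
      have tr: "(prof a b (m # ms) has_real_derivative d) (at c)"
        if "((\<lambda>x. \<bar>x + a * real m\<bar> + a * real m) has_real_derivative d) (at c)" for d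
        using that
        by (rule has_field_derivative_transform_within_open[of _ _ _ "{..<b - a * real m}"])
           (use False c prof_left2[OF a b ms] in \<open>auto simp del: prof.simps\<close>)
      show ?thesis using d tr by blast
    qed
    moreover have "finite ?S" using S(1) by simp
    ultimately show ?case by blast
  qed
qed

definition col :: "int_partition \<Rightarrow> nat \<Rightarrow> nat" where "col l j = card {i. j < row l i}"
definition cols :: "int_partition \<Rightarrow> nat list" where "cols l = map (col l) [0..<row l 0]"

lemma row_gt_iff: "j < row l i \<longleftrightarrow> i < col l j"
  using row_ge_iff[of "Suc j" l i] by (simp add: col_def Suc_le_eq)

lemma col_antimono: "i \<le> j \<Longrightarrow> col l j \<le> col l i"
  by (metis linorder_not_le order.strict_trans1 order_less_irrefl row_gt_iff)

lemma col_eq_0: "j \<ge> row l 0 \<Longrightarrow> col l j = 0"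
  using row_gt_iff[of j l 0] by simp

lemma cols_sorted: "sorted_wrt (\<ge>) (cols l)"
  by (simp add: cols_def sorted_wrt_iff_nth_less col_antimono)

text \<open>The union of the closed unit squares of the boxes is the closed region under the
  staircase of column lengths.\<close>

lemma boxes_region:
  fixes s t :: real
  assumes "0 \<le> s" "0 \<le> t"
  shows "(\<exists>(i, j)\<in>boxes l. real i \<le> s \<and> s \<le> real i + 1 \<and> real j \<le> t \<and> t \<le> real j + 1) \<longleftrightarrow>
     (\<exists>j<length (cols l). s \<le> real (cols l ! j) \<and> t \<le> real j + 1)"
proof
  assume "\<exists>(i, j)\<in>boxes l. real i \<le> s \<and> s \<le> real i + 1 \<and> real j \<le> t \<and> t \<le> real j + 1"
  then obtain i j where ij: "j < row l i" "s \<le> real i + 1" "t \<le> real j + 1" by (auto simp: boxes_def)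
  have "i < col l j" using ij row_gt_iff by blast
  then have "s \<le> real (col l j)" using ij(2) by linarith
  moreover have "j < row l 0" using ij(1) antimonoD[OF antimono_row[of l], of 0 i] by simp
  ultimately show "\<exists>j<length (cols l). s \<le> real (cols l ! j) \<and> t \<le> real j + 1"
    using ij(3) by (intro exI[of _ j]) (simp add: cols_def)
next
  assume "\<exists>j<length (cols l). s \<le> real (cols l ! j) \<and> t \<le> real j + 1"
  then obtain j where j: "j < row l 0" "s \<le> real (col l j)" "t \<le> real j + 1" by (auto simp: cols_def)
  have c0: "col l j > 0" using j(1) row_gt_iff by auto
  \<comment> \<open>On the outer edge, where s equals the column length, the floor would be one too
    large; the minimum selects the last box of the column. The same holds for k.\<close>
  define i where "i = min (nat \<lfloor>s\<rfloor>) (col l j - 1)"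
  define k where "k = min (nat \<lfloor>t\<rfloor>) j"
  have "i < col l j" using c0 by (simp add: i_def)
  then have "j < row l i" using row_gt_iff by blast
  then have "k < row l i" by (simp add: k_def)
  moreover have "real i \<le> s" "s \<le> real i + 1"
  proof -
    have f: "real (nat \<lfloor>s\<rfloor>) \<le> s" "s \<le> real (nat \<lfloor>s\<rfloor>) + 1" using assms(1) by linarith+
    have "real (col l j - 1) = real (col l j) - 1" using c0 by simp
    then show "real i \<le> s" "s \<le> real i + 1"
      using f j(2) by (cases "nat \<lfloor>s\<rfloor> \<le> col l j - 1"; simp add: i_def; linarith)+
  qed
  moreover have "real k \<le> t" "t \<le> real k + 1"
  proof -
    have f: "real (nat \<lfloor>t\<rfloor>) \<le> t" "t \<le> real (nat \<lfloor>t\<rfloor>) + 1" using assms(2) by linarith+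
    then show "real k \<le> t" "t \<le> real k + 1"
      using f j(3) by (cases "nat \<lfloor>t\<rfloor> \<le> j"; simp add: k_def; linarith)+
  qed
  ultimately show "\<exists>(i, j)\<in>boxes l. real i \<le> s \<and> s \<le> real i + 1 \<and> real j \<le> t \<and> t \<le> real j + 1"
    by (auto simp: boxes_def)
qed

text \<open>Uniqueness: the region contains the graph of the absolute value, so a competing f lies
  above it, and then f c is the largest ordinate of the region over c.\<close>

lemma profile_eq:
  assumes "h > 0" shows "profile e h l = prof (- eps2 e h) (eps1 e h) (cols l)"
proof -
  define a b where "a = - eps2 e h" and "b = eps1 e h"
  have a: "a > 0" and b: "b > 0" using eps_props[OF assms] by (simp_all add: a_def b_def)
  let ?R = "{(c, y). y = \<bar>c\<bar>} \<union> (\<Union>x \<in> boxes l. box_rect e h x)"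
  have box: "(c, y) \<in> ?R \<longleftrightarrow> s = 0 \<or> t = 0 \<or> (\<exists>j<length (cols l). s \<le> real (cols l ! j) \<and> t \<le> real j + 1)"
    if st: "s \<ge> 0" "t \<ge> 0" "c = b * t - a * s" "y = a * s + b * t" for c y s t
  proof -
    have as: "a * s \<ge> 0" "b * t \<ge> 0" using a b st by simp_all
    have yc: "y = \<bar>c\<bar> \<longleftrightarrow> s = 0 \<or> t = 0"
    proof -
      have "y = \<bar>c\<bar> \<longleftrightarrow> a * s = 0 \<or> b * t = 0" using as st(3,4) by (auto simp: abs_if)
      then show ?thesis using a b by simp
    qed
    have rect: "(c, y) \<in> box_rect e h (i, j) \<longleftrightarrow> real i \<le> s \<and> s \<le> real i + 1 \<and> real j \<le> t \<and> t \<le> real j + 1" for i j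
    proof
      assume "(c, y) \<in> box_rect e h (i, j)"
      then obtain s' t' where *: "c = - a * (real i + s') + b * (real j + t')" "y = a * (real i + s') + b * (real j + t')"
        "0 \<le> s'" "s' \<le> 1" "0 \<le> t'" "t' \<le> 1" by (auto simp: box_rect_def a_def b_def)
      have "a * s = a * (real i + s')" "b * t = b * (real j + t')" using *(1,2) st(3,4) by linarith+
      then have "s = real i + s'" "t = real j + t'" using a b by simp_all
      then show "real i \<le> s \<and> s \<le> real i + 1 \<and> real j \<le> t \<and> t \<le> real j + 1" using * by simp
    next
      assume "real i \<le> s \<and> s \<le> real i + 1 \<and> real j \<le> t \<and> t \<le> real j + 1"
      then show "(c, y) \<in> box_rect e h (i, j)"
        unfolding box_rect_def split_conv mem_Collect_eq
        by (intro exI[of _ "s - real i"] exI[of _ "t - real j"])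
           (use st(3,4) in \<open>simp add: a_def b_def algebra_simps\<close>)
    qed
    have "(\<exists>x\<in>boxes l. (c, y) \<in> box_rect e h x) \<longleftrightarrow>
      (\<exists>(i, j)\<in>boxes l. real i \<le> s \<and> s \<le> real i + 1 \<and> real j \<le> t \<and> t \<le> real j + 1)"
      by (intro bex_cong refl) (simp add: rect split: prod.split)
    then show ?thesis unfolding boxes_region[OF st(1,2), of l] by (simp add: yc)
  qed
  have region: "{(c, y). \<bar>c\<bar> \<le> y \<and> y \<le> prof a b (cols l) c} = ?R"
  proof (rule set_eqI, clarify)
    fix c y :: real
    \<comment> \<open>The coordinates of (c, y) in the basis (- a, a), (b, b).\<close>
    define s t where "s = (y - c) / (2 * a)" and "t = (y + c) / (2 * b)"
    have cy: "c = b * t - a * s" "y = a * s + b * t" using a b by (simp_all add: s_def t_def field_simps)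
    show "(c, y) \<in> {(c, y). \<bar>c\<bar> \<le> y \<and> y \<le> prof a b (cols l) c} \<longleftrightarrow> (c, y) \<in> ?R"
    proof (cases "\<bar>c\<bar> \<le> y")
      case True
      then have st: "s \<ge> 0" "t \<ge> 0" using a b by (auto simp: s_def t_def)
      show ?thesis
        using True prof_region[OF a b cols_sorted st] box[OF st cy] by (simp add: cy[symmetric])
    next
      case False
      have "(c, y) \<notin> box_rect e h (i, j)" for i j
      proof
        assume "(c, y) \<in> box_rect e h (i, j)"
        then obtain s' t' where *: "c = - a * (real i + s') + b * (real j + t')" "y = a * (real i + s') + b * (real j + t')"
          "0 \<le> s'" "0 \<le> t'" by (auto simp: box_rect_def a_def b_def)
        have "a * (real i + s') \<ge> 0" "b * (real j + t') \<ge> 0" using a b * by simp_all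
        then show False using False *(1,2) by linarith
      qed
      then show ?thesis using False by auto
    qed
  qed
  show ?thesis
    unfolding profile_def a_def[symmetric] b_def[symmetric]
  proof (rule the_equality)
    show "piecewise_slopes_pm1 (prof a b (cols l)) \<and> {(c, y). \<bar>c\<bar> \<le> y \<and> y \<le> prof a b (cols l) c} = ?R"
      using region prof_slopes[OF a b cols_sorted] by simp
  next
    fix f assume f: "piecewise_slopes_pm1 f \<and> {(c, y). \<bar>c\<bar> \<le> y \<and> y \<le> f c} = ?R"
    then have eq: "(\<bar>c\<bar> \<le> y \<and> y \<le> f c) \<longleftrightarrow> (\<bar>c\<bar> \<le> y \<and> y \<le> prof a b (cols l) c)" for c y
      using region by (auto simp: set_eq_iff)
    show "f = prof a b (cols l)"
    proof
      fix c
      have "\<bar>c\<bar> \<le> f c" using eq[of c "\<bar>c\<bar>"] prof_ge_abs[OF a b] by simp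
      then show "f c = prof a b (cols l) c"
        using eq[of c "f c"] eq[of c "prof a b (cols l) c"] prof_ge_abs[OF a b, of c "cols l"] by simp
    qed
  qed
qed

text \<open>A box belongs to the diagram exactly when its highest corner lies below the profile;
  hence the profile determines the partition.\<close>

lemma boxes_prof:
  assumes "a > 0" "b > 0"
  shows "(i, j) \<in> boxes l \<longleftrightarrow>
    a * real (Suc i) + b * real (Suc j) \<le> prof a b (cols l) (b * real (Suc j) - a * real (Suc i))"
proof -
  have "(\<exists>k<length (cols l). real (Suc i) \<le> real (cols l ! k) \<and> real (Suc j) \<le> real k + 1) \<longleftrightarrow> (i, j) \<in> boxes l"
  proof
    assume "\<exists>k<length (cols l). real (Suc i) \<le> real (cols l ! k) \<and> real (Suc j) \<le> real k + 1"
    then obtain k where "k < row l 0" "Suc i \<le> col l k" "j \<le> k" by (auto simp: cols_def)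
    then show "(i, j) \<in> boxes l" using row_gt_iff[of k l i] by (simp add: boxes_def Suc_le_eq)
  next
    assume "(i, j) \<in> boxes l"
    then have "j < row l i" by (simp add: boxes_def)
    moreover then have "i < col l j" by (simp add: row_gt_iff)
    moreover have "j < row l 0" using \<open>j < row l i\<close> antimonoD[OF antimono_row[of l], of 0 i] by simp
    ultimately show "\<exists>k<length (cols l). real (Suc i) \<le> real (cols l ! k) \<and> real (Suc j) \<le> real k + 1"
      by (intro exI[of _ j]) (simp add: cols_def)
  qed
  then show ?thesis using prof_region[OF assms cols_sorted, of "real (Suc i)" "real (Suc j)" l] by simp
qed

lemma boxes_inject: assumes "boxes l = boxes m" shows "l = m"
proof -
  have "row l i = row m i" for i
  proof -
    have "j < row l i \<longleftrightarrow> j < row m i" for j using assms by (auto simp: boxes_def set_eq_iff)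
    then show ?thesis by (metis linorder_neqE_nat order_less_irrefl)
  qed
  then show ?thesis by (metis ext row_inject)
qed

text \<open>The abscissae of the local minima and maxima of the profile, plus the pairs \<open>vmin (B + 1) = vmax B\<close>, which
  cancel, between columns of equal length.\<close>

definition vmin :: "real \<Rightarrow> real \<Rightarrow> int_partition \<Rightarrow> nat \<Rightarrow> real" where
  "vmin a b l B = b * real B - a * real (col l B)"
definition vmax :: "real \<Rightarrow> real \<Rightarrow> int_partition \<Rightarrow> nat \<Rightarrow> real" where
  "vmax a b l B = b * real (Suc B) - a * real (col l B)"

lemma prof_sum: "prof a b ms c = (\<Sum>B<length ms. \<bar>c - (b * real B - a * real (ms ! B))\<bar> - \<bar>c - (b * real (Suc B) - a * real (ms ! B))\<bar>) + \<bar>c - b * real (length ms)\<bar>"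
proof (induction ms arbitrary: c)
  case (Cons m ms)
  show ?case
    unfolding prof.simps Cons length_Cons sum.lessThan_Suc_shift
    by (simp add: algebra_simps)
qed simp

text \<open>The column after the last has length 0, so the final absolute value of
  \<open>prof_sum\<close> is the minimum with index \<open>row l 0\<close>; there is one minimum
  more than maxima.\<close>

lemma prof_cols:
  "prof a b (cols l) c = (\<Sum>B\<le>row l 0. \<bar>c - vmin a b l B\<bar>) - (\<Sum>B<row l 0. \<bar>c - vmax a b l B\<bar>)"
  by (simp add: prof_sum cols_def vmin_def vmax_def sum_subtractf lessThan_Suc_atMost[symmetric] col_eq_0)


section \<open>The resolvent of the triangular part\<close>

text \<open>The Stieltjes transform of the transition measure of the profile in the sense of
  Kerov.\<close>

definition res :: "real \<Rightarrow> real \<Rightarrow> int_partition \<Rightarrow> complex \<Rightarrow> complex" where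
  "res a b l u = (\<Prod>B<row l 0. u - of_real (vmax a b l B)) / (\<Prod>B\<le>row l 0. u - of_real (vmin a b l B))"

lemma finite_row_gt: "finite {i. B < row l i}"
  by (rule finite_subset[OF _ finite_row[of l]]) auto

text \<open>In \<open>C\<close> the first summand bounds b B. The second stems from at most
  \<open>col l 0\<close> rows, each contributing a difference of two values.\<close>

lemma tv_bound:
  fixes a b :: real and l :: int_partition
  assumes "a > 0" "b > 0"
  defines "C \<equiv> b * real (row l 0) + 2 * a * real (col l 0)"
  shows "B \<le> row l 0 \<Longrightarrow> \<bar>tv a b l k B\<bar> \<le> C ^ k"
proof (induction k arbitrary: B)
  case (Suc k)
  have C0: "C ^ k \<ge> 0" by (simp add: C_def assms(1,2) less_imp_le)
  have "\<bar>\<Sum>i | B < row l i. tv a b l k (row l i) - tv a b l k B\<bar> \<le> (\<Sum>i | B < row l i. 2 * C ^ k)"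
  proof (rule order_trans[OF sum_abs], rule sum_mono)
    fix i
    have "row l i \<le> row l 0" using antimonoD[OF antimono_row[of l], of 0 i] by simp
    then have "\<bar>tv a b l k (row l i)\<bar> \<le> C ^ k" by (rule Suc.IH)
    moreover have "\<bar>tv a b l k B\<bar> \<le> C ^ k" using Suc by blast
    ultimately show "\<bar>tv a b l k (row l i) - tv a b l k B\<bar> \<le> 2 * C ^ k" by linarith
  qed
  also have "\<dots> = real (col l B) * (2 * C ^ k)" by (simp add: col_def)
  also have "\<dots> \<le> real (col l 0) * (2 * C ^ k)"
    using C0 col_antimono[of 0 B l] by (intro mult_right_mono) auto
  finally have 1: "a * \<bar>\<Sum>i | B < row l i. tv a b l k (row l i) - tv a b l k B\<bar> \<le> a * (real (col l 0) * (2 * C ^ k))"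
    using assms(1) by simp
  have 2: "b * real B * \<bar>tv a b l k B\<bar> \<le> b * real (row l 0) * C ^ k"
    using Suc assms(2) C0 by (intro mult_mono) auto
  have "\<bar>tv a b l (Suc k) B\<bar> \<le> \<bar>b * real B * tv a b l k B\<bar> + \<bar>a * (\<Sum>i | B < row l i. tv a b l k (row l i) - tv a b l k B)\<bar>"
    unfolding tv.simps by (rule abs_triangle_ineq)
  also have "\<dots> = b * real B * \<bar>tv a b l k B\<bar> + a * \<bar>\<Sum>i | B < row l i. tv a b l k (row l i) - tv a b l k B\<bar>"
    using assms(1,2) by (simp add: abs_mult)
  also have "\<dots> \<le> b * real (row l 0) * C ^ k + a * (real (col l 0) * (2 * C ^ k))"
    using 1 2 by (rule add_mono[rotated])
  also have "\<dots> = C ^ Suc k" by (simp add: C_def algebra_simps)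
  finally show ?case .
qed simp

text \<open>Let G B be the generating function of \<open>tv a b l k B\<close> in k. The recursion
  becomes a triangular linear system, (u - vmin B) G B = S B, where S B is 1 plus a times the sum of
  G over all rows longer than B. From S at \<open>row l 0\<close>, which is 1, one descends to B = 0
  and collects one factor (u - vmax B) / (u - vmin (B + 1)) per column.\<close>

lemma tv_sums:
  assumes a: "a > 0" and b: "b > 0"
    and u: "cmod u > b * real (row l 0) + 2 * a * real (col l 0)"
  shows "(\<lambda>k. complex_of_real (tv a b l k 0) / u ^ (k + 1)) sums res a b l u"
proof -
  define M where "M = row l 0"
  define C where "C = b * real M + 2 * a * real (col l 0)"
  have C0: "C \<ge> 0" using a b by (simp add: C_def)
  have u0: "u \<noteq> 0" using u C0 unfolding C_def M_def by auto
  have uC: "C / cmod u < 1" using u u0 unfolding C_def M_def by simp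
  define f where "f B k = complex_of_real (tv a b l k B) / u ^ (k + 1)" for B k
  define G where "G B = suminf (f B)" for B
  have sm: "summable (f B)" if "B \<le> M" for B
  proof (rule summable_comparison_test')
    show "summable (\<lambda>k. (C / cmod u) ^ k * (1 / cmod u))"
      by (intro summable_mult2 summable_geometric) (use uC C0 in auto)
    fix k
    have "norm (f B k) = \<bar>tv a b l k B\<bar> / cmod u ^ (k + 1)" by (simp add: f_def norm_divide norm_power norm_mult)
    also have "\<dots> \<le> C ^ k / cmod u ^ (k + 1)"
      using tv_bound[OF a b that[unfolded M_def], of k] u0 by (intro divide_right_mono) (auto simp: C_def M_def)
    also have "\<dots> = (C / cmod u) ^ k * (1 / cmod u)" by (simp add: power_divide)
    finally show "norm (f B k) \<le> (C / cmod u) ^ k * (1 / cmod u)" .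
  qed
  have fG: "f B sums G B" if "B \<le> M" for B using sm[OF that] by (simp add: G_def summable_sums)
  define S where "S B = 1 + of_real a * (\<Sum>i | B < row l i. G (row l i))" for B
  have rowM: "row l i \<le> M" for i using antimonoD[OF antimono_row[of l], of 0 i] by (simp add: M_def)
  have GS: "(u - of_real (vmin a b l B)) * G B = S B" if B: "B \<le> M" for B
  proof -
    have "(\<lambda>k. u * f B (Suc k)) sums (u * (G B - f B 0))"
      using fG[OF B] by (intro sums_mult) (simp add: sums_Suc_iff)
    moreover have "u * f B (Suc k) = of_real (vmin a b l B) * f B k + of_real a * (\<Sum>i | B < row l i. f (row l i) k)" for k
    proof -
      have "u * f B (Suc k) = complex_of_real (tv a b l (Suc k) B) / u ^ (k + 1)" using u0 by (simp add: f_def)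
      \<comment> \<open>The subtracted values, one for each of the \<open>col l B\<close> rows
        longer than B, turn the coefficient b B into b B - a \<open>col l B\<close>, which is
        \<open>vmin\<close>.\<close>
      also have "tv a b l (Suc k) B = vmin a b l B * tv a b l k B + a * (\<Sum>i | B < row l i. tv a b l k (row l i))"
        by (simp add: sum_subtractf vmin_def col_def algebra_simps)
      finally show ?thesis by (simp add: f_def add_divide_distrib sum_divide_distrib sum_distrib_left)
    qed
    moreover have "(\<lambda>k. of_real (vmin a b l B) * f B k + of_real a * (\<Sum>i | B < row l i. f (row l i) k)) sums
        (of_real (vmin a b l B) * G B + of_real a * (\<Sum>i | B < row l i. G (row l i)))"
      by (intro sums_add sums_mult sums_sum fG B rowM)
    ultimately have "u * (G B - f B 0) = of_real (vmin a b l B) * G B + of_real a * (\<Sum>i | B < row l i. G (row l i))"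
      using sums_unique2 by simp
    moreover have "u * f B 0 = 1" using u0 by (simp add: f_def)
    ultimately show ?thesis by (simp add: S_def algebra_simps)
  qed
  have nz: "u \<noteq> of_real (vmin a b l B)" if "B \<le> M" for B
  proof
    assume "u = of_real (vmin a b l B)"
    then have "cmod u = \<bar>vmin a b l B\<bar>" by simp
    also have "\<dots> \<le> b * real B + a * real (col l B)" using a b by (simp add: vmin_def abs_le_iff)
    also have "\<dots> \<le> C"
    proof -
      have "b * real B \<le> b * real M" using b that by simp
      moreover have "a * real (col l B) \<le> a * real (col l 0)" using a col_antimono[of 0 B l] by simp
      moreover have "0 \<le> a * real (col l 0)" using a by simp
      ultimately show ?thesis by (simp add: C_def)
    qed
    finally show False using u by (simp add: C_def M_def)
  qed
  \<comment> \<open>S B and S (B + 1) differ by the rows of length exactly B + 1, whose number is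
    the difference of two consecutive column lengths.\<close>
  have step: "S B = S (Suc B) * (u - of_real (vmax a b l B)) / (u - of_real (vmin a b l (Suc B)))" if "Suc B \<le> M" for B
  proof -
    have split: "{i. B < row l i} = {i. Suc B < row l i} \<union> {i. row l i = Suc B}" by auto
    have fin: "finite {i. Suc B < row l i}" "finite {i. row l i = Suc B}"
      using finite_row_gt[of B l] by (auto elim: finite_subset[rotated])
    have card: "real (card {i. row l i = Suc B}) = real (col l B) - real (col l (Suc B))"
      unfolding col_def split by (subst card_Un_disjoint) (use fin in auto)
    have "(\<Sum>i | B < row l i. G (row l i)) = (\<Sum>i | Suc B < row l i. G (row l i)) + (\<Sum>i | row l i = Suc B. G (row l i))"
      unfolding split by (rule sum.union_disjoint) (use fin in auto)
    also have "(\<Sum>i | row l i = Suc B. G (row l i)) = of_real (real (card {i. row l i = Suc B})) * G (Suc B)"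
      by simp
    finally have "S B = S (Suc B) + of_real a * (of_real (real (col l B) - real (col l (Suc B))) * G (Suc B))"
      unfolding card by (simp only: S_def distrib_left add.assoc)
    moreover have "G (Suc B) = S (Suc B) / (u - of_real (vmin a b l (Suc B)))"
      using GS[OF that] nz[OF that] by (simp add: field_simps)
    ultimately have "S B = S (Suc B) * ((u - of_real (vmin a b l (Suc B))) + of_real a * of_real (real (col l B) - real (col l (Suc B)))) / (u - of_real (vmin a b l (Suc B)))"
      using nz[OF that] by (simp add: field_simps)
    also have "(u - of_real (vmin a b l (Suc B))) + of_real a * of_real (real (col l B) - real (col l (Suc B))) = u - of_real (vmax a b l B)"
      by (simp add: vmin_def vmax_def algebra_simps)
    finally show ?thesis .
  qed
  have SK: "K \<le> M \<Longrightarrow> S 0 = S K * (\<Prod>B<K. u - of_real (vmax a b l B)) / (\<Prod>B<K. u - of_real (vmin a b l (Suc B)))" for K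
  proof (induction K)
    case (Suc K)
    then show ?case using step[of K] by (simp add: mult_ac)
  qed simp
  have "{i. M < row l i} = {}" using rowM by (auto simp: not_less)
  then have SM: "S M = 1" by (simp add: S_def)
  have "G 0 = S 0 / (u - of_real (vmin a b l 0))" using GS[of 0] nz[of 0] by (simp add: field_simps)
  also have "\<dots> = (\<Prod>B<M. u - of_real (vmax a b l B)) / ((u - of_real (vmin a b l 0)) * (\<Prod>B<M. u - of_real (vmin a b l (Suc B))))"
    using SK[of M] SM by simp
  also have "\<dots> = res a b l u"
    by (simp add: res_def M_def prod.atMost_shift)
  finally have "f 0 sums res a b l u" using fG[of 0] by simp
  moreover have "f 0 = (\<lambda>k. complex_of_real (tv a b l k 0) / u ^ (k + 1))" by (rule ext) (simp add: f_def)
  ultimately show ?thesis by simp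
qed

text \<open>Equal eigenvalues give equal rational functions \<open>res\<close>. Cross multiplication
  yields an identity of polynomials at infinitely many points, and comparing multisets of roots
  shows that minima and maxima agree up to cancelling pairs. Such pairs do not affect the profile,
  and the profile determines the boxes.\<close>

lemma tv_separates:
  assumes a: "a > 0" and b: "b > 0" and eq: "\<And>k. tv a b l k 0 = tv a b m k 0"
  shows "l = m"
proof -
  define X where "X l = image_mset (\<lambda>B. complex_of_real (vmin a b l B)) (mset_set {..row l 0})" for l
  define Y where "Y l = image_mset (\<lambda>B. complex_of_real (vmax a b l B)) (mset_set {..<row l 0})" for l
  define P where "P X = prod_mset (image_mset (\<lambda>x. [:- x, 1:]) X)" for X :: "complex multiset"
  define bd where "bd = Max {b * real (row l 0) + 2 * a * real (col l 0), b * real (row m 0) + 2 * a * real (col m 0)}"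
  have pX: "poly (P (X l)) u = (\<Prod>B\<le>row l 0. u - of_real (vmin a b l B))" for l u
    by (simp add: P_def X_def poly_prod_mset prod_unfold_prod_mset multiset.map_comp o_def)
  have pY: "poly (P (Y l)) u = (\<Prod>B<row l 0. u - of_real (vmax a b l B))" for l u
    by (simp add: P_def Y_def poly_prod_mset prod_unfold_prod_mset multiset.map_comp o_def)
  have P0: "P X \<noteq> 0" for X by (auto simp: P_def prod_mset_zero_iff dest: arg_cong[of _ _ degree])
  \<comment> \<open>The fractions need not be in lowest terms, since neighbouring columns of equal
    length share a minimum and a maximum; hence the products are compared instead of numerators and
    denominators.\<close>
  have "poly (P (Y l + X m)) u = poly (P (Y m + X l)) u" if u: "cmod u > bd" "poly (P (X l)) u \<noteq> 0" "poly (P (X m)) u \<noteq> 0" for u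
  proof -
    have "res a b l u = res a b m u"
      by (rule sums_unique2[OF tv_sums[OF a b]]) (use u tv_sums[OF a b, of m u] eq in \<open>auto simp: bd_def\<close>)
    then have "poly (P (Y l)) u / poly (P (X l)) u = poly (P (Y m)) u / poly (P (X m)) u"
      by (simp add: res_def pX pY)
    then show ?thesis using u(2,3) by (simp add: P_def field_simps)
  qed
  then have "{u. cmod u > bd} - {u. poly (P (X l)) u = 0} - {u. poly (P (X m)) u = 0} \<subseteq> {u. poly (P (Y l + X m) - P (Y m + X l)) u = 0}" by auto
  moreover have "infinite ({u. cmod u > bd} - {u. poly (P (X l)) u = 0} - {u. poly (P (X m)) u = 0})"
  proof -
    have "range (\<lambda>n. complex_of_real (\<bar>bd\<bar> + 1 + real n)) \<subseteq> {u. cmod u > bd}" by (auto simp: abs_if simp del: of_real_add)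
    moreover have "infinite (range (\<lambda>n. complex_of_real (\<bar>bd\<bar> + 1 + real n)))"
      by (rule range_inj_infinite) (auto simp: inj_def)
    ultimately have "infinite {u. cmod u > bd}" by (rule infinite_super)
    then show ?thesis using poly_roots_finite[OF P0] by (simp add: Diff_infinite_finite)
  qed
  ultimately have "infinite {u. poly (P (Y l + X m) - P (Y m + X l)) u = 0}" using infinite_super by blast
  then have "P (Y l + X m) - P (Y m + X l) = 0" using poly_roots_finite by blast
  then have "proots (P (Y l + X m)) = proots (P (Y m + X l))" by simp
  moreover have "proots (P X) = X" for X
  proof (induction X)
    case (add x X)
    have "P (add_mset x X) = [:- x, 1:] * P X" by (simp add: P_def)
    then show ?case using P0[of X] add by (simp add: proots_mult del: mult_pCons_left)
  qed (simp add: P_def)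
  ultimately have XY: "Y l + X m = Y m + X l" by simp
  have "prof a b (cols l) c = prof a b (cols m) c" for c
  proof -
    define \<phi> where "\<phi> X = (\<Sum>x\<in>#X. \<bar>c - Re x\<bar>)" for X :: "complex multiset"
    have "\<phi> (X l) = (\<Sum>B\<le>row l 0. \<bar>c - vmin a b l B\<bar>)" "\<phi> (Y l) = (\<Sum>B<row l 0. \<bar>c - vmax a b l B\<bar>)" for l
      by (simp_all add: \<phi>_def X_def Y_def sum_unfold_sum_mset multiset.map_comp o_def)
    then have "prof a b (cols l) c = \<phi> (X l) - \<phi> (Y l)" for l by (simp add: prof_cols)
    moreover have "\<phi> (Y l) + \<phi> (X m) = \<phi> (Y m) + \<phi> (X l)" using XY by (simp add: \<phi>_def flip: image_mset_union sum_mset.union)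
    ultimately show ?thesis by simp
  qed
  then have "boxes l = boxes m" using boxes_prof[OF a b] by (auto simp: set_eq_iff)
  then show ?thesis by (rule boxes_inject)
qed

section \<open>Second derivatives of profiles\<close>

text \<open>\<open>p x / (1 - x\<^sup>2) ^ n * exp (- 1 / (1 - x\<^sup>2))\<close> on the unit interval, extended by 0: a class of test functions that is
  closed under derivatives.\<close>

definition bump :: "real poly \<Rightarrow> nat \<Rightarrow> real \<Rightarrow> real" where
  "bump p n x = (if \<bar>x\<bar> < 1 then poly p x / (1 - x\<^sup>2) ^ n * exp (- 1 / (1 - x\<^sup>2)) else 0)"

lemma bump_outside: "\<not> \<bar>x\<bar> < 1 \<Longrightarrow> bump p n x = 0" by (simp add: bump_def)

text \<open>A single term of the series of exp (1 / s), the one of index n + 2, already dominates 1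
  / s^n with two powers of s to spare.\<close>

lemma exp_decay: fixes s :: real assumes "0 < s" shows "exp (- 1 / s) / s ^ n \<le> fact (n + 2) * s\<^sup>2"
proof -
  have "(1 / s) ^ (n + 2) / fact (n + 2) \<le> exp (1 / s)"
  proof -
    have "(\<Sum>k\<in>{n + 2}. (1 / s) ^ k /\<^sub>R fact k) \<le> suminf (\<lambda>k. (1 / s) ^ k /\<^sub>R fact k)"
      using assms exp_converges[of "1 / s"] by (intro sum_le_suminf) (auto simp: sums_iff)
    then show ?thesis using exp_converges[of "1 / s"] by (simp add: sums_iff field_simps)
  qed
  then have "1 / s ^ (n + 2) \<le> fact (n + 2) * exp (1 / s)"
    by (simp only: power_one_over pos_divide_le_eq[OF fact_gt_zero] mult.commute)
  then have "exp (- (1 / s)) * (1 / s ^ (n + 2)) \<le> exp (- (1 / s)) * (fact (n + 2) * exp (1 / s))"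
    by (intro mult_left_mono) auto
  also have "\<dots> = fact (n + 2)" by (simp add: exp_minus)
  finally have "exp (- (1 / s)) * (1 / s ^ (n + 2)) * s\<^sup>2 \<le> fact (n + 2) * s\<^sup>2"
    by (intro mult_right_mono) auto
  moreover have "exp (- (1 / s)) * (1 / s ^ (n + 2)) * s\<^sup>2 = exp (- 1 / s) / s ^ n"
    using assms by (simp add: power_add field_simps power2_eq_square)
  ultimately show ?thesis by simp
qed

text \<open>The second power of 1 - x^2 is what makes the difference quotient at the end points tend
  to 0.\<close>

lemma bump_bound: "\<exists>K\<ge>0. \<forall>x. \<bar>bump p n x\<bar> \<le> K * (1 - x\<^sup>2)\<^sup>2"
proof -
  have "compact (poly p ` {-1..1})" by (intro compact_continuous_image continuous_intros) auto
  then obtain K0 where K0: "\<And>x. x \<in> {-1..1} \<Longrightarrow> \<bar>poly p x\<bar> \<le> K0"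
    using compact_imp_bounded bounded_iff by (metis imageI real_norm_def)
  have K0p: "K0 \<ge> 0" using K0[of 0] by auto
  have "\<bar>bump p n x\<bar> \<le> K0 * fact (n + 2) * (1 - x\<^sup>2)\<^sup>2" for x
  proof (cases "\<bar>x\<bar> < 1")
    case True
    then have s: "1 - x\<^sup>2 > 0" by (simp add: abs_square_less_1)
    have Kx: "\<bar>poly p x\<bar> \<le> K0" using True by (intro K0) (auto simp: abs_less_iff)
    have "\<bar>bump p n x\<bar> = \<bar>poly p x\<bar> * (exp (- 1 / (1 - x\<^sup>2)) / (1 - x\<^sup>2) ^ n)"
      using True s by (simp add: bump_def abs_mult)
    also have "\<dots> \<le> K0 * (fact (n + 2) * (1 - x\<^sup>2)\<^sup>2)"
      using s Kx K0p by (intro mult_mono exp_decay) auto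
    finally show ?thesis by (simp add: mult.assoc)
  qed (simp add: bump_def K0p)
  then show ?thesis using K0p by (intro exI[of _ "K0 * fact (n + 2)"]) auto
qed

text \<open>The quotient rule raises the exponent of the denominator by 2 in the interior; at the
  two end points the derivative is 0 by \<open>bump_bound\<close>, and outside the function
  vanishes.\<close>

lemma bump_deriv:
  obtains q m where "\<And>x. (bump p n has_real_derivative bump q m x) (at x)"
proof
  let ?s = "[:1, 0, -1:] :: real poly"
  let ?q = "pderiv p * ?s\<^sup>2 + smult (2 * real n) ([:0, 1:] * p * ?s) - smult 2 ([:0, 1:] * p)"
  fix x
  show "(bump p n has_real_derivative bump ?q (n + 2) x) (at x)"
  proof (cases "\<bar>x\<bar> < 1")
    case True
    then have s: "1 - x\<^sup>2 > 0" by (simp add: abs_square_less_1)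
    have ps: "poly ?s x = 1 - x\<^sup>2" by (simp add: power2_eq_square)
    define z where "z = 1 - x\<^sup>2"
    have z: "z > 0" using s by (simp add: z_def)
    have "((\<lambda>x. poly p x / (1 - x\<^sup>2) ^ n * exp (- 1 / (1 - x\<^sup>2))) has_real_derivative
      ((poly (pderiv p) x * z ^ n + poly p x * (real n * z ^ (n - 1) * (2 * x))) / (z ^ n)\<^sup>2) * exp (- 1 / z)
       + poly p x / z ^ n * (exp (- 1 / z) * (- (2 * x) / z\<^sup>2))) (at x)"
    proof -
      have dz: "((\<lambda>x. 1 - x\<^sup>2) has_real_derivative - (2 * x)) (at x)"
        by (auto intro!: derivative_eq_intros)
      have dp: "(poly p has_real_derivative poly (pderiv p) x) (at x)" by (rule poly_DERIV)
      have "((\<lambda>x. (1 - x\<^sup>2) ^ n) has_real_derivative real n * (- (2 * x) * (1 - x\<^sup>2) ^ (n - 1))) (at x)"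
        using DERIV_power[OF dz, of n] by simp
      note dn = this
      have nz: "(1 - x\<^sup>2) ^ n \<noteq> 0" using s by simp
      have 1: "((\<lambda>x. poly p x / (1 - x\<^sup>2) ^ n) has_real_derivative
        (poly (pderiv p) x * z ^ n + poly p x * (real n * z ^ (n - 1) * (2 * x))) / (z ^ n)\<^sup>2) (at x)"
        by (rule DERIV_cong[OF DERIV_divide[OF dp dn nz]]) (simp add: z_def power2_eq_square algebra_simps)
      have "((\<lambda>x. - 1 / (1 - x\<^sup>2)) has_real_derivative - (2 * x) / z\<^sup>2) (at x)"
        by (rule DERIV_cong[OF DERIV_divide[OF DERIV_const[of "- 1"] dz]]) (use s in \<open>simp_all add: z_def power2_eq_square\<close>)
      from DERIV_fun_exp[OF this]
      have 2: "((\<lambda>x. exp (- 1 / (1 - x\<^sup>2))) has_real_derivative exp (- 1 / z) * (- (2 * x) / z\<^sup>2)) (at x)"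
        by (simp add: z_def)
      show ?thesis
        using DERIV_mult[OF 1 2] by (rule DERIV_cong) (simp add: z_def mult_ac add_ac)
    qed
    also have "((poly (pderiv p) x * z ^ n + poly p x * (real n * z ^ (n - 1) * (2 * x))) / (z ^ n)\<^sup>2) * exp (- 1 / z)
       + poly p x / z ^ n * (exp (- 1 / z) * (- (2 * x) / z\<^sup>2)) = bump ?q (n + 2) x"
    proof -
      have "bump ?q (n + 2) x = (poly (pderiv p) x * z\<^sup>2 + 2 * real n * (x * poly p x * z) - 2 * (x * poly p x)) / z ^ (n + 2) * exp (- 1 / z)"
        using True by (simp add: bump_def z_def power2_eq_square) (simp add: algebra_simps)
      note bq = this
      show ?thesis unfolding bq using z by (cases n) (simp_all add: power_add field_simps power2_eq_square)
    qed
    finally show ?thesis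
      by (rule has_field_derivative_transform_within_open[of _ _ _ "{-1<..<1}"]) (use True in \<open>auto simp: bump_def abs_less_iff\<close>)
  next
    case False
    show ?thesis
    proof (cases "\<bar>x\<bar> = 1")
      case True
      then have x2: "x\<^sup>2 = 1" by (simp add: abs_square_eq_1)
      obtain K where K: "K \<ge> 0" "\<And>x. \<bar>bump p n x\<bar> \<le> K * (1 - x\<^sup>2)\<^sup>2" using bump_bound by blast
      have "((\<lambda>y. (bump p n y - bump p n x) / (y - x)) \<longlongrightarrow> 0) (at x)"
      proof (rule Lim_null_comparison)
        have "\<bar>(bump p n y - bump p n x) / (y - x)\<bar> \<le> K * \<bar>y - x\<bar> * (y + x)\<^sup>2" for y
        proof (cases "y = x")
          case False
          have "(1 - y\<^sup>2)\<^sup>2 = \<bar>y - x\<bar> * \<bar>y - x\<bar> * (y + x)\<^sup>2"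
          proof -
            have "1 - y\<^sup>2 = - ((y - x) * (y + x))" using x2 by (simp add: power2_eq_square algebra_simps)
            then show ?thesis by (simp add: power2_eq_square mult_ac)
          qed
          then have "\<bar>bump p n y\<bar> \<le> \<bar>y - x\<bar> * (K * \<bar>y - x\<bar> * (y + x)\<^sup>2)"
            using K(2)[of y] by (simp add: mult_ac)
          then show ?thesis using False \<open>\<not> \<bar>x\<bar> < 1\<close> by (simp add: bump_def[of p n x] field_simps)
        qed simp
        then show "\<forall>\<^sub>F y in at x. norm ((bump p n y - bump p n x) / (y - x)) \<le> K * \<bar>y - x\<bar> * (y + x)\<^sup>2" by simp
        show "((\<lambda>y. K * \<bar>y - x\<bar> * (y + x)\<^sup>2) \<longlongrightarrow> 0) (at x)"
          by (auto intro!: tendsto_eq_intros)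
      qed
      then show ?thesis using bump_outside[OF False, of ?q] by (simp only: has_field_derivative_iff)
    next
      case False
      then have "\<bar>x\<bar> > 1" using \<open>\<not> \<bar>x\<bar> < 1\<close> by simp
      have "((\<lambda>_. 0) has_real_derivative 0) (at x)" by simp
      then have "(bump p n has_real_derivative 0) (at x)"
        by (rule has_field_derivative_transform_within_open[of _ _ _ "- {-1..1}"])
           (use \<open>\<bar>x\<bar> > 1\<close> in \<open>auto simp: bump_def abs_less_iff\<close>)
      then show ?thesis using bump_outside[OF \<open>\<not> \<bar>x\<bar> < 1\<close>, of ?q] by (simp only:)
    qed
  qed
qed

lemma smooth_bump:
  assumes "d > 0" shows "smooth_compact_support (\<lambda>x. bump 1 0 ((x - c) / d))"
proof -
  have "\<exists>p n. (deriv ^^ k) (\<lambda>x. bump 1 0 ((x - c) / d)) = (\<lambda>x. bump p n ((x - c) / d))" for k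
  proof (induction k)
    case (Suc k)
    then obtain p n where pn: "(deriv ^^ k) (\<lambda>x. bump 1 0 ((x - c) / d)) = (\<lambda>x. bump p n ((x - c) / d))" by blast
    obtain q m where qm: "\<And>x. (bump p n has_real_derivative bump q m x) (at x)" using bump_deriv by blast
    have "((\<lambda>x. bump p n ((x - c) / d)) has_real_derivative bump q m ((x - c) / d) * (1 / d)) (at x)" for x
      by (rule DERIV_chain2[OF qm]) (use assms in \<open>auto intro!: derivative_eq_intros\<close>)
    then have "deriv (\<lambda>x. bump p n ((x - c) / d)) = (\<lambda>x. bump (smult (1 / d) q) m ((x - c) / d))"
    proof (intro ext DERIV_imp_deriv)
      have "bump (smult (1 / d) q) m y = bump q m y * (1 / d)" for y by (simp add: bump_def)
      then show "((\<lambda>x. bump p n ((x - c) / d)) has_real_derivative bump (smult (1 / d) q) m ((x - c) / d)) (at x)" for x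
        using \<open>\<And>x. ((\<lambda>x. bump p n ((x - c) / d)) has_real_derivative bump q m ((x - c) / d) * (1 / d)) (at x)\<close>[of x]
        by (simp only:)
    qed
    then show ?case using pn by auto
  qed auto
  moreover have "(\<lambda>x. bump p n ((x - c) / d)) differentiable_on UNIV" for p n
  proof -
    obtain q m where qm: "\<And>x. (bump p n has_real_derivative bump q m x) (at x)" using bump_deriv by blast
    have "((\<lambda>x. bump p n ((x - c) / d)) has_real_derivative bump q m ((x - c) / d) * (1 / d)) (at x)" for x
      by (rule DERIV_chain2[OF qm]) (use assms in \<open>auto intro!: derivative_eq_intros\<close>)
    then show ?thesis unfolding differentiable_on_def
      by (metis real_differentiable_def differentiable_at_withinI)
  qed
  moreover have "bounded {x. bump 1 0 ((x - c) / d) \<noteq> 0}"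
  proof (rule bounded_subset[OF bounded_cball[of c d]])
    show "{x. bump 1 0 ((x - c) / d) \<noteq> 0} \<subseteq> cball c d"
      using assms by (auto simp: bump_def dist_real_def abs_minus_commute split: if_splits)
  qed
  ultimately show ?thesis unfolding smooth_compact_support_def by metis
qed

text \<open>Test with a bump centred at c whose radius is at most the distance to all other atoms of
  both candidates: each side reduces to the mass at c.\<close>

lemma distr_unique:
  assumes "distr_second_deriv f w" "distr_second_deriv f w'" shows "w = w'"
proof
  fix c
  define A where "A = {c. w c \<noteq> 0} \<union> {c. w' c \<noteq> 0}"
  have fin: "finite A" using assms by (simp add: A_def distr_second_deriv_def)
  obtain d where d: "d > 0" "\<And>x. x \<in> A - {c} \<Longrightarrow> d \<le> \<bar>x - c\<bar>"
  proof (cases "A - {c} = {}")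
    case False
    define d where "d = Min ((\<lambda>x. \<bar>x - c\<bar>) ` (A - {c}))"
    have "d > 0" unfolding d_def using fin False by (subst Min_gr_iff) auto
    moreover have "\<And>x. x \<in> A - {c} \<Longrightarrow> d \<le> \<bar>x - c\<bar>" unfolding d_def using fin by (intro Min_le) auto
    ultimately show ?thesis by (rule that)
  qed (use that[of 1] in auto)
  define g where "g = (\<lambda>x. bump 1 0 ((x - c) / d))"
  have g: "smooth_compact_support g" unfolding g_def by (rule smooth_bump[OF d(1)])
  have gc: "g c > 0" by (simp add: g_def bump_def)
  have g0: "g x = 0" if "x \<in> A - {c}" for x using d(1) d(2)[OF that] by (auto simp: g_def bump_def abs_divide)
  have S: "(\<Sum>x | v x \<noteq> 0. v x * g x) = v c * g c" if "{x. v x \<noteq> 0} \<subseteq> A" for v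
  proof -
    have "(\<Sum>x | v x \<noteq> 0. v x * g x) = (\<Sum>x\<in>insert c A. v x * g x)"
      by (rule sum.mono_neutral_left) (use fin that in auto)
    also have "\<dots> = (\<Sum>x\<in>{c}. v x * g x)"
      by (rule sum.mono_neutral_right) (use fin g0 in auto)
    finally show ?thesis by simp
  qed
  have "(\<Sum>x | w x \<noteq> 0. w x * g x) = (\<Sum>x | w' x \<noteq> 0. w' x * g x)"
    using assms g unfolding distr_second_deriv_def by metis
  then have "w c * g c = w' c * g c" using S[of w] S[of w'] by (auto simp: A_def)
  then show "w c = w' c" using gc by simp
qed

text \<open>Integrate on the two sides of x separately, with antiderivatives (c - x) g' - g and (x -
  c) g' + g; each side contributes g x.\<close>

lemma integral_abs_second_deriv:
  assumes g: "smooth_compact_support g"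
  shows "has_bochner_integral lborel (\<lambda>c. \<bar>c - x\<bar> * deriv (deriv g) c) (2 * g x)"
proof -
  have dk: "(deriv ^^ k) g differentiable_on UNIV" for k using g by (simp add: smooth_compact_support_def)
  have d: "((deriv ^^ k) g has_real_derivative (deriv ^^ Suc k) g c) (at c)" for k c
    using dk[of k] by (simp add: differentiable_on_def DERIV_deriv_iff_real_differentiable)
  have d0: "(g has_real_derivative deriv g c) (at c)" for c using d[of 0 c] by simp
  have d1: "(deriv g has_real_derivative deriv (deriv g) c) (at c)" for c using d[of 1 c] by simp
  have d2: "isCont (deriv (deriv g)) c" for c using d[of 2 c] DERIV_isCont by (simp add: numeral_2_eq_2)
  obtain R0 where R0: "\<And>c. g c \<noteq> 0 \<Longrightarrow> \<bar>c\<bar> \<le> R0"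
    using g unfolding smooth_compact_support_def bounded_iff by auto
  \<comment> \<open>Large enough for x to lie between - R and R, and strictly outside the support,
    so that the boundary terms at both ends vanish.\<close>
  define R where "R = max R0 \<bar>x\<bar> + 1"
  have xR: "- R \<le> x" "x \<le> R" by (auto simp: R_def)
  have out: "g c = 0 \<and> deriv g c = 0 \<and> deriv (deriv g) c = 0" if "\<bar>c\<bar> > R0" for c
  proof -
    let ?S = "- {- R0..R0}"
    have S: "open ?S" and gz: "g y = 0" if "y \<in> ?S" for y
    proof -
      show "open ?S" by (simp add: open_Compl)
      have "\<not> \<bar>y\<bar> \<le> R0" using that by auto
      then show "g y = 0" using R0 by blast
    qed
    have dz: "deriv g y = 0" if "y \<in> ?S" for y
    proof -
      have "((\<lambda>_. 0) has_real_derivative 0) (at y)" by simp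
      then have "(g has_real_derivative 0) (at y)"
        by (rule has_field_derivative_transform_within_open[of _ _ _ ?S]) (use that gz in auto)
      then show ?thesis by (rule DERIV_imp_deriv)
    qed
    have cS: "c \<in> ?S" using that by (auto simp: abs_if split: if_splits)
    have "((\<lambda>_. 0) has_real_derivative 0) (at c)" by simp
    then have "(deriv g has_real_derivative 0) (at c)"
      by (rule has_field_derivative_transform_within_open[of _ _ _ ?S]) (use cS dz in auto)
    then show ?thesis using gz[OF cS] dz[OF cS] DERIV_imp_deriv by blast
  qed
  have RR: "\<bar>R\<bar> > R0" "\<bar>- R\<bar> > R0" by (auto simp: R_def)
  have 1: "has_bochner_integral lborel (\<lambda>c. ((c - x) * deriv (deriv g) c) * indicator {x..R} c)
     (((R - x) * deriv g R - g R) - ((x - x) * deriv g x - g x))"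
    by (rule has_bochner_integral_FTC_Icc_real) (use xR d0 d1 d2 in \<open>auto intro!: derivative_eq_intros continuous_intros\<close>)
  have 2: "has_bochner_integral lborel (\<lambda>c. ((x - c) * deriv (deriv g) c) * indicator {- R..x} c)
     (((x - x) * deriv g x + g x) - ((x - (- R)) * deriv g (- R) + g (- R)))"
    by (rule has_bochner_integral_FTC_Icc_real) (use xR d0 d1 d2 in \<open>auto intro!: derivative_eq_intros continuous_intros\<close>)
  have "has_bochner_integral lborel (\<lambda>c. ((c - x) * deriv (deriv g) c) * indicator {x..R} c + ((x - c) * deriv (deriv g) c) * indicator {- R..x} c)
    (2 * g x)"
    using has_bochner_integral_add[OF 1 2] out[OF RR(1)] out[OF RR(2)] by simp
  moreover have "((c - x) * deriv (deriv g) c) * indicator {x..R} c + ((x - c) * deriv (deriv g) c) * indicator {- R..x} c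
    = \<bar>c - x\<bar> * deriv (deriv g) c" for c
  proof (cases "\<bar>c\<bar> > R")
    case True
    then have "deriv (deriv g) c = 0" using out[of c] by (auto simp: R_def)
    then show ?thesis by simp
  next
    case False
    then have "- R \<le> c" "c \<le> R" by auto
    then show ?thesis by (auto simp: indicator_def abs_if)
  qed
  ultimately show ?thesis by simp
qed

text \<open>Several of the points may coincide, and their masses then add up or cancel, so
  \<open>w\<close> collects them by position. Integration against \<open>w\<close> can nevertheless
  be done over the index set.\<close>

lemma distr_sum_abs:
  fixes \<kappa> p :: "'i \<Rightarrow> real"
  assumes X: "finite X"
  defines "w \<equiv> \<lambda>c. \<Sum>x | x \<in> X \<and> p x = c. 2 * \<kappa> x"
  shows "distr_second_deriv (\<lambda>c. \<Sum>x\<in>X. \<kappa> x * \<bar>c - p x\<bar>) w"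
    and "(\<Sum>c | w c \<noteq> 0. F c * complex_of_real (1 / 2 * w c)) = (\<Sum>x\<in>X. of_real (\<kappa> x) * F (p x))"
proof -
  have w0: "w c = 0" if "c \<notin> p ` X" for c
    unfolding w_def by (rule sum.neutral) (use that in auto)
  then have sub: "{c. w c \<noteq> 0} \<subseteq> p ` X" by auto
  have fin: "finite {c. w c \<noteq> 0}" using sub X finite_subset by blast
  have W: "(\<Sum>c | w c \<noteq> 0. w c * g c) = (\<Sum>x\<in>X. 2 * \<kappa> x * g (p x))" for g
  proof -
    have "(\<Sum>c | w c \<noteq> 0. w c * g c) = (\<Sum>c\<in>p ` X. w c * g c)"
      by (rule sum.mono_neutral_left) (use X sub in auto)
    also have "\<dots> = (\<Sum>c\<in>p ` X. \<Sum>x | x \<in> X \<and> p x = c. 2 * \<kappa> x * g (p x))"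
      unfolding w_def sum_distrib_right by (intro sum.cong) auto
    also have "\<dots> = (\<Sum>x\<in>X. 2 * \<kappa> x * g (p x))"
      by (rule sum.image_gen[OF X, symmetric])
    finally show ?thesis .
  qed
  show "distr_second_deriv (\<lambda>c. \<Sum>x\<in>X. \<kappa> x * \<bar>c - p x\<bar>) w"
    unfolding distr_second_deriv_def
  proof (intro conjI fin allI impI)
    fix g assume g: "smooth_compact_support g"
    have "has_bochner_integral lborel (\<lambda>c. \<Sum>x\<in>X. \<kappa> x * (\<bar>c - p x\<bar> * deriv (deriv g) c)) (\<Sum>x\<in>X. \<kappa> x * (2 * g (p x)))"
      by (intro has_bochner_integral_sum has_bochner_integral_mult_right integral_abs_second_deriv g)
    then have "(LINT c|lborel. (\<Sum>x\<in>X. \<kappa> x * \<bar>c - p x\<bar>) * deriv (deriv g) c) = (\<Sum>x\<in>X. \<kappa> x * (2 * g (p x)))"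
      by (simp add: has_bochner_integral_integral_eq sum_distrib_right mult.assoc)
    then show "(LINT c|lborel. (\<Sum>x\<in>X. \<kappa> x * \<bar>c - p x\<bar>) * deriv (deriv g) c) = (\<Sum>c | w c \<noteq> 0. w c * g c)"
      unfolding W by (simp add: mult_ac)
  qed
  have "(\<Sum>c | w c \<noteq> 0. F c * complex_of_real (1 / 2 * w c)) = (\<Sum>c\<in>p ` X. F c * complex_of_real (1 / 2 * w c))"
    by (rule sum.mono_neutral_left) (use X sub in auto)
  also have "\<dots> = (\<Sum>c\<in>p ` X. \<Sum>x | x \<in> X \<and> p x = c. of_real (\<kappa> x) * F (p x))"
    unfolding w_def by (intro sum.cong) (auto simp: sum_distrib_left mult_ac)
  also have "\<dots> = (\<Sum>x\<in>X. of_real (\<kappa> x) * F (p x))"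
    by (rule sum.image_gen[OF X, symmetric])
  finally show "(\<Sum>c | w c \<noteq> 0. F c * complex_of_real (1 / 2 * w c)) = (\<Sum>x\<in>X. of_real (\<kappa> x) * F (p x))" .
qed

text \<open>Minima and maxima form one family with signs 1 and -1, indexed by a disjoint sum because
  their positions may coincide. The exponential of plus or minus a logarithm is the number itself or
  its inverse, whatever the branch.\<close>

lemma T_generating_eq:
  assumes h: "h > 0"
    and min: "\<And>B. B \<le> row l 0 \<Longrightarrow> u \<noteq> of_real (vmin (- eps2 e h) (eps1 e h) l B)"
    and max: "\<And>B. B < row l 0 \<Longrightarrow> u \<noteq> of_real (vmax (- eps2 e h) (eps1 e h) l B)"
  shows "T_generating e h l u = res (- eps2 e h) (eps1 e h) l u"
proof -
  define a b where "a = - eps2 e h" and "b = eps1 e h"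
  define X where "X = Inl ` {..row l 0} \<union> Inr ` {..<row l 0}"
  define p where "p = case_sum (vmin a b l) (vmax a b l)"
  define \<kappa> :: "nat + nat \<Rightarrow> real" where "\<kappa> = case_sum (\<lambda>_. 1) (\<lambda>_. - 1)"
  define w where "w = (\<lambda>c. \<Sum>x | x \<in> X \<and> p x = c. 2 * \<kappa> x)"
  have fin: "finite X" by (simp add: X_def)
  have sumX: "(\<Sum>x\<in>X. f x) = (\<Sum>B\<le>row l 0. f (Inl B)) + (\<Sum>B<row l 0. f (Inr B))" for f :: "nat + nat \<Rightarrow> 'b::comm_monoid_add"
    unfolding X_def by (subst sum.union_disjoint) (auto simp: sum.reindex)
  have "profile e h l = (\<lambda>c. \<Sum>x\<in>X. \<kappa> x * \<bar>c - p x\<bar>)"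
    by (rule ext) (simp add: profile_eq[OF h] prof_cols sumX p_def \<kappa>_def a_def b_def sum_negf)
  then have "distr_second_deriv (profile e h l) w"
    unfolding w_def using distr_sum_abs(1)[OF fin, of \<kappa> p] by simp
  then have dd: "profile_dd e h l = w"
    unfolding profile_dd_def using distr_unique by (intro the_equality) auto
  have "T_generating e h l u = exp (\<Sum>x\<in>X. of_real (\<kappa> x) * Ln (1 / (u - of_real (p x))))"
    unfolding T_generating_def dd
    unfolding w_def distr_sum_abs(2)[OF fin, where F="\<lambda>c. Ln (1 / (u - of_real c))"] ..
  also have "\<dots> = (\<Prod>x\<in>X. exp (of_real (\<kappa> x) * Ln (1 / (u - of_real (p x)))))"
    using fin by (rule exp_sum)
  also have "\<dots> = (\<Prod>x\<in>Inl ` {..row l 0}. exp (of_real (\<kappa> x) * Ln (1 / (u - of_real (p x))))) * (\<Prod>x\<in>Inr ` {..<row l 0}. exp (of_real (\<kappa> x) * Ln (1 / (u - of_real (p x)))))"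
    unfolding X_def by (rule prod.union_disjoint) auto
  also have "(\<Prod>x\<in>Inl ` {..row l 0}. exp (of_real (\<kappa> x) * Ln (1 / (u - of_real (p x))))) = (\<Prod>B\<le>row l 0. 1 / (u - of_real (vmin a b l B)))"
    using min by (auto simp: prod.reindex p_def \<kappa>_def a_def b_def intro!: prod.cong)
  also have "(\<Prod>x\<in>Inr ` {..<row l 0}. exp (of_real (\<kappa> x) * Ln (1 / (u - of_real (p x))))) = (\<Prod>B<row l 0. u - of_real (vmax a b l B))"
    using max by (auto simp: prod.reindex p_def \<kappa>_def a_def b_def exp_minus intro!: prod.cong)
  finally show ?thesis by (simp add: res_def a_def b_def prod_dividef)
qed

text \<open>The point z = 0 corresponds to u = \<infinity> and is excluded, so the leading
  coefficient is obtained as a limit; dividing by z then reduces to the next one.\<close>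

lemma series_unique:
  fixes d :: "nat \<Rightarrow> complex"
  assumes "r > 0" "\<And>z. z \<noteq> 0 \<Longrightarrow> norm z < r \<Longrightarrow> (\<lambda>k. d k * z ^ k) sums 0"
  shows "d n = 0"
  using assms(2)
proof (induction n arbitrary: d)
  case (0 d)
  have "((\<lambda>_. 0) \<longlongrightarrow> d 0) (at (0 :: complex))" by (rule powser_limit_0_strong[OF assms(1), where f="\<lambda>_. 0"]) (use 0 in auto)
  then show ?case using tendsto_unique[OF _ tendsto_const] by (metis trivial_limit_at)
next
  case (Suc n d)
  have d0: "d 0 = 0"
  proof -
    have "((\<lambda>_. 0) \<longlongrightarrow> d 0) (at (0 :: complex))" by (rule powser_limit_0_strong[OF assms(1), where f="\<lambda>_. 0"]) (use Suc in auto)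
    then show ?thesis using tendsto_unique[OF _ tendsto_const] by (metis trivial_limit_at)
  qed
  have "(\<lambda>k. d (Suc k) * z ^ k) sums 0" if z: "z \<noteq> 0" "norm z < r" for z
  proof -
    have "(\<lambda>k. d (Suc k) * z ^ Suc k) sums 0" using Suc.prems[OF z] d0 sums_Suc_iff[of "\<lambda>k. d k * z ^ k" 0] by simp
    then have "(\<lambda>k. (1 / z) * (d (Suc k) * z ^ Suc k)) sums ((1 / z) * 0)" by (rule sums_mult)
    then show ?thesis using z by simp
  qed
  then show ?case by (rule Suc.IH[of "\<lambda>k. d (Suc k)"])
qed

text \<open>For large u both sequences have the same generating function, by
  \<open>T_generating_eq\<close> and \<open>tv_sums\<close>; uniqueness of the expansion follows by
  the substitution u = 1 / z.\<close>

theorem T_up_eq: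
  assumes h: "h > 0" shows "T_up e h l k = tv (- eps2 e h) (eps1 e h) l k 0"
proof -
  define a b where "a = - eps2 e h" and "b = eps1 e h"
  have a: "a > 0" and b: "b > 0" using eps_props[OF h] by (simp_all add: a_def b_def)
  define T where "T k = tv a b l k 0" for k
  \<comment> \<open>The first summand ensures convergence; the two sums bound every single abscissa,
    so a larger u meets neither a zero nor a pole.\<close>
  let ?R = "(b * real (row l 0) + 2 * a * real (col l 0)) + (\<Sum>B\<le>row l 0. \<bar>vmin a b l B\<bar>) + (\<Sum>B<row l 0. \<bar>vmax a b l B\<bar>)"
  have ev: "\<forall>\<^sub>F u in at_infinity. (\<lambda>k. complex_of_real (T k) / u ^ (k + 1)) sums T_generating e h l u"
  proof -
    have "(\<lambda>k. complex_of_real (T k) / u ^ (k + 1)) sums T_generating e h l u" if u: "cmod u \<ge> ?R + 1" for u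
    proof -
      have s: "(\<Sum>B\<le>row l 0. \<bar>vmin a b l B\<bar>) \<ge> 0" "(\<Sum>B<row l 0. \<bar>vmax a b l B\<bar>) \<ge> 0" by (simp_all add: sum_nonneg)
      have p: "b * real (row l 0) + 2 * a * real (col l 0) \<ge> 0" using a b by simp
      have "u \<noteq> of_real (vmin a b l B)" if "B \<le> row l 0" for B
      proof -
        have "\<bar>vmin a b l B\<bar> \<le> (\<Sum>B\<le>row l 0. \<bar>vmin a b l B\<bar>)" by (rule member_le_sum) (use that in auto)
        then have "cmod (of_real (vmin a b l B)) < cmod u" unfolding norm_of_real using u s p by linarith
        then show ?thesis by auto
      qed
      moreover have "u \<noteq> of_real (vmax a b l B)" if "B < row l 0" for B
      proof -
        have "\<bar>vmax a b l B\<bar> \<le> (\<Sum>B<row l 0. \<bar>vmax a b l B\<bar>)" by (rule member_le_sum) (use that in auto)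
        then have "cmod (of_real (vmax a b l B)) < cmod u" unfolding norm_of_real using u s p by linarith
        then show ?thesis by auto
      qed
      ultimately have "T_generating e h l u = res a b l u"
        using T_generating_eq[OF h, of l u e] by (simp add: a_def b_def)
      then show ?thesis using tv_sums[OF a b, of l u] u s by (simp add: T_def)
    qed
    then show ?thesis unfolding eventually_at_infinity by blast
  qed
  have uniq: "T' = T" if ev': "\<forall>\<^sub>F u in at_infinity. (\<lambda>k. complex_of_real (T' k) / u ^ (k + 1)) sums T_generating e h l u" for T'
  proof -
    from eventually_conj[OF ev ev'] obtain R where R: "\<And>u. cmod u \<ge> R \<Longrightarrow>
       (\<lambda>k. complex_of_real (T k) / u ^ (k + 1)) sums T_generating e h l u \<and>
       (\<lambda>k. complex_of_real (T' k) / u ^ (k + 1)) sums T_generating e h l u"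
      unfolding eventually_at_infinity by blast
    define r where "r = 1 / (\<bar>R\<bar> + 1)"
    have r: "r > 0" by (simp add: r_def)
    have "complex_of_real (T' n - T n) = 0" for n
    proof (rule series_unique[OF r])
      fix z :: complex assume z: "z \<noteq> 0" "norm z < r"
      have p: "\<bar>R\<bar> + 1 > 0" by simp
      have "norm z * (\<bar>R\<bar> + 1) < 1" using z(2) unfolding r_def pos_less_divide_eq[OF p] .
      then have "\<bar>R\<bar> + 1 < 1 / norm z" using z(1) by (simp add: pos_less_divide_eq mult.commute)
      then have "cmod (1 / z) \<ge> R" by (simp add: norm_divide)
      note RR = R[OF this]
      have "(\<lambda>k. complex_of_real (T' k) / (1 / z) ^ (k + 1) - complex_of_real (T k) / (1 / z) ^ (k + 1)) sums 0"
        using sums_diff[OF conjunct2[OF RR] conjunct1[OF RR]] by simp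
      then have "(\<lambda>k. (1 / z) * (complex_of_real (T' k) / (1 / z) ^ (k + 1) - complex_of_real (T k) / (1 / z) ^ (k + 1))) sums ((1 / z) * 0)"
        by (rule sums_mult)
      moreover have "(1 / z) * (complex_of_real (T' k) / (1 / z) ^ (k + 1) - complex_of_real (T k) / (1 / z) ^ (k + 1)) = complex_of_real (T' k - T k) * z ^ k" for k
      proof -
        have "(1 / z) * (x / (1 / z) ^ (k + 1)) = x * z ^ k" for x using z by (simp add: power_divide)
        then show ?thesis unfolding right_diff_distrib by (simp add: left_diff_distrib)
      qed
      ultimately show "(\<lambda>k. complex_of_real (T' k - T k) * z ^ k) sums 0" by simp
    qed
    then show ?thesis by (simp add: fun_eq_iff)
  qed
  have "T_up e h l = T" unfolding T_up_def by (rule the_equality[where P="\<lambda>T. \<forall>\<^sub>F u in at_infinity. (\<lambda>k. complex_of_real (T k) / u ^ (k + 1)) sums T_generating e h l u", OF ev uniq])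
  then show ?thesis by (simp add: T_def a_def b_def)
qed


section \<open>Monomial symmetric functions\<close>

lemma const_eq_0_iff [simp]: "const c = 0 \<longleftrightarrow> c = 0"
  by (metis const_0 const_eq_iff)

lemma rho_add: "f \<in> rho_polys \<Longrightarrow> g \<in> rho_polys \<Longrightarrow> f + g \<in> rho_polys"
  using keys_add[of f g] by (auto simp: rho_polys_def)
lemma rho_const_mult: "f \<in> rho_polys \<Longrightarrow> const a * f \<in> rho_polys"
  by (auto simp: rho_polys_def in_keys_iff)
lemma rho_sum: "(\<And>x. x \<in> A \<Longrightarrow> f x \<in> rho_polys) \<Longrightarrow> sum f A \<in> rho_polys"
  by (induction A rule: infinite_finite_induct) (simp_all add: rho_add hom_rho[OF hom_0])
lemma rho_diff: "f \<in> rho_polys \<Longrightarrow> g \<in> rho_polys \<Longrightarrow> f - g \<in> rho_polys"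
  using keys_diff[of f g] by (auto simp: rho_polys_def)

lemma tp_add_single:
  assumes "j \<notin> keys d" "k > 0" shows "tp (d + single j k) = add_mset k (tp d)"
proof -
  have dj: "lookup d j = 0" using assms(1) by (simp add: in_keys_iff)
  have keys: "keys (d + single j k) = insert j (keys d)"
  proof (rule set_eqI)
    fix x show "x \<in> keys (d + single j k) \<longleftrightarrow> x \<in> insert j (keys d)"
      using assms dj by (cases "x = j") (auto simp: in_keys_iff lookup_add lookup_single when_def)
  qed
  have "image_mset (lookup (d + single j k)) (mset_set (keys d)) = image_mset (lookup d) (mset_set (keys d))"
    by (rule image_mset_cong) (use assms in \<open>auto simp: lookup_add lookup_single when_def\<close>)
  then show ?thesis using assms(1) dj by (simp add: tp_def keys lookup_add)
qed

lemma card_keys_rowp_remove: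
  assumes "i \<in> keys (rowp l)"
  shows "card (keys (rowp (ip (rowp l - single i (row l i))))) = card (keys (rowp l)) - 1"
    and "psize (ip (rowp l - single i (row l i))) + row l i = psize l"
    and "i \<notin> keys (rowp l - single i (row l i))"
proof -
  let ?d = "rowp l - single i (row l i)"
  show i: "i \<notin> keys ?d" by (simp add: in_keys_iff lookup_minus)
  have pos: "row l i > 0" using assms by (simp add: in_keys_iff)
  have d: "?d + single i (row l i) = rowp l"
    by (rule poly_mapping_eqI) (auto simp: lookup_add lookup_minus lookup_single when_def)
  then have "tp (rowp l) = add_mset (row l i) (tp ?d)" using tp_add_single[OF i pos] by simp
  then show "card (keys (rowp (ip ?d))) = card (keys (rowp l)) - 1" by (simp add: card_keys_tp)
  show "psize (ip ?d) + row l i = psize l" by (metis d psize_ip psize_tdeg tdeg_add tdeg_single)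
qed

text \<open>Let l' be l without one part k. In p_k m_(l') the part k is either added as a new part,
  which gives m_l with nonzero coefficient, or to an existing part, which gives functions with fewer
  parts. Subtracting the latter, known by induction, leaves a multiple of m_l.\<close>

lemma ex_Msym: "\<exists>f\<in>hom (psize l). \<forall>N. in_vars N f = monomial_sym N l"
proof (induction "card (keys (rowp l))" arbitrary: l rule: less_induct)
  case less
  show ?case
  proof (cases "keys (rowp l) = {}")
    case True
    then have r: "rowp l = 0" by simp
    have tp0: "tp d = tp 0 \<longleftrightarrow> d = 0" for d
      by (metis card_0_eq card_keys_tp finite_keys keys_eq_empty)
    have "in_vars N (const 1) = monomial_sym N l" for N
    proof (rule poly_mapping_eqI)
      fix d show "lookup (in_vars N (const 1)) d = lookup (monomial_sym N l) d"
        using tp0[of d] by (auto simp: lookup_monomial_sym ip_eq_iff r lookup_const simp del: const_1)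
    qed
    moreover have "const 1 \<in> hom (psize l)" using const_hom[of 1] by (simp add: psize_tdeg r)
    ultimately show ?thesis by blast
  next
    case False
    then obtain i where i: "i \<in> keys (rowp l)" by blast
    define k where "k = row l i"
    have k: "k > 0" using i by (simp add: k_def in_keys_iff)
    define l' where "l' = ip (rowp l - single i k)"
    note rem = card_keys_rowp_remove[OF i, folded k_def, folded l'_def]
    have cpos: "card (keys (rowp l)) > 0" using i by (metis card_gt_0_iff empty_iff finite_keys)
    obtain f' where f': "f' \<in> hom (psize l')" "\<And>N. in_vars N f' = monomial_sym N l'"
      using less(1)[of l'] rem(1) cpos by auto
    define g where "g = var k * f'"
    have g: "g \<in> hom (psize l)" unfolding g_def using hom_var_mult[OF f'(1), of k] k rem(2) by simp
    \<comment> \<open>The coefficient counts the positions of m from which k can be subtracted so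
      that l' remains.\<close>
    have cf_g: "cf g m = of_nat (card {j\<in>{..<psize m}. k \<le> row m j \<and> ip (rowp m - single j k) = l'})" for m
    proof -
      have sub: "keys (rowp m - single j k) \<subseteq> {..<psize m}" for j
        using keys_rowp_subset[of m] by (auto simp: in_keys_iff lookup_minus subset_iff)
      have "cf g m = (\<Sum>j<psize m. lookup (monom_power j k * monomial_sym (psize m) l') (rowp m))"
        by (simp add: cf_def g_def in_vars_mult in_vars_var f'(2) sum_distrib_right lookup_sum)
      also have "\<dots> = (\<Sum>j<psize m. if k \<le> row m j \<and> ip (rowp m - single j k) = l' then 1 else 0)"
        by (rule sum.cong) (auto simp: lookup_monom_power_mult lookup_monomial_sym sub)
      finally show ?thesis by (simp add: sum.If_cases Int_def)
    qed
    have cf_gl: "cf g l \<noteq> 0"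
    proof -
      have "i \<in> {j\<in>{..<psize l}. k \<le> row l j \<and> ip (rowp l - single j k) = l'}"
        using i keys_rowp_subset[of l] by (auto simp: k_def l'_def)
      then have "card {j\<in>{..<psize l}. k \<le> row l j \<and> ip (rowp l - single j k) = l'} > 0"
        by (subst card_gt_0_iff) (auto intro: finite_subset[of _ "{..<psize l}"])
      then show ?thesis unfolding cf_g of_nat_eq_0_iff by linarith
    qed
    \<comment> \<open>If k was added to a part already present, m has only as many parts as l', one
      less than l; if it became a new part, m has the type of l.\<close>
    have smaller: "card (keys (rowp m)) < card (keys (rowp l))" if m: "cf g m \<noteq> 0" "m \<noteq> l" for m
    proof -
      have "{j\<in>{..<psize m}. k \<le> row m j \<and> ip (rowp m - single j k) = l'} \<noteq> {}" using m(1) by (auto simp: cf_g)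
      then obtain j where j: "k \<le> row m j" "ip (rowp m - single j k) = l'" by blast
      define d where "d = rowp m - single j k"
      have md: "rowp m = d + single j k"
        by (rule poly_mapping_eqI) (use j in \<open>auto simp: d_def lookup_add lookup_minus lookup_single when_def\<close>)
      have tpd: "tp d = tp (rowp l - single i k)" using j(2) by (metis d_def l'_def tp_ip)
      have cd: "card (keys d) = card (keys (rowp l)) - 1" using rem(1) by (metis card_keys_tp l'_def tp_ip tpd)
      show ?thesis
      proof (cases "j \<in> keys d")
        case True
        then have "keys (rowp m) \<subseteq> keys d" unfolding md using keys_add[of d "single j k"] by (auto split: if_splits)
        then show ?thesis using card_mono[OF finite_keys, of "keys (rowp m)" d] cd cpos by simp
      next
        case False
        have "tp (rowp m) = add_mset k (tp (rowp l - single i k))" using tp_add_single[OF False k] md tpd by simp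
        also have "\<dots> = tp (rowp l - single i k + single i k)" using tp_add_single[OF rem(3) k] by simp
        also have "rowp l - single i k + single i k = rowp l"
          by (rule poly_mapping_eqI) (auto simp: k_def lookup_add lookup_minus lookup_single when_def)
        finally show ?thesis using m(2) tp_rowp_inject by blast
      qed
    qed
    define S where "S = {m. psize m = psize l \<and> m \<noteq> l \<and> cf g m \<noteq> 0}"
    have finS: "finite S" by (rule finite_subset[OF _ finite_psize[of "psize l"]]) (auto simp: S_def)
    have "\<forall>m\<in>S. \<exists>f. f \<in> hom (psize l) \<and> (\<forall>N. in_vars N f = monomial_sym N m)"
      using less(1) smaller unfolding S_def by (metis (mono_tags, lifting) mem_Collect_eq)
    then obtain M where M: "\<And>m. m \<in> S \<Longrightarrow> M m \<in> hom (psize l)" "\<And>m N. m \<in> S \<Longrightarrow> in_vars N (M m) = monomial_sym N m"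
      by metis
    define f where "f = const (1 / cf g l) * (g - (\<Sum>m\<in>S. const (cf g m) * M m))"
    have "f \<in> hom (psize l)" unfolding f_def by (intro hom_const_mult hom_diff g hom_sum M(1))
    moreover have "in_vars N f = monomial_sym N l" for N
    proof -
      have "in_vars N g = (\<Sum>m\<in>insert l S. const (cf g m) * monomial_sym N m)"
        by (rule in_vars_expansion[OF hom_rho[OF g]]) (use finS cf_hom[OF g] in \<open>auto simp: S_def\<close>)
      also have "\<dots> = const (cf g l) * monomial_sym N l + (\<Sum>m\<in>S. const (cf g m) * monomial_sym N m)"
        using finS by (simp add: S_def)
      finally have "in_vars N f = const (1 / cf g l) * (const (cf g l) * monomial_sym N l)"
        by (simp add: f_def in_vars_const_mult in_vars_diff in_vars_sum M(2))
      also have "\<dots> = const (1 / cf g l * cf g l) * monomial_sym N l" by (simp only: const_mult mult.assoc)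
      finally show ?thesis using cf_gl by simp
    qed
    ultimately show ?thesis by blast
  qed
qed

definition Msym :: "int_partition \<Rightarrow> cpoly" where
  "Msym l = (SOME f. f \<in> hom (psize l) \<and> (\<forall>N. in_vars N f = monomial_sym N l))"

lemma Msym_hom: "Msym l \<in> hom (psize l)" and in_vars_Msym: "in_vars N (Msym l) = monomial_sym N l"
proof -
  have "\<exists>f. f \<in> hom (psize l) \<and> (\<forall>N. in_vars N f = monomial_sym N l)" using ex_Msym by blast
  from someI_ex[OF this] show "Msym l \<in> hom (psize l)" "in_vars N (Msym l) = monomial_sym N l"
    by (simp_all add: Msym_def)
qed

lemma cf_Msym: "cf (Msym m) l = (if l = m then 1 else 0)"
  by (rule cf_monomial_sym) (rule in_vars_Msym)

lemma Msym_expansion: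
  assumes "f \<in> hom n" "finite S" "\<And>m. cf f m \<noteq> 0 \<Longrightarrow> m \<in> S"
  shows "f = (\<Sum>m\<in>S. const (cf f m) * Msym m)"
proof -
  let ?S = "{m\<in>S. psize m = n}"
  have "f = (\<Sum>m\<in>?S. const (cf f m) * Msym m)"
  proof (rule cf_inj[OF hom_rho[OF assms(1)]])
    have "(\<Sum>m\<in>?S. const (cf f m) * Msym m) \<in> hom n"
      using Msym_hom by (intro hom_sum hom_const_mult) auto
    then show "(\<Sum>m\<in>?S. const (cf f m) * Msym m) \<in> rho_polys" by (rule hom_rho)
    show "in_vars N f = in_vars N (\<Sum>m\<in>?S. const (cf f m) * Msym m)" for N
      unfolding in_vars_sum in_vars_const_mult in_vars_Msym
      by (rule in_vars_expansion[OF hom_rho[OF assms(1)]]) (use assms cf_hom[OF assms(1)] in auto)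
  qed
  also have "\<dots> = (\<Sum>m\<in>S. const (cf f m) * Msym m)"
    by (rule sum.mono_neutral_left) (use assms cf_hom[OF assms(1)] in auto)
  finally show ?thesis .
qed

section \<open>Jack polynomials\<close>

lemma inner_hom_neq:
  assumes "f \<in> hom m" "g \<in> hom n" "m \<noteq> n" shows "inner_h h f g = 0"
  unfolding inner_h_def
proof (rule sum.neutral, rule ballI)
  fix d assume d: "d \<in> keys f"
  then have "wt d = m" using assms(1) by (simp add: hom_def)
  then have "lookup g d = 0" using assms(2,3) by (auto simp: hom_iff)
  then show "cnj (lookup f d) * lookup g d * complex_of_real (monom_sqnorm h d) = 0" by simp
qed

text \<open>Gram-Schmidt, one vector at a time and without linear independence: the new vector is
  first made orthogonal to the others, and its residual is then split off.\<close>

lemma projection_exists: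
  assumes h: "h > 0" and "finite S" and F: "\<And>s. s \<in> S \<Longrightarrow> F s \<in> rho_polys"
  shows "\<exists>c. \<forall>s\<in>S. inner_h h (F s) (v - (\<Sum>t\<in>S. const (c t) * F t)) = 0"
  using assms(2) F
proof (induction S arbitrary: v)
  case empty
  show ?case by simp
next
  case (insert x S)
  obtain c1 where c1: "\<forall>s\<in>S. inner_h h (F s) (F x - (\<Sum>t\<in>S. const (c1 t) * F t)) = 0"
    using insert.IH[of "F x"] insert.prems by auto
  obtain c where c: "\<forall>s\<in>S. inner_h h (F s) (v - (\<Sum>t\<in>S. const (c t) * F t)) = 0"
    using insert.IH[of v] insert.prems by auto
  define x' where "x' = F x - (\<Sum>t\<in>S. const (c1 t) * F t)"
  define v' where "v' = v - (\<Sum>t\<in>S. const (c t) * F t)"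
  \<comment> \<open>For a residual 0 the division returns 0, and orthogonality to the residual is
    trivial.\<close>
  define \<alpha> where "\<alpha> = inner_h h x' v' / inner_h h x' x'"
  define c' where "c' t = (if t = x then \<alpha> else c t - \<alpha> * c1 t)" for t
  have "(\<Sum>t\<in>insert x S. const (c' t) * F t) = const \<alpha> * F x + (\<Sum>t\<in>S. const (c t - \<alpha> * c1 t) * F t)"
  proof -
    have "(\<Sum>t\<in>S. const (c' t) * F t) = (\<Sum>t\<in>S. const (c t - \<alpha> * c1 t) * F t)"
      by (rule sum.cong) (use insert.hyps in \<open>auto simp: c'_def\<close>)
    then show ?thesis using insert.hyps by (simp add: c'_def)
  qed
  then have r: "v - (\<Sum>t\<in>insert x S. const (c' t) * F t) = v' - const \<alpha> * x'"
    by (simp add: v'_def x'_def const_diff const_mult left_diff_distrib right_diff_distrib sum_subtractf sum_distrib_left mult.assoc)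
  have orth: "inner_h h (F s) (v' - const \<alpha> * x') = 0" if "s \<in> S" for s
    using c c1 that by (simp add: inner_diff_right inner_const_right x'_def v'_def)
  have x'rho: "x' \<in> rho_polys"
    unfolding x'_def using insert.prems by (intro rho_diff rho_sum rho_const_mult) auto
  have "inner_h h x' (v' - const \<alpha> * x') = 0"
  proof (cases "x' = 0")
    case False
    then have "inner_h h x' x' \<noteq> 0" using inner_eq_0[OF h x'rho] by blast
    then show ?thesis by (simp add: inner_diff_right inner_const_right \<alpha>_def)
  qed simp
  moreover have "inner_h h (\<Sum>t\<in>S. const (c1 t) * F t) (v' - const \<alpha> * x') = 0"
    by (simp add: inner_sum_left inner_const_left orth)
  ultimately have "inner_h h (F x) (v' - const \<alpha> * x') = 0"
    by (simp add: x'_def inner_diff_left)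
  then show ?case using orth r by (intro exI[of _ c']) auto
qed

text \<open>Orthogonal projection away from the monomial functions strictly below \<open>l\<close> gives a triangular vector;
  self-adjointness and triangularity of \<open>T\<close> make it an eigenvector.\<close>

lemma jack_exists:
  assumes a: "a > 0" and b: "b > 0"
  defines "T \<equiv> \<lambda>D k. Top (of_real a) (of_real b) (of_real (b - a)) D k"
  shows "\<exists>P\<in>hom (psize l). cf P l = 1 \<and> (\<forall>m. cf P m \<noteq> 0 \<longrightarrow> dominated m l) \<and>
     (\<forall>k. T (psize l) k P = const (of_real (tv a b l k 0)) * P)"
proof -
  \<comment> \<open>The norm parameter for which the operator with coefficients a and b is
    self-adjoint, since then b = a h; it is also the Jack parameter \<alpha>.\<close>
  define h where "h = b / a"
  have h: "h > 0" using a b by (simp add: h_def)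
  have bh: "b = a * h" using a by (simp add: h_def)
  define W where "W = {m. dominated m l} - {l}"
  have finW: "finite W" using finite_dominated by (simp add: W_def)
  have szW: "psize m = psize l" if "m \<in> W" for m using that by (auto simp: W_def dominated_def)
  obtain c where c: "\<And>m. m \<in> W \<Longrightarrow> inner_h h (Msym m) (Msym l - (\<Sum>t\<in>W. const (c t) * Msym t)) = 0"
    using projection_exists[OF h finW, of Msym "Msym l"] Msym_hom hom_rho by blast
  define P where "P = Msym l - (\<Sum>t\<in>W. const (c t) * Msym t)"
  have hM: "Msym m \<in> hom (psize l)" if "m \<in> W" for m using Msym_hom[of m] szW[OF that] by simp
  have P: "P \<in> hom (psize l)" unfolding P_def by (intro hom_diff Msym_hom hom_sum hom_const_mult hM)
  have lW: "l \<notin> W" by (simp add: W_def)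
  have cfP: "cf P m = (if m = l then 1 else 0) - (if m \<in> W then c m else 0)" for m
    using finW by (simp add: P_def cf_diff cf_sum cf_const_mult cf_Msym if_distrib sum.delta cong: if_cong)
  have T: "cf (T (psize l) k (Msym m)) m = of_real (tv a b m k 0)"
    "cf (T (psize l) k (Msym m)) m' \<noteq> 0 \<Longrightarrow> dominated m' m" if "m \<in> insert l W" for m m' k
    using that cf_Top[OF Msym_hom[of m] in_vars_Msym, where a=a and b=b and k=k] szW[of m] unfolding T_def by auto
  have eig: "T (psize l) k P = const (of_real (tv a b l k 0)) * P" for k
  proof -
    \<comment> \<open>The defect of the eigenvalue equation. By triangularity it lies in the span of
      the monomial functions strictly below l, and by self-adjointness it is orthogonal to this
      span, so it is 0.\<close>
    define v where "v = T (psize l) k P - const (of_real (tv a b l k 0)) * P"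
    have TP: "T (psize l) k P \<in> hom (psize l)" unfolding T_def by (rule Top_hom[OF P])
    have v: "v \<in> hom (psize l)" unfolding v_def by (intro hom_diff TP hom_const_mult P)
    have cfT: "cf (T (psize l) k P) m = cf (T (psize l) k (Msym l)) m - (\<Sum>t\<in>W. c t * cf (T (psize l) k (Msym t)) m)" for m
    proof -
      have "T (psize l) k P = T (psize l) k (Msym l) - (\<Sum>t\<in>W. const (c t) * T (psize l) k (Msym t))"
      proof -
        have "Msym l = P + (\<Sum>t\<in>W. const (c t) * Msym t)" by (simp add: P_def)
        then have "T (psize l) k (Msym l) = T (psize l) k P + (\<Sum>t\<in>W. const (c t) * T (psize l) k (Msym t))"
          by (simp add: T_def Top_add Top_sum Top_const_mult)
        then show ?thesis by simp
      qed
      then show ?thesis by (simp add: cf_diff cf_sum cf_const_mult)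
    qed
    have cfv: "m \<in> W" if "cf v m \<noteq> 0" for m
    proof (rule ccontr)
      assume mW: "m \<notin> W"
      have no: "cf (T (psize l) k (Msym t)) m = 0" if "t \<in> W" for t
      proof (rule ccontr)
        assume "cf (T (psize l) k (Msym t)) m \<noteq> 0"
        then have "dominated m t" using T(2)[of t k m] that by auto
        moreover have "dominated t l" "t \<noteq> l" using that by (auto simp: W_def)
        ultimately show False using mW dominated_trans dominated_antisym by (metis DiffI W_def mem_Collect_eq singletonD)
      qed
      then have c1: "cf (T (psize l) k P) m = cf (T (psize l) k (Msym l)) m" by (simp add: cfT)
      show False
      proof (cases "m = l")
        case True
        then show False using that c1 T(1)[of l k] lW by (simp add: v_def cf_diff cf_const_mult cfP)
      next
        case False
        then have "cf (T (psize l) k (Msym l)) m = 0" using T(2)[of l k m] mW by (auto simp: W_def)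
        then show False using that c1 False mW by (simp add: v_def cf_diff cf_const_mult cfP)
      qed
    qed
    have orthM: "inner_h h (Msym m) v = 0" if m: "m \<in> W" for m
    proof -
      have "inner_h h (Msym m) (T (psize l) k P) = inner_h h (T (psize l) k (Msym m)) P"
        unfolding T_def by (rule Top_selfadjoint[of _ a _ _ _ "b - a"]) (simp_all add: bh)
      also have "T (psize l) k (Msym m) = (\<Sum>t\<in>W. const (cf (T (psize l) k (Msym m)) t) * Msym t)"
      proof (rule Msym_expansion[OF _ finW])
        show "T (psize l) k (Msym m) \<in> hom (psize l)" unfolding T_def by (rule Top_hom[OF hM[OF m]])
        fix t assume "cf (T (psize l) k (Msym m)) t \<noteq> 0"
        then have "dominated t m" using T(2)[of m k t] m by auto
        moreover have "dominated m l" "m \<noteq> l" using m by (auto simp: W_def)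
        ultimately show "t \<in> W" using dominated_trans dominated_antisym by (metis DiffI W_def mem_Collect_eq singletonD)
      qed
      also have "inner_h h \<dots> P = 0"
        unfolding inner_sum_left inner_const_left using c by (simp add: P_def)
      finally show ?thesis using c[OF m] by (simp add: v_def inner_diff_right inner_const_right P_def)
    qed
    have "v = (\<Sum>t\<in>W. const (cf v t) * Msym t)" by (rule Msym_expansion[OF v finW cfv])
    then have "inner_h h v v = inner_h h (\<Sum>t\<in>W. const (cf v t) * Msym t) v" by simp
    also have "\<dots> = 0" by (simp add: inner_sum_left inner_const_left orthM)
    finally have "v = 0" using inner_eq_0[OF h hom_rho[OF v]] by blast
    then show ?thesis by (simp add: v_def)
  qed
  show ?thesis
  proof (intro bexI[OF _ P] conjI allI impI)
    show "cf P l = 1" using lW by (simp add: cfP)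
    fix m assume "cf P m \<noteq> 0"
    then show "dominated m l" by (auto simp: cfP W_def split: if_splits)
  qed (rule eig)
qed

lemma dominated_induct [case_names less]:
  assumes "\<And>l. (\<And>m. dominated m l \<Longrightarrow> m \<noteq> l \<Longrightarrow> Q m) \<Longrightarrow> Q l" shows "Q l"
proof (induction "card {m. dominated m l}" arbitrary: l rule: less_induct)
  case less
  show ?case
  proof (rule assms)
    fix m assume m: "dominated m l" "m \<noteq> l"
    have "{t. dominated t m} \<subset> {t. dominated t l}"
    proof
      show "{t. dominated t m} \<subseteq> {t. dominated t l}" using m(1) dominated_trans by blast
      show "{t. dominated t m} \<noteq> {t. dominated t l}" using m dominated_antisym dominated_refl by blast
    qed
    then show "Q m" by (intro less psubset_card_mono finite_dominated)
  qed
qed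

text \<open>By induction along dominance both families agree strictly below l. The difference at l
  is a combination of monomial functions strictly below l, and it is orthogonal to all of them,
  hence to itself.\<close>

lemma jack_family_unique:
  assumes "\<alpha> > 0" "jack_family \<alpha> P" "jack_family \<alpha> Q" shows "P = Q"
proof
  fix l
  show "P l = Q l"
  proof (induction l rule: dominated_induct)
    case (less l)
    let ?W = "\<lambda>l. {m. dominated m l \<and> m \<noteq> l}"
    have finW: "finite (?W m)" for m using finite_dominated[of m] by (rule finite_subset[rotated]) auto
    have rho: "P m \<in> rho_polys" "Q m \<in> rho_polys" for m using assms(2,3) by (auto simp: jack_family_def)
    have tri: "\<exists>u. R = Msym m + (\<Sum>t\<in>?W m. const (u t) * Msym t)" if RR: "R = P m \<or> R = Q m" for R m
    proof -
      have ex: "\<exists>u. \<forall>N. in_vars N (R m) = monomial_sym N m + (\<Sum>t\<in>?W m. const (u t) * monomial_sym N t)"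
        if "jack_family \<alpha> R" for R using that unfolding jack_family_def by blast
      obtain u where u: "\<And>N. in_vars N R = monomial_sym N m + (\<Sum>t\<in>?W m. const (u t) * monomial_sym N t)"
        using RR ex[OF assms(2)] ex[OF assms(3)] by blast
      have "R = Msym m + (\<Sum>t\<in>?W m. const (u t) * Msym t)"
      proof (rule cf_inj)
        show "R \<in> rho_polys" using RR rho by auto
        show "Msym m + (\<Sum>t\<in>?W m. const (u t) * Msym t) \<in> rho_polys"
          by (intro rho_add rho_sum rho_const_mult hom_rho[OF Msym_hom])
      qed (simp add: u in_vars_add in_vars_sum in_vars_const_mult in_vars_Msym)
      then show ?thesis by blast
    qed
    define v where "v = P l - Q l"
    \<comment> \<open>The common vector of m is orthogonal to both candidates at l. It equals
      \<open>Msym m\<close> plus lower terms, which a second induction disposes of.\<close>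
    have orth: "m \<in> ?W l \<Longrightarrow> inner_h \<alpha> (Msym m) v = 0" for m
    proof (induction m rule: dominated_induct)
      case (less m)
      obtain u where u: "Q m = Msym m + (\<Sum>t\<in>?W m. const (u t) * Msym t)" using tri by blast
      have "t \<in> ?W l" if "t \<in> ?W m" for t using that less.prems dominated_trans dominated_antisym by blast
      then have 1: "inner_h \<alpha> (\<Sum>t\<in>?W m. const (u t) * Msym t) v = 0"
        by (simp add: inner_sum_left inner_const_left less.IH)
      have "inner_h \<alpha> (Q m) (Q l) = 0" "inner_h \<alpha> (P m) (P l) = 0"
        using assms(2,3) less.prems by (auto simp: jack_family_def)
      moreover have "P m = Q m" using \<open>\<And>m. dominated m l \<Longrightarrow> m \<noteq> l \<Longrightarrow> P m = Q m\<close> less.prems by blast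
      ultimately have "inner_h \<alpha> (Q m) v = 0" by (simp add: v_def inner_diff_right)
      then show ?case using 1 by (simp add: u inner_add_left)
    qed
    obtain u u' where "P l = Msym l + (\<Sum>t\<in>?W l. const (u t) * Msym t)" "Q l = Msym l + (\<Sum>t\<in>?W l. const (u' t) * Msym t)"
      using tri[of "P l" l] tri[of "Q l" l] by blast
    then have v: "v = (\<Sum>t\<in>?W l. const (u t - u' t) * Msym t)"
      by (simp add: v_def const_diff left_diff_distrib sum_subtractf)
    have "inner_h \<alpha> (\<Sum>t\<in>?W l. const (u t - u' t) * Msym t) v = 0"
      by (simp add: inner_sum_left inner_const_left orth)
    then have "inner_h \<alpha> v v = 0" using v by simp
    moreover have "v \<in> rho_polys" unfolding v_def by (intro rho_diff rho)
    ultimately have "v = 0" using inner_eq_0[OF assms(1)] by blast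
    then show ?case by (simp add: v_def)
  qed
qed

text \<open>Orthogonality of the eigenvectors: for different weights by the grading, for equal
  weights because some power of the operator has different real eigenvalues on them. This covers
  incomparable partitions, and uniqueness then identifies the eigenvectors with
  \<open>jack_sym\<close>.\<close>

lemma jack_sym_props:
  assumes a: "a > 0" and b: "b > 0"
  shows "jack_family (b / a) (jack_sym (b / a))"
    and "jack_sym (b / a) l \<in> hom (psize l)"
    and "Top (of_real a) (of_real b) (of_real (b - a)) (psize l) k (jack_sym (b / a) l) =
           const (of_real (tv a b l k 0)) * jack_sym (b / a) l"
    and "cf (jack_sym (b / a) l) l = 1"
    and "cf (jack_sym (b / a) l) m \<noteq> 0 \<Longrightarrow> dominated m l"
proof -
  have h: "b / a > 0" using a b by simp
  obtain P where P: "\<And>l. P l \<in> hom (psize l)" "\<And>l. cf (P l) l = 1" "\<And>l m. cf (P l) m \<noteq> 0 \<Longrightarrow> dominated m l"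
    "\<And>l k. Top (of_real a) (of_real b) (of_real (b - a)) (psize l) k (P l) = const (of_real (tv a b l k 0)) * P l"
    using jack_exists[OF a b] by metis
  have fam: "jack_family (b / a) P"
    unfolding jack_family_def
  proof (intro conjI allI impI)
    fix l show "P l \<in> rho_polys" by (rule hom_rho[OF P(1)])
    have "in_vars N (P l) = monomial_sym N l + (\<Sum>m | dominated m l \<and> m \<noteq> l. const (cf (P l) m) * monomial_sym N m)" for N
    proof -
      have fin: "finite {m. dominated m l \<and> m \<noteq> l}" using finite_dominated[of l] by (rule finite_subset[rotated]) auto
      have "in_vars N (P l) = (\<Sum>m\<in>insert l {m. dominated m l \<and> m \<noteq> l}. const (cf (P l) m) * monomial_sym N m)"
        by (rule in_vars_expansion[OF hom_rho[OF P(1)]]) (use fin P(3) in auto)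
      then show ?thesis using fin P(2) by simp
    qed
    then show "\<exists>u. \<forall>N. in_vars N (P l) = monomial_sym N l + (\<Sum>m | dominated m l \<and> m \<noteq> l. const (u m) * monomial_sym N m)"
      by blast
  next
    fix l m :: int_partition assume lm: "l \<noteq> m"
    show "inner_h (b / a) (P l) (P m) = 0"
    proof (cases "psize l = psize m")
      case False
      then show ?thesis by (rule inner_hom_neq[OF P(1) P(1)])
    next
      case True
      obtain k where k: "tv a b l k 0 \<noteq> tv a b m k 0" using tv_separates[OF a b] lm by blast
      have "inner_h (b / a) (P l) (Top (of_real a) (of_real b) (of_real (b - a)) (psize l) k (P m)) =
        inner_h (b / a) (Top (of_real a) (of_real b) (of_real (b - a)) (psize l) k (P l)) (P m)"
        by (rule Top_selfadjoint[of _ a _ _ _ "b - a"]) (use a in simp_all)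
      then have "of_real (tv a b m k 0) * inner_h (b / a) (P l) (P m) = of_real (tv a b l k 0) * inner_h (b / a) (P l) (P m)"
        using P(4)[of m k] P(4)[of l k] True by (simp add: inner_const_left inner_const_right)
      then show ?thesis using k by simp
    qed
  qed
  have "jack_sym (b / a) = P"
    unfolding jack_sym_def using fam jack_family_unique[OF h] by (intro the_equality) auto
  then show "jack_family (b / a) (jack_sym (b / a))"
    "jack_sym (b / a) l \<in> hom (psize l)"
    "Top (of_real a) (of_real b) (of_real (b - a)) (psize l) k (jack_sym (b / a) l) =
           const (of_real (tv a b l k 0)) * jack_sym (b / a) l"
    "cf (jack_sym (b / a) l) l = 1"
    "cf (jack_sym (b / a) l) m \<noteq> 0 \<Longrightarrow> dominated m l"
    using fam P by auto
qed


section \<open>Normalized Jack polynomials\<close>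

text \<open>The change of variables between power sums and the \<rho>_k; it multiplies a monomial by
  a power of c according to its number of factors.\<close>

definition scale :: "complex \<Rightarrow> cpoly \<Rightarrow> cpoly" where
  "scale c = psubst (\<lambda>k. const c * var k)"

lemma lookup_scale: "lookup (scale c f) d = c ^ tdeg d * lookup f d"
proof (induction f rule: cpoly_induct)
  case (single d' x)
  have "mono_at (\<lambda>k. const c * var k) d' = const (\<Prod>k\<in>keys d'. c ^ lookup d' k) * mono_at var d'"
    by (simp add: mono_at_def power_mult_distrib prod.distrib const_prod const_power)
  also have "(\<Prod>k\<in>keys d'. c ^ lookup d' k) = c ^ tdeg d'"
    by (simp add: tdeg_def power_sum)
  also have "mono_at var d' = single d' 1"
    using psubst_id[of "single d' 1"] by (simp add: psubst_lin)
  finally show ?case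
    by (simp add: scale_def psubst_lin const_mult_single lookup_single when_def)
qed (simp_all add: scale_def psubst_add lookup_add distrib_left)

lemma scale_add: "scale c (f + g) = scale c f + scale c g" by (simp add: scale_def psubst_add)
lemma scale_0 [simp]: "scale c 0 = 0" by (simp add: scale_def)
lemma scale_sum: "scale c (sum f A) = (\<Sum>x\<in>A. scale c (f x))" by (simp add: scale_def psubst_sum)
lemma scale_const_mult: "scale c (const x * f) = const x * scale c f" by (simp add: scale_def psubst_const_mult)
lemma scale_var_mult: "scale c (var k * f) = const c * (var k * scale c f)"
  by (simp add: scale_def psubst_mult mult_ac)
lemma scale_dd: "dd k (scale c f) = const c * scale c (dd k f)"
  by (rule poly_mapping_eqI) (simp add: lookup_dd lookup_scale tdeg_add mult_ac)
lemma scale_scale: "scale c (scale c' f) = scale (c * c') f"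
  by (rule poly_mapping_eqI) (simp add: lookup_scale power_mult_distrib)
lemma scale_1 [simp]: "scale 1 f = f" by (rule poly_mapping_eqI) (simp add: lookup_scale)
lemma scale_hom: "f \<in> hom n \<Longrightarrow> scale c f \<in> hom n" by (simp add: hom_iff lookup_scale)
lemma keys_scale: "c \<noteq> 0 \<Longrightarrow> keys (scale c f) = keys f"
  by (auto simp: in_keys_iff lookup_scale)

text \<open>Conjugation gives a factor c to each multiplication and 1 / c to each derivative, so
  only the product of the two coefficients is invariant. With c = 1 / a the coefficients a and b
  become 1 and ab = h.\<close>

lemma scale_Lop:
  assumes "c1 * c = 1" "c2 = h * c"
  shows "(\<lambda>j. scale c (Lop c1 c2 e D g j)) = Lop 1 h e D (\<lambda>j. scale c (g j))"
proof
  fix j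
  have 1: "const c1 * (const c * X) = X" for X by (metis assms(1) const_1 const_mult mult.assoc mult_1)
  have 2: "const (c2 * x) * scale c (dd k f) = const (h * x) * dd k (scale c f)" for x k f
    by (simp add: assms(2) scale_dd const_mult mult_ac)
  show "scale c (Lop c1 c2 e D g j) = Lop 1 h e D (\<lambda>j. scale c (g j)) j"
    by (simp add: Lop_def scale_add scale_sum scale_const_mult scale_var_mult 1 2)
qed

lemma scale_Top:
  assumes "c1 * c = 1" "c2 = h * c"
  shows "scale c (Top c1 c2 e D l f) = Top 1 h e D l (scale c f)"
proof -
  have "(\<lambda>j. scale c ((Lop c1 c2 e D ^^ l) g j)) = (Lop 1 h e D ^^ l) (\<lambda>j. scale c (g j))" for g
    by (induction l) (simp_all add: scale_Lop[OF assms])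
  from fun_cong[OF this[of "init f"], of 0] show ?thesis
    unfolding Top_def by (simp add: init_def[abs_def] if_distrib cong: if_cong)
qed

text \<open>Each factor of a monomial contributes c^2 to the squared norm, as does a factor c^2 in
  the norm parameter. For c = 1 / a the parameter ab becomes b / a.\<close>

lemma inner_scale:
  assumes "c \<noteq> 0" shows "inner_h h (scale (of_real c) f) (scale (of_real c) g) = inner_h (h * c\<^sup>2) f g"
proof -
  have "monom_sqnorm (h * c\<^sup>2) d = (c ^ tdeg d)\<^sup>2 * monom_sqnorm h d" for d
  proof -
    have "c ^ tdeg d = (\<Prod>k\<in>keys d. c ^ lookup d k)" by (simp add: tdeg_def power_sum)
    then have "(c ^ tdeg d)\<^sup>2 = (\<Prod>k\<in>keys d. (c\<^sup>2) ^ lookup d k)"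
      by (simp add: prod_power_distrib power_mult[symmetric] mult.commute)
    then show ?thesis by (simp add: monom_sqnorm_def prod.distrib[symmetric] power_mult_distrib mult_ac)
  qed
  then show ?thesis
    using assms by (simp add: inner_h_def keys_scale lookup_scale power2_eq_square mult_ac)
qed

definition mons :: "nat \<Rightarrow> (nat \<Rightarrow>\<^sub>0 nat) set" where "mons n = {d. lookup d 0 = 0 \<and> wt d = n}"

lemma finite_mons: "finite (mons n)"
proof (rule finite_subset[OF _ finite_exponents[of "Suc n" n]], rule subsetI)
  fix d assume d: "d \<in> mons n"
  have kk: "k \<le> n" if "k \<in> keys d" for k
  proof -
    have "k * lookup d k \<le> wt d" unfolding wt_def by (rule member_le_sum) (use that in auto)
    moreover have "k * 1 \<le> k * lookup d k" using that by (intro mult_le_mono2) (simp add: in_keys_iff Suc_le_eq)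
    ultimately have "k \<le> wt d" by linarith
    then show ?thesis using d by (simp add: mons_def)
  qed
  have "tdeg d \<le> wt d" unfolding tdeg_def wt_def
  proof (rule sum_mono)
    fix k assume "k \<in> keys d"
    then have "k \<noteq> 0" using d by (auto simp: mons_def in_keys_iff intro: ccontr)
    then show "lookup d k \<le> k * lookup d k" by simp
  qed
  then show "d \<in> {d. keys d \<subseteq> {..<Suc n} \<and> tdeg d \<le> n}" using d kk by (auto simp: mons_def less_Suc_eq_le)
qed

definition monval :: "(nat \<Rightarrow> complex) \<Rightarrow> (nat \<Rightarrow>\<^sub>0 nat) \<Rightarrow> complex" where
  "monval V d = (\<Prod>k\<in>keys d. V k ^ lookup d k)"

lemma monval_add_single: "monval V (d + single k 1) = V k * monval V d"
proof -
  have "evalp V (single (d + single k 1) 1) = evalp V (var k) * evalp V (single d 1)"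
    unfolding evalp_mult[symmetric] by (simp add: monom_power_def mult_single add.commute)
  then show ?thesis by (simp add: evalp_single monval_def)
qed

context
  fixes e h :: real
begin

definition "Tl D k = Top 1 (of_real h) (of_real e) D k"

abbreviation "jn \<equiv> jack_normalized e h"

context
  assumes h: "h > 0"
begin

text \<open>All is transported from \<open>jack_sym\<close> by \<open>scale\<close> with factor 1 /
  a. The last claim is completeness in a fixed weight: being triangular, the Jack polynomials span
  the same space as the monomial functions.\<close>

lemma jack_poly_props:
  shows "jack_poly e h l \<in> hom (psize l)" (is ?A)
    and "jack_poly e h l \<noteq> 0" (is ?B)
    and "Tl (psize l) k (jack_poly e h l) = const (of_real (T_up e h l k)) * jack_poly e h l" (is ?C)
    and "l \<noteq> m \<Longrightarrow> inner_h h (jack_poly e h l) (jack_poly e h m) = 0" (is "_ \<Longrightarrow> ?D")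
    and "f \<in> hom n \<Longrightarrow> (\<And>l. psize l = n \<Longrightarrow> inner_h h (jack_poly e h l) f = 0) \<Longrightarrow> f = 0"
proof -
  define a b where "a = - eps2 e h" and "b = eps1 e h"
  have a: "a > 0" and b: "b > 0" and ab: "a * b = h" "b - a = e"
    using eps_props[OF h, of e] by (simp_all add: a_def b_def mult.commute)
  note J = jack_sym_props[OF a b]
  have jp: "jack_poly e h l = scale (of_real (1 / a)) (jack_sym (b / a) l)" for l
    by (simp add: jack_poly_def scale_def a_def b_def)
  show ?A unfolding jp by (intro scale_hom J(2))
  have "jack_sym (b / a) l \<noteq> 0" using J(4)[of l] by (auto simp: cf_def)
  then show ?B using keys_scale[of "of_real (1 / a)" "jack_sym (b / a) l"] a unfolding jp
    by (metis keys_eq_empty of_real_eq_0_iff divide_eq_0_iff less_irrefl zero_neq_one)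
  have "scale (of_real (1 / a)) (Top (of_real a) (of_real b) (of_real (b - a)) (psize l) k (jack_sym (b / a) l))
     = Tl (psize l) k (jack_poly e h l)"
    unfolding Tl_def jp ab(2)
  proof (rule scale_Top)
    show "complex_of_real a * complex_of_real (1 / a) = 1" using a by simp
    show "complex_of_real b = complex_of_real h * complex_of_real (1 / a)" using a ab(1) by (simp add: field_simps flip: of_real_mult)
  qed
  then show ?C using J(3)[of l k] by (simp add: scale_const_mult jp T_up_eq[OF h] a_def[symmetric] b_def[symmetric])
  have hc: "h * (1 / a)\<^sup>2 = b / a" using a ab(1) by (simp add: power2_eq_square field_simps)
  have inner: "inner_h h (scale (of_real (1 / a)) f) (scale (of_real (1 / a)) g) = inner_h (b / a) f g" for f g
  proof -
    have "1 / a \<noteq> 0" using a by simp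
    from inner_scale[OF this, of h f g] show ?thesis by (simp only: hc)
  qed
  show ?D if "l \<noteq> m" using J(1) that unfolding jp inner jack_family_def by blast
  show "f = 0" if f: "f \<in> hom n" and orth: "\<And>l. psize l = n \<Longrightarrow> inner_h h (jack_poly e h l) f = 0"
  proof -
    define f' where "f' = scale (of_real a) f"
    have f': "f' \<in> hom n" unfolding f'_def by (rule scale_hom[OF f])
    have ff: "f = scale (of_real (1 / a)) f'" using a by (simp add: f'_def scale_scale flip: of_real_mult)
    have o: "inner_h (b / a) (jack_sym (b / a) l) f' = 0" if "psize l = n" for l
      using orth[OF that] unfolding jp ff inner .
    have M: "psize l = n \<Longrightarrow> inner_h (b / a) (Msym l) f' = 0" for l
    proof (induction l rule: dominated_induct)
      case (less l)
      let ?W = "{m. dominated m l} - {l}"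
      have fin: "finite ?W" and lW: "l \<notin> ?W" using finite_dominated by simp_all
      have "jack_sym (b / a) l = (\<Sum>m\<in>insert l ?W. const (cf (jack_sym (b / a) l) m) * Msym m)"
        by (rule Msym_expansion[OF J(2)]) (use fin J(5) in auto)
      also have "(\<Sum>m\<in>insert l ?W. const (cf (jack_sym (b / a) l) m) * Msym m) = Msym l + (\<Sum>m\<in>?W. const (cf (jack_sym (b / a) l) m) * Msym m)"
        by (subst sum.insert[OF fin lW]) (simp only: J(4) const_1 mult_1)
      finally have J_Msym: "jack_sym (b / a) l = Msym l + (\<Sum>m\<in>?W. const (cf (jack_sym (b / a) l) m) * Msym m)"
        .
      have "inner_h (b / a) (\<Sum>m\<in>?W. const (cf (jack_sym (b / a) l) m) * Msym m) f' = 0"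
        unfolding inner_sum_left inner_const_left
        by (rule sum.neutral) (use less in \<open>auto simp: dominated_def\<close>)
      then have "inner_h (b / a) (jack_sym (b / a) l) f' = inner_h (b / a) (Msym l) f'"
        by (subst J_Msym) (simp only: inner_add_left add_0_right)
      then show ?case using o[OF less.prems] by simp
    qed
    have "f' = (\<Sum>m | psize m = n. const (cf f' m) * Msym m)"
      by (rule Msym_expansion[OF f' finite_psize]) (use cf_hom[OF f'] in auto)
    then have "inner_h (b / a) f' f' = inner_h (b / a) (\<Sum>m | psize m = n. const (cf f' m) * Msym m) f'" by simp
    also have "\<dots> = 0" by (simp add: inner_sum_left inner_const_left M)
    finally have "f' = 0" using inner_eq_0[OF _ hom_rho[OF f'], of "b / a"] a b by simp
    then show ?thesis using ff by simp
  qed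
qed

lemma jn_props:
  shows "jn l \<in> hom (psize l)"
    and "Tl (psize l) k (jn l) = const (of_real (T_up e h l k)) * jn l"
    and "inner_h h (jn l) (jn m) = (if l = m then 1 else 0)"
    and "f \<in> hom n \<Longrightarrow> (\<And>l. psize l = n \<Longrightarrow> inner_h h (jn l) f = 0) \<Longrightarrow> f = 0"
proof -
  define s where "s l = 1 / norm_h h (jack_poly e h l)" for l
  have jn: "jn l = const (of_real (s l)) * jack_poly e h l" for l by (simp add: jack_normalized_def s_def)
  have pos: "inner_h h (jack_poly e h l) (jack_poly e h l) \<in> \<real>" "Re (inner_h h (jack_poly e h l) (jack_poly e h l)) > 0" for l
    using inner_pos[OF h hom_rho[OF jack_poly_props(1)] jack_poly_props(2)] by auto
  have s: "s l > 0" for l using pos(2)[of l] by (simp add: s_def norm_h_def)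
  have ss: "s l * s l * Re (inner_h h (jack_poly e h l) (jack_poly e h l)) = 1" for l
  proof -
    have "(norm_h h (jack_poly e h l))\<^sup>2 = Re (inner_h h (jack_poly e h l) (jack_poly e h l))"
      using pos(2)[of l] by (simp add: norm_h_def)
    then show ?thesis using pos(2)[of l] by (simp add: s_def power2_eq_square[symmetric] power_divide)
  qed
  show "jn l \<in> hom (psize l)" unfolding jn by (intro hom_const_mult jack_poly_props)
  show "Tl (psize l) k (jn l) = const (of_real (T_up e h l k)) * jn l"
    using jack_poly_props(3)[of l k] unfolding jn Tl_def Top_const_mult by (simp add: mult_ac)
  show "inner_h h (jn l) (jn m) = (if l = m then 1 else 0)"
  proof (cases "l = m")
    case True
    have "inner_h h (jn l) (jn l) = of_real (s l * s l * Re (inner_h h (jack_poly e h l) (jack_poly e h l)))"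
      using pos(1)[of l] by (simp add: jn inner_const_left inner_const_right of_real_Re)
    then show ?thesis using True by (simp add: ss)
  next
    case False
    then show ?thesis by (simp add: jn inner_const_left inner_const_right jack_poly_props(4))
  qed
  show "f = 0" if "f \<in> hom n" "\<And>l. psize l = n \<Longrightarrow> inner_h h (jn l) f = 0"
  proof (rule jack_poly_props(5)[OF that(1)])
    fix l assume "psize l = n"
    then have "inner_h h (jn l) f = 0" by (rule that(2))
    then show "inner_h h (jack_poly e h l) f = 0" using s[of l] by (simp add: jn inner_const_left)
  qed
qed

lemma jn_expansion:
  assumes "f \<in> hom n"
  shows "f = (\<Sum>l | psize l = n. const (inner_h h (jn l) f) * jn l)"
proof -
  define g where "g = f - (\<Sum>l | psize l = n. const (inner_h h (jn l) f) * jn l)"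
  have hg: "g \<in> hom n" unfolding g_def
    by (intro hom_diff assms hom_sum hom_const_mult) (use jn_props(1) in auto)
  have "g = 0"
  proof (rule jn_props(4)[OF hg])
    fix l assume l: "psize l = n"
    have "inner_h h (jn l) (\<Sum>m | psize m = n. const (inner_h h (jn m) f) * jn m) =
       (\<Sum>m | psize m = n. if l = m then inner_h h (jn m) f else 0)"
      unfolding inner_sum_right inner_const_right jn_props(3) by (rule sum.cong) auto
    also have "\<dots> = inner_h h (jn l) f" using l finite_psize by simp
    finally show "inner_h h (jn l) g = 0" by (simp add: g_def inner_diff_right)
  qed
  then show ?thesis by (simp add: g_def)
qed

end

section \<open>The reproducing kernel\<close>

text \<open>The part of weight n of exp (\<Sum> cnj (V k) \<rho>_k / (h k)). The index is an
  integer, with value 0 below 0, so that derivatives may lower it without case distinctions.\<close>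

definition kern :: "(nat \<Rightarrow> complex) \<Rightarrow> int \<Rightarrow> cpoly" where
  "kern V n = (if n < 0 then 0 else
     (\<Sum>d\<in>mons (nat n). single d (cnj (monval V d) / of_real (monom_sqnorm h d))))"

lemma lookup_kern: "lookup (kern V n) d =
  (if lookup d 0 = 0 \<and> int (wt d) = n then cnj (monval V d) / of_real (monom_sqnorm h d) else 0)"
proof (cases "n < 0")
  case False
  then have "lookup (kern V n) d = (\<Sum>d'\<in>mons (nat n). if d' = d then cnj (monval V d) / of_real (monom_sqnorm h d) else 0)"
    unfolding kern_def by (simp add: lookup_sum lookup_single when_def) (rule sum.cong, auto)
  then show ?thesis using False finite_mons[of "nat n"] by (auto simp: mons_def)
qed (auto simp: kern_def)

lemma kern_hom: "kern V (int n) \<in> hom n"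
  by (auto simp: hom_iff lookup_kern split: if_splits)

context
  assumes h: "h > 0"
begin

text \<open>The coefficients of the kernel are chosen to cancel the squared norms; the conjugate
  appears because the form is conjugate-linear on the left.\<close>

lemma inner_kern:
  assumes "f \<in> hom n" shows "inner_h h f (kern V (int n)) = cnj (evalp V f)"
proof -
  have "inner_h h f (kern V (int n)) = (\<Sum>d\<in>keys f. cnj (lookup f d) * cnj (monval V d))"
    unfolding inner_h_def
  proof (rule sum.cong)
    fix d assume "d \<in> keys f"
    then have d: "lookup d 0 = 0" "wt d = n" using assms by (auto simp: hom_iff in_keys_iff)
    then show "cnj (lookup f d) * lookup (kern V (int n)) d * complex_of_real (monom_sqnorm h d) = cnj (lookup f d) * cnj (monval V d)"
      using sqnorm_pos[OF h d(1)] by (simp add: lookup_kern)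
  qed simp
  then show ?thesis by (simp add: evalp_def monval_def)
qed

lemma kern_jack: "kern V (int n) = (\<Sum>l | psize l = n. const (cnj (evalp V (jn l))) * jn l)"
proof -
  have "kern V (int n) = (\<Sum>l | psize l = n. const (inner_h h (jn l) (kern V (int n))) * jn l)"
    by (rule jn_expansion[OF h kern_hom])
  also have "\<dots> = (\<Sum>l | psize l = n. const (cnj (evalp V (jn l))) * jn l)"
  proof (rule sum.cong)
    fix l assume "l \<in> {l. psize l = n}"
    then have "inner_h h (jn l) (kern V (int n)) = cnj (evalp V (jn l))" using inner_kern[OF jn_props(1)[OF h, of l]] by auto
    then show "const (inner_h h (jn l) (kern V (int n))) * jn l = const (cnj (evalp V (jn l))) * jn l" by simp
  qed simp
  finally show ?thesis .
qed

text \<open>The full exponential is an eigenvector of h k d/d\<rho>_k with eigenvalue cnj (V k); on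
  homogeneous parts this becomes a shift of the weight by k.\<close>

lemma dd_kern:
  assumes "k \<ge> 1"
  shows "const (of_real h * of_nat k) * dd k (kern V n) = const (cnj (V k)) * kern V (n - int k)"
proof (rule poly_mapping_eqI)
  fix d :: "nat \<Rightarrow>\<^sub>0 nat"
  have 0: "lookup (d + single k 1) 0 = lookup d 0" using assms by (simp add: lookup_add lookup_single when_def)
  have w: "wt (d + single k 1) = wt d + k" by (simp add: wt_add)
  show "lookup (const (of_real h * of_nat k) * dd k (kern V n)) d = lookup (const (cnj (V k)) * kern V (n - int k)) d"
  proof (cases "lookup d 0 = 0 \<and> int (wt d) = n - int k")
    case True
    have sq: "monom_sqnorm h d > 0" using sqnorm_pos[OF h] True by blast
    have "lookup (const (of_real h * of_nat k) * dd k (kern V n)) d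
      = of_real h * of_nat k * (of_nat (lookup d k + 1) * (cnj (V k * monval V d) / of_real (h * real k * real (lookup d k + 1) * monom_sqnorm h d)))"
      unfolding lookup_const_mult lookup_dd lookup_kern 0 w monval_add_single sqnorm_add_single using True by simp
    also have "\<dots> = cnj (V k) * (cnj (monval V d) / of_real (monom_sqnorm h d))"
    proof -
      have "complex_of_real (h * real k * real (lookup d k + 1) * monom_sqnorm h d) =
         (of_real h * of_nat k * of_nat (lookup d k + 1)) * of_real (monom_sqnorm h d)" by simp
      moreover have "of_real h * of_nat k * of_nat (lookup d k + 1) \<noteq> (0::complex)"
        using assms h by (simp del: of_nat_add of_nat_Suc)
      ultimately show ?thesis by (simp only: mult.assoc[symmetric] complex_cnj_mult times_divide_eq_right) (simp add: field_simps del: of_nat_Suc of_nat_add)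
    qed
    finally show ?thesis using True by (simp add: lookup_kern)
  next
    case False
    then have "\<not> (lookup (d + single k 1) 0 = 0 \<and> int (wt (d + single k 1)) = n)" unfolding 0 w by auto
    then have "lookup (kern V n) (d + single k 1) = 0" by (simp only: lookup_kern if_False)
    then show ?thesis using False by (auto simp: lookup_dd lookup_kern)
  qed
qed

end

definition Tls :: "nat \<Rightarrow> nat list \<Rightarrow> cpoly \<Rightarrow> cpoly" where "Tls D ls f = foldr (Tl D) ls f"

lemma Tls_sum: "Tls D ls (sum f A) = (\<Sum>x\<in>A. Tls D ls (f x))"
  by (induction ls) (simp_all add: Tls_def Tl_def Top_sum)
lemma Tls_const_mult: "Tls D ls (const c * f) = const c * Tls D ls f"
  by (induction ls) (simp_all add: Tls_def Tl_def Top_const_mult)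

context
  assumes h: "h > 0"
begin

lemma Tls_jn: "Tls (psize l) ls (jn l) = const (of_real (\<Prod>k\<leftarrow>ls. T_up e h l k)) * jn l"
proof (induction ls)
  case (Cons k ls)
  have "Tls (psize l) (k # ls) (jn l) = Tl (psize l) k (Tls (psize l) ls (jn l))" by (simp add: Tls_def)
  also have "\<dots> = const (of_real (\<Prod>k\<leftarrow>ls. T_up e h l k)) * Tl (psize l) k (jn l)"
    unfolding Cons Tl_def Top_const_mult ..
  finally show ?case by (simp add: jn_props(2)[OF h] const_mult mult_ac)
qed (simp add: Tls_def)

text \<open>Each Jack component of the kernel is multiplied by the product of its eigenvalues. This
  is the contribution of the partitions of n to the moment, before normalization.\<close>

theorem trace_formula:
  "evalp Vin (Tls n ls (kern Vout (int n))) =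
     (\<Sum>l | psize l = n. of_real (\<Prod>k\<leftarrow>ls. T_up e h l k) * jack_weight e h Vout Vin l)"
proof -
  have "Tls n ls (kern Vout (int n)) = (\<Sum>l | psize l = n. const (cnj (evalp Vout (jn l))) * (const (of_real (\<Prod>k\<leftarrow>ls. T_up e h l k)) * jn l))"
    unfolding kern_jack[OF h] Tls_sum Tls_const_mult by (rule sum.cong) (use Tls_jn in auto)
  then show ?thesis by (simp add: evalp_sum evalp_mult jack_weight_def mult_ac)
qed

end

section \<open>Path expansion\<close>

text \<open>The generators of a Heisenberg algebra, indexed by the degree of a step. Degree 0 acts
  as the identity; the weight of a slide is carried by \<open>slc\<close>.\<close>

definition op :: "int \<Rightarrow> cpoly \<Rightarrow> cpoly" where
  "op k f = (if k > 0 then var (nat k) * f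
     else if k < 0 then const (of_real h * of_nat (nat (- k))) * dd (nat (- k)) f else f)"

lemma op_add: "op k (f + g) = op k f + op k g" by (simp add: op_def distrib_left dd_add)
lemma op_const_mult: "op k (const c * f) = const c * op k f" by (simp add: op_def dd_const_mult mult.left_commute)
lemma op_0 [simp]: "op k 0 = 0" by (simp add: op_def)
lemma op_sum: "op k (sum f A) = (\<Sum>x\<in>A. op k (f x))"
  by (induction A rule: infinite_finite_induct) (simp_all add: op_add)

definition slc :: "nat \<Rightarrow> nat \<Rightarrow> complex" where "slc j i = (if i = j then of_real e * of_nat j else 1)"

text \<open>Entry (j, i) of the operator as a matrix over the powers of w: a step of a path from
  height j to height i. The outermost factor of a product is thus the first step of the
  path.\<close>

lemma Lop_op:
  assumes "j \<le> D"
  shows "Lop 1 (of_real h) (of_real e) D g j = (\<Sum>i\<le>D. const (slc j i) * op (int i - int j) (g i))"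
proof -
  have "{..D} = {..<j} \<union> {j} \<union> {j<..D}" using assms by auto
  then have "(\<Sum>i\<le>D. const (slc j i) * op (int i - int j) (g i)) =
    (\<Sum>i<j. const (slc j i) * op (int i - int j) (g i)) + const (slc j j) * op 0 (g j) + (\<Sum>i\<in>{j<..D}. const (slc j i) * op (int i - int j) (g i))"
    by (simp add: sum.union_disjoint)
       (subst sum.union_disjoint, auto)
  also have "(\<Sum>i<j. const (slc j i) * op (int i - int j) (g i)) = (\<Sum>i<j. const (of_real h * of_nat (j - i)) * dd (j - i) (g i))"
    by (rule sum.cong) (auto simp: slc_def op_def nat_diff_distrib)
  also have "(\<Sum>i\<in>{j<..D}. const (slc j i) * op (int i - int j) (g i)) = (\<Sum>i\<in>{j<..D}. const 1 * (var (i - j) * g i))"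
    by (rule sum.cong) (auto simp: slc_def op_def nat_diff_distrib)
  finally show ?thesis using assms by (simp add: Lop_def slc_def op_def)
qed

definition paths :: "nat \<Rightarrow> nat \<Rightarrow> nat \<Rightarrow> nat list set" where
  "paths D l j = {js. length js = Suc l \<and> js ! 0 = j \<and> js ! l = 0 \<and> set js \<subseteq> {..D}}"

fun degs :: "nat list \<Rightarrow> int list" where
  "degs (j # i # js) = (int i - int j) # degs (i # js)"
| "degs _ = []"

fun slw :: "nat list \<Rightarrow> complex" where
  "slw (j # i # js) = slc j i * slw (i # js)"
| "slw _ = 1"

lemma finite_paths: "finite (paths D l j)"
  by (rule finite_subset[OF _ finite_lists_length_eq[of "{..D}" "Suc l"]]) (auto simp: paths_def)

lemma paths_Suc: "j \<le> D \<Longrightarrow> paths D (Suc l) j = (\<Union>i\<le>D. Cons j ` paths D l i)"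
proof (intro set_eqI iffI)
  fix js assume j: "j \<le> D" and "js \<in> paths D (Suc l) j"
  then have js: "length js = Suc (Suc l)" "js ! 0 = j" "js ! Suc l = 0" "set js \<subseteq> {..D}" by (auto simp: paths_def)
  then obtain i js' where js': "js = j # i # js'" by (cases js; cases "tl js") auto
  then have "i # js' \<in> paths D l i" using js by (auto simp: paths_def)
  moreover have "i \<le> D" using js js' by simp
  ultimately show "js \<in> (\<Union>i\<le>D. Cons j ` paths D l i)" using js' by blast
qed (auto simp: paths_def)

text \<open>Expansion of a matrix power. Paths end at 0 because \<open>init\<close> is supported at
  w^0, and they stay below D because of the truncation.\<close>

lemma Lop_pow_paths:
  assumes "j \<le> D"
  shows "(Lop 1 (of_real h) (of_real e) D ^^ l) (init f) j = (\<Sum>js\<in>paths D l j. const (slw js) * foldr op (degs js) f)"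
  using assms
proof (induction l arbitrary: j)
  case 0
  have "paths D 0 j = (if j = 0 then {[0]} else {})"
    by (auto simp: paths_def length_Suc_conv)
  then show ?case by (simp add: init_def)
next
  case (Suc l)
  have inj: "inj_on (Cons j) X" for X :: "nat list set" by simp
  have cons: "const (slw (j # js)) * foldr op (degs (j # js)) f = const (slc j i) * op (int i - int j) (const (slw js) * foldr op (degs js) f)"
    if "js \<in> paths D l i" for i js
  proof -
    from that obtain js' where "js = i # js'" by (cases js) (auto simp: paths_def)
    then show ?thesis by (simp add: op_const_mult const_mult mult_ac)
  qed
  have "(Lop 1 (of_real h) (of_real e) D ^^ Suc l) (init f) j = (\<Sum>i\<le>D. const (slc j i) * op (int i - int j) (\<Sum>js\<in>paths D l i. const (slw js) * foldr op (degs js) f))"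
    using Suc by (simp add: Lop_op)
  also have "\<dots> = (\<Sum>i\<le>D. \<Sum>js\<in>paths D l i. const (slw (j # js)) * foldr op (degs (j # js)) f)"
    unfolding op_sum sum_distrib_left by (intro sum.cong refl cons[symmetric])
  also have "\<dots> = (\<Sum>i\<le>D. \<Sum>js\<in>Cons j ` paths D l i. const (slw js) * foldr op (degs js) f)"
    by (simp add: sum.reindex[OF inj])
  also have "\<dots> = (\<Sum>js\<in>(\<Union>i\<le>D. Cons j ` paths D l i). const (slw js) * foldr op (degs js) f)"
  proof (rule sum.UNION_disjoint[symmetric])
    show "\<forall>i\<in>{..D}. finite (Cons j ` paths D l i)" by (simp add: finite_paths)
    show "\<forall>i\<in>{..D}. \<forall>k\<in>{..D}. i \<noteq> k \<longrightarrow> Cons j ` paths D l i \<inter> Cons j ` paths D l k = {}"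
      by (auto simp: paths_def)
  qed simp
  finally show ?case using Suc.prems by (simp add: paths_Suc)
qed

fun sites :: "nat \<Rightarrow> nat list \<Rightarrow> nat list list set" where
  "sites D [] = {[]}"
| "sites D (l # ls) = (\<lambda>(js, gs). js # gs) ` (paths D l 0 \<times> sites D ls)"

lemma finite_sites: "finite (sites D ls)" by (induction ls) (auto simp: finite_paths)

lemma Tls_sites:
  "Tls D ls f = (\<Sum>gs\<in>sites D ls. const (\<Prod>js\<leftarrow>gs. slw js) * foldr op (concat (map degs gs)) f)"
proof (induction ls)
  case (Cons l ls)
  have inj: "inj_on (\<lambda>(js, gs). js # gs) X" for X :: "(nat list \<times> nat list list) set" by (auto simp: inj_on_def)
  have Tl: "Tl D l g = (\<Sum>js\<in>paths D l 0. const (slw js) * foldr op (degs js) g)" for g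
    unfolding Tl_def Top_def by (rule Lop_pow_paths) simp
  have lin: "foldr op w (const c * g) = const c * foldr op w g" for w c g
    by (induction w) (simp_all add: op_const_mult)
  have "Tls D (l # ls) f = (\<Sum>gs\<in>sites D ls. const (\<Prod>js\<leftarrow>gs. slw js) * Tl D l (foldr op (concat (map degs gs)) f))"
    using Cons by (simp add: Tls_def Tl_def Top_sum Top_const_mult)
  also have "\<dots> = (\<Sum>gs\<in>sites D ls. \<Sum>js\<in>paths D l 0. const (\<Prod>js\<leftarrow>js # gs. slw js) * foldr op (concat (map degs (js # gs))) f)"
    unfolding Tl sum_distrib_left by (intro sum.cong refl) (simp add: const_mult mult_ac)
  also have "\<dots> = (\<Sum>(js, gs)\<in>paths D l 0 \<times> sites D ls. const (\<Prod>js\<leftarrow>js # gs. slw js) * foldr op (concat (map degs (js # gs))) f)"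
    by (subst sum.swap) (simp add: sum.cartesian_product)
  also have "\<dots> = (\<Sum>gs\<in>sites D (l # ls). const (\<Prod>js\<leftarrow>gs. slw js) * foldr op (concat (map degs gs)) f)"
    unfolding sites.simps by (subst sum.reindex[OF inj]) (simp add: case_prod_unfold)
  finally show ?case .
qed (simp add: Tls_def)

section \<open>Wick's theorem\<close>

definition opl :: "('s \<Rightarrow> int) \<Rightarrow> 's list \<Rightarrow> cpoly \<Rightarrow> cpoly" where
  "opl dg xs = foldr (\<lambda>x. op (dg x)) xs"

lemma opl_simps [simp]: "opl dg [] f = f" "opl dg (x # xs) f = op (dg x) (opl dg xs f)"
  by (simp_all add: opl_def)

lemma opl_const_mult: "opl dg xs (const c * f) = const c * opl dg xs f"
  by (induction xs) (simp_all add: op_const_mult)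

text \<open>The Heisenberg relation: a derivative commutes with every generator except the
  multiplication of opposite degree, where the commutator is h n.\<close>

lemma op_neg_commute:
  assumes "n \<ge> 1"
  shows "op (- int n) (op k f) = op k (op (- int n) f) + (if k = int n then const (of_real h * of_nat n) * f else 0)"
proof -
  have neg: "op (- int n) g = const (of_real h * of_nat n) * dd n g" for g using assms by (simp add: op_def)
  consider "k > 0" | "k = 0" | "k < 0" by linarith
  then show ?thesis
  proof cases
    case 1
    have "nat k = n \<longleftrightarrow> k = int n" using 1 by auto
    then show ?thesis using 1 unfolding neg by (simp add: op_def dd_mult dd_var algebra_simps)
  next
    case 2 then show ?thesis using assms by (simp add: op_def)
  next
    case 3
    then have "op k g = const (of_real h * of_nat (nat (- k))) * dd (nat (- k)) g" for g by (simp add: op_def)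
    then have "op (- int n) (op k f) = op k (op (- int n) f)"
      by (simp only: neg dd_const_mult dd_commute[of n "nat (- k)"] mult.left_commute)
    then show ?thesis using 3 by simp
  qed
qed

text \<open>Moving a derivative through a product to the right leaves one correction for every
  multiplication of opposite degree that it passes, namely h n times the product without that
  factor.\<close>

lemma op_neg_opl:
  assumes "n \<ge> 1" "distinct xs"
  shows "op (- int n) (opl dg xs f) = opl dg xs (op (- int n) f) +
    (\<Sum>y | y \<in> set xs \<and> dg y = int n. const (of_real h * of_nat n) * opl dg (remove1 y xs) f)"
  using assms(2)
proof (induction xs)
  case (Cons x xs)
  let ?c = "const (of_real h * of_nat n)"
  let ?Y = "{y. y \<in> set xs \<and> dg y = int n}"
  have IH: "op (- int n) (opl dg xs f) = opl dg xs (op (- int n) f) + (\<Sum>y\<in>?Y. ?c * opl dg (remove1 y xs) f)"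
    using Cons by simp
  have fin: "finite ?Y" by simp
  have xY: "x \<notin> ?Y" using Cons.prems by simp
  have rem: "(\<Sum>y\<in>?Y. ?c * opl dg (remove1 y (x # xs)) f) = op (dg x) (\<Sum>y\<in>?Y. ?c * opl dg (remove1 y xs) f)"
    unfolding op_sum by (rule sum.cong) (use Cons.prems in \<open>auto simp: op_const_mult\<close>)
  have "op (- int n) (opl dg (x # xs) f) = op (dg x) (opl dg xs (op (- int n) f)) + (\<Sum>y\<in>?Y. ?c * opl dg (remove1 y (x # xs)) f)
     + (if dg x = int n then ?c * opl dg xs f else 0)"
    unfolding rem by (simp add: op_neg_commute[OF assms(1)] IH op_add)
  note main = this
  show ?case
  proof (cases "dg x = int n")
    case True
    then have "{y. y \<in> set (x # xs) \<and> dg y = int n} = insert x ?Y" by auto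
    then show ?thesis using main True by (simp only: sum.insert[OF fin xY] if_True remove1.simps add_ac opl_simps simp_thms)
  next
    case False
    then have "{y. y \<in> set (x # xs) \<and> dg y = int n} = ?Y" by auto
    then show ?thesis using main False by simp
  qed
qed simp

text \<open>Sets of disjoint contractions, with \<open>R\<close> read as standing further left. The
  type of the factors is abstract, so that removing factors from a product stays within the same
  notion.\<close>

definition pairsets :: "('s \<Rightarrow> 's \<Rightarrow> bool) \<Rightarrow> ('s \<Rightarrow> int) \<Rightarrow> 's set \<Rightarrow> ('s \<times> 's) set set" where
  "pairsets R dg X = {ps. (\<forall>(x, y)\<in>ps. x \<in> X \<and> y \<in> X \<and> R x y \<and> dg x < 0 \<and> dg y = - dg x) \<and>
     (\<forall>p\<in>ps. \<forall>p'\<in>ps. p \<noteq> p' \<longrightarrow> {fst p, snd p} \<inter> {fst p', snd p'} = {})}"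

lemma pairsetsD: "ps \<in> pairsets R dg X \<Longrightarrow> (u, v) \<in> ps \<Longrightarrow> u \<in> X \<and> v \<in> X \<and> R u v \<and> dg u < 0 \<and> dg v = - dg u"
  by (auto simp: pairsets_def)
lemma pairsets_disj: "ps \<in> pairsets R dg X \<Longrightarrow> p \<in> ps \<Longrightarrow> p' \<in> ps \<Longrightarrow> p \<noteq> p' \<Longrightarrow> {fst p, snd p} \<inter> {fst p', snd p'} = {}"
  by (simp add: pairsets_def)

definition pset :: "('s \<times> 's) set \<Rightarrow> 's set" where "pset ps = fst ` ps \<union> snd ` ps"

text \<open>The amount by which the unpaired derivatives lower the weight of the kernel.\<close>

definition drop_weight :: "('s \<Rightarrow> int) \<Rightarrow> 's set \<Rightarrow> int" where
  "drop_weight dg Z = (\<Sum>x | x \<in> Z \<and> dg x < 0. - dg x)"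

definition unp_weight :: "(nat \<Rightarrow> complex) \<Rightarrow> (nat \<Rightarrow> complex) \<Rightarrow> ('s \<Rightarrow> int) \<Rightarrow> 's set \<Rightarrow> complex" where
  "unp_weight Vout Vin dg Z = (\<Prod>x | x \<in> Z \<and> dg x < 0. cnj (Vout (nat (- dg x)))) * (\<Prod>x | x \<in> Z \<and> dg x > 0. Vin (nat (dg x)))"

definition pair_weight :: "('s \<Rightarrow> int) \<Rightarrow> ('s \<times> 's) set \<Rightarrow> complex" where
  "pair_weight dg ps = (\<Prod>p\<in>ps. of_real h * of_nat (nat (- dg (fst p))))"

definition kap :: "(nat \<Rightarrow> complex) \<Rightarrow> (nat \<Rightarrow> complex) \<Rightarrow> int \<Rightarrow> complex" where
  "kap Vout Vin d = evalp Vin (kern Vout d)"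

lemma pairsets_subset: "ps \<in> pairsets R dg X \<Longrightarrow> ps \<subseteq> X \<times> X" by (auto simp: pairsets_def)

lemma finite_pairsets: "finite X \<Longrightarrow> finite (pairsets R dg X)"
  by (rule finite_subset[of _ "Pow (X \<times> X)"]) (use pairsets_subset in blast)+

lemma pset_subset: "ps \<in> pairsets R dg X \<Longrightarrow> pset ps \<subseteq> X"
  using pairsets_subset by (fastforce simp: pset_def)

lemma pairsets_nonneg:
  assumes "dg x \<ge> 0" "\<And>z. z \<in> insert x X \<Longrightarrow> \<not> R z x"
  shows "pairsets R dg (insert x X) = pairsets R dg X"
proof -
  have "(u \<in> insert x X \<and> v \<in> insert x X \<and> R u v \<and> dg u < 0 \<and> dg v = - dg u) \<longleftrightarrow>
    (u \<in> X \<and> v \<in> X \<and> R u v \<and> dg u < 0 \<and> dg v = - dg u)" for u v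
    using assms(1) assms(2)[of u] by auto
  then show ?thesis unfolding pairsets_def by (simp only:)
qed

text \<open>The leftmost factor can only be the left member of a pair, so it is either unpaired or
  paired with one y, and the other pairs avoid both.\<close>

lemma pairsets_neg:
  assumes neg: "dg x < 0" and x: "x \<notin> X" and R: "\<And>z. z \<in> insert x X \<Longrightarrow> \<not> R z x" "\<And>z. z \<in> X \<Longrightarrow> R x z"
  shows "pairsets R dg (insert x X) = pairsets R dg X \<union>
    (\<Union>y\<in>{y. y \<in> X \<and> dg y = - dg x}. insert (x, y) ` pairsets R dg (X - {y}))"
proof (intro set_eqI iffI)
  fix ps assume ps: "ps \<in> pairsets R dg (insert x X)"
  have P: "u \<in> insert x X \<and> v \<in> X \<and> R u v \<and> dg u < 0 \<and> dg v = - dg u" if "(u, v) \<in> ps" for u v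
    using pairsetsD[OF ps that] R(1)[of u] by auto
  have D: "{fst p, snd p} \<inter> {fst p', snd p'} = {}" if "p \<in> ps" "p' \<in> ps" "p \<noteq> p'" for p p'
    by (rule pairsets_disj[OF ps that])
  show "ps \<in> pairsets R dg X \<union> (\<Union>y\<in>{y. y \<in> X \<and> dg y = - dg x}. insert (x, y) ` pairsets R dg (X - {y}))"
  proof (cases "x \<in> fst ` ps")
    case False
    have P': "u \<in> X" if "(u, v) \<in> ps" for u v
    proof -
      have "u \<in> fst ` ps" using that by (metis fst_conv image_eqI)
      then have "u \<noteq> x" using False by auto
      then show ?thesis using P[OF that] by simp
    qed
    have "ps \<in> pairsets R dg X"
      unfolding pairsets_def
    proof (intro CollectI conjI ballI impI)
      fix p assume "p \<in> ps"
      then show "case p of (u, v) \<Rightarrow> u \<in> X \<and> v \<in> X \<and> R u v \<and> dg u < 0 \<and> dg v = - dg u"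
        using P P' by (cases p) simp
    qed (rule D)
    then show ?thesis by blast
  next
    case True
    then obtain y where xy: "(x, y) \<in> ps" by auto
    define qs where "qs = ps - {(x, y)}"
    have "qs \<in> pairsets R dg (X - {y})"
      unfolding pairsets_def
    proof (intro CollectI conjI ballI impI)
      fix p assume p: "p \<in> qs"
      obtain u v where uv: "p = (u, v)" by fastforce
      have "{fst p, snd p} \<inter> {x, y} = {}" using D[of p "(x, y)"] p xy by (auto simp: qs_def)
      then have "u \<noteq> x" "u \<noteq> y" "v \<noteq> x" "v \<noteq> y" using uv by auto
      then show "case p of (u, v) \<Rightarrow> u \<in> X - {y} \<and> v \<in> X - {y} \<and> R u v \<and> dg u < 0 \<and> dg v = - dg u"
        using P[of u v] p by (auto simp: uv qs_def)
    next
      fix p p' assume "p \<in> qs" "p' \<in> qs" "p \<noteq> p'"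
      then show "{fst p, snd p} \<inter> {fst p', snd p'} = {}" by (intro D) (auto simp: qs_def)
    qed
    moreover have "ps = insert (x, y) qs" using xy by (auto simp: qs_def)
    moreover have "y \<in> X" "dg y = - dg x" using P[OF xy] by auto
    ultimately show ?thesis by blast
  qed
next
  fix ps assume "ps \<in> pairsets R dg X \<union> (\<Union>y\<in>{y. y \<in> X \<and> dg y = - dg x}. insert (x, y) ` pairsets R dg (X - {y}))"
  then show "ps \<in> pairsets R dg (insert x X)"
  proof
    assume "ps \<in> pairsets R dg X"
    then show ?thesis unfolding pairsets_def by blast
  next
    assume "ps \<in> (\<Union>y\<in>{y. y \<in> X \<and> dg y = - dg x}. insert (x, y) ` pairsets R dg (X - {y}))"
    then obtain y qs where y: "y \<in> X" "dg y = - dg x" and qs: "qs \<in> pairsets R dg (X - {y})" "ps = insert (x, y) qs" by blast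
    have P: "u \<in> X \<and> v \<in> X \<and> u \<noteq> y \<and> v \<noteq> y \<and> R u v \<and> dg u < 0 \<and> dg v = - dg u" if "(u, v) \<in> qs" for u v
      using pairsetsD[OF qs(1) that] by auto
    have D: "{fst p, snd p} \<inter> {fst p', snd p'} = {}" if "p \<in> qs" "p' \<in> qs" "p \<noteq> p'" for p p'
      by (rule pairsets_disj[OF qs(1) that])
    have new: "{fst p, snd p} \<inter> {x, y} = {}" if "p \<in> qs" for p
      using P[of "fst p" "snd p"] that x by auto
    show ?thesis
      unfolding pairsets_def qs(2)
    proof (intro CollectI conjI ballI impI)
      fix p assume "p \<in> insert (x, y) qs"
      then show "case p of (u, v) \<Rightarrow> u \<in> insert x X \<and> v \<in> insert x X \<and> R u v \<and> dg u < 0 \<and> dg v = - dg u"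
        using P y neg R(2) by (auto split: prod.splits)
    next
      fix p p' assume "p \<in> insert (x, y) qs" "p' \<in> insert (x, y) qs" "p \<noteq> p'"
      then show "{fst p, snd p} \<inter> {fst p', snd p'} = {}" using D new by fastforce
    qed
  qed
qed

text \<open>Look at the leftmost factor. A multiplication evaluates to a value of
  \<open>Vin\<close>. A derivative is moved to the right: it reaches the kernel, giving a value of
  \<open>Vout\<close> and a smaller weight, or it is contracted with some y. Contraction removes two
  factors, hence the induction on the length.\<close>

theorem wick:
  assumes h: "h > 0" and "distinct xs" "sorted_wrt R xs" "\<And>x y. R x y \<Longrightarrow> \<not> R y x"
  shows "evalp Vin (opl dg xs (kern Vout d)) =
    (\<Sum>ps\<in>pairsets R dg (set xs). pair_weight dg ps * unp_weight Vout Vin dg (set xs - pset ps) *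
       kap Vout Vin (d - drop_weight dg (set xs - pset ps)))"
  using assms(2,3)
proof (induction "length xs" arbitrary: xs d rule: less_induct)
  case less
  show ?case
  proof (cases xs)
    case Nil
    have "pairsets R dg {} = {{}}" by (auto simp: pairsets_def)
    then show ?thesis using Nil by (simp add: pair_weight_def unp_weight_def drop_weight_def kap_def)
  next
    case (Cons x ys)
    let ?X = "set ys"
    define w where "w d X ps = pair_weight dg ps * unp_weight Vout Vin dg (X - pset ps) * kap Vout Vin (d - drop_weight dg (X - pset ps))" for d X ps
    have x: "x \<notin> ?X" and dys: "distinct ys" and sys: "sorted_wrt R ys" and Rx: "\<And>z. z \<in> ?X \<Longrightarrow> R x z"
      using less.prems Cons by auto
    have Rz: "\<not> R z x" if "z \<in> insert x ?X" for z using Rx assms(4) that by blast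
    have IH: "evalp Vin (opl dg ys (kern Vout d)) = (\<Sum>ps\<in>pairsets R dg ?X. w d ?X ps)" for d
      unfolding w_def by (rule less.hyps) (use Cons dys sys in auto)
    have xps: "x \<notin> pset ps" if "ps \<in> pairsets R dg ?X" for ps using pset_subset[OF that] x by blast
    consider "dg x = 0" | "dg x > 0" | "dg x < 0" by linarith
    then have "evalp Vin (opl dg (x # ys) (kern Vout d)) = (\<Sum>ps\<in>pairsets R dg (insert x ?X). w d (insert x ?X) ps)"
    proof cases
      case 1
      have "w d (insert x ?X) ps = w d ?X ps" if "ps \<in> pairsets R dg ?X" for ps
      proof -
        have "{z. z \<in> insert x ?X - pset ps \<and> dg z < 0} = {z. z \<in> ?X - pset ps \<and> dg z < 0}"
          "{z. z \<in> insert x ?X - pset ps \<and> dg z > 0} = {z. z \<in> ?X - pset ps \<and> dg z > 0}" using 1 by auto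
        then show ?thesis by (simp only: w_def unp_weight_def drop_weight_def)
      qed
      then show ?thesis using 1 pairsets_nonneg[of dg x ?X R] Rz IH by (simp add: op_def)
    next
      case 2
      have "w d (insert x ?X) ps = Vin (nat (dg x)) * w d ?X ps" if "ps \<in> pairsets R dg ?X" for ps
      proof -
        have "{z. z \<in> insert x ?X - pset ps \<and> dg z < 0} = {z. z \<in> ?X - pset ps \<and> dg z < 0}"
          "{z. z \<in> insert x ?X - pset ps \<and> dg z > 0} = insert x {z. z \<in> ?X - pset ps \<and> dg z > 0}" using 2 xps[OF that] by auto
        then have "unp_weight Vout Vin dg (insert x ?X - pset ps) = Vin (nat (dg x)) * unp_weight Vout Vin dg (?X - pset ps)"
          "drop_weight dg (insert x ?X - pset ps) = drop_weight dg (?X - pset ps)"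
          using x by (simp_all add: unp_weight_def drop_weight_def)
        then show ?thesis by (simp add: w_def)
      qed
      then show ?thesis using 2 pairsets_nonneg[of dg x ?X R] Rz IH by (simp add: op_def evalp_mult sum_distrib_left)
    next
      case 3
      define n where "n = nat (- dg x)"
      have n: "n \<ge> 1" "dg x = - int n" using 3 by (auto simp: n_def)
      let ?Y = "{y. y \<in> ?X \<and> dg y = - dg x}"
      have "evalp Vin (opl dg (x # ys) (kern Vout d)) = evalp Vin (op (- int n) (opl dg ys (kern Vout d)))"
        by (simp add: n(2))
      also have "\<dots> = cnj (Vout n) * evalp Vin (opl dg ys (kern Vout (d - int n))) +
         (\<Sum>y\<in>?Y. of_real h * of_nat n * evalp Vin (opl dg (remove1 y ys) (kern Vout d)))"
      proof -
        have "op (- int n) (kern Vout d) = const (cnj (Vout n)) * kern Vout (d - int n)"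
          using n(1) dd_kern[OF h n(1), of Vout d] by (simp add: op_def)
        then show ?thesis
          using op_neg_opl[OF n(1) dys, of dg "kern Vout d"]
          by (simp add: evalp_add evalp_mult evalp_sum opl_const_mult n(2))
      qed
      also have "cnj (Vout n) * evalp Vin (opl dg ys (kern Vout (d - int n))) = (\<Sum>ps\<in>pairsets R dg ?X. w d (insert x ?X) ps)"
      proof -
        have "w d (insert x ?X) ps = cnj (Vout n) * w (d - int n) ?X ps" if "ps \<in> pairsets R dg ?X" for ps
        proof -
          have "{z. z \<in> insert x ?X - pset ps \<and> dg z > 0} = {z. z \<in> ?X - pset ps \<and> dg z > 0}"
            "{z. z \<in> insert x ?X - pset ps \<and> dg z < 0} = insert x {z. z \<in> ?X - pset ps \<and> dg z < 0}" using 3 xps[OF that] by auto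
          then have "unp_weight Vout Vin dg (insert x ?X - pset ps) = cnj (Vout n) * unp_weight Vout Vin dg (?X - pset ps)"
            "drop_weight dg (insert x ?X - pset ps) = int n + drop_weight dg (?X - pset ps)"
            using x n by (simp_all add: unp_weight_def drop_weight_def)
          then show ?thesis by (simp add: w_def algebra_simps)
        qed
        then show ?thesis by (simp add: IH sum_distrib_left)
      qed
      also have "(\<Sum>y\<in>?Y. of_real h * of_nat n * evalp Vin (opl dg (remove1 y ys) (kern Vout d))) =
        (\<Sum>y\<in>?Y. \<Sum>ps\<in>insert (x, y) ` pairsets R dg (?X - {y}). w d (insert x ?X) ps)"
      proof (rule sum.cong)
        fix y assume y: "y \<in> ?Y"
        have notin: "(x, y) \<notin> ps" if "ps \<in> pairsets R dg (?X - {y})" for ps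
          using pairsets_subset[OF that] by blast
        have inj: "inj_on (insert (x, y)) (pairsets R dg (?X - {y}))"
          by (rule inj_onI) (metis insert_ident notin)
        have "evalp Vin (opl dg (remove1 y ys) (kern Vout d)) = (\<Sum>ps\<in>pairsets R dg (set (remove1 y ys)). w d (set (remove1 y ys)) ps)"
          unfolding w_def
        proof (rule less.hyps)
          show "length (remove1 y ys) < length xs" using Cons y by (simp add: length_remove1)
          show "distinct (remove1 y ys)" using dys by simp
          show "sorted_wrt R (remove1 y ys)" using sys by (simp add: sorted_wrt_filter remove1_filter_not distinct_remove1_removeAll[OF dys] removeAll_filter_not_eq)
        qed
        also have "set (remove1 y ys) = ?X - {y}" using dys by (simp add: set_remove1_eq)
        finally have "of_real h * of_nat n * evalp Vin (opl dg (remove1 y ys) (kern Vout d)) =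
          (\<Sum>ps\<in>pairsets R dg (?X - {y}). of_real h * of_nat n * w d (?X - {y}) ps)" by (simp add: sum_distrib_left)
        also have "\<dots> = (\<Sum>ps\<in>pairsets R dg (?X - {y}). w d (insert x ?X) (insert (x, y) ps))"
        proof (rule sum.cong)
          fix ps assume ps: "ps \<in> pairsets R dg (?X - {y})"
          have finps: "finite ps" using pairsets_subset[OF ps] finite_subset by blast
          have "insert x ?X - pset (insert (x, y) ps) = (?X - {y}) - pset ps"
            using x by (auto simp: pset_def)
          moreover have "pair_weight dg (insert (x, y) ps) = of_real h * of_nat n * pair_weight dg ps"
            using finps notin[OF ps] by (simp add: pair_weight_def n(2))
          ultimately show "of_real h * of_nat n * w d (?X - {y}) ps = w d (insert x ?X) (insert (x, y) ps)"
            by (simp add: w_def)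
        qed simp
        also have "\<dots> = (\<Sum>ps\<in>insert (x, y) ` pairsets R dg (?X - {y}). w d (insert x ?X) ps)"
          by (simp add: sum.reindex[OF inj])
        finally show "of_real h * of_nat n * evalp Vin (opl dg (remove1 y ys) (kern Vout d)) = \<dots>" .
      qed simp
      finally have calc: "evalp Vin (opl dg (x # ys) (kern Vout d)) = (\<Sum>ps\<in>pairsets R dg ?X. w d (insert x ?X) ps) +
         (\<Sum>y\<in>?Y. \<Sum>ps\<in>insert (x, y) ` pairsets R dg (?X - {y}). w d (insert x ?X) ps)" .
      have un: "(\<Sum>y\<in>?Y. \<Sum>ps\<in>insert (x, y) ` pairsets R dg (?X - {y}). w d (insert x ?X) ps) =
         (\<Sum>ps\<in>(\<Union>y\<in>?Y. insert (x, y) ` pairsets R dg (?X - {y})). w d (insert x ?X) ps)"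
      proof (rule sum.UNION_disjoint[symmetric])
        show "\<forall>y\<in>?Y. finite (insert (x, y) ` pairsets R dg (?X - {y}))" by (simp add: finite_pairsets)
        show "\<forall>y\<in>?Y. \<forall>y'\<in>?Y. y \<noteq> y' \<longrightarrow> insert (x, y) ` pairsets R dg (?X - {y}) \<inter> insert (x, y') ` pairsets R dg (?X - {y'}) = {}"
          using x pairsets_subset by fastforce
      qed simp
      have pn: "pairsets R dg (insert x ?X) = pairsets R dg ?X \<union> (\<Union>y\<in>?Y. insert (x, y) ` pairsets R dg (?X - {y}))"
        by (rule pairsets_neg[where dg=dg and x=x, OF 3 x]) (use Rz Rx in auto)
      have "(\<Sum>ps\<in>pairsets R dg ?X. w d (insert x ?X) ps) + (\<Sum>ps\<in>(\<Union>y\<in>?Y. insert (x, y) ` pairsets R dg (?X - {y})). w d (insert x ?X) ps)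
        = (\<Sum>ps\<in>pairsets R dg (insert x ?X). w d (insert x ?X) ps)"
        unfolding pn
      proof (rule sum.union_disjoint[symmetric])
        show "finite (pairsets R dg ?X)" by (simp add: finite_pairsets)
        show "finite (\<Union>y\<in>?Y. insert (x, y) ` pairsets R dg (?X - {y}))" by (simp add: finite_pairsets)
        show "pairsets R dg ?X \<inter> (\<Union>y\<in>?Y. insert (x, y) ` pairsets R dg (?X - {y})) = {}"
          using x pairsets_subset[of _ R dg ?X] by blast
      qed
      with calc un show ?thesis by (simp only:)
    qed
    then show ?thesis by (simp add: Cons w_def)
  qed
qed

end


section \<open>The exponential series of the kernel\<close>

text \<open>The factor n + 1 on the left eventually outgrows the geometric sum on the right, so from
  some index on the bound reproduces itself with the same constant.\<close>

lemma recursion_bound: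
  fixes \<kappa> B :: "nat \<Rightarrow> complex"
  assumes rec: "\<And>n. of_nat (Suc n) * \<kappa> (Suc n) = (\<Sum>i\<le>n. B (Suc i) * \<kappa> (n - i))"
    and B: "\<And>k. k \<ge> 1 \<Longrightarrow> cmod (B k) \<le> K * \<rho> ^ k" and K: "K \<ge> 0" and \<rho>: "0 < \<rho>" "\<rho> < s"
  shows "\<exists>C\<ge>0. \<forall>d. cmod (\<kappa> d) \<le> C * s ^ d"
proof -
  define q where "q = \<rho> / s"
  have s: "s > 0" using \<rho> by simp
  have q: "0 < q" "q < 1" using \<rho> s by (auto simp: q_def)
  \<comment> \<open>Beyond N the division by d compensates K / (1 - q), which bounds the sum over
    the coefficients; the values up to N are absorbed into \<open>C\<close>.\<close>
  obtain N where N: "K / (1 - q) \<le> real N" using real_arch_simple by blast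
  define C where "C = (\<Sum>d\<le>N. cmod (\<kappa> d) / s ^ d)"
  have C0: "C \<ge> 0" unfolding C_def using s by (intro sum_nonneg) auto
  have "cmod (\<kappa> d) \<le> C * s ^ d" for d
  proof (induction d rule: less_induct)
    case (less d)
    show ?case
    proof (cases "d \<le> N")
      case True
      have "cmod (\<kappa> d) / s ^ d \<le> C" unfolding C_def using s True by (intro member_le_sum) auto
      then show ?thesis using s by (simp add: field_simps)
    next
      case False
      then obtain n where n: "d = Suc n" by (cases d) auto
      have "real d * cmod (\<kappa> d) = cmod (\<Sum>i\<le>n. B (Suc i) * \<kappa> (n - i))"
        using arg_cong[OF rec[of n], of cmod] unfolding n norm_mult norm_of_nat .
      also have "\<dots> \<le> (\<Sum>i\<le>n. K * q ^ Suc i * (C * s ^ Suc n))"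
      proof (rule order_trans[OF norm_sum], rule sum_mono)
        fix i assume i: "i \<in> {..n}"
        have "cmod (B (Suc i) * \<kappa> (n - i)) \<le> (K * \<rho> ^ Suc i) * (C * s ^ (n - i))"
          unfolding norm_mult using B[of "Suc i"] less.IH[of "n - i"] K \<rho> n by (intro mult_mono) auto
        also have "s ^ (n - i) = s ^ Suc n / s ^ Suc i" using s i by (simp add: power_diff)
        finally show "cmod (B (Suc i) * \<kappa> (n - i)) \<le> K * q ^ Suc i * (C * s ^ Suc n)"
          by (simp add: q_def power_divide del: power_Suc)
      qed
      also have "\<dots> = K * (C * s ^ Suc n) * (\<Sum>i\<le>n. q ^ Suc i)"
        by (simp add: sum_distrib_left mult_ac)
      also have "\<dots> \<le> K * (C * s ^ Suc n) * (1 / (1 - q))"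
      proof (rule mult_left_mono)
        have "(\<Sum>i\<le>n. q ^ Suc i) \<le> (\<Sum>i\<le>n. q ^ i)" using q by (intro sum_mono) (simp add: mult_left_le_one_le)
        also have "\<dots> \<le> suminf (\<lambda>i. q ^ i)" using q by (intro sum_le_suminf summable_geometric) auto
        also have "\<dots> = 1 / (1 - q)" using q by (intro suminf_geometric) auto
        finally show "(\<Sum>i\<le>n. q ^ Suc i) \<le> 1 / (1 - q)" .
      qed (use K C0 s in auto)
      also have "\<dots> = (K / (1 - q)) * (C * s ^ d)" by (simp add: n)
      also have "\<dots> \<le> real d * (C * s ^ d)"
        using N False C0 s by (intro mult_right_mono) auto
      finally show ?thesis using n by simp
    qed
  qed
  then show ?thesis using C0 by blast
qed

text \<open>With F the series of \<kappa> and G that of B k / k, the recursion says F' = G' F. Hence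
  F exp (- G) is constant on a disc that contains 1, and it is 1 at the origin.\<close>

lemma recursion_exp:
  fixes \<kappa> B :: "nat \<Rightarrow> complex"
  assumes k0: "\<kappa> 0 = 1" and rec: "\<And>n. of_nat (Suc n) * \<kappa> (Suc n) = (\<Sum>i\<le>n. B (Suc i) * \<kappa> (n - i))"
    and B: "\<And>k. k \<ge> 1 \<Longrightarrow> cmod (B k) \<le> K * \<rho> ^ k" and K: "K \<ge> 0" and \<rho>: "0 < \<rho>" "\<rho> < 1"
  shows "summable (\<lambda>d. cmod (\<kappa> d))" and "suminf \<kappa> = exp (suminf (\<lambda>k. B (Suc k) / of_nat (Suc k)))"
proof -
  define s where "s = (1 + \<rho>) / 2"
  have s: "\<rho> < s" "0 < s" "s < 1" using \<rho> by (auto simp: s_def)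
  obtain C where C: "C \<ge> 0" "\<And>d. cmod (\<kappa> d) \<le> C * s ^ d" using recursion_bound[OF rec B K \<rho>(1) s(1)] by blast
  show "summable (\<lambda>d. cmod (\<kappa> d))"
    by (rule summable_comparison_test'[of "\<lambda>d. C * s ^ d" 0]) (use C s in \<open>auto intro!: summable_mult summable_geometric\<close>)
  \<comment> \<open>Since s t = (1 + s) / 2 < 1, both series converge on a disc of radius t > 1, so
    evaluation at 1 is an interior one.\<close>
  define t where "t = (1 + 1 / s) / 2"
  have t: "t > 1" "s * t < 1" using s by (auto simp: t_def field_simps)
  define g where "g k = (if k = 0 then 0 else B k / of_nat k)" for k
  define F G where "F = Abs_fps \<kappa>" and "G = Abs_fps g"
  have gb: "cmod (g k) \<le> K * s ^ k" for k
  proof (cases k)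
    case 0 then show ?thesis using K by (simp add: g_def)
  next
    case (Suc j)
    have "cmod (g k) = cmod (B k) / real k" using Suc by (simp add: g_def norm_divide del: of_nat_Suc)
    also have "\<dots> \<le> cmod (B k) / 1" using Suc by (intro divide_left_mono) auto
    also have "\<dots> \<le> K * \<rho> ^ k" using B[of k] Suc by simp
    also have "\<dots> \<le> K * s ^ k" using K \<rho> s by (intro mult_left_mono power_mono) auto
    finally show ?thesis .
  qed
  have rad: "ereal t \<le> fps_conv_radius (Abs_fps f)" if "\<And>k. cmod (f k) \<le> D * s ^ k" for f D
  proof -
    have "summable (\<lambda>n. f n * of_real t ^ n)"
    proof (rule summable_comparison_test'[of "\<lambda>n. D * (s * t) ^ n" 0])
      show "summable (\<lambda>n. D * (s * t) ^ n)" using s t by (intro summable_mult summable_geometric) auto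
      show "norm (f n * of_real t ^ n) \<le> D * (s * t) ^ n" for n
        using mult_right_mono[OF that[of n], of "t ^ n"] t by (simp add: norm_mult norm_power power_mult_distrib mult_ac)
    qed
    from conv_radius_geI[OF this] show ?thesis using t by (simp add: fps_conv_radius_def)
  qed
  have radF: "ereal t \<le> fps_conv_radius F" unfolding F_def by (rule rad[OF C(2)])
  have radG: "ereal t \<le> fps_conv_radius G" unfolding G_def by (rule rad[OF gb])
  have ode: "fps_deriv F = fps_deriv G * F"
  proof (rule fps_ext)
    fix n
    have "fps_nth (fps_deriv F) n = of_nat (Suc n) * \<kappa> (Suc n)" by (simp add: F_def)
    also have "\<dots> = (\<Sum>i\<le>n. B (Suc i) * \<kappa> (n - i))" by (rule rec)
    also have "\<dots> = fps_nth (fps_deriv G * F) n"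
      unfolding fps_mult_nth by (intro sum.cong) (auto simp: F_def G_def g_def simp del: of_nat_Suc)
    finally show "fps_nth (fps_deriv F) n = fps_nth (fps_deriv G * F) n" .
  qed
  let ?S = "ball (0::complex) t"
  have inside: "ereal (norm z) < fps_conv_radius F" "ereal (norm z) < fps_conv_radius G" if "z \<in> ?S" for z
    using that radF radG less_le_trans[of "ereal (norm z)" "ereal t"] by auto
  have "\<exists>c. \<forall>z\<in>?S. eval_fps F z * exp (- eval_fps G z) = c"
  proof (rule has_field_derivative_zero_constant)
    fix z assume z: "z \<in> ?S"
    have dG: "ereal (norm z) < fps_conv_radius (fps_deriv G)"
      using inside(2)[OF z] fps_conv_radius_deriv[of G] less_le_trans by blast
    have e: "eval_fps (fps_deriv F) z = eval_fps (fps_deriv G) z * eval_fps F z"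
      unfolding ode by (rule eval_fps_mult[OF dG inside(1)[OF z]])
    have 1: "(eval_fps F has_field_derivative eval_fps (fps_deriv F) z) (at z within ?S)"
      by (rule has_field_derivative_eval_fps[OF inside(1)[OF z]])
    have 2: "(eval_fps G has_field_derivative eval_fps (fps_deriv G) z) (at z within ?S)"
      by (rule has_field_derivative_eval_fps[OF inside(2)[OF z]])
    have "((\<lambda>z. eval_fps F z * exp (- eval_fps G z)) has_field_derivative
       eval_fps (fps_deriv F) z * exp (- eval_fps G z) + (exp (- eval_fps G z) * - eval_fps (fps_deriv G) z) * eval_fps F z) (at z within ?S)"
      by (rule DERIV_mult'[OF 1 DERIV_chain2[OF DERIV_exp DERIV_minus[OF 2]], THEN DERIV_cong]) (simp add: mult_ac)
    then show "((\<lambda>z. eval_fps F z * exp (- eval_fps G z)) has_field_derivative 0) (at z within ?S)"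
      by (rule DERIV_cong) (simp add: e mult_ac)
  qed simp
  then obtain c where c: "\<And>z. z \<in> ?S \<Longrightarrow> eval_fps F z * exp (- eval_fps G z) = c" by blast
  have "c = 1" using c[of 0] t k0 by (simp add: eval_fps_at_0 F_def G_def g_def)
  then have "eval_fps F 1 * exp (- eval_fps G 1) = 1" using c[of 1] t by simp
  then have FG: "eval_fps F 1 = exp (eval_fps G 1)" by (simp add: exp_minus field_simps)
  have "summable g"
    by (rule summable_comparison_test'[of "\<lambda>d. K * s ^ d" 0]) (use gb s in \<open>auto intro!: summable_mult summable_geometric\<close>)
  then have "suminf g = suminf (\<lambda>k. g (Suc k))" using suminf_split_head[of g] by (simp add: g_def)
  then show "suminf \<kappa> = exp (suminf (\<lambda>k. B (Suc k) / of_nat (Suc k)))"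
  proof -
    have "eval_fps F 1 = suminf \<kappa>" "eval_fps G 1 = suminf g" by (simp_all add: eval_fps_def F_def G_def)
    moreover have "(\<lambda>k. g (Suc k)) = (\<lambda>k. B (Suc k) / of_nat (Suc k))" by (simp add: g_def)
    ultimately show ?thesis using FG \<open>suminf g = suminf (\<lambda>k. g (Suc k))\<close> by (simp only:)
  qed
qed

lemma euler: assumes "f \<in> hom n" shows "(\<Sum>k=1..n. var k * (const (of_nat k) * dd k f)) = const (of_nat n) * f"
proof (rule poly_mapping_eqI)
  fix d
  have vd: "lookup (var k * dd k f) d = of_nat (lookup d k) * lookup f d" for k
  proof (cases "lookup d k = 0")
    case False
    then obtain x where x: "d = single k 1 + x" using exists_single_add by blast
    then show ?thesis by (simp add: lookup_monom_power_mult lookup_dd lookup_add add.commute)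
  qed (simp add: lookup_monom_power_mult)
  have "lookup (\<Sum>k=1..n. var k * (const (of_nat k) * dd k f)) d = (\<Sum>k=1..n. of_nat k * (of_nat (lookup d k) * lookup f d))"
    unfolding lookup_sum mult.left_commute[of "var _"] lookup_const_mult vd ..
  also have "\<dots> = of_nat n * lookup f d"
  proof (cases "lookup f d = 0")
    case False
    then have d: "wt d = n" "d \<in> keys f" using assms by (auto simp: hom_iff in_keys_iff)
    have "keys d \<subseteq> {1..n}" using polys_inD[OF hle_polys_in[OF hom_hle[OF assms]] d(2)] by blast
    then have "wt d = (\<Sum>k=1..n. k * lookup d k)" by (intro wt_superset) auto
    moreover have "of_nat (\<Sum>k=1..n. k * lookup d k) = (\<Sum>k=1..n. of_nat k * of_nat (lookup d k) :: complex)" by simp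
    ultimately have "of_nat n = (\<Sum>k=1..n. of_nat k * of_nat (lookup d k) :: complex)" using d(1) by (simp only:)
    then show ?thesis by (simp add: sum_distrib_right mult.assoc)
  qed simp
  finally show "lookup (\<Sum>k=1..n. var k * (const (of_nat k) * dd k f)) d = lookup (const (of_nat n) * f) d" by simp
qed

locale specs =
  fixes e h A r :: real and Vout Vin :: "nat \<Rightarrow> complex"
  assumes h: "h > 0" and A: "A > 0" and r: "0 < r" "r < 1"
    and V: "\<And>k. k \<ge> 1 \<Longrightarrow> cmod (Vout k) \<le> A * r ^ k" "\<And>k. k \<ge> 1 \<Longrightarrow> cmod (Vin k) \<le> A * r ^ k"
begin

abbreviation "\<kappa> \<equiv> kap h Vout Vin"

lemma kap_neg: "d < 0 \<Longrightarrow> \<kappa> d = 0"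
  by (simp add: kap_def kern_def)

lemma evalp_1 [simp]: "evalp X 1 = 1" by (metis const_1 evalp_const)

lemma kap_0: "\<kappa> 0 = 1"
proof -
  have "mons 0 = {0}"
  proof (intro set_eqI iffI)
    fix d assume d: "d \<in> mons 0"
    have "single d (1::complex) \<in> hom 0" using d by (auto simp: hom_iff lookup_single when_def mons_def)
    then have "single d (1::complex) = const (lookup (single d 1) 0)" by (rule hom_0_const)
    then have "lookup (single d (1::complex)) d = (if d = 0 then lookup (single d 1) 0 else 0)" by (metis lookup_const)
    then show "d \<in> {0}" by (auto split: if_splits)
  qed (simp add: mons_def)
  then show ?thesis
    by (simp add: kap_def kern_def monval_def monom_sqnorm_def evalp_single)
qed

text \<open>Euler's identity for the weighted grading, applied to the kernel, with each derivative
  replaced by means of \<open>dd_kern\<close>.\<close>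

lemma kap_rec:
  "of_nat (Suc n) * \<kappa> (int (Suc n)) = (\<Sum>i\<le>n. (cnj (Vout (Suc i)) * Vin (Suc i) / of_real h) * \<kappa> (int (n - i)))"
proof -
  let ?K = "kern h Vout (int (Suc n))"
  have step: "const (of_nat k) * dd k ?K = const (cnj (Vout k) / of_real h) * kern h Vout (int (Suc n) - int k)" if "k \<ge> 1" for k
  proof -
    have "const (of_nat k) * dd k ?K = const (1 / of_real h) * (const (of_real h * of_nat k) * dd k ?K)"
      using h by (simp flip: mult.assoc const_mult)
    also have "\<dots> = const (1 / of_real h) * (const (cnj (Vout k)) * kern h Vout (int (Suc n) - int k))"
      by (simp only: dd_kern[OF h that])
    also have "\<dots> = const (cnj (Vout k) / of_real h) * kern h Vout (int (Suc n) - int k)"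
      by (simp flip: mult.assoc const_mult)
    finally show ?thesis .
  qed
  have "of_nat (Suc n) * \<kappa> (int (Suc n)) = evalp Vin (const (of_nat (Suc n)) * ?K)" by (simp add: kap_def evalp_mult del: of_nat_Suc)
  also have "\<dots> = evalp Vin (\<Sum>k=1..Suc n. var k * (const (of_nat k) * dd k ?K))"
    by (simp only: euler[OF kern_hom])
  also have "\<dots> = (\<Sum>k=1..Suc n. Vin k * (cnj (Vout k) / of_real h * \<kappa> (int (Suc n) - int k)))"
    unfolding evalp_sum
  proof (rule sum.cong)
    fix k assume "k \<in> {1..Suc n}"
    then show "evalp Vin (var k * (const (of_nat k) * dd k ?K)) = Vin k * (cnj (Vout k) / of_real h * \<kappa> (int (Suc n) - int k))"
      using step[of k] by (simp only: atLeastAtMost_iff evalp_mult evalp_const evalp_var kap_def power_Suc power_0 mult_1_right)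
  qed simp
  also have "\<dots> = (\<Sum>i\<le>n. Vin (Suc i) * (cnj (Vout (Suc i)) / of_real h * \<kappa> (int (Suc n) - int (Suc i))))"
    by (rule sum.reindex_bij_witness[of _ Suc "\<lambda>k. k - 1"]) auto
  also have "\<dots> = (\<Sum>i\<le>n. (cnj (Vout (Suc i)) * Vin (Suc i) / of_real h) * \<kappa> (int (n - i)))"
    by (rule sum.cong) (auto simp: of_nat_diff mult_ac)
  finally show ?thesis .
qed

definition Z :: complex where
  "Z = exp ((1 / of_real h) * suminf (\<lambda>k. cnj (Vout (Suc k)) * Vin (Suc k) / of_nat (Suc k)))"

lemma V_nonneg: "A * r ^ k \<ge> 0" using A r by simp

lemma prod_bound: assumes "k \<ge> 1" shows "cmod (cnj (Vout k) * Vin k) \<le> A\<^sup>2 * (r\<^sup>2) ^ k"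
proof -
  have "cmod (cnj (Vout k) * Vin k) \<le> (A * r ^ k) * (A * r ^ k)"
    unfolding norm_mult using V[OF assms] V_nonneg by (intro mult_mono) auto
  then show ?thesis by (simp add: power2_eq_square power_mult_distrib mult_ac)
qed

lemma kap_sum:
  shows "summable (\<lambda>d. cmod (\<kappa> (int d)))" and "suminf (\<lambda>d. \<kappa> (int d)) = Z"
proof -
  define B where "B k = cnj (Vout k) * Vin k / of_real h" for k
  have B: "cmod (B k) \<le> (A\<^sup>2 / h) * (r\<^sup>2) ^ k" if "k \<ge> 1" for k
  proof -
    have "cmod (B k) = cmod (cnj (Vout k) * Vin k) / h" using h by (simp add: B_def norm_divide)
    also have "\<dots> \<le> (A\<^sup>2 * (r\<^sup>2) ^ k) / h" using h prod_bound[OF that] by (intro divide_right_mono) auto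
    finally show ?thesis by simp
  qed
  have rr: "0 < r\<^sup>2" "r\<^sup>2 < 1" using r by (auto simp: power_less_one_iff)
  have A0: "A\<^sup>2 / h \<ge> 0" using h by simp
  note R = recursion_exp[of "\<lambda>d. \<kappa> (int d)" B, OF _ _ B A0 rr]
  show "summable (\<lambda>d. cmod (\<kappa> (int d)))"
    by (rule R(1)) (use kap_0 kap_rec in \<open>auto simp: B_def\<close>)
  have "suminf (\<lambda>d. \<kappa> (int d)) = exp (suminf (\<lambda>k. B (Suc k) / of_nat (Suc k)))"
    by (rule R(2)) (use kap_0 kap_rec in \<open>auto simp: B_def\<close>)
  moreover have "summable (\<lambda>k. cnj (Vout (Suc k)) * Vin (Suc k) / of_nat (Suc k))"
  proof (rule summable_comparison_test'[of "\<lambda>k. A\<^sup>2 * (r\<^sup>2) ^ Suc k" 0])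
    show "summable (\<lambda>k. A\<^sup>2 * (r\<^sup>2) ^ Suc k)" using rr by (subst summable_Suc_iff) (auto intro!: summable_mult summable_geometric)
    fix k
    have "norm (cnj (Vout (Suc k)) * Vin (Suc k) / of_nat (Suc k)) \<le> cmod (cnj (Vout (Suc k)) * Vin (Suc k)) / 1"
      unfolding norm_divide norm_of_nat by (intro divide_left_mono) auto
    then show "norm (cnj (Vout (Suc k)) * Vin (Suc k) / of_nat (Suc k)) \<le> A\<^sup>2 * (r\<^sup>2) ^ Suc k"
      using prod_bound[of "Suc k"] by simp
  qed
  then have "suminf (\<lambda>k. B (Suc k) / of_nat (Suc k)) = (1 / of_real h) * suminf (\<lambda>k. cnj (Vout (Suc k)) * Vin (Suc k) / of_nat (Suc k))"
    by (subst suminf_mult[symmetric]) (simp_all add: B_def)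
  ultimately show "suminf (\<lambda>d. \<kappa> (int d)) = Z" by (simp add: Z_def)
qed

lemma Z_nz: "Z \<noteq> 0" by (simp add: Z_def)

end


section \<open>Ribbon paths\<close>

text \<open>The lexicographic order of steps is the order from left to right of the corresponding
  operators in the product over all sites.\<close>

definition before :: "step \<Rightarrow> step \<Rightarrow> bool" where
  "before x y \<longleftrightarrow> fst x < fst y \<or> fst x = fst y \<and> snd x < snd y"

lemma before_asym: "before x y \<Longrightarrow> \<not> before y x" by (auto simp: before_def)
lemma before_irrefl: "\<not> before x x" by (auto simp: before_def)
lemma before_trans: "before x y \<Longrightarrow> before y z \<Longrightarrow> before x z" by (auto simp: before_def)

definition stepl :: "nat list list \<Rightarrow> nat \<Rightarrow> step list" where
  "stepl gs n = concat (map (\<lambda>a. map (Pair a) [0..<length (gs ! a) - 1]) [0..<n])"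

lemma set_stepl: "set (stepl gs (length gs)) = steps gs"
  by (auto simp: stepl_def steps_def)

lemma steps_Sigma: "steps gs = (SIGMA a:{..<length gs}. {..<length (gs ! a) - 1})"
  by (auto simp: steps_def)

lemma finite_steps [simp]: "finite (steps gs)" by (simp add: steps_Sigma)

lemma sorted_stepl: "sorted_wrt before (stepl gs n)"
proof (induction n)
  case (Suc n)
  have "sorted_wrt before (map (Pair n) [0..<m])" for m
    by (simp add: sorted_wrt_map sorted_wrt_iff_nth_less before_def)
  moreover have "fst x < n" if "x \<in> set (stepl gs n)" for x using that by (auto simp: stepl_def)
  moreover have "before x (n, i)" if "fst x < n" for x i using that by (simp add: before_def)
  ultimately show ?case using Suc by (auto simp: stepl_def sorted_wrt_append)
qed (simp add: stepl_def)

lemma distinct_stepl: "distinct (stepl gs n)"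
  unfolding distinct_conv_nth
proof (intro allI impI)
  fix i j assume ij: "i < length (stepl gs n)" "j < length (stepl gs n)" "i \<noteq> j"
  then have "before (stepl gs n ! i) (stepl gs n ! j) \<or> before (stepl gs n ! j) (stepl gs n ! i)"
    using sorted_stepl[of gs n] unfolding sorted_wrt_iff_nth_less by (metis linorder_neqE_nat)
  then show "stepl gs n ! i \<noteq> stepl gs n ! j" using before_irrefl by metis
qed

lemma degs_conv: "degs js = map (\<lambda>i. int (js ! Suc i) - int (js ! i)) [0..<length js - 1]"
proof (induction js rule: degs.induct)
  case (1 j i js)
  have "[0..<length (j # i # js) - 1] = 0 # map Suc [0..<length (i # js) - 1]"
    by (simp add: upt_conv_Cons map_Suc_upt del: upt_Suc)
  then show ?case using 1 by simp
qed auto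

lemma slw_conv: "slw e js = (\<Prod>i\<leftarrow>[0..<length js - 1]. slc e (js ! i) (js ! Suc i))"
proof (induction js rule: slw.induct)
  case (1 j i js)
  have "[0..<length (j # i # js) - 1] = 0 # map Suc [0..<length (i # js) - 1]"
    by (simp add: upt_conv_Cons map_Suc_upt del: upt_Suc)
  then show ?case using 1 by (simp add: o_def)
qed auto

lemma map_deg_stepl: "map (deg gs) (stepl gs (length gs)) = concat (map degs gs)"
proof -
  have "map (deg gs) (stepl gs (length gs)) = concat (map (\<lambda>a. degs (gs ! a)) [0..<length gs])"
    unfolding stepl_def map_concat map_map by (intro arg_cong[of _ _ concat] map_cong) (auto simp: degs_conv deg_def)
  also have "map (\<lambda>a. degs (gs ! a)) [0..<length gs] = map degs gs"
    using map_nth[of gs] by (metis (no_types, lifting) map_map o_def map_eq_conv)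
  finally show ?thesis .
qed

lemma prod_slw: "(\<Prod>js\<leftarrow>gs. slw e js) = (\<Prod>x\<in>slides gs. of_real e * of_nat (height gs x))"
proof -
  let ?f = "\<lambda>(a, i). slc e (gs ! a ! i) (gs ! a ! Suc i)"
  have "map (slw e) gs = map (\<lambda>a. slw e (gs ! a)) [0..<length gs]"
    by (metis (no_types, lifting) map_nth map_map o_def map_eq_conv)
  then have "(\<Prod>js\<leftarrow>gs. slw e js) = (\<Prod>a\<leftarrow>[0..<length gs]. slw e (gs ! a))" by simp
  also have "\<dots> = prod_list (map ?f (stepl gs (length gs)))"
  proof -
    have "prod_list (map ?f (stepl gs n)) = (\<Prod>a\<leftarrow>[0..<n]. slw e (gs ! a))" for n
      by (induction n) (simp_all add: stepl_def slw_conv o_def)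
    then show ?thesis by simp
  qed
  also have "\<dots> = (\<Prod>x\<in>steps gs. ?f x)"
    using prod.distinct_set_conv_list[OF distinct_stepl[of gs "length gs"], of ?f] by (simp add: set_stepl)
  also have "\<dots> = (\<Prod>x\<in>slides gs. ?f x)"
    by (rule prod.mono_neutral_right) (auto simp: slides_def slc_def deg_def split: if_splits)
  also have "\<dots> = (\<Prod>x\<in>slides gs. of_real e * of_nat (height gs x))"
    by (rule prod.cong) (auto simp: slides_def slc_def deg_def height_def)
  finally show ?thesis .
qed

definition valid :: "nat list \<Rightarrow> nat list list \<Rightarrow> bool" where
  "valid ls gs \<longleftrightarrow> length gs = length ls \<and> (\<forall>a<length ls. is_sliding_path (ls ! a) (gs ! a))"

lemma sites_iff: "gs \<in> sites D ls \<longleftrightarrow> valid ls gs \<and> (\<forall>a<length ls. set (gs ! a) \<subseteq> {..D})"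
proof (induction ls arbitrary: gs)
  case (Cons l ls)
  show ?case
  proof (cases gs)
    case Nil then show ?thesis by (auto simp: valid_def)
  next
    case (Cons js gs')
    have "gs \<in> sites D (l # ls) \<longleftrightarrow> js \<in> paths D l 0 \<and> gs' \<in> sites D ls" using Cons by auto
    then show ?thesis using Cons.IH[of gs'] Cons
      by (auto simp: valid_def paths_def is_sliding_path_def All_less_Suc2)
  qed
qed (auto simp: valid_def)

abbreviation "ppairs gs \<equiv> pairsets before (deg gs) (steps gs)"

lemma pairing_iff: "(\<exists>k. is_pairing gs k (x, y)) \<longleftrightarrow> x \<in> steps gs \<and> y \<in> steps gs \<and> before x y \<and> deg gs x < 0 \<and> deg gs y = - deg gs x"
proof
  assume "x \<in> steps gs \<and> y \<in> steps gs \<and> before x y \<and> deg gs x < 0 \<and> deg gs y = - deg gs x"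
  then have "is_pairing gs (nat (- deg gs x)) (x, y)" by (auto simp: is_pairing_def before_def)
  then show "\<exists>k. is_pairing gs k (x, y)" ..
qed (auto simp: is_pairing_def before_def)

lemma ribbon_iff: "is_ribbon_path ls (gs, ps) \<longleftrightarrow> valid ls gs \<and> ps \<in> ppairs gs"
proof -
  have "(\<forall>p\<in>ps. \<exists>k. is_pairing gs k p) \<longleftrightarrow> (\<forall>(x, y)\<in>ps. x \<in> steps gs \<and> y \<in> steps gs \<and> before x y \<and> deg gs x < 0 \<and> deg gs y = - deg gs x)"
  proof (rule ball_cong[OF refl])
    fix p :: "step \<times> step"
    obtain x y where p: "p = (x, y)" by (cases p)
    show "(\<exists>k. is_pairing gs k p) \<longleftrightarrow> (case p of (x, y) \<Rightarrow> x \<in> steps gs \<and> y \<in> steps gs \<and> before x y \<and> deg gs x < 0 \<and> deg gs y = - deg gs x)"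
      unfolding p by (simp only: pairing_iff split_conv)
  qed
  then show ?thesis by (simp add: is_ribbon_path_def valid_def pairsets_def)
qed

definition Rib :: "nat list \<Rightarrow> ribbon_path set" where "Rib ls = {g. is_ribbon_path ls g}"

text \<open>The total degree of the unpaired downward jumps, which is the weight that the ribbon
  path takes away from the kernel.\<close>

definition Uw :: "ribbon_path \<Rightarrow> int" where
  "Uw = (\<lambda>(gs, ps). drop_weight (deg gs) (steps gs - pset ps))"

lemma pset_sum:
  assumes "ps \<in> pairsets R dg X" "finite X" "\<And>x. \<not> R x x"
  shows "sum f (pset ps) = (\<Sum>p\<in>ps. f (fst p) + f (snd p))"
proof -
  have fin: "finite ps" using finite_subset[OF pairsets_subset[OF assms(1)]] assms(2) by blast
  have neq: "fst p \<noteq> snd p" if "p \<in> ps" for p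
  proof
    have m: "(fst p, snd p) \<in> ps" using that by simp
    assume "fst p = snd p"
    moreover have "R (fst p) (snd p)" using pairsetsD[OF assms(1) m] by blast
    ultimately show False using assms(3)[of "fst p"] by simp
  qed
  have d: "{fst p, snd p} \<inter> {fst p', snd p'} = {}" if "p \<in> ps" "p' \<in> ps" "p \<noteq> p'" for p p'
    by (rule pairsets_disj[OF assms(1) that])
  have 1: "inj_on fst ps"
  proof (rule inj_onI, rule ccontr)
    fix p p' assume "p \<in> ps" "p' \<in> ps" "fst p = fst p'" "p \<noteq> p'"
    then show False using d[of p p'] by simp
  qed
  have 2: "inj_on snd ps"
  proof (rule inj_onI, rule ccontr)
    fix p p' assume "p \<in> ps" "p' \<in> ps" "snd p = snd p'" "p \<noteq> p'"
    then show False using d[of p p'] by simp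
  qed
  have 3: "fst ` ps \<inter> snd ` ps = {}"
  proof -
    have "fst p \<noteq> snd p'" if "p \<in> ps" "p' \<in> ps" for p p' using d[OF that] neq[OF that(1)] by (cases "p = p'") auto
    then show ?thesis by auto
  qed
  have "sum f (pset ps) = sum f (fst ` ps) + sum f (snd ` ps)"
    unfolding pset_def using fin 3 by (intro sum.union_disjoint) auto
  then show ?thesis by (simp add: sum.reindex[OF 1] sum.reindex[OF 2] sum.distrib)
qed

lemma card_pset:
  assumes "ps \<in> ppairs gs" shows "card (pset ps) = 2 * card ps"
  using pset_sum[OF assms finite_steps before_irrefl, of "\<lambda>_. 1 :: nat"] by simp

lemma finite_ppairs: "ps \<in> ppairs gs \<Longrightarrow> finite ps"
  by (rule finite_subset[OF pairsets_subset[of ps before "deg gs" "steps gs"]]) simp_all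

section \<open>Heights are bounded by the unpaired jumps\<close>

lemma site_sum:
  assumes "valid ls gs" "a < length ls" "i \<le> ls ! a"
  shows "(\<Sum>k<i. deg gs (a, k)) = int (gs ! a ! i)"
proof -
  have "(\<Sum>k<i. deg gs (a, k)) = int (gs ! a ! i) - int (gs ! a ! 0)"
    unfolding deg_def split_conv by (rule sum_lessThan_telescope)
  then show ?thesis using assms by (auto simp: valid_def is_sliding_path_def)
qed

text \<open>Every completed site returns to height 0, so all steps preceding a vertex, on whatever
  sites, add up to its height.\<close>

lemma initial_sum:
  assumes v: "valid ls gs" and a: "a < length ls" "i \<le> ls ! a"
  shows "(\<Sum>z | z \<in> steps gs \<and> before z (a, i). deg gs z) = int (gs ! a ! i)"
proof -
  have len: "length (gs ! b) - 1 = ls ! b" "length gs = length ls" "gs ! b ! (ls ! b) = 0" if "b < length ls" for b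
    using v that by (auto simp: valid_def is_sliding_path_def)
  have "{z. z \<in> steps gs \<and> before z (a, i)} = (SIGMA b:{..<a}. {..<ls ! b}) \<union> Pair a ` {..<i}"
    using a len by (auto simp: steps_Sigma before_def)
  then have "(\<Sum>z | z \<in> steps gs \<and> before z (a, i). deg gs z) = (\<Sum>z\<in>(SIGMA b:{..<a}. {..<ls ! b}). deg gs z) + (\<Sum>z\<in>Pair a ` {..<i}. deg gs z)"
    by (simp only:) (rule sum.union_disjoint, auto)
  also have "(\<Sum>z\<in>(SIGMA b:{..<a}. {..<ls ! b}). deg gs z) = (\<Sum>b<a. \<Sum>k<ls ! b. deg gs (b, k))"
    by (subst sum.Sigma) (auto intro!: sum.cong)
  also have "\<dots> = 0" using site_sum[OF v] len a by (intro sum.neutral) auto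
  also have "(\<Sum>z\<in>Pair a ` {..<i}. deg gs z) = (\<Sum>k<i. deg gs (a, k))"
    by (subst sum.reindex) (auto simp: inj_on_def)
  finally show ?thesis using site_sum[OF v a] by simp
qed

lemma total_sum: assumes v: "valid ls gs" shows "(\<Sum>z\<in>steps gs. deg gs z) = 0"
proof -
  have len: "length (gs ! b) - 1 = ls ! b" "gs ! b ! (ls ! b) = 0" if "b < length ls" for b
    using v that by (auto simp: valid_def is_sliding_path_def)
  have lg: "length gs = length ls" using v by (simp add: valid_def)
  have "(\<Sum>z\<in>steps gs. deg gs z) = (\<Sum>b<length ls. \<Sum>k<length (gs ! b) - 1. deg gs (b, k))"
    unfolding steps_Sigma lg by (subst sum.Sigma) (auto intro!: sum.cong)
  also have "\<dots> = 0" using site_sum[OF v] len by (intro sum.neutral) auto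
  finally show ?thesis .
qed

lemma card_steps: assumes "valid ls gs" shows "card (steps gs) = sum_list ls"
proof -
  have "card (steps gs) = (\<Sum>a<length gs. length (gs ! a) - 1)" unfolding steps_Sigma by (subst card_SigmaI) auto
  also have "\<dots> = (\<Sum>a<length ls. ls ! a)" using assms by (intro sum.cong) (auto simp: valid_def is_sliding_path_def)
  finally show ?thesis by (simp add: sum_list_sum_nth atLeast0LessThan)
qed

text \<open>In a pairing the downward step comes first. An initial segment therefore contains both
  members, the downward one or none, and a pair never contributes positively to the height.\<close>

lemma height_bound_up:
  assumes v: "valid ls gs" and ps: "ps \<in> ppairs gs" and Z: "Z \<subseteq> steps gs" "\<And>x y. before x y \<Longrightarrow> y \<in> Z \<Longrightarrow> x \<in> steps gs \<Longrightarrow> x \<in> Z"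
  shows "(\<Sum>z\<in>Z. deg gs z) \<le> (\<Sum>x | x \<in> steps gs - pset ps \<and> deg gs x > 0. deg gs x)"
proof -
  have finZ: "finite Z" by (rule finite_subset[OF Z(1) finite_steps])
  have sub: "pset ps \<subseteq> steps gs" by (rule pset_subset[OF ps])
  have "(\<Sum>z\<in>Z. deg gs z) = (\<Sum>z\<in>Z \<inter> pset ps. deg gs z) + (\<Sum>z\<in>Z - pset ps. deg gs z)"
    by (subst sum.union_disjoint[symmetric]) (use finZ in \<open>auto intro!: sum.cong\<close>)
  also have "(\<Sum>z\<in>Z \<inter> pset ps. deg gs z) = (\<Sum>z\<in>pset ps. if z \<in> Z then deg gs z else 0)"
    using finite_subset[OF sub] by (simp add: sum.inter_restrict[symmetric] Int_commute)
  also have "\<dots> = (\<Sum>p\<in>ps. (if fst p \<in> Z then deg gs (fst p) else 0) + (if snd p \<in> Z then deg gs (snd p) else 0))"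
    by (rule pset_sum[OF ps finite_steps before_irrefl])
  also have "\<dots> \<le> 0"
  proof (rule sum_nonpos)
    fix p assume "p \<in> ps"
    then have p: "fst p \<in> steps gs" "before (fst p) (snd p)" "deg gs (fst p) < 0" "deg gs (snd p) = - deg gs (fst p)"
      using pairsetsD[OF ps, of "fst p" "snd p"] by auto
    then show "(if fst p \<in> Z then deg gs (fst p) else 0) + (if snd p \<in> Z then deg gs (snd p) else 0) \<le> 0"
      using Z(2)[OF p(2)] by auto
  qed
  also have "(\<Sum>z\<in>Z - pset ps. deg gs z) \<le> (\<Sum>x | x \<in> Z - pset ps \<and> deg gs x > 0. deg gs x)"
  proof -
    have "(\<Sum>z\<in>Z - pset ps. deg gs z) \<le> (\<Sum>z\<in>Z - pset ps. if deg gs z > 0 then deg gs z else 0)"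
      by (rule sum_mono) auto
    also have "\<dots> = (\<Sum>x | x \<in> Z - pset ps \<and> deg gs x > 0. deg gs x)"
      using finZ by (subst sum.inter_filter[symmetric]) auto
    finally show ?thesis .
  qed
  also have "\<dots> \<le> (\<Sum>x | x \<in> steps gs - pset ps \<and> deg gs x > 0. deg gs x)"
    by (rule sum_mono2) (use Z(1) in auto)
  finally show ?thesis by simp
qed

text \<open>All degrees sum to 0 and so do those of each pair, hence unpaired upward and downward
  jumps balance.\<close>

lemma up_eq_down:
  assumes v: "valid ls gs" and ps: "ps \<in> ppairs gs"
  shows "(\<Sum>x | x \<in> steps gs - pset ps \<and> deg gs x > 0. deg gs x) = Uw (gs, ps)"
proof -
  have sub: "pset ps \<subseteq> steps gs" by (rule pset_subset[OF ps])
  have "(\<Sum>z\<in>pset ps. deg gs z) = (\<Sum>p\<in>ps. deg gs (fst p) + deg gs (snd p))"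
    by (rule pset_sum[OF ps finite_steps before_irrefl])
  also have "\<dots> = 0" using pairsetsD[OF ps] by (intro sum.neutral) auto
  finally have "(\<Sum>z\<in>steps gs - pset ps. deg gs z) = 0"
    using total_sum[OF v] sub by (simp add: sum_diff)
  moreover have "(\<Sum>z\<in>steps gs - pset ps. deg gs z) =
     (\<Sum>z\<in>steps gs - pset ps. (if deg gs z > 0 then deg gs z else 0) - (if deg gs z < 0 then - deg gs z else 0))"
    by (rule sum.cong) auto
  moreover have "\<dots> = (\<Sum>x | x \<in> steps gs - pset ps \<and> deg gs x > 0. deg gs x) - Uw (gs, ps)"
    unfolding sum_subtractf Uw_def split_conv drop_weight_def
    by (subst (1 2) sum.inter_filter[symmetric]) auto
  ultimately show ?thesis by simp
qed

lemma height_le_Uw: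
  assumes v: "valid ls gs" and ps: "ps \<in> ppairs gs" and a: "a < length ls" "i \<le> ls ! a"
  shows "int (gs ! a ! i) \<le> Uw (gs, ps)"
  unfolding initial_sum[OF v a, symmetric] up_eq_down[OF v ps, symmetric]
  by (rule height_bound_up[OF v ps]) (use before_trans in blast)+

lemma Uw_nonneg: "Uw g \<ge> 0"
  by (cases g) (auto simp: Uw_def drop_weight_def intro!: sum_nonneg)

lemma Rib_sites:
  assumes "(gs, ps) \<in> Rib ls" shows "gs \<in> sites (nat (Uw (gs, ps))) ls"
proof -
  have v: "valid ls gs" and ps: "ps \<in> ppairs gs" using assms by (auto simp: Rib_def ribbon_iff)
  have "set (gs ! a) \<subseteq> {..nat (Uw (gs, ps))}" if a: "a < length ls" for a
  proof
    fix x assume "x \<in> set (gs ! a)"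
    then obtain i where i: "i < length (gs ! a)" "x = gs ! a ! i" by (metis in_set_conv_nth)
    have "i \<le> ls ! a" using v a i(1) by (auto simp: valid_def is_sliding_path_def)
    then have "int x \<le> Uw (gs, ps)" using height_le_Uw[OF v ps a] i(2) by blast
    then show "x \<in> {..nat (Uw (gs, ps))}" by auto
  qed
  then show ?thesis using v by (simp add: sites_iff)
qed

lemma sites_mono: "D \<le> D' \<Longrightarrow> sites D ls \<subseteq> sites D' ls"
  by (auto simp: sites_iff) (meson atMost_iff le_trans subsetD)

lemma finite_Rib_level: "finite {g \<in> Rib ls. Uw g \<le> int n}"
proof (rule finite_subset)
  show "{g \<in> Rib ls. Uw g \<le> int n} \<subseteq> (SIGMA gs:sites n ls. ppairs gs)"
  proof clarify
    fix gs ps assume g: "(gs, ps) \<in> Rib ls" "Uw (gs, ps) \<le> int n"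
    then have "nat (Uw (gs, ps)) \<le> n" by simp
    then have "gs \<in> sites n ls" using Rib_sites[OF g(1)] sites_mono[of "nat (Uw (gs, ps))" n ls] by blast
    then show "gs \<in> sites n ls \<and> ps \<in> ppairs gs" using g(1) by (auto simp: Rib_def ribbon_iff)
  qed
  show "finite (SIGMA gs:sites n ls. ppairs gs)"
    by (intro finite_SigmaI finite_sites finite_pairsets finite_steps)
qed

lemma pairing_size_eq:
  assumes "ps \<in> ppairs gs" "p \<in> ps" shows "pairing_size gs p = nat (- deg gs (fst p))"
proof -
  obtain x y where p: "p = (x, y)" by (cases p)
  have "x \<in> steps gs \<and> y \<in> steps gs \<and> before x y \<and> deg gs x < 0 \<and> deg gs y = - deg gs x"
    using pairsetsD[OF assms(1), of x y] assms(2) p by auto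
  then show ?thesis
    unfolding pairing_size_def p by (intro the_equality) (auto simp: is_pairing_def before_def)
qed

lemma sum_list_card_slides: "valid ls gs \<Longrightarrow> card (slides gs) \<le> sum_list ls"
  using card_mono[of "steps gs" "slides gs"] card_steps[of ls gs] by (auto simp: slides_def)

lemma card_pairs_le: assumes "valid ls gs" "ps \<in> ppairs gs" shows "2 * card ps \<le> sum_list ls"
  using card_mono[OF finite_steps pset_subset[OF assms(2)]] card_pset[OF assms(2)] card_steps[OF assms(1)] by simp

section \<open>Counting ribbon paths\<close>

lemma card_sites: "card (sites D ls) \<le> (D + 1) ^ (sum_list ls + length ls)"
proof (induction ls)
  case (Cons l ls)
  have "card (paths D l 0) \<le> card {js. set js \<subseteq> {..D} \<and> length js = Suc l}"
    by (rule card_mono[OF finite_lists_length_eq]) (auto simp: paths_def)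
  also have "\<dots> = (D + 1) ^ Suc l" by (subst card_lists_length_eq) auto
  finally have p: "card (paths D l 0) \<le> (D + 1) ^ Suc l" .
  have "card (sites D (l # ls)) \<le> card (paths D l 0 \<times> sites D ls)"
    unfolding sites.simps by (intro card_image_le finite_cartesian_product finite_paths finite_sites)
  also have "\<dots> \<le> (D + 1) ^ Suc l * (D + 1) ^ (sum_list ls + length ls)"
    unfolding card_cartesian_product using p Cons by (rule mult_le_mono)
  also have "\<dots> = (D + 1) ^ (sum_list (l # ls) + length (l # ls))"
    unfolding power_add[symmetric] by (rule arg_cong[of _ _ "power (D + 1)"]) simp
  finally show ?case .
qed simp

text \<open>A crude count: a height of at most u for each vertex, and an arbitrary set of pairs of
  steps. It suffices that the bound is polynomial in u.\<close>

lemma card_Rib_eq: "card {g \<in> Rib ls. Uw g = int u} \<le> (u + 1) ^ (sum_list ls + length ls) * 2 ^ (sum_list ls * sum_list ls)"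
proof -
  define S where "S = (SIGMA a:{..<length ls}. {..<ls ! a})"
  have cS: "card S = sum_list ls" unfolding S_def by (subst card_SigmaI) (auto simp: sum_list_sum_nth atLeast0LessThan)
  have finS: "finite S" by (simp add: S_def)
  have "{g \<in> Rib ls. Uw g = int u} \<subseteq> sites u ls \<times> Pow (S \<times> S)"
  proof clarify
    fix gs ps assume g: "(gs, ps) \<in> Rib ls" "Uw (gs, ps) = int u"
    then have v: "valid ls gs" and ps: "ps \<in> ppairs gs" by (auto simp: Rib_def ribbon_iff)
    have "steps gs = S" unfolding S_def steps_Sigma using v by (auto simp: valid_def is_sliding_path_def)
    then show "gs \<in> sites u ls \<and> ps \<in> Pow (S \<times> S)" using Rib_sites[OF g(1)] g(2) pairsets_subset[OF ps] by auto
  qed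
  then have "card {g \<in> Rib ls. Uw g = int u} \<le> card (sites u ls \<times> Pow (S \<times> S))"
    using finS by (intro card_mono finite_cartesian_product finite_sites) auto
  also have "\<dots> = card (sites u ls) * 2 ^ (sum_list ls * sum_list ls)"
    using finS cS by (simp add: card_cartesian_product card_Pow)
  also have "\<dots> \<le> (u + 1) ^ (sum_list ls + length ls) * 2 ^ (sum_list ls * sum_list ls)"
    by (intro mult_le_mono1 card_sites)
  finally show ?thesis .
qed

text \<open>Write r as the (M + 1)-st power of s. Each of the M factors u + 1 is absorbed by one s^u
  at the cost of a constant, and one s^u is left for convergence.\<close>

lemma summable_poly_geometric:
  fixes r :: real assumes "0 < r" "r < 1" shows "summable (\<lambda>u. (real u + 1) ^ M * r ^ u)"
proof -
  define s where "s = root (Suc M) r"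
  have "s ^ Suc M = r" unfolding s_def by (rule real_root_pow_pos2) (use assms in auto)
  then have s: "0 < s" "s < 1" "s ^ Suc M = r" using assms by (auto simp: s_def real_root_lt_1_iff simp del: power_Suc)
  have b: "(real u + 1) * s ^ u \<le> 1 / (1 - s)" for u
  proof -
    have "(real u + 1) * s ^ u = (\<Sum>i\<le>u. s ^ u)" by simp
    also have "\<dots> \<le> (\<Sum>i\<le>u. s ^ i)" using s by (intro sum_mono power_decreasing) auto
    also have "\<dots> \<le> suminf (\<lambda>i. s ^ i)" using s by (intro sum_le_suminf summable_geometric) auto
    also have "\<dots> = 1 / (1 - s)" using s by (intro suminf_geometric) auto
    finally show ?thesis .
  qed
  show ?thesis
  proof (rule summable_comparison_test'[of "\<lambda>u. (1 / (1 - s)) ^ M * s ^ u" 0])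
    show "summable (\<lambda>u. (1 / (1 - s)) ^ M * s ^ u)" using s by (intro summable_mult summable_geometric) auto
    fix u
    have "r ^ u = (s ^ u) ^ M * s ^ u" using s(3) by (metis power_Suc2 power_mult mult.commute)
    then have "(real u + 1) ^ M * r ^ u = ((real u + 1) * s ^ u) ^ M * s ^ u" by (simp add: power_mult_distrib)
    also have "\<dots> \<le> (1 / (1 - s)) ^ M * s ^ u" using b[of u] s by (intro mult_right_mono power_mono) auto
    finally show "norm ((real u + 1) ^ M * r ^ u) \<le> (1 / (1 - s)) ^ M * s ^ u" using assms by simp
  qed
qed

context specs
begin

abbreviation "rw \<equiv> ribbon_weight Vout Vin"

definition cw :: "ribbon_path \<Rightarrow> complex" where
  "cw g = rw g * of_real h ^ card (snd g) * of_real e ^ card (slides (fst g))"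

lemma pset_paired: "pset ps = paired ps" by (simp add: pset_def paired_def)

lemma cw_eq:
  assumes "ps \<in> ppairs gs"
  shows "cw (gs, ps) = (\<Prod>js\<leftarrow>gs. slw e js) * pair_weight h (deg gs) ps * unp_weight Vout Vin (deg gs) (steps gs - pset ps)"
proof -
  have "pair_weight h (deg gs) ps = of_real h ^ card ps * (\<Prod>p\<in>ps. of_nat (pairing_size gs p))"
    unfolding pair_weight_def by (simp add: prod.distrib pairing_size_eq[OF assms] cong: prod.cong)
  moreover have "(\<Prod>js\<leftarrow>gs. slw e js) = of_real e ^ card (slides gs) * (\<Prod>x\<in>slides gs. of_nat (height gs x))"
    unfolding prod_slw by (simp add: prod.distrib)
  ultimately show ?thesis
    by (simp add: cw_def ribbon_weight_def unp_weight_def pset_paired)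
qed

lemma trace_ribbons:
  "evalp Vin (Tls e h n ls (kern h Vout (int n))) = (\<Sum>g | g \<in> Rib ls \<and> Uw g \<le> int n. cw g * \<kappa> (int n - Uw g))"
proof -
  have "evalp Vin (Tls e h n ls (kern h Vout (int n))) =
    (\<Sum>gs\<in>sites n ls. (\<Prod>js\<leftarrow>gs. slw e js) * evalp Vin (foldr (op h) (concat (map degs gs)) (kern h Vout (int n))))"
    by (simp add: Tls_sites evalp_sum evalp_mult)
  also have "\<dots> = (\<Sum>gs\<in>sites n ls. \<Sum>ps\<in>ppairs gs. cw (gs, ps) * \<kappa> (int n - Uw (gs, ps)))"
  proof (rule sum.cong)
    fix gs
    have "foldr (op h) (concat (map degs gs)) f = opl h (deg gs) (stepl gs (length gs)) f" for f
      unfolding map_deg_stepl[symmetric] by (simp add: opl_def foldr_map o_def)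
    then have "evalp Vin (foldr (op h) (concat (map degs gs)) (kern h Vout (int n))) =
      (\<Sum>ps\<in>ppairs gs. pair_weight h (deg gs) ps * unp_weight Vout Vin (deg gs) (steps gs - pset ps) * \<kappa> (int n - Uw (gs, ps)))"
      using wick[OF h distinct_stepl sorted_stepl before_asym, of Vin "deg gs" gs "length gs" Vout "int n"]
      by (simp add: set_stepl Uw_def)
    then show "(\<Prod>js\<leftarrow>gs. slw e js) * evalp Vin (foldr (op h) (concat (map degs gs)) (kern h Vout (int n))) =
       (\<Sum>ps\<in>ppairs gs. cw (gs, ps) * \<kappa> (int n - Uw (gs, ps)))"
      by (simp add: sum_distrib_left cw_eq mult.assoc)
  qed simp
  also have "\<dots> = (\<Sum>g\<in>(SIGMA gs:sites n ls. ppairs gs). cw g * \<kappa> (int n - Uw g))"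
    by (subst sum.Sigma) (auto simp: finite_sites finite_pairsets case_prod_unfold)
  also have "\<dots> = (\<Sum>g | g \<in> Rib ls \<and> Uw g \<le> int n. cw g * \<kappa> (int n - Uw g))"
  proof (rule sum.mono_neutral_right)
    show "finite (SIGMA gs:sites n ls. ppairs gs)"
      by (intro finite_SigmaI finite_sites finite_pairsets finite_steps)
    show "{g. g \<in> Rib ls \<and> Uw g \<le> int n} \<subseteq> (SIGMA gs:sites n ls. ppairs gs)"
    proof clarify
      fix gs ps assume g: "(gs, ps) \<in> Rib ls" "Uw (gs, ps) \<le> int n"
      then have "nat (Uw (gs, ps)) \<le> n" by simp
    then have "gs \<in> sites n ls" using Rib_sites[OF g(1)] sites_mono[of "nat (Uw (gs, ps))" n ls] by blast
      then show "gs \<in> sites n ls \<and> ps \<in> ppairs gs" using g(1) by (auto simp: Rib_def ribbon_iff)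
    qed
    show "\<forall>g\<in>(SIGMA gs:sites n ls. ppairs gs) - {g. g \<in> Rib ls \<and> Uw g \<le> int n}. cw g * \<kappa> (int n - Uw g) = 0"
    proof
      fix g assume g: "g \<in> (SIGMA gs:sites n ls. ppairs gs) - {g. g \<in> Rib ls \<and> Uw g \<le> int n}"
      then have "g \<in> Rib ls" by (auto simp: Rib_def ribbon_iff sites_iff)
      then have "int n - Uw g < 0" using g by auto
      then show "cw g * \<kappa> (int n - Uw g) = 0" by (simp add: kap_neg)
    qed
  qed
  finally show ?thesis .
qed

text \<open>The unpaired downward jumps have total degree u and yield r^u; the upward ones are only
  bounded. Sizes and slide heights are at most u. Using 1 + A and u + 1, which are at least 1,
  allows raising all exponents to the number of steps.\<close>

lemma rw_bound:
  assumes g: "g \<in> Rib ls" and u: "Uw g = int u"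
  shows "cmod (rw g) \<le> ((1 + A) ^ sum_list ls)\<^sup>2 * (real u + 1) ^ (2 * sum_list ls) * r ^ u"
proof -
  obtain gs ps where gp: "g = (gs, ps)" by fastforce
  have v: "valid ls gs" and ps: "ps \<in> ppairs gs" using g by (auto simp: gp Rib_def ribbon_iff)
  let ?L = "sum_list ls"
  let ?Z = "steps gs - paired ps"
  have ht: "gs ! a ! i \<le> u" if "a < length ls" "i \<le> ls ! a" for a i
    using height_le_Uw[OF v ps that] u by (simp add: gp)
  have st: "a < length ls \<and> Suc i \<le> ls ! a" if "(a, i) \<in> steps gs" for a i
    using that v by (auto simp: steps_def valid_def is_sliding_path_def)
  have u1: "1 \<le> real u + 1" by simp
  have P1: "cmod (\<Prod>p\<in>ps. of_nat (pairing_size gs p)) \<le> (real u + 1) ^ ?L"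
  proof -
    have "cmod (\<Prod>p\<in>ps. of_nat (pairing_size gs p)) \<le> (\<Prod>p\<in>ps. real u + 1)"
      unfolding prod_norm[symmetric]
    proof (rule prod_mono)
      fix p assume p: "p \<in> ps"
      obtain a i where ai: "fst p = (a, i)" by fastforce
      have "(fst p, snd p) \<in> ps" using p by simp
      then have "(a, i) \<in> steps gs" using pairsetsD[OF ps] ai by metis
      then have "gs ! a ! i \<le> u" using st[of a i] ht[of a i] by auto
      then have "nat (- deg gs (a, i)) \<le> u" by (simp add: deg_def)
      then show "0 \<le> norm (of_nat (pairing_size gs p) :: complex) \<and> norm (of_nat (pairing_size gs p) :: complex) \<le> real u + 1"
        by (simp add: pairing_size_eq[OF ps p] ai)
    qed
    also have "\<dots> \<le> (real u + 1) ^ ?L"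
      using card_pairs_le[OF v ps] by (simp add: power_increasing)
    finally show ?thesis .
  qed
  have P2: "cmod (\<Prod>x\<in>slides gs. of_nat (height gs x)) \<le> (real u + 1) ^ ?L"
  proof -
    have "cmod (\<Prod>x\<in>slides gs. of_nat (height gs x)) \<le> (\<Prod>x\<in>slides gs. real u + 1)"
      unfolding prod_norm[symmetric]
    proof (rule prod_mono)
      fix x assume x: "x \<in> slides gs"
      obtain a i where ai: "x = (a, i)" by fastforce
      have "(a, i) \<in> steps gs" using x ai by (simp add: slides_def)
      then have "gs ! a ! Suc i \<le> u" using st[of a i] ht[of a "Suc i"] by auto
      then show "0 \<le> norm (of_nat (height gs x) :: complex) \<and> norm (of_nat (height gs x) :: complex) \<le> real u + 1"
        by (simp add: height_def ai)
    qed
    also have "\<dots> \<le> (real u + 1) ^ ?L"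
      using sum_list_card_slides[OF v] by (simp add: power_increasing)
    finally show ?thesis .
  qed
  have cardZ: "card Y \<le> ?L" if "Y \<subseteq> steps gs" for Y
    using card_mono[OF finite_steps that] card_steps[OF v] by simp
  have P3: "cmod (\<Prod>x\<in>{x \<in> ?Z. deg gs x < 0}. cnj (Vout (nat (- deg gs x)))) \<le> (1 + A) ^ ?L * r ^ u"
  proof -
    let ?Y = "{x \<in> ?Z. deg gs x < 0}"
    have "cmod (\<Prod>x\<in>?Y. cnj (Vout (nat (- deg gs x)))) \<le> (\<Prod>x\<in>?Y. A * r ^ nat (- deg gs x))"
      unfolding prod_norm[symmetric] by (rule prod_mono) (use V(1) in auto)
    also have "\<dots> = A ^ card ?Y * r ^ (\<Sum>x\<in>?Y. nat (- deg gs x))" by (simp add: prod.distrib power_sum)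
    also have "(\<Sum>x\<in>?Y. nat (- deg gs x)) = u"
    proof -
      have "int (\<Sum>x\<in>?Y. nat (- deg gs x)) = (\<Sum>x\<in>?Y. - deg gs x)" unfolding of_nat_sum by (rule sum.cong) auto
      also have "\<dots> = int u" using u by (simp add: gp Uw_def drop_weight_def pset_paired)
      finally show ?thesis by (simp only: of_nat_eq_iff)
    qed
    also have "A ^ card ?Y \<le> (1 + A) ^ ?L"
    proof -
      have "A ^ card ?Y \<le> (1 + A) ^ card ?Y" using A by (intro power_mono) auto
      also have "\<dots> \<le> (1 + A) ^ ?L" using A cardZ[of ?Y] by (intro power_increasing) auto
      finally show ?thesis .
    qed
    finally show ?thesis using r by (simp add: mult_right_mono)
  qed
  have P4: "cmod (\<Prod>x\<in>{x \<in> ?Z. deg gs x > 0}. Vin (nat (deg gs x))) \<le> (1 + A) ^ ?L"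
  proof -
    let ?Y = "{x \<in> ?Z. deg gs x > 0}"
    have "cmod (\<Prod>x\<in>?Y. Vin (nat (deg gs x))) \<le> (\<Prod>x\<in>?Y. 1 + A)"
      unfolding prod_norm[symmetric]
    proof (rule prod_mono)
      fix x assume x: "x \<in> ?Y"
      have "cmod (Vin (nat (deg gs x))) \<le> A * r ^ nat (deg gs x)" using x by (intro V(2)) auto
      also have "\<dots> \<le> A * 1" using A r by (intro mult_left_mono power_le_one) auto
      finally show "0 \<le> cmod (Vin (nat (deg gs x))) \<and> cmod (Vin (nat (deg gs x))) \<le> 1 + A" by simp
    qed
    also have "\<dots> \<le> (1 + A) ^ ?L" using A cardZ[of ?Y] by (simp add: power_increasing)
    finally show ?thesis .
  qed
  have pos: "0 \<le> (real u + 1) ^ ?L" "0 \<le> (1 + A) ^ ?L" "0 \<le> (1 + A) ^ ?L * r ^ u" using A r by auto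
  have "cmod (rw g) \<le> ((real u + 1) ^ ?L * (real u + 1) ^ ?L) * ((1 + A) ^ ?L * r ^ u) * (1 + A) ^ ?L"
    unfolding gp ribbon_weight_def split_conv norm_mult
    by (intro mult_mono P1 P2 P3 P4 mult_nonneg_nonneg norm_ge_zero pos)
  also have "\<dots> = ((1 + A) ^ ?L)\<^sup>2 * (real u + 1) ^ (2 * ?L) * r ^ u"
    unfolding power2_eq_square mult_2 power_add by (simp only: mult_ac)
  finally show ?thesis .
qed

text \<open>Group by u = \<open>Uw\<close>: polynomially many ribbon paths, each with a weight of
  polynomial size times r^u.\<close>

lemma rw_abs_summable: "(\<lambda>g. cmod (rw g)) summable_on Rib ls"
proof -
  let ?L = "sum_list ls"
  define C where "C = ((1 + A) ^ ?L)\<^sup>2 * 2 ^ (?L * ?L)"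
  define M where "M = 2 * ?L + (?L + length ls)"
  define b where "b u = C * ((real u + 1) ^ M * r ^ u)" for u
  have sb: "summable b" unfolding b_def by (intro summable_mult summable_poly_geometric r)
  have b0: "b u \<ge> 0" for u using A r by (simp add: b_def C_def)
  show ?thesis
  proof (rule nonneg_bdd_above_summable_on)
    show "bdd_above (sum (\<lambda>g. cmod (rw g)) ` {F. F \<subseteq> Rib ls \<and> finite F})"
    proof (rule bdd_aboveI2)
      fix F assume F: "F \<in> {F. F \<subseteq> Rib ls \<and> finite F}"
      define N where "N = (\<lambda>g. nat (Uw g)) ` F"
      have finN: "finite N" using F by (simp add: N_def)
      have level: "(\<Sum>g | g \<in> F \<and> nat (Uw g) = u. cmod (rw g)) \<le> b u" for u
      proof -
        let ?R = "{g \<in> Rib ls. Uw g = int u}"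
        have finR: "finite ?R" by (rule finite_subset[OF _ finite_Rib_level[of ls u]]) auto
        have "(\<Sum>g | g \<in> F \<and> nat (Uw g) = u. cmod (rw g)) \<le> (\<Sum>g\<in>?R. cmod (rw g))"
          by (rule sum_mono2[OF finR]) (use F Uw_nonneg in auto)
        also have "\<dots> \<le> (\<Sum>g\<in>?R. ((1 + A) ^ ?L)\<^sup>2 * (real u + 1) ^ (2 * ?L) * r ^ u)"
          by (rule sum_mono) (use rw_bound in auto)
        also have "\<dots> = real (card ?R) * (((1 + A) ^ ?L)\<^sup>2 * (real u + 1) ^ (2 * ?L) * r ^ u)" by simp
        also have "\<dots> \<le> ((real u + 1) ^ (?L + length ls) * 2 ^ (?L * ?L)) * (((1 + A) ^ ?L)\<^sup>2 * (real u + 1) ^ (2 * ?L) * r ^ u)"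
        proof (rule mult_right_mono)
          have "real (card ?R) \<le> real ((u + 1) ^ (?L + length ls) * 2 ^ (?L * ?L))" using card_Rib_eq of_nat_le_iff by blast
          then show "real (card ?R) \<le> (real u + 1) ^ (?L + length ls) * 2 ^ (?L * ?L)" by (simp add: add.commute)
        qed (use A r in simp)
        also have "\<dots> = b u" by (simp only: b_def C_def M_def power_add mult_ac)
        finally show ?thesis .
      qed
      have "sum (\<lambda>g. cmod (rw g)) F = (\<Sum>u\<in>N. \<Sum>g | g \<in> F \<and> nat (Uw g) = u. cmod (rw g))"
        unfolding N_def using F by (intro sum.image_gen) auto
      also have "\<dots> \<le> (\<Sum>u\<in>N. b u)" by (rule sum_mono[OF level])
      also have "\<dots> \<le> suminf b" by (rule sum_le_suminf[OF sb finN]) (use b0 in auto)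
      finally show "sum (\<lambda>g. cmod (rw g)) F \<le> suminf b" .
    qed
  qed simp
qed

lemma cw_abs_summable: "(\<lambda>g. cmod (cw g)) summable_on Rib ls"
proof (rule summable_on_comparison_test)
  let ?L = "sum_list ls"
  show "(\<lambda>g. ((1 + h) ^ ?L * (1 + \<bar>e\<bar>) ^ ?L) * cmod (rw g)) summable_on Rib ls"
    by (intro summable_on_cmult_right rw_abs_summable)
  fix g assume g: "g \<in> Rib ls"
  obtain gs ps where gp: "g = (gs, ps)" by fastforce
  have v: "valid ls gs" and ps: "ps \<in> ppairs gs" using g by (auto simp: gp Rib_def ribbon_iff)
  have "h ^ card ps \<le> (1 + h) ^ card ps" using h by (intro power_mono) auto
  also have "\<dots> \<le> (1 + h) ^ ?L" using h card_pairs_le[OF v ps] by (intro power_increasing) auto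
  finally have 1: "h ^ card ps \<le> (1 + h) ^ ?L" .
  have "\<bar>e\<bar> ^ card (slides gs) \<le> (1 + \<bar>e\<bar>) ^ card (slides gs)" by (intro power_mono) auto
  also have "\<dots> \<le> (1 + \<bar>e\<bar>) ^ ?L" using sum_list_card_slides[OF v] by (intro power_increasing) auto
  finally have 2: "\<bar>e\<bar> ^ card (slides gs) \<le> (1 + \<bar>e\<bar>) ^ ?L" .
  have "cmod (cw g) = cmod (rw g) * (h ^ card ps * \<bar>e\<bar> ^ card (slides gs))"
    using h by (simp add: cw_def gp norm_mult norm_power)
  also have "\<dots> \<le> cmod (rw g) * ((1 + h) ^ ?L * (1 + \<bar>e\<bar>) ^ ?L)"
    using h by (intro mult_left_mono mult_mono 1 2) auto
  finally show "cmod (cw g) \<le> ((1 + h) ^ ?L * (1 + \<bar>e\<bar>) ^ ?L) * cmod (rw g)" by (simp add: mult.commute)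
qed simp

text \<open>Interchange the sums over weights n and ribbon paths g. For fixed g the substitution n =
  d + \<open>Uw g\<close> leaves the sum of all \<kappa> d, which is \<open>Z\<close> for every
  g.\<close>

lemma trace_sum:
  defines "a \<equiv> \<lambda>ls n. evalp Vin (Tls e h n ls (kern h Vout (int n)))"
  shows "(\<lambda>n. cmod (a ls n)) summable_on UNIV" and "infsum (a ls) UNIV = infsum cw (Rib ls) * Z"
proof -
  define F where "F g n = (if Uw g \<le> int n then cw g * \<kappa> (int n - Uw g) else 0)" for g and n :: nat
  have shift: "bij_betw (\<lambda>d. d + nat (Uw g)) UNIV {n. Uw g \<le> int n}" for g
    by (rule bij_betwI[of _ _ _ "\<lambda>n. n - nat (Uw g)"]) (use Uw_nonneg[of g] in auto)
  have k1: "(\<lambda>d. cmod (\<kappa> (int d))) summable_on UNIV"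
    using kap_sum(1) by (intro norm_summable_imp_summable_on) simp
  have ki: "infsum (\<lambda>d. \<kappa> (int d)) UNIV = Z"
    using norm_summable_imp_has_sum[OF kap_sum(1)] kap_sum(2) summable_norm_cancel[OF kap_sum(1)]
    by (metis infsumI summable_sums)
  have Fi: "(\<lambda>n. cmod (F g n)) summable_on UNIV" "infsum (\<lambda>n. F g n) UNIV = cw g * Z"
    "infsum (\<lambda>n. cmod (F g n)) UNIV = cmod (cw g) * infsum (\<lambda>d. cmod (\<kappa> (int d))) UNIV" for g
  proof -
    have Fd: "F g (d + nat (Uw g)) = cw g * \<kappa> (int d)" for d using Uw_nonneg[of g] by (simp add: F_def)
    have "(\<lambda>d. cmod (cw g) * cmod (\<kappa> (int d))) summable_on UNIV" by (intro summable_on_cmult_right k1)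
    then have "(\<lambda>d. cmod (F g (d + nat (Uw g)))) summable_on UNIV" by (simp add: Fd norm_mult)
    then have "(\<lambda>n. cmod (F g n)) summable_on {n. Uw g \<le> int n}"
      using summable_on_reindex_bij_betw[OF shift, of "\<lambda>n. cmod (F g n)"] by blast
    then show "(\<lambda>n. cmod (F g n)) summable_on UNIV"
      by (rule summable_on_cong_neutral[THEN iffD1, rotated 3]) (auto simp: F_def)
    have "infsum (\<lambda>n. F g n) UNIV = infsum (\<lambda>n. F g n) {n. Uw g \<le> int n}"
      by (rule infsum_cong_neutral) (auto simp: F_def)
    also have "\<dots> = infsum (\<lambda>d. cw g * \<kappa> (int d)) UNIV"
      using infsum_reindex_bij_betw[OF shift[of g], of "F g"] by (simp add: Fd)
    finally show "infsum (\<lambda>n. F g n) UNIV = cw g * Z" by (simp add: infsum_cmult_right' ki)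
    have "infsum (\<lambda>n. cmod (F g n)) UNIV = infsum (\<lambda>n. cmod (F g n)) {n. Uw g \<le> int n}"
      by (rule infsum_cong_neutral) (auto simp: F_def)
    also have "\<dots> = infsum (\<lambda>d. cmod (cw g) * cmod (\<kappa> (int d))) UNIV"
      using infsum_reindex_bij_betw[OF shift[of g], of "\<lambda>n. cmod (F g n)"] by (simp add: Fd norm_mult)
    finally show "infsum (\<lambda>n. cmod (F g n)) UNIV = cmod (cw g) * infsum (\<lambda>d. cmod (\<kappa> (int d))) UNIV"
      by (simp add: infsum_cmult_right')
  qed
  have joint: "(\<lambda>x. norm (case x of (g, n) \<Rightarrow> F g n)) summable_on Rib ls \<times> UNIV"
    unfolding Infinite_Sum.abs_summable_on_Sigma_iff split_conv
  proof (intro conjI ballI)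
    show "(\<lambda>n. cmod (F g n)) summable_on UNIV" for g using Fi(1) .
    have "(\<lambda>g. cmod (cw g) * infsum (\<lambda>d. cmod (\<kappa> (int d))) UNIV) summable_on Rib ls"
      by (intro summable_on_cmult_left cw_abs_summable)
    then show "(\<lambda>g. norm (\<Sum>\<^sub>\<infinity>n\<in>UNIV. cmod (F g n))) summable_on Rib ls"
      unfolding Fi(3) by (simp add: abs_mult infsum_nonneg)
  qed
  have joint': "(\<lambda>x. norm (case x of (n, g) \<Rightarrow> F g n)) summable_on UNIV \<times> Rib ls"
  proof -
    have bij: "bij_betw prod.swap (UNIV \<times> Rib ls) (Rib ls \<times> (UNIV :: nat set))"
      by (rule bij_betwI[of _ _ _ prod.swap]) auto
    have "(\<lambda>x. cmod (case prod.swap x of (g, n) \<Rightarrow> F g n)) summable_on UNIV \<times> Rib ls"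
      using summable_on_reindex_bij_betw[OF bij, of "\<lambda>x. cmod (case x of (g, n) \<Rightarrow> F g n)"] joint by simp
    then show ?thesis by (simp add: case_prod_unfold)
  qed
  have an: "a ls n = infsum (\<lambda>g. F g n) (Rib ls)" for n
  proof -
    have "infsum (\<lambda>g. F g n) (Rib ls) = infsum (\<lambda>g. cw g * \<kappa> (int n - Uw g)) {g. g \<in> Rib ls \<and> Uw g \<le> int n}"
      by (rule infsum_cong_neutral) (auto simp: F_def)
    also have "\<dots> = a ls n" using finite_Rib_level[of ls n] by (simp add: a_def trace_ribbons)
    finally show ?thesis ..
  qed
  show "(\<lambda>n. cmod (a ls n)) summable_on UNIV"
  proof (rule summable_on_comparison_test)
    show "(\<lambda>n. infsum (\<lambda>g. cmod (F g n)) (Rib ls)) summable_on UNIV"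
      using joint' unfolding Infinite_Sum.abs_summable_on_Sigma_iff by (simp add: infsum_nonneg)
    fix n
    have "(\<lambda>g. cmod (F g n)) summable_on Rib ls" using joint' unfolding Infinite_Sum.abs_summable_on_Sigma_iff by simp
    then show "cmod (a ls n) \<le> infsum (\<lambda>g. cmod (F g n)) (Rib ls)" unfolding an by (rule norm_infsum_bound)
  qed simp
  have "infsum (a ls) UNIV = infsum (\<lambda>n. infsum (\<lambda>g. F g n) (Rib ls)) UNIV" unfolding an ..
  also have "\<dots> = infsum (\<lambda>g. infsum (\<lambda>n. F g n) UNIV) (Rib ls)"
    by (rule infsum_swap_banach) (rule abs_summable_summable[OF joint'])
  also have "\<dots> = infsum cw (Rib ls) * Z" unfolding Fi(2) by (simp add: infsum_cmult_left')
  finally show "infsum (a ls) UNIV = infsum cw (Rib ls) * Z" .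
qed

end


section \<open>Moments of the Jack measure\<close>

lemma infsum_finite_Union:
  fixes f :: "'a \<Rightarrow> complex"
  assumes "finite I" "\<And>i. i \<in> I \<Longrightarrow> f summable_on A i" "\<And>i j. i \<in> I \<Longrightarrow> j \<in> I \<Longrightarrow> i \<noteq> j \<Longrightarrow> A i \<inter> A j = {}"
  shows "f summable_on (\<Union>i\<in>I. A i) \<and> infsum f (\<Union>i\<in>I. A i) = (\<Sum>i\<in>I. infsum f (A i))"
  using assms
proof (induction I)
  case (insert i I)
  have d: "A i \<inter> (\<Union>j\<in>I. A j) = {}" using insert.prems(2)[of i] insert.hyps(2) by auto
  have IH: "f summable_on (\<Union>i\<in>I. A i) \<and> infsum f (\<Union>i\<in>I. A i) = (\<Sum>i\<in>I. infsum f (A i))"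
    using insert by auto
  have i: "f summable_on A i" using insert.prems by auto
  have "f summable_on A i \<union> (\<Union>i\<in>I. A i)" using i IH d by (intro summable_on_Un_disjoint) auto
  moreover have "infsum f (A i \<union> (\<Union>i\<in>I. A i)) = infsum f (A i) + infsum f (\<Union>i\<in>I. A i)"
    using i IH d by (intro infsum_Un_disjoint) auto
  ultimately show ?case using IH insert.hyps by simp
qed simp

lemma infsum_times:
  fixes f :: "'a \<Rightarrow> complex" and g :: "'b \<Rightarrow> complex"
  assumes f: "(\<lambda>x. cmod (f x)) summable_on A" and g: "(\<lambda>x. cmod (g x)) summable_on B"
  shows "infsum (\<lambda>(x, y). f x * g y) (A \<times> B) = infsum f A * infsum g B"
proof -
  have "(\<lambda>z. norm (case z of (x, y) \<Rightarrow> f x * g y)) summable_on A \<times> B"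
    unfolding Infinite_Sum.abs_summable_on_Sigma_iff split_conv
  proof (intro conjI ballI)
    fix x
    show "(\<lambda>y. cmod (f x * g y)) summable_on B" unfolding norm_mult by (intro summable_on_cmult_right g)
  next
    have "(\<lambda>x. cmod (f x) * infsum (\<lambda>y. cmod (g y)) B) summable_on A" by (intro summable_on_cmult_left f)
    then show "(\<lambda>x. norm (\<Sum>\<^sub>\<infinity>y\<in>B. cmod (f x * g y))) summable_on A"
      by (simp add: norm_mult infsum_cmult_right' abs_mult infsum_nonneg)
  qed
  then have "infsum (\<lambda>(x, y). f x * g y) (A \<times> B) = (\<Sum>\<^sub>\<infinity>x\<in>A. \<Sum>\<^sub>\<infinity>y\<in>B. f x * g y)"
    using infsum_Sigma_banach[OF abs_summable_summable, of "\<lambda>(x, y). f x * g y" A "\<lambda>_. B"] by simp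
  then show ?thesis by (simp add: infsum_cmult_right' infsum_cmult_left')
qed

locale jack_spec = specs +
  assumes jack: "defines_jack_measure e h Vout Vin"
begin

definition X :: "nat list \<Rightarrow> int_partition \<Rightarrow> real" where "X ls l = (\<Prod>k\<leftarrow>ls. T_up e h l k)"
definition wr :: "int_partition \<Rightarrow> real" where "wr l = Re (jack_weight e h Vout Vin l)"

lemma wr: "jack_weight e h Vout Vin l = of_real (wr l)" "wr l \<ge> 0"
proof -
  have "jack_weight e h Vout Vin l \<in> \<real>\<^sub>\<ge>\<^sub>0" using jack by (simp add: defines_jack_measure_def)
  then obtain x where "jack_weight e h Vout Vin l = of_real x" "x \<ge> 0" by (auto elim: nonneg_Reals_cases)
  then show "jack_weight e h Vout Vin l = of_real (wr l)" "wr l \<ge> 0" by (simp_all add: wr_def)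
qed

lemma trace_X:
  "evalp Vin (Tls e h n ls (kern h Vout (int n))) = of_real (\<Sum>l | psize l = n. X ls l * wr l)"
  by (simp add: trace_formula[OF h] X_def wr)

text \<open>For nonnegative terms a finite set of partitions is dominated by full weight levels, and
  the level sums are summable as traces.\<close>

lemma X_nonneg_summable:
  assumes "\<And>l. X ls l \<ge> 0" shows "(\<lambda>l. X ls l * wr l) summable_on UNIV"
proof (rule nonneg_bdd_above_summable_on)
  let ?a = "\<lambda>n. \<Sum>l | psize l = n. X ls l * wr l"
  have nn: "X ls l * wr l \<ge> 0" for l using assms wr(2) by simp
  have a0: "?a n \<ge> 0" for n by (rule sum_nonneg) (use nn in auto)
  have sa: "?a summable_on UNIV"
    using trace_sum(1)[of ls] unfolding trace_X norm_of_real by (simp add: a0)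
  show "bdd_above (sum (\<lambda>l. X ls l * wr l) ` {F. F \<subseteq> UNIV \<and> finite F})"
  proof (rule bdd_aboveI2)
    fix F :: "int_partition set" assume F: "F \<in> {F. F \<subseteq> UNIV \<and> finite F}"
    have "sum (\<lambda>l. X ls l * wr l) F = (\<Sum>n\<in>psize ` F. \<Sum>l | l \<in> F \<and> psize l = n. X ls l * wr l)"
      using F by (intro sum.image_gen) auto
    also have "\<dots> \<le> (\<Sum>n\<in>psize ` F. ?a n)"
      by (intro sum_mono sum_mono2 finite_psize) (use nn in auto)
    also have "\<dots> \<le> infsum ?a UNIV"
      by (rule finite_sum_le_infsum[OF sa]) (use F a0 in auto)
    finally show "sum (\<lambda>l. X ls l * wr l) F \<le> infsum ?a UNIV" .
  qed
qed (use assms wr(2) in simp)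

text \<open>\<open>X ls\<close> may change sign, but its square is the nonnegative \<open>X (ls @ ls)\<close>, to which the trace formula applies as well.\<close>

lemma X_abs_summable: "(\<lambda>l. \<bar>X ls l\<bar> * wr l) summable_on UNIV"
proof (rule summable_on_comparison_test)
  have "(\<lambda>l. X [] l * wr l) summable_on UNIV" "(\<lambda>l. X (ls @ ls) l * wr l) summable_on UNIV"
    by (rule X_nonneg_summable, simp add: X_def)+
  then show "(\<lambda>l. X [] l * wr l + X (ls @ ls) l * wr l) summable_on UNIV" by (rule summable_on_add)
  fix l
  have "\<bar>X ls l\<bar> \<le> 1 + (X ls l)\<^sup>2"
  proof (cases "\<bar>X ls l\<bar> \<le> 1")
    case False
    then have "\<bar>X ls l\<bar> * 1 \<le> \<bar>X ls l\<bar> * \<bar>X ls l\<bar>" by (intro mult_left_mono) auto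
    then show ?thesis by (simp add: power2_eq_square)
  qed (simp add: add_increasing2)
  also have "\<dots> = X [] l + X (ls @ ls) l" by (simp add: X_def power2_eq_square)
  finally have "\<bar>X ls l\<bar> * wr l \<le> (X [] l + X (ls @ ls) l) * wr l" using wr(2) by (intro mult_right_mono)
  then show "\<bar>X ls l\<bar> * wr l \<le> X [] l * wr l + X (ls @ ls) l * wr l" by (simp add: distrib_right)
qed (use wr(2) in simp)

lemma X_infsum: "of_real (infsum (\<lambda>l. X ls l * wr l) UNIV) = infsum cw (Rib ls) * Z"
proof -
  let ?f = "\<lambda>l. X ls l * wr l"
  let ?S = "SIGMA n:UNIV. {l. psize l = n}"
  have bij: "bij_betw (\<lambda>l. (psize l, l)) UNIV ?S"
    by (rule bij_betwI[of _ _ _ snd]) auto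
  have "(\<lambda>l. norm (?f l)) summable_on UNIV" using X_abs_summable[of ls] wr(2) by (simp add: abs_mult)
  then have sf: "?f summable_on UNIV" by (rule abs_summable_summable)
  then have "(\<lambda>x. ?f (snd x)) summable_on ?S"
    using summable_on_reindex_bij_betw[OF bij, of "\<lambda>x. ?f (snd x)"] by simp
  then have "infsum (\<lambda>n. infsum ?f {l. psize l = n}) UNIV = infsum (\<lambda>x. ?f (snd x)) ?S"
    using infsum_Sigma_banach[of "\<lambda>x. ?f (snd x)" UNIV "\<lambda>n. {l. psize l = n}"] by simp
  also have "\<dots> = infsum ?f UNIV" using infsum_reindex_bij_betw[OF bij, of "\<lambda>x. ?f (snd x)"] by simp
  finally have eq: "infsum ?f UNIV = infsum (\<lambda>n. \<Sum>l | psize l = n. ?f l) UNIV"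
    by (simp add: finite_psize)
  have "of_real (infsum ?f UNIV) = infsum (\<lambda>n. complex_of_real (\<Sum>l | psize l = n. ?f l)) UNIV"
  proof -
    have "(\<lambda>n. cmod (evalp Vin (Tls e h n ls (kern h Vout (int n))))) summable_on UNIV" by (rule trace_sum(1))
    then have "(\<lambda>n. norm (\<Sum>l | psize l = n. ?f l)) summable_on UNIV" unfolding trace_X norm_of_real real_norm_def .
    then have "(\<lambda>n. \<Sum>l | psize l = n. ?f l) summable_on UNIV" by (rule abs_summable_summable)
    then have "((\<lambda>n. \<Sum>l | psize l = n. ?f l) has_sum infsum (\<lambda>n. \<Sum>l | psize l = n. ?f l) UNIV) UNIV" by (rule has_sum_infsum)
    then have "((\<lambda>n. complex_of_real (\<Sum>l | psize l = n. ?f l)) has_sum of_real (infsum (\<lambda>n. \<Sum>l | psize l = n. ?f l) UNIV)) UNIV"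
      by (rule has_sum_of_real)
    then show ?thesis unfolding eq by (rule infsumI[symmetric])
  qed
  then show ?thesis using trace_sum(2)[of ls] unfolding trace_X by simp
qed

lemma Rib_Nil: "Rib [] = {([], {})}"
proof -
  have st: "steps [] = {}" by (simp add: steps_def)
  have "ps \<in> ppairs [] \<longleftrightarrow> ps = {}" for ps
    using pairsets_subset[of ps before "deg []" "steps []"] by (auto simp: st pairsets_def)
  moreover have "valid [] gs \<longleftrightarrow> gs = []" for gs by (simp add: valid_def)
  ultimately have "is_ribbon_path [] (gs, ps) \<longleftrightarrow> (gs, ps) = ([], {})" for gs ps unfolding ribbon_iff by (cases "gs = []") auto
  then show ?thesis unfolding Rib_def by (intro set_eqI) (metis mem_Collect_eq singleton_iff surj_pair)
qed

definition z :: real where "z = infsum wr UNIV"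

text \<open>The empty list of lengths has a single ribbon path, of weight 1, so \<open>Z\<close> is
  the total mass of the unnormalized weights. It is an exponential, hence nonzero, and this makes
  the mass positive.\<close>

lemma Z_z: "Z = of_real z" and z_pos: "z > 0"
proof -
  have c: "cw ([], {}) = 1" by (simp add: cw_def ribbon_weight_def slides_def steps_def)
  have "of_real (infsum (\<lambda>l. X [] l * wr l) UNIV) = infsum cw (Rib []) * Z" by (rule X_infsum)
  then show "Z = of_real z" by (simp add: Rib_Nil c z_def X_def)
  have "z \<ge> 0" unfolding z_def by (rule infsum_nonneg) (rule wr(2))
  moreover have "z \<noteq> 0" using Z_nz \<open>Z = of_real z\<close> by auto
  ultimately show "z > 0" by simp
qed

lemma jack_prob_eq: "Re (jack_prob e h Vout Vin l) = wr l / z"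
proof -
  have "jack_prob e h Vout Vin l = of_real (wr l) / Z"
    by (simp add: jack_prob_def wr(1) Z_def exp_minus field_simps)
  also have "\<dots> = of_real (wr l / z)" by (simp add: Z_z)
  finally show ?thesis by simp
qed

abbreviation "J \<equiv> jack_measure e h Vout Vin"

theorem moment:
  shows "integrable J (X ls)" and "complex_of_real (LINT l|J. X ls l) = infsum cw (Rib ls)"
proof -
  let ?g = "\<lambda>l. wr l / z"
  have J: "J = density (count_space UNIV) (\<lambda>l. ennreal (?g l))"
    unfolding jack_measure_def jack_prob_eq ..
  have g0: "?g l \<ge> 0" for l using wr(2) z_pos by simp
  let ?F = "\<lambda>l. ?g l *\<^sub>R X ls l"
  have "(\<lambda>l. (1 / z) * (\<bar>X ls l\<bar> * wr l)) summable_on UNIV" by (intro summable_on_cmult_right X_abs_summable)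
  moreover have "(1 / z) * (\<bar>X ls l\<bar> * wr l) = norm (?F l)" for l
    using z_pos wr(2) by (simp add: abs_mult)
  ultimately have "(\<lambda>l. norm (?F l)) summable_on UNIV" by simp
  then have abs: "Infinite_Set_Sum.abs_summable_on ?F UNIV" using abs_summable_equivalent by blast
  then have int: "integrable (count_space UNIV) ?F" by (simp add: Infinite_Set_Sum.abs_summable_on_def)
  show "integrable J (X ls)"
    unfolding J using int g0 by (subst integrable_density) auto
  have "(LINT l|J. X ls l) = (LINT l|count_space UNIV. ?F l)"
    unfolding J using g0 by (subst integral_density) auto
  also have "\<dots> = infsetsum ?F UNIV" by (simp add: infsetsum_def)
  also have "\<dots> = infsum ?F UNIV" by (rule infsetsum_infsum[OF abs])
  also have "?F = (\<lambda>l. (1 / z) * (X ls l * wr l))" by (rule ext) simp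
  also have "infsum \<dots> UNIV = (1 / z) * infsum (\<lambda>l. X ls l * wr l) UNIV" by (rule infsum_cmult_right')
  finally have "complex_of_real (LINT l|J. X ls l) = (1 / of_real z) * of_real (infsum (\<lambda>l. X ls l * wr l) UNIV)"
    by (simp only: of_real_mult of_real_divide of_real_1)
  then show "complex_of_real (LINT l|J. X ls l) = infsum cw (Rib ls)"
    using z_pos unfolding X_infsum Z_z by simp
qed

lemma T_up_0: "T_up e h l 0 = 1" by (simp add: T_up_eq[OF h])

end

context specs
begin

lemma rw_summable: "R \<subseteq> Rib ls \<Longrightarrow> rw summable_on R"
  using summable_on_subset_banach[OF abs_summable_summable[OF rw_abs_summable]] .

lemma cw_summable: "R \<subseteq> Rib ls \<Longrightarrow> cw summable_on R"
  using summable_on_subset_banach[OF abs_summable_summable[OF cw_abs_summable]] .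

lemma ribbon_paths_Rib: "ribbon_paths ls q m \<subseteq> Rib ls"
  by (auto simp: ribbon_paths_def Rib_def)

lemma Rib_bounds:
  assumes "g \<in> Rib ls" shows "card (snd g) \<le> sum_list ls div 2" "card (slides (fst g)) \<le> sum_list ls"
proof -
  obtain gs ps where g: "g = (gs, ps)" by fastforce
  have v: "valid ls gs" and ps: "ps \<in> ppairs gs" using assms by (auto simp: g Rib_def ribbon_iff)
  show "card (snd g) \<le> sum_list ls div 2" using card_pairs_le[OF v ps] by (simp add: g)
  show "card (slides (fst g)) \<le> sum_list ls" using sum_list_card_slides[OF v] by (simp add: g)
qed

lemma infsum_cw_level:
  assumes "R \<subseteq> Rib ls" "\<And>g. g \<in> R \<Longrightarrow> card (snd g) = q \<and> card (slides (fst g)) = m"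
  shows "infsum cw R = infsum rw R * of_real h ^ q * of_real e ^ m"
proof -
  have "infsum cw R = infsum (\<lambda>g. rw g * (of_real h ^ q * of_real e ^ m)) R"
    by (rule infsum_cong) (use assms(2) in \<open>auto simp: cw_def\<close>)
  then show ?thesis by (simp add: infsum_cmult_left' mult.assoc)
qed

text \<open>The map \<open>f\<close> accommodates both gradings: by the number of pairings itself,
  and by g with n - 1 + g pairings in the connected case.\<close>

lemma infsum_cw_levels:
  assumes R: "R \<subseteq> Rib ls" and Q: "finite Q" "\<And>g. g \<in> R \<Longrightarrow> \<exists>q\<in>Q. card (snd g) = f q" "inj_on f Q"
  shows "infsum cw R = (\<Sum>q\<in>Q. \<Sum>m = 0..sum_list ls.
    infsum rw {g \<in> R. card (snd g) = f q \<and> card (slides (fst g)) = m} * of_real h ^ f q * of_real e ^ m)"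
proof -
  let ?A = "\<lambda>(q, m). {g \<in> R. card (snd g) = f q \<and> card (slides (fst g)) = m}"
  let ?I = "Q \<times> {0..sum_list ls}"
  have U: "R = (\<Union>i\<in>?I. ?A i)"
  proof (intro set_eqI iffI)
    fix g assume g: "g \<in> R"
    then obtain q where "q \<in> Q" "card (snd g) = f q" using Q(2) by blast
    moreover have "card (slides (fst g)) \<le> sum_list ls" using Rib_bounds(2) g R by blast
    ultimately show "g \<in> (\<Union>i\<in>?I. ?A i)" using g by auto
  qed auto
  have "infsum cw (\<Union>i\<in>?I. ?A i) = (\<Sum>i\<in>?I. infsum cw (?A i))"
  proof (rule infsum_finite_Union[THEN conjunct2])
    show "cw summable_on ?A i" for i by (rule cw_summable[of _ ls]) (use R in auto)
    show "?A i \<inter> ?A j = {}" if "i \<in> ?I" "j \<in> ?I" "i \<noteq> j" for i j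
      using that inj_onD[OF Q(3)] by fastforce
  qed (use Q(1) in auto)
  also have "\<dots> = (\<Sum>i\<in>?I. (\<lambda>(q, m). infsum rw (?A (q, m)) * of_real h ^ f q * of_real e ^ m) i)"
    by (rule sum.cong) (use R in \<open>auto intro!: infsum_cw_level[of _ ls]\<close>)
  finally show ?thesis unfolding U[symmetric] by (simp add: sum.cartesian_product)
qed

end

section \<open>Cumulants and connected ribbon paths\<close>

text \<open>Grow a tree: as long as not all vertices are reached, connectivity supplies an edge
  leaving the set, and it is new because earlier edges lie inside.\<close>

lemma connected_edges:
  fixes V :: "nat set"
  assumes V: "finite V" and E: "finite E" "E \<subseteq> V \<times> V"
    and con: "\<And>a b. a \<in> V \<Longrightarrow> b \<in> V \<Longrightarrow> (a, b) \<in> (E \<union> E\<inverse>)\<^sup>*"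
  shows "card V \<le> card E + 1"
proof (cases "V = {}")
  case False
  then obtain v0 where v0: "v0 \<in> V" by blast
  have "k < card V \<Longrightarrow> \<exists>A E'. A \<subseteq> V \<and> v0 \<in> A \<and> E' \<subseteq> E \<and> E' \<subseteq> A \<times> A \<and> card A = Suc k \<and> card E' = k" for k
  proof (induction k)
    case 0
    show ?case by (intro exI[of _ "{v0}"] exI[of _ "{}"]) (use v0 in auto)
  next
    case (Suc k)
    then obtain A E' where A: "A \<subseteq> V" "v0 \<in> A" "E' \<subseteq> E" "E' \<subseteq> A \<times> A" "card A = Suc k" "card E' = k" by auto
    have "A \<noteq> V" using A(5) Suc.prems by auto
    then obtain v where v: "v \<in> V" "v \<notin> A" using A(1) by blast
    have "\<exists>x y. (x, y) \<in> E \<union> E\<inverse> \<and> x \<in> A \<and> y \<notin> A"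
    proof (rule ccontr)
      assume no: "\<not> ?thesis"
      have "b \<in> A" if "(v0, b) \<in> (E \<union> E\<inverse>)\<^sup>*" for b
        using that by induction (use A(2) no in blast)+
      then show False using con[OF v0 v(1)] v(2) by blast
    qed
    then obtain x y where xy: "(x, y) \<in> E \<union> E\<inverse>" "x \<in> A" "y \<notin> A" by blast
    define ed where "ed = (if (x, y) \<in> E then (x, y) else (y, x))"
    have ed: "ed \<in> E" "ed \<notin> E'" "ed \<in> insert y A \<times> insert y A" using xy A(4) by (auto simp: ed_def)
    have y: "y \<in> V" using xy(1) E(2) by auto
    have fin: "finite A" "finite E'" using A(1,3) V E(1) finite_subset by blast+
    show ?case
      by (intro exI[of _ "insert y A"] exI[of _ "insert ed E'"]) (use A ed y fin xy(3) in auto)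
  qed
  note grow = this
  have "card V - 1 < card V" using V False by (simp add: card_gt_0_iff)
  from grow[OF this] obtain E' where "E' \<subseteq> E" "card E' = card V - 1" by blast
  then show ?thesis using card_mono[OF E(1), of E'] by simp
qed simp

section \<open>Cumulants and their recursion\<close>

definition cumulant_sum :: "('a set \<Rightarrow> complex) \<Rightarrow> 'a set \<Rightarrow> complex" where
  "cumulant_sum Z S = (\<Sum>\<pi> | partition_on S \<pi>. (- 1) ^ (card \<pi> - 1) * fact (card \<pi> - 1) * (\<Prod>B\<in>\<pi>. Z B))"

text \<open>A partition of a proper subset B containing s, completed by the block S - B, is the same
  as a partition of S with a marked block that avoids s.\<close>

lemma partition_on_marked:
  assumes S: "finite S" "s \<in> S"
  shows "bij_betw (\<lambda>(B, \<pi>). (insert (S - B) \<pi>, S - B))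
     (SIGMA B:{B. s \<in> B \<and> B \<subset> S}. {\<pi>. partition_on B \<pi>})
     (SIGMA \<sigma>:{\<sigma>. partition_on S \<sigma>}. {D \<in> \<sigma>. s \<notin> D})"
proof (rule bij_betwI[of _ _ _ "\<lambda>(\<sigma>, D). (S - D, \<sigma> - {D})"])
  show "(\<lambda>(B, \<pi>). (insert (S - B) \<pi>, S - B)) \<in>
     (SIGMA B:{B. s \<in> B \<and> B \<subset> S}. {\<pi>. partition_on B \<pi>}) \<rightarrow> (SIGMA \<sigma>:{\<sigma>. partition_on S \<sigma>}. {D \<in> \<sigma>. s \<notin> D})"
  proof (rule Pi_I)
    fix x assume "x \<in> (SIGMA B:{B. s \<in> B \<and> B \<subset> S}. {\<pi>. partition_on B \<pi>})"
    then obtain B \<pi> where x: "x = (B, \<pi>)" and B: "s \<in> B" "B \<subset> S" "partition_on B \<pi>" by auto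
    have "partition_on S (insert (S - B) \<pi>)"
      unfolding partition_on_def
    proof (intro conjI)
      show "\<Union> (insert (S - B) \<pi>) = S" using B by (auto simp: partition_on_def)
      show "disjoint (insert (S - B) \<pi>)" using B by (auto simp: partition_on_def disjoint_def)
      show "{} \<notin> insert (S - B) \<pi>" using B by (auto simp: partition_on_def)
    qed
    then show "(case x of (B, \<pi>) \<Rightarrow> (insert (S - B) \<pi>, S - B)) \<in> (SIGMA \<sigma>:{\<sigma>. partition_on S \<sigma>}. {D \<in> \<sigma>. s \<notin> D})"
      using B(1) x by simp
  qed
  show "(\<lambda>(\<sigma>, D). (S - D, \<sigma> - {D})) \<in>
     (SIGMA \<sigma>:{\<sigma>. partition_on S \<sigma>}. {D \<in> \<sigma>. s \<notin> D}) \<rightarrow> (SIGMA B:{B. s \<in> B \<and> B \<subset> S}. {\<pi>. partition_on B \<pi>})"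
  proof (rule Pi_I)
    fix x assume "x \<in> (SIGMA \<sigma>:{\<sigma>. partition_on S \<sigma>}. {D \<in> \<sigma>. s \<notin> D})"
    then obtain \<sigma> D where x: "x = (\<sigma>, D)" and D: "partition_on S \<sigma>" "D \<in> \<sigma>" "s \<notin> D" by auto
    have "D \<noteq> {}" "D \<subseteq> S" using D by (auto simp: partition_on_def)
    moreover have "partition_on (S - D) (\<sigma> - {D})"
      unfolding partition_on_def
    proof (intro conjI)
      show "\<Union> (\<sigma> - {D}) = S - D" using D by (auto simp: partition_on_def disjoint_def)
      show "disjoint (\<sigma> - {D})" using D by (auto simp: partition_on_def disjoint_def)
      show "{} \<notin> \<sigma> - {D}" using D by (auto simp: partition_on_def)
    qed
    ultimately show "(case x of (\<sigma>, D) \<Rightarrow> (S - D, \<sigma> - {D})) \<in> (SIGMA B:{B. s \<in> B \<and> B \<subset> S}. {\<pi>. partition_on B \<pi>})"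
      using S(2) D(3) x by auto
  qed
next
  fix x assume "x \<in> (SIGMA B:{B. s \<in> B \<and> B \<subset> S}. {\<pi>. partition_on B \<pi>})"
  then obtain B \<pi> where x: "x = (B, \<pi>)" and B: "s \<in> B" "B \<subset> S" "partition_on B \<pi>" by auto
  have "S - B \<notin> \<pi>" using B by (auto simp: partition_on_def)
  moreover have "S - (S - B) = B" using B by auto
  ultimately show "(case case x of (B, \<pi>) \<Rightarrow> (insert (S - B) \<pi>, S - B) of (\<sigma>, D) \<Rightarrow> (S - D, \<sigma> - {D})) = x"
    by (simp add: x)
next
  fix x assume "x \<in> (SIGMA \<sigma>:{\<sigma>. partition_on S \<sigma>}. {D \<in> \<sigma>. s \<notin> D})"
  then obtain \<sigma> D where x: "x = (\<sigma>, D)" and D: "partition_on S \<sigma>" "D \<in> \<sigma>" by auto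
  have "S - (S - D) = D" using D by (auto simp: partition_on_def)
  then show "(case case x of (\<sigma>, D) \<Rightarrow> (S - D, \<sigma> - {D}) of (B, \<pi>) \<Rightarrow> (insert (S - B) \<pi>, S - B)) = x"
    using D by (auto simp: x)
qed

lemma finite_partitions: "finite S \<Longrightarrow> finite {\<pi>. partition_on S \<pi>}"
  by (rule finite_subset[of _ "Pow (Pow S)"]) (auto simp: partition_on_def)

text \<open>Collect the coefficient of a partition of S with k blocks. It is \<mu> k from B = S,
  plus \<mu> (k - 1) for each of the k - 1 blocks avoiding s that may be the complement of B. With
  \<mu> k = (-1)^(k-1) (k-1)! this vanishes except for k = 1.\<close>

lemma cumulant_sum_recursion:
  assumes S: "finite S" "s \<in> S" and Z0: "Z {} = 1"
  shows "Z S = (\<Sum>B | s \<in> B \<and> B \<subseteq> S. cumulant_sum Z B * Z (S - B))"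
proof -
  \<comment> \<open>Subtraction is truncated, so \<mu> 0 = 1; for k = 1 it occurs with the factor k
    - 1 = 0.\<close>
  define \<mu> :: "nat \<Rightarrow> complex" where "\<mu> k = (- 1) ^ (k - 1) * fact (k - 1)" for k
  have finB: "finite {B. s \<in> B \<and> B \<subset> S}" by (rule finite_subset[of _ "Pow S"]) (use S in auto)
  have eq: "{B. s \<in> B \<and> B \<subseteq> S} = insert S {B. s \<in> B \<and> B \<subset> S}" using S by auto
  have "(\<Sum>B | s \<in> B \<and> B \<subseteq> S. cumulant_sum Z B * Z (S - B)) =
    cumulant_sum Z S + (\<Sum>B | s \<in> B \<and> B \<subset> S. cumulant_sum Z B * Z (S - B))"
    unfolding eq using finB by (subst sum.insert) (auto simp: Z0)
  also have "(\<Sum>B | s \<in> B \<and> B \<subset> S. cumulant_sum Z B * Z (S - B)) =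
     (\<Sum>B | s \<in> B \<and> B \<subset> S. \<Sum>\<pi> | partition_on B \<pi>. \<mu> (card \<pi>) * (\<Prod>B\<in>\<pi>. Z B) * Z (S - B))"
    by (simp add: cumulant_sum_def \<mu>_def sum_distrib_right)
  also have "\<dots> = (\<Sum>(B, \<pi>)\<in>(SIGMA B:{B. s \<in> B \<and> B \<subset> S}. {\<pi>. partition_on B \<pi>}). \<mu> (card \<pi>) * (\<Prod>B\<in>\<pi>. Z B) * Z (S - B))"
    by (rule sum.Sigma) (use finB S in \<open>auto intro: finite_partitions finite_subset\<close>)
  also have "\<dots> = (\<Sum>(B, \<pi>)\<in>(SIGMA B:{B. s \<in> B \<and> B \<subset> S}. {\<pi>. partition_on B \<pi>}).
      (\<lambda>(\<sigma>, D). \<mu> (card \<sigma> - 1) * (\<Prod>B\<in>\<sigma>. Z B)) (insert (S - B) \<pi>, S - B))"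
  proof (rule sum.cong)
    fix x assume "x \<in> (SIGMA B:{B. s \<in> B \<and> B \<subset> S}. {\<pi>. partition_on B \<pi>})"
    then obtain B \<pi> where x: "x = (B, \<pi>)" and B: "s \<in> B" "B \<subset> S" "partition_on B \<pi>" by auto
    have fin: "finite \<pi>" using B S finite_elements[of B \<pi>] finite_subset[of B S] by auto
    have "S - B \<notin> \<pi>" using B by (auto simp: partition_on_def)
    then show "(case x of (B, \<pi>) \<Rightarrow> \<mu> (card \<pi>) * (\<Prod>B\<in>\<pi>. Z B) * Z (S - B)) =
       (case x of (B, \<pi>) \<Rightarrow> (\<lambda>(\<sigma>, D). \<mu> (card \<sigma> - 1) * (\<Prod>B\<in>\<sigma>. Z B)) (insert (S - B) \<pi>, S - B))"
      using fin by (simp add: x)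
  qed simp
  also have "\<dots> = (\<Sum>(\<sigma>, D)\<in>(SIGMA \<sigma>:{\<sigma>. partition_on S \<sigma>}. {D \<in> \<sigma>. s \<notin> D}). \<mu> (card \<sigma> - 1) * (\<Prod>B\<in>\<sigma>. Z B))"
    using sum.reindex_bij_betw[OF partition_on_marked[OF S], of "\<lambda>(\<sigma>, D). \<mu> (card \<sigma> - 1) * (\<Prod>B\<in>\<sigma>. Z B)"]
    by (simp add: case_prod_unfold)
  also have "\<dots> = (\<Sum>\<sigma> | partition_on S \<sigma>. \<Sum>D | D \<in> \<sigma> \<and> s \<notin> D. \<mu> (card \<sigma> - 1) * (\<Prod>B\<in>\<sigma>. Z B))"
    by (subst sum.Sigma) (use S in \<open>auto intro: finite_partitions finite_subset[OF _ finite_elements]\<close>)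
  also have "\<dots> = (\<Sum>\<sigma> | partition_on S \<sigma>. of_nat (card \<sigma> - 1) * \<mu> (card \<sigma> - 1) * (\<Prod>B\<in>\<sigma>. Z B))"
  proof (rule sum.cong)
    fix \<sigma> assume "\<sigma> \<in> {\<sigma>. partition_on S \<sigma>}"
    then have \<sigma>: "partition_on S \<sigma>" by simp
    obtain B where B: "B \<in> \<sigma>" "s \<in> B" using \<sigma> S(2) by (auto simp: partition_on_def)
    have "{D \<in> \<sigma>. s \<notin> D} = \<sigma> - {B}" using B \<sigma> by (auto simp: partition_on_def disjoint_def)
    then have "card {D \<in> \<sigma>. s \<notin> D} = card \<sigma> - 1" using B(1) finite_elements[OF S(1) \<sigma>] by simp
    then show "(\<Sum>D | D \<in> \<sigma> \<and> s \<notin> D. \<mu> (card \<sigma> - 1) * (\<Prod>B\<in>\<sigma>. Z B)) = of_nat (card \<sigma> - 1) * \<mu> (card \<sigma> - 1) * (\<Prod>B\<in>\<sigma>. Z B)"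
      by simp
  qed simp
  also have "cumulant_sum Z S + \<dots> = (\<Sum>\<sigma> | partition_on S \<sigma>. (\<mu> (card \<sigma>) + of_nat (card \<sigma> - 1) * \<mu> (card \<sigma> - 1)) * (\<Prod>B\<in>\<sigma>. Z B))"
    by (simp add: cumulant_sum_def \<mu>_def sum.distrib[symmetric] distrib_right)
  also have "\<dots> = (\<Sum>\<sigma> | partition_on S \<sigma>. if \<sigma> = {S} then Z S else 0)"
  proof (rule sum.cong)
    fix \<sigma> assume "\<sigma> \<in> {\<sigma>. partition_on S \<sigma>}"
    then have \<sigma>: "partition_on S \<sigma>" by simp
    have fin: "finite \<sigma>" by (rule finite_elements[OF S(1) \<sigma>])
    have ne: "\<sigma> \<noteq> {}" using \<sigma> S(2) by (auto simp: partition_on_def)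
    show "(\<mu> (card \<sigma>) + of_nat (card \<sigma> - 1) * \<mu> (card \<sigma> - 1)) * (\<Prod>B\<in>\<sigma>. Z B) = (if \<sigma> = {S} then Z S else 0)"
    proof (cases "card \<sigma> = 1")
      case True
      then obtain B where "\<sigma> = {B}" by (metis card_1_singletonE)
      then have "\<sigma> = {S}" using \<sigma> by (auto simp: partition_on_def)
      then show ?thesis by (simp add: \<mu>_def)
    next
      case False
      then obtain k where k: "card \<sigma> = Suc (Suc k)" using fin ne by (metis card_0_eq not0_implies_Suc One_nat_def)
      then have "\<sigma> \<noteq> {S}" by auto
      then show ?thesis by (simp add: k \<mu>_def)
    qed
  qed simp
  also have "\<dots> = Z S"
  proof -
    have "partition_on S {S}" using S(2) by (auto simp: partition_on_def)
    then show ?thesis using finite_partitions[OF S(1)] by simp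
  qed
  finally show ?thesis ..
qed

text \<open>The term B = S carries the factor \<open>Z {}\<close> = 1, so the recursion can be
  solved for \<open>K S\<close> in terms of smaller sets.\<close>

lemma cumulant_sum_unique:
  assumes fin: "finite A" and Z0: "Z {} = 1"
    and rec: "\<And>S s. S \<subseteq> A \<Longrightarrow> s \<in> S \<Longrightarrow> Z S = (\<Sum>B | s \<in> B \<and> B \<subseteq> S. K B * Z (S - B))"
  shows "S \<subseteq> A \<Longrightarrow> S \<noteq> {} \<Longrightarrow> K S = cumulant_sum Z S"
proof (induction "card S" arbitrary: S rule: less_induct)
  case less
  obtain s where s: "s \<in> S" using less.prems by blast
  have finS: "finite S" using less.prems(1) fin finite_subset by blast
  have finB: "finite {B. s \<in> B \<and> B \<subset> S}" by (rule finite_subset[of _ "Pow S"]) (use finS in auto)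
  have eq: "{B. s \<in> B \<and> B \<subseteq> S} = insert S {B. s \<in> B \<and> B \<subset> S}" using s by auto
  have split: "(\<Sum>B | s \<in> B \<and> B \<subseteq> S. f B * Z (S - B)) = f S + (\<Sum>B | s \<in> B \<and> B \<subset> S. f B * Z (S - B))" for f
    unfolding eq using finB by (subst sum.insert) (auto simp: Z0)
  have "(\<Sum>B | s \<in> B \<and> B \<subset> S. K B * Z (S - B)) = (\<Sum>B | s \<in> B \<and> B \<subset> S. cumulant_sum Z B * Z (S - B))"
  proof (rule sum.cong)
    fix B assume "B \<in> {B. s \<in> B \<and> B \<subset> S}"
    then have "K B = cumulant_sum Z B" using less.prems psubset_card_mono[OF finS, of B] by (intro less.hyps) auto
    then show "K B * Z (S - B) = cumulant_sum Z B * Z (S - B)" by simp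
  qed simp
  then show ?case
    using rec[OF less.prems(1) s] cumulant_sum_recursion[where Z=Z, OF finS s Z0] unfolding split by simp
qed


section \<open>Cutting and merging ribbon paths along sets of sites\<close>

lemma pairsets_Un:
  assumes "ps1 \<in> pairsets R d X1" "ps2 \<in> pairsets R d X2" "X1 \<inter> X2 = {}"
  shows "ps1 \<union> ps2 \<in> pairsets R d (X1 \<union> X2)"
proof -
  have 1: "{fst p, snd p} \<subseteq> X1" if "p \<in> ps1" for p
    using pairsetsD[OF assms(1), of "fst p" "snd p"] that by simp
  have 2: "{fst p, snd p} \<subseteq> X2" if "p \<in> ps2" for p
    using pairsetsD[OF assms(2), of "fst p" "snd p"] that by simp
  have dj: "{fst p, snd p} \<inter> {fst p', snd p'} = {}" if "p \<in> ps1 \<union> ps2" "p' \<in> ps1 \<union> ps2" "p \<noteq> p'" for p p'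
  proof (cases "p \<in> ps1 \<longleftrightarrow> p' \<in> ps1")
    case True
    then consider "p \<in> ps1 \<and> p' \<in> ps1" | "p \<in> ps2 \<and> p' \<in> ps2" using \<open>p \<in> ps1 \<union> ps2\<close> \<open>p' \<in> ps1 \<union> ps2\<close> by blast
    then show ?thesis using pairsets_disj[OF assms(1)] pairsets_disj[OF assms(2)] that(3) by cases blast+
  next
    case False
    then consider "p \<in> ps1 \<and> p' \<in> ps2" | "p \<in> ps2 \<and> p' \<in> ps1" using \<open>p \<in> ps1 \<union> ps2\<close> \<open>p' \<in> ps1 \<union> ps2\<close> by blast
    then show ?thesis using 1[of p] 2[of p'] 1[of p'] 2[of p] assms(3) by cases blast+
  qed
  have "x \<in> X1 \<union> X2 \<and> y \<in> X1 \<union> X2 \<and> R x y \<and> d x < 0 \<and> d y = - d x" if "(x, y) \<in> ps1 \<union> ps2" for x y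
    using that pairsetsD[OF assms(1), of x y] pairsetsD[OF assms(2), of x y] by blast
  then show ?thesis unfolding pairsets_def using dj by blast
qed

lemma pairsets_cong:
  assumes "\<And>x. x \<in> X \<Longrightarrow> d x = d' x" shows "pairsets R d X = pairsets R d' X"
  unfolding pairsets_def using assms by (intro Collect_cong conj_cong ball_cong refl) auto

lemma pairsets_restrict:
  assumes "ps \<in> pairsets R d X" "\<And>p. p \<in> ps \<Longrightarrow> fst p \<in> Y \<longleftrightarrow> snd p \<in> Y"
  shows "{p \<in> ps. fst p \<in> Y} \<in> pairsets R d {x \<in> X. x \<in> Y}"
proof -
  have "x \<in> {x \<in> X. x \<in> Y} \<and> y \<in> {x \<in> X. x \<in> Y} \<and> R x y \<and> d x < 0 \<and> d y = - d x" if "(x, y) \<in> {p \<in> ps. fst p \<in> Y}" for x y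
    using that pairsetsD[OF assms(1), of x y] assms(2)[of "(x, y)"] by simp
  then show ?thesis unfolding pairsets_def using pairsets_disj[OF assms(1)] by blast
qed

definition comb :: "nat set \<Rightarrow> sliding_path list \<Rightarrow> sliding_path list \<Rightarrow> sliding_path list" where
  "comb B gs gs' = map (\<lambda>a. if a \<in> B then gs ! a else gs' ! a) [0..<length gs]"

lemma comb_simps [simp]:
  "length (comb B gs gs') = length gs"
  "a < length gs \<Longrightarrow> comb B gs gs' ! a = (if a \<in> B then gs ! a else gs' ! a)"
  by (simp_all add: comb_def)

lemma steps_comb:
  "length gs' = length gs \<Longrightarrow> steps (comb B gs gs') = {x \<in> steps gs. fst x \<in> B} \<union> {x \<in> steps gs'. fst x \<notin> B}"
  by (auto simp: steps_def split: if_splits)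

lemma deg_comb: "fst x < length gs \<Longrightarrow> deg (comb B gs gs') x = (if fst x \<in> B then deg gs x else deg gs' x)"
  by (cases x) (simp add: deg_def)

lemma fst_steps: "x \<in> steps gs \<Longrightarrow> fst x < length gs" by (auto simp: steps_def)

text \<open>Sites outside B receive the trivial path, so that site numbers and the order of steps do
  not change.\<close>

definition cut :: "nat set \<Rightarrow> ribbon_path \<Rightarrow> ribbon_path" where
  "cut B = (\<lambda>(gs, ps). (comb B gs (replicate (length gs) [0]), {p \<in> ps. fst (fst p) \<in> B}))"

definition merge :: "nat set \<Rightarrow> ribbon_path \<times> ribbon_path \<Rightarrow> ribbon_path" where
  "merge B = (\<lambda>((gs, ps), (gs', ps')). (comb B gs gs', ps \<union> ps'))"

text \<open>Since \<open>T_up\<close> is 1 at index 0 and \<open>[0]\<close> is the only sliding path of length 0, a site is removed without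
  renumbering the others by giving it length 0.\<close>

definition restr :: "nat set \<Rightarrow> nat list \<Rightarrow> nat list" where
  "restr B ls = map (\<lambda>a. if a \<in> B then ls ! a else 0) [0..<length ls]"

lemma restr_simps [simp]:
  "length (restr B ls) = length ls" "a < length ls \<Longrightarrow> restr B ls ! a = (if a \<in> B then ls ! a else 0)"
  by (simp_all add: restr_def)

lemma sliding_0: "is_sliding_path 0 js \<longleftrightarrow> js = [0]"
  by (auto simp: is_sliding_path_def length_Suc_conv)

lemma valid_restr:
  "valid (restr B ls) gs \<longleftrightarrow> length gs = length ls \<and>
     (\<forall>a<length ls. if a \<in> B then is_sliding_path (ls ! a) (gs ! a) else gs ! a = [0])"
  by (auto simp: valid_def sliding_0)

lemma steps_restr:
  assumes "valid (restr B ls) gs" "x \<in> steps gs" shows "fst x \<in> B"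
proof (rule ccontr)
  assume "fst x \<notin> B"
  then have "gs ! fst x = [0]" using assms fst_steps[OF assms(2)] by (auto simp: valid_restr)
  then show False using assms(2) by (auto simp: steps_def)
qed

definition closed_sites :: "nat set \<Rightarrow> ribbon_path \<Rightarrow> bool" where
  "closed_sites B g \<longleftrightarrow> (\<forall>p\<in>snd g. fst (fst p) \<in> B \<longleftrightarrow> fst (snd p) \<in> B)"

lemma merge_props:
  assumes B: "B \<subseteq> S" and g1: "(gs, ps) \<in> Rib (restr B ls)" and g2: "(gs', ps') \<in> Rib (restr (S - B) ls)"
  shows "length gs = length ls" "length gs' = length ls"
    and "steps (comb B gs gs') = steps gs \<union> steps gs'" "steps gs \<inter> steps gs' = {}"
    and "\<And>x. x \<in> steps gs \<Longrightarrow> fst x \<in> B" "\<And>x. x \<in> steps gs' \<Longrightarrow> fst x \<in> S - B"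
    and "\<And>x. x \<in> steps gs \<Longrightarrow> deg (comb B gs gs') x = deg gs x"
    and "\<And>x. x \<in> steps gs' \<Longrightarrow> deg (comb B gs gs') x = deg gs' x"
    and "ps \<in> pairsets before (deg (comb B gs gs')) (steps gs)"
    and "ps' \<in> pairsets before (deg (comb B gs gs')) (steps gs')"
    and "merge B ((gs, ps), (gs', ps')) \<in> Rib (restr S ls)"
proof -
  have v: "valid (restr B ls) gs" "valid (restr (S - B) ls) gs'" and p: "ps \<in> ppairs gs" "ps' \<in> ppairs gs'"
    using g1 g2 by (auto simp: Rib_def ribbon_iff)
  show l: "length gs = length ls" "length gs' = length ls" using v by (auto simp: valid_restr)
  show 1: "\<And>x. x \<in> steps gs \<Longrightarrow> fst x \<in> B" by (rule steps_restr[OF v(1)])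
  show 2: "\<And>x. x \<in> steps gs' \<Longrightarrow> fst x \<in> S - B" by (rule steps_restr[OF v(2)])
  show st: "steps (comb B gs gs') = steps gs \<union> steps gs'" using 1 2 l by (subst steps_comb) auto
  show dj: "steps gs \<inter> steps gs' = {}" using 1 2 by fastforce
  show d1: "deg (comb B gs gs') x = deg gs x" if "x \<in> steps gs" for x
    using 1[OF that] fst_steps[OF that] by (simp add: deg_comb)
  show d2: "deg (comb B gs gs') x = deg gs' x" if "x \<in> steps gs'" for x
    using 2[OF that] fst_steps[OF that] l by (simp add: deg_comb)
  show q1: "ps \<in> pairsets before (deg (comb B gs gs')) (steps gs)" by (subst pairsets_cong[OF d1]) (use p(1) in auto)
  show q2: "ps' \<in> pairsets before (deg (comb B gs gs')) (steps gs')" by (subst pairsets_cong[OF d2]) (use p(2) in auto)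
  have "valid (restr S ls) (comb B gs gs')" using v B l by (auto simp: valid_restr)
  then show "merge B ((gs, ps), (gs', ps')) \<in> Rib (restr S ls)"
    using pairsets_Un[OF q1 q2 dj] by (simp add: merge_def Rib_def ribbon_iff st)
qed

lemma cut_Rib:
  assumes B: "B \<subseteq> S" and g: "g \<in> Rib (restr S ls)" and sep: "closed_sites B g"
  shows "cut B g \<in> Rib (restr B ls)"
proof -
  obtain gs ps where gp: "g = (gs, ps)" by (cases g)
  have v: "valid (restr S ls) gs" and p: "ps \<in> ppairs gs" using g by (auto simp: gp Rib_def ribbon_iff)
  let ?c = "comb B gs (replicate (length gs) [0])"
  have z: "steps (replicate k [0]) = {}" for k by (auto simp: steps_def)
  have st: "steps ?c = {x \<in> steps gs. x \<in> {x. fst x \<in> B}}" by (subst steps_comb) (auto simp: z)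
  have d: "deg gs x = deg ?c x" if "x \<in> {x \<in> steps gs. x \<in> {x. fst x \<in> B}}" for x
    using that fst_steps[of x gs] by (simp add: deg_comb)
  have "{p \<in> ps. fst p \<in> {x. fst x \<in> B}} \<in> pairsets before (deg gs) {x \<in> steps gs. x \<in> {x. fst x \<in> B}}"
    by (rule pairsets_restrict[OF p]) (use sep in \<open>auto simp: closed_sites_def gp\<close>)
  then have "{p \<in> ps. fst p \<in> {x. fst x \<in> B}} \<in> ppairs ?c"
    unfolding st using pairsets_cong[of "{x \<in> steps gs. x \<in> {x. fst x \<in> B}}" "deg gs" "deg ?c" before] d by simp
  then have "{p \<in> ps. fst (fst p) \<in> B} \<in> ppairs ?c" by simp
  moreover have "valid (restr B ls) ?c" using v B by (auto simp: valid_restr)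
  ultimately show ?thesis by (simp add: gp cut_def Rib_def ribbon_iff)
qed

text \<open>Sites of length 0 have no steps, so the two factors occupy disjoint sets of steps. When
  no pairing leads out of B, every pairing lies on one side, and cutting on both sides loses
  nothing.\<close>

lemma bij_merge:
  assumes B: "B \<subseteq> S"
  shows "bij_betw (merge B) (Rib (restr B ls) \<times> Rib (restr (S - B) ls)) {g \<in> Rib (restr S ls). closed_sites B g}"
proof (rule bij_betwI[of _ _ _ "\<lambda>g. (cut B g, cut (S - B) g)"])
  have fstps: "fst p \<in> steps gs \<and> snd p \<in> steps gs" if "(gs, ps) \<in> Rib L" "p \<in> ps" for gs ps p L
  proof -
    have "ps \<in> ppairs gs" using that(1) by (simp add: Rib_def ribbon_iff)
    then show ?thesis using pairsetsD[of ps before "deg gs" "steps gs" "fst p" "snd p"] that(2) by simp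
  qed
  show "merge B \<in> Rib (restr B ls) \<times> Rib (restr (S - B) ls) \<rightarrow> {g \<in> Rib (restr S ls). closed_sites B g}"
  proof (rule Pi_I)
    fix x assume "x \<in> Rib (restr B ls) \<times> Rib (restr (S - B) ls)"
    then obtain gs ps gs' ps' where x: "x = ((gs, ps), (gs', ps'))"
      and g: "(gs, ps) \<in> Rib (restr B ls)" "(gs', ps') \<in> Rib (restr (S - B) ls)" by (cases x) auto
    note m = merge_props[OF B g]
    have "closed_sites B (merge B x)" unfolding closed_sites_def
    proof
      fix p assume "p \<in> snd (merge B x)"
      then have "p \<in> ps \<or> p \<in> ps'" by (auto simp: x merge_def)
      then show "fst (fst p) \<in> B \<longleftrightarrow> fst (snd p) \<in> B"
        using fstps[OF g(1), of p] fstps[OF g(2), of p] m(5,6) by blast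
    qed
    then show "merge B x \<in> {g \<in> Rib (restr S ls). closed_sites B g}" using m(11) by (simp add: x)
  qed
  show "(\<lambda>g. (cut B g, cut (S - B) g)) \<in> {g \<in> Rib (restr S ls). closed_sites B g} \<rightarrow> Rib (restr B ls) \<times> Rib (restr (S - B) ls)"
  proof (rule Pi_I)
    fix g assume "g \<in> {g \<in> Rib (restr S ls). closed_sites B g}"
    then have g: "g \<in> Rib (restr S ls)" "closed_sites B g" by auto
    obtain gs ps where gp: "g = (gs, ps)" by (cases g)
    have v: "valid (restr S ls) gs" using g(1) by (simp add: gp Rib_def ribbon_iff)
    have "closed_sites (S - B) g" unfolding closed_sites_def
    proof
      fix p assume p: "p \<in> snd g"
      then have "fst (fst p) \<in> S \<and> fst (snd p) \<in> S"
        using fstps[of gs ps "restr S ls" p] g(1) steps_restr[OF v] by (simp add: gp)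
      then show "fst (fst p) \<in> S - B \<longleftrightarrow> fst (snd p) \<in> S - B" using g(2) p by (simp add: closed_sites_def)
    qed
    then show "(cut B g, cut (S - B) g) \<in> Rib (restr B ls) \<times> Rib (restr (S - B) ls)"
      using cut_Rib[OF B g] cut_Rib[OF _ g(1), of "S - B"] by auto
  qed
next
  fix x assume "x \<in> Rib (restr B ls) \<times> Rib (restr (S - B) ls)"
  then obtain gs ps gs' ps' where x: "x = ((gs, ps), (gs', ps'))"
    and g: "(gs, ps) \<in> Rib (restr B ls)" "(gs', ps') \<in> Rib (restr (S - B) ls)" by (cases x) auto
  note m = merge_props[OF B g]
  have v: "valid (restr B ls) gs" "valid (restr (S - B) ls) gs'" using g by (auto simp: Rib_def ribbon_iff)
  have in1: "fst (fst p) \<in> B" if "p \<in> ps" for p using pairsetsD[OF m(9), of "fst p" "snd p"] m(5) that by simp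
  have in2: "fst (fst p) \<in> S - B" if "p \<in> ps'" for p using pairsetsD[OF m(10), of "fst p" "snd p"] m(6) that by simp
  have "{p \<in> ps \<union> ps'. fst (fst p) \<in> B} = ps" "{p \<in> ps \<union> ps'. fst (fst p) \<in> S - B} = ps'" using in1 in2 by blast+
  moreover have "comb B (comb B gs gs') (replicate (length gs) [0]) = gs"
    by (rule nth_equalityI) (use v m(1) in \<open>auto simp: valid_restr\<close>)
  moreover have "comb (S - B) (comb B gs gs') (replicate (length gs) [0]) = gs'"
    by (rule nth_equalityI) (use v m(1,2) in \<open>auto simp: valid_restr\<close>)
  ultimately show "(cut B (merge B x), cut (S - B) (merge B x)) = x" by (simp add: x merge_def cut_def)
next
  fix g assume "g \<in> {g \<in> Rib (restr S ls). closed_sites B g}"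
  then have g: "g \<in> Rib (restr S ls)" by auto
  obtain gs ps where gp: "g = (gs, ps)" by (cases g)
  have v: "valid (restr S ls) gs" and p: "ps \<in> ppairs gs" using g by (auto simp: gp Rib_def ribbon_iff)
  have "fst (fst p) \<in> S" if "p \<in> ps" for p
    using pairsetsD[OF p, of "fst p" "snd p"] steps_restr[OF v, of "fst p"] that by simp
  then have "{p \<in> ps. fst (fst p) \<in> B} \<union> {p \<in> ps. fst (fst p) \<in> S - B} = ps" by blast
  moreover have "comb B (comb B gs (replicate (length gs) [0])) (comb (S - B) gs (replicate (length gs) [0])) = gs"
    by (rule nth_equalityI) (use v in \<open>auto simp: valid_restr\<close>)
  ultimately show "merge B (cut B g, cut (S - B) g) = g" by (simp add: gp merge_def cut_def)
qed

lemma unp_weight_Un: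
  assumes "finite X" "finite Y" "X \<inter> Y = {}"
  shows "unp_weight Vo Vi d (X \<union> Y) = unp_weight Vo Vi d X * unp_weight Vo Vi d Y"
proof -
  have e: "{x. x \<in> X \<union> Y \<and> P x} = {x. x \<in> X \<and> P x} \<union> {x. x \<in> Y \<and> P x}" for P by auto
  have u: "prod f {x. x \<in> X \<union> Y \<and> P x} = prod f {x. x \<in> X \<and> P x} * prod f {x. x \<in> Y \<and> P x}" for f :: "_ \<Rightarrow> complex" and P
    unfolding e by (rule prod.union_disjoint) (use assms in auto)
  show ?thesis unfolding unp_weight_def u by (simp only: mult_ac)
qed

lemma unp_weight_cong:
  "(\<And>x. x \<in> X \<Longrightarrow> d x = d' x) \<Longrightarrow> unp_weight Vo Vi d X = unp_weight Vo Vi d' X"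
  unfolding unp_weight_def by (intro arg_cong2[of _ _ _ _ times] prod.cong) auto

context specs
begin

text \<open>Trivial sites contribute the factor 1, and the pairings and unpaired jumps of the merged
  path are the disjoint unions of those of its parts, with unchanged degrees.\<close>

lemma cw_merge:
  assumes B: "B \<subseteq> S" and g: "g \<in> Rib (restr B ls)" "g' \<in> Rib (restr (S - B) ls)"
  shows "cw (merge B (g, g')) = cw g * cw g'"
proof -
  obtain gs ps gs' ps' where gp: "g = (gs, ps)" "g' = (gs', ps')" by (cases g, cases g')
  note m = merge_props[OF B g[unfolded gp]]
  let ?c = "comb B gs gs'"
  have v: "valid (restr B ls) gs" "valid (restr (S - B) ls) gs'" and p: "ps \<in> ppairs gs" "ps' \<in> ppairs gs'"
    using g by (auto simp: gp Rib_def ribbon_iff)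
  have pc: "ps \<union> ps' \<in> ppairs ?c" using m(11) by (simp add: merge_def Rib_def ribbon_iff)
  have sub: "pset ps \<subseteq> steps gs" "pset ps' \<subseteq> steps gs'" using pset_subset[OF p(1)] pset_subset[OF p(2)] .
  have site: "(\<Prod>js\<leftarrow>js. slw e js) = (\<Prod>a<length js. slw e (js ! a))" for js :: "nat list list"
    by (simp add: prod.list_conv_set_nth atLeast0LessThan)
  have "(\<Prod>js\<leftarrow>?c. slw e js) = (\<Prod>a<length ls. slw e (gs ! a) * slw e (gs' ! a))"
    unfolding site using v m(1) by (intro prod.cong) (auto simp: valid_restr)
  then have 1: "(\<Prod>js\<leftarrow>?c. slw e js) = (\<Prod>js\<leftarrow>gs. slw e js) * (\<Prod>js\<leftarrow>gs'. slw e js)"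
    unfolding site using m(1,2) by (simp add: prod.distrib)
  have "ps \<inter> ps' = {}"
  proof -
    have "(fst p, snd p) \<notin> ps'" if "(fst p, snd p) \<in> ps" for p
      using pairsetsD[OF m(9) that] pairsetsD[OF m(10), of "fst p" "snd p"] m(4) by blast
    then show ?thesis by auto
  qed
  then have "pair_weight h (deg ?c) (ps \<union> ps') = pair_weight h (deg ?c) ps * pair_weight h (deg ?c) ps'"
    unfolding pair_weight_def using finite_ppairs[OF p(1)] finite_ppairs[OF p(2)] by (intro prod.union_disjoint)
  also have "pair_weight h (deg ?c) ps = pair_weight h (deg gs) ps"
    unfolding pair_weight_def
  proof (rule prod.cong)
    fix q assume "q \<in> ps"
    then have "fst q \<in> steps gs" using sub by (auto simp: pset_def)
    then show "complex_of_real h * of_nat (nat (- deg ?c (fst q))) = of_real h * of_nat (nat (- deg gs (fst q)))" by (simp add: m(7))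
  qed simp
  also have "pair_weight h (deg ?c) ps' = pair_weight h (deg gs') ps'"
    unfolding pair_weight_def
  proof (rule prod.cong)
    fix q assume "q \<in> ps'"
    then have "fst q \<in> steps gs'" using sub by (auto simp: pset_def)
    then show "complex_of_real h * of_nat (nat (- deg ?c (fst q))) = of_real h * of_nat (nat (- deg gs' (fst q)))" by (simp add: m(8))
  qed simp
  finally have 2: "pair_weight h (deg ?c) (ps \<union> ps') = pair_weight h (deg gs) ps * pair_weight h (deg gs') ps'" .
  have "steps ?c - pset (ps \<union> ps') = (steps gs - pset ps) \<union> (steps gs' - pset ps')"
    unfolding m(3) using sub m(4) by (auto simp: pset_def)
  then have "unp_weight Vout Vin (deg ?c) (steps ?c - pset (ps \<union> ps')) =
    unp_weight Vout Vin (deg ?c) (steps gs - pset ps) * unp_weight Vout Vin (deg ?c) (steps gs' - pset ps')"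
    using m(4) by (simp only:) (intro unp_weight_Un, auto)
  also have "unp_weight Vout Vin (deg ?c) (steps gs - pset ps) = unp_weight Vout Vin (deg gs) (steps gs - pset ps)"
    by (rule unp_weight_cong) (simp add: m(7))
  also have "unp_weight Vout Vin (deg ?c) (steps gs' - pset ps') = unp_weight Vout Vin (deg gs') (steps gs' - pset ps')"
    by (rule unp_weight_cong) (simp add: m(8))
  finally have 3: "unp_weight Vout Vin (deg ?c) (steps ?c - pset (ps \<union> ps')) =
    unp_weight Vout Vin (deg gs) (steps gs - pset ps) * unp_weight Vout Vin (deg gs') (steps gs' - pset ps')" .
  show ?thesis
    unfolding gp merge_def split_conv cw_eq[OF pc] cw_eq[OF p(1)] cw_eq[OF p(2)] 1 2 3 by (simp only: mult_ac)
qed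

end


section \<open>Connected components of ribbon paths\<close>

definition reach :: "ribbon_path \<Rightarrow> (nat \<times> nat) set" where
  "reach g = (site_edges g \<union> (site_edges g)\<inverse>)\<^sup>*"

lemma site_edges_iff: "(a, b) \<in> site_edges g \<longleftrightarrow> (\<exists>p\<in>snd g. a = fst (fst p) \<and> b = fst (snd p))"
proof (cases g)
  case (Pair gs ps)
  have "site_edges g = (\<lambda>p. (fst (fst p), fst (snd p))) ` ps" by (simp add: Pair site_edges_def case_prod_unfold)
  then show ?thesis by (auto simp: Pair)
qed

lemma reach_sym: "(a, b) \<in> reach g \<Longrightarrow> (b, a) \<in> reach g"
  unfolding reach_def by (rule symD[OF sym_rtrancl]) (auto simp: sym_def)

lemma reach_trans: "(a, b) \<in> reach g \<Longrightarrow> (b, c) \<in> reach g \<Longrightarrow> (a, c) \<in> reach g"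
  unfolding reach_def by (rule rtrancl_trans)

lemma reach_refl: "(a, a) \<in> reach g" by (simp add: reach_def)

lemma reach_edge: "(a, b) \<in> site_edges g \<Longrightarrow> (a, b) \<in> reach g"
  by (auto simp: reach_def)

definition connected_on :: "nat set \<Rightarrow> ribbon_path \<Rightarrow> bool" where
  "connected_on B g \<longleftrightarrow> (\<forall>a\<in>B. \<forall>b\<in>B. (a, b) \<in> reach g)"

lemma connected_ribbon_iff: "connected_ribbon g \<longleftrightarrow> connected_on {..<length (fst g)} g"
  by (auto simp: connected_ribbon_def connected_on_def reach_def)

lemma cut_edges: "site_edges (cut B g) = {x \<in> site_edges g. fst x \<in> B}"
proof -
  have "snd (cut B g) = {p \<in> snd g. fst (fst p) \<in> B}" by (simp add: cut_def case_prod_unfold)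
  then have "(a, b) \<in> site_edges (cut B g) \<longleftrightarrow> (a, b) \<in> {x \<in> site_edges g. fst x \<in> B}" for a b
    unfolding mem_Collect_eq site_edges_iff fst_conv by blast
  then show ?thesis by auto
qed

text \<open>A component is closed under pairings, so a walk from s never leaves it and uses only
  pairings kept by \<open>cut\<close>. Conversely, connectivity inside B together with closedness
  confines the walks from s to exactly B.\<close>

lemma component_iff:
  assumes s: "s \<in> B"
  shows "{b. (s, b) \<in> reach g} = B \<longleftrightarrow> closed_sites B g \<and> connected_on B (cut B g)"
proof
  assume c: "{b. (s, b) \<in> reach g} = B"
  have cl: "a \<in> B \<longleftrightarrow> b \<in> B" if "(a, b) \<in> site_edges g" for a b
    using reach_edge[OF that] reach_sym[OF reach_edge[OF that]] reach_trans c by blast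
  have "(s, b) \<in> reach (cut B g) \<and> b \<in> B" if "(s, b) \<in> (site_edges g \<union> (site_edges g)\<inverse>)\<^sup>*" for b
    using that
  proof induction
    case base show ?case using s by (simp add: reach_refl)
  next
    case (step y z)
    then have "(y, z) \<in> site_edges (cut B g) \<union> (site_edges (cut B g))\<inverse> \<and> z \<in> B"
      using cl by (auto simp: cut_edges)
    then show ?case using step.IH by (auto simp: reach_def intro: rtrancl_into_rtrancl)
  qed
  then have "(s, b) \<in> reach (cut B g)" if "b \<in> B" for b using that c by (auto simp: reach_def)
  then have "connected_on B (cut B g)" unfolding connected_on_def using reach_sym reach_trans by blast
  moreover have "closed_sites B g" using cl by (auto simp: closed_sites_def site_edges_iff)
  ultimately show "closed_sites B g \<and> connected_on B (cut B g)" by blast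
next
  assume a: "closed_sites B g \<and> connected_on B (cut B g)"
  have cl: "a \<in> B \<longleftrightarrow> b \<in> B" if "(a, b) \<in> site_edges g" for a b
    using a that by (auto simp: closed_sites_def site_edges_iff)
  have "reach (cut B g) \<subseteq> reach g" unfolding reach_def by (rule rtrancl_mono) (auto simp: cut_edges)
  then have "B \<subseteq> {b. (s, b) \<in> reach g}" using a s by (auto simp: connected_on_def)
  moreover have "b \<in> B" if "(s, b) \<in> (site_edges g \<union> (site_edges g)\<inverse>)\<^sup>*" for b
    using that by induction (use s cl in auto)
  ultimately show "{b. (s, b) \<in> reach g} = B" by (auto simp: reach_def)
qed

lemma cut_merge:
  assumes B: "B \<subseteq> S" and g: "g \<in> Rib (restr B ls)" "g' \<in> Rib (restr (S - B) ls)"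
  shows "cut B (merge B (g, g')) = g"
proof -
  obtain gs ps gs' ps' where x: "g = (gs, ps)" "g' = (gs', ps')" by (cases g, cases g')
  note m = merge_props[OF B g[unfolded x]]
  have v: "valid (restr B ls) gs" using g by (auto simp: x Rib_def ribbon_iff)
  have in1: "fst (fst p) \<in> B" if "p \<in> ps" for p using pairsetsD[OF m(9), of "fst p" "snd p"] m(5) that by simp
  have in2: "fst (fst p) \<in> S - B" if "p \<in> ps'" for p using pairsetsD[OF m(10), of "fst p" "snd p"] m(6) that by simp
  have "{p \<in> ps \<union> ps'. fst (fst p) \<in> B} = ps" using in1 in2 by blast
  moreover have "comb B (comb B gs gs') (replicate (length gs) [0]) = gs"
    by (rule nth_equalityI) (use v m(1) in \<open>auto simp: valid_restr\<close>)
  ultimately show ?thesis by (simp add: x merge_def cut_def)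
qed

lemma site_edges_restr:
  assumes "g \<in> Rib (restr S ls)" shows "site_edges g \<subseteq> S \<times> S"
proof -
  obtain gs ps where g: "g = (gs, ps)" by (cases g)
  have v: "valid (restr S ls) gs" and p: "ps \<in> ppairs gs" using assms by (auto simp: g Rib_def ribbon_iff)
  have "fst (fst q) \<in> S \<and> fst (snd q) \<in> S" if "q \<in> ps" for q
    using pairsetsD[OF p, of "fst q" "snd q"] steps_restr[OF v] that by simp
  then show ?thesis by (auto simp: g site_edges_iff)
qed

lemma bij_merge_component:
  assumes B: "B \<subseteq> S" "s \<in> B"
  shows "bij_betw (merge B) ({g \<in> Rib (restr B ls). connected_on B g} \<times> Rib (restr (S - B) ls))
    {g \<in> Rib (restr S ls). {b. (s, b) \<in> reach g} = B}"
proof -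
  note bij = bij_merge[OF B(1), of ls]
  let ?D = "{g \<in> Rib (restr B ls). connected_on B g} \<times> Rib (restr (S - B) ls)"
  have "merge B ` ?D = {g \<in> Rib (restr S ls). {b. (s, b) \<in> reach g} = B}"
  proof (intro set_eqI iffI)
    fix g assume "g \<in> merge B ` ?D"
    then obtain g1 g2 where x: "g1 \<in> Rib (restr B ls)" "connected_on B g1" "g2 \<in> Rib (restr (S - B) ls)" "g = merge B (g1, g2)" by auto
    have "g \<in> {g \<in> Rib (restr S ls). closed_sites B g}" using bij_betwE[OF bij] x by blast
    then show "g \<in> {g \<in> Rib (restr S ls). {b. (s, b) \<in> reach g} = B}"
      using x(2) cut_merge[OF B(1) x(1,3)] by (simp add: component_iff[OF B(2)] x(4))
  next
    fix g assume "g \<in> {g \<in> Rib (restr S ls). {b. (s, b) \<in> reach g} = B}"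
    then have g: "g \<in> {g \<in> Rib (restr S ls). closed_sites B g}" "connected_on B (cut B g)"
      by (simp_all add: component_iff[OF B(2)])
    then have "g \<in> merge B ` (Rib (restr B ls) \<times> Rib (restr (S - B) ls))" using bij by (simp add: bij_betw_def)
    then obtain g1 g2 where x: "g1 \<in> Rib (restr B ls)" "g2 \<in> Rib (restr (S - B) ls)" "g = merge B (g1, g2)" by auto
    then show "g \<in> merge B ` ?D" using g(2) cut_merge[OF B(1) x(1,2)] by auto
  qed
  moreover have "inj_on (merge B) ?D" by (rule inj_on_subset[OF bij_betw_imp_inj_on[OF bij]]) auto
  ultimately show ?thesis by (simp add: bij_betw_def)
qed

lemma restr_all [simp]: "restr {..<length ls} ls = ls"
  by (rule nth_equalityI) simp_all

context specs
begin

text \<open>Sort the ribbon paths by the component B of s: the part on B is connected, the part on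
  the remaining sites is arbitrary, and weights multiply.\<close>

lemma component_recursion:
  assumes s: "s \<in> S" and S: "finite S"
  shows "infsum cw (Rib (restr S ls)) =
    (\<Sum>B | s \<in> B \<and> B \<subseteq> S. infsum cw {g \<in> Rib (restr B ls). connected_on B g} * infsum cw (Rib (restr (S - B) ls)))"
proof -
  let ?I = "{B. s \<in> B \<and> B \<subseteq> S}"
  let ?P = "\<lambda>B. {g \<in> Rib (restr S ls). {b. (s, b) \<in> reach g} = B}"
  have "Rib (restr S ls) = (\<Union>B\<in>?I. ?P B)"
  proof (intro set_eqI iffI)
    fix g assume g: "g \<in> Rib (restr S ls)"
    have "b \<in> S" if "(s, b) \<in> (site_edges g \<union> (site_edges g)\<inverse>)\<^sup>*" for b
      using that by induction (use s site_edges_restr[OF g] in auto)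
    then have "{b. (s, b) \<in> reach g} \<in> ?I" by (auto simp: reach_refl reach_def)
    then show "g \<in> (\<Union>B\<in>?I. ?P B)" using g by blast
  qed auto
  then have "infsum cw (Rib (restr S ls)) = infsum cw (\<Union>B\<in>?I. ?P B)" by simp
  also have "\<dots> = (\<Sum>B\<in>?I. infsum cw (?P B))"
    by (rule infsum_finite_Union[THEN conjunct2]) (use S in \<open>auto intro: cw_summable[of _ "restr S ls"]\<close>)
  also have "\<dots> = (\<Sum>B\<in>?I. infsum cw {g \<in> Rib (restr B ls). connected_on B g} * infsum cw (Rib (restr (S - B) ls)))"
  proof (rule sum.cong)
    fix B assume "B \<in> ?I"
    then have B: "B \<subseteq> S" "s \<in> B" by auto
    let ?C = "{g \<in> Rib (restr B ls). connected_on B g}" and ?R = "Rib (restr (S - B) ls)"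
    have "infsum cw (?P B) = infsum (\<lambda>x. cw (merge B x)) (?C \<times> ?R)"
      by (rule infsum_reindex_bij_betw[OF bij_merge_component[OF B], symmetric])
    also have "\<dots> = infsum (\<lambda>(g, g'). cw g * cw g') (?C \<times> ?R)"
      by (rule infsum_cong) (auto simp: cw_merge[OF B(1)])
    also have "\<dots> = infsum cw ?C * infsum cw ?R"
    proof (rule infsum_times)
      show "(\<lambda>x. cmod (cw x)) summable_on ?C"
        by (rule summable_on_subset_banach[OF cw_abs_summable[of "restr B ls"]]) auto
    qed (rule cw_abs_summable)
    finally show "infsum cw (?P B) = infsum cw ?C * infsum cw ?R" .
  qed simp
  finally show ?thesis .
qed

text \<open>A connected graph on n sites has at least n - 1 edges, and different pairings may join
  the same two sites.\<close>

lemma connected_card: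
  assumes "g \<in> Rib ls" "connected_ribbon g" "ls \<noteq> []"
  shows "length ls - 1 \<le> card (snd g)"
proof -
  obtain gs ps where g: "g = (gs, ps)" by (cases g)
  have v: "valid ls gs" and p: "ps \<in> ppairs gs" using assms(1) by (auto simp: g Rib_def ribbon_iff)
  have fin: "finite ps" by (rule finite_ppairs[OF p])
  have l: "length (fst g) = length ls" using v by (simp add: g valid_def)
  have E: "site_edges g = (\<lambda>(x, y). (fst x, fst y)) ` ps" by (simp add: g site_edges_def)
  have "card {..<length ls} \<le> card (site_edges g) + 1"
  proof (rule connected_edges)
    show "site_edges g \<subseteq> {..<length ls} \<times> {..<length ls}"
      using site_edges_restr[of g "{..<length ls}" ls] assms(1) by simp
    show "(a, b) \<in> (site_edges g \<union> (site_edges g)\<inverse>)\<^sup>*" if "a \<in> {..<length ls}" "b \<in> {..<length ls}" for a b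
      using assms(2) that l by (auto simp: connected_ribbon_def)
  qed (use fin E in auto)
  moreover have "card (site_edges g) \<le> card ps" unfolding E by (rule card_image_le[OF fin])
  ultimately show ?thesis by (simp add: g)
qed

lemma infsum_cw_ribbon_paths:
  "infsum cw (Rib ls) = (\<Sum>q = 0..sum_list ls div 2. \<Sum>m = 0..sum_list ls.
     Y_coeff ls q m Vout Vin * of_real h ^ q * of_real e ^ m)"
proof -
  have "ribbon_paths ls q m = {g \<in> Rib ls. card (snd g) = q \<and> card (slides (fst g)) = m}" for q m
    by (auto simp: ribbon_paths_def Rib_def)
  then show ?thesis
    using infsum_cw_levels[of "Rib ls" ls "{0..sum_list ls div 2}" "\<lambda>q. q"] Rib_bounds(1)[of _ ls]
    by (simp add: Y_coeff_def)
qed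

lemma infsum_cw_connected:
  assumes n: "length ls = n" "n \<ge> 1"
  shows "infsum cw {g \<in> Rib ls. connected_ribbon g} =
    (\<Sum>g | int g \<le> int (sum_list ls div 2) - int n + 1. \<Sum>m = 0..sum_list ls.
       W_coeff ls g m Vout Vin * of_real h ^ (n - 1 + g) * of_real e ^ m)"
proof -
  let ?R = "{g \<in> Rib ls. connected_ribbon g}"
  \<comment> \<open>The bound is compared in the integers: if at most n - 2 pairings fit, the range
    is empty, in accordance with the absence of connected ribbon paths.\<close>
  let ?Q = "{g. int g \<le> int (sum_list ls div 2) - int n + 1}"
  have Q: "\<exists>q\<in>?Q. card (snd g) = n - 1 + q" if "g \<in> ?R" for g
  proof
    have "ls \<noteq> []" using n by auto
    then have "n - 1 \<le> card (snd g)" using connected_card[of g ls] that n(1) by auto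
    moreover have "card (snd g) \<le> sum_list ls div 2" using Rib_bounds(1) that by blast
    ultimately show "card (snd g) = n - 1 + (card (snd g) - (n - 1))" "card (snd g) - (n - 1) \<in> ?Q" using n(2) by auto
  qed
  have "finite ?Q" by (rule finite_subset[of _ "{..sum_list ls div 2}"]) (use n(2) in auto)
  moreover have "connected_ribbon_paths ls g m = {x \<in> ?R. card (snd x) = n - 1 + g \<and> card (slides (fst x)) = m}" for g m
    using n(1) by (auto simp: connected_ribbon_paths_def ribbon_paths_def Rib_def)
  ultimately show ?thesis
    using infsum_cw_levels[of ?R ls ?Q "\<lambda>q. n - 1 + q", OF _ _ Q] by (simp add: W_coeff_def inj_on_def)
qed

end

context jack_spec
begin

lemma X_nth: "X ls l = (\<Prod>a<length ls. T_up e h l (ls ! a))"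
  by (simp add: X_def prod.list_conv_set_nth atLeast0LessThan)

lemma joint_moment_eq:
  assumes "B \<subseteq> {..<length ls}"
  shows "complex_of_real (joint_moment J B (\<lambda>a l. T_up e h l (ls ! a))) = infsum cw (Rib (restr B ls))"
proof -
  have "X (restr B ls) l = (\<Prod>a\<in>B. T_up e h l (ls ! a))" for l
  proof -
    have "X (restr B ls) l = (\<Prod>a<length ls. if a \<in> B then T_up e h l (ls ! a) else 1)"
      unfolding X_nth by (intro prod.cong) (auto simp: T_up_0)
    also have "\<dots> = (\<Prod>a\<in>B. T_up e h l (ls ! a))"
      using assms by (simp add: prod.inter_restrict[symmetric] Int_absorb1)
    finally show ?thesis .
  qed
  then show ?thesis unfolding joint_moment_def using moment(2)[of "restr B ls"] by simp
qed

text \<open>Connected sums and moments of subfamilies satisfy the recursion that characterizes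
  \<open>cumulant_sum\<close>; its normalization at the empty set holds because the measure has
  total mass 1.\<close>

theorem cumulant:
  assumes "ls \<noteq> []"
  shows "complex_of_real (joint_cumulant J (length ls) (\<lambda>a l. T_up e h l (ls ! a))) =
    infsum cw {g \<in> Rib ls. connected_ribbon g}"
proof -
  let ?N = "{..<length ls}"
  define ZZ where "ZZ B = infsum cw (Rib (restr B ls))" for B
  define KK where "KK B = infsum cw {g \<in> Rib (restr B ls). connected_on B g}" for B
  have "KK ?N = cumulant_sum ZZ ?N"
  proof (rule cumulant_sum_unique[of ?N])
    have "complex_of_real (LINT l|J. X [] l) = 1"
      unfolding moment(2)[of "[]"] by (simp add: Rib_Nil cw_def ribbon_weight_def slides_def steps_def)
    then have "complex_of_real (joint_moment J {} (\<lambda>a l. T_up e h l (ls ! a))) = 1" by (simp add: joint_moment_def X_def)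
    then show "ZZ {} = 1" using joint_moment_eq[of "{}" ls] by (simp add: ZZ_def)
    show "ZZ S = (\<Sum>B | s \<in> B \<and> B \<subseteq> S. KK B * ZZ (S - B))" if "S \<subseteq> ?N" "s \<in> S" for S s
      unfolding ZZ_def KK_def using that finite_subset by (intro component_recursion) auto
  qed (use assms in auto)
  also have "\<dots> = complex_of_real (joint_cumulant J (length ls) (\<lambda>a l. T_up e h l (ls ! a)))"
  proof -
    have "(\<Prod>B\<in>\<pi>. ZZ B) = complex_of_real (\<Prod>B\<in>\<pi>. joint_moment J B (\<lambda>a l. T_up e h l (ls ! a)))" if "partition_on ?N \<pi>" for \<pi>
      unfolding ZZ_def of_real_prod
      by (intro prod.cong refl joint_moment_eq[symmetric]) (use that in \<open>auto simp: partition_on_def\<close>)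
    then show ?thesis unfolding cumulant_sum_def joint_cumulant_def by simp
  qed
  also have "KK ?N = infsum cw {g \<in> Rib ls. connected_ribbon g}"
  proof -
    have "length (fst g) = length ls" if "g \<in> Rib ls" for g
      using that by (cases g) (auto simp: Rib_def ribbon_iff valid_def)
    then have "{g \<in> Rib ls. connected_on ?N g} = {g \<in> Rib ls. connected_ribbon g}"
      by (auto simp: connected_ribbon_iff)
    then show ?thesis by (simp add: KK_def)
  qed
  finally show ?thesis by (rule sym)
qed

end

theorem theorem4p3p1:
  fixes e h A r :: real
    and Vout Vin :: "nat \<Rightarrow> complex"
    and n :: nat
    and ls :: "nat list"
  assumes "h > 0"
    and "defines_jack_measure e h Vout Vin"
    and "A > 0" and "0 < r" and "r < 1"
    and "\<And>k. k \<ge> 1 \<Longrightarrow> max (cmod (Vout k)) (cmod (Vin k)) \<le> A * r ^ k"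
    and "n \<ge> 1" and "length ls = n"
  shows
    "((\<forall>q m. ribbon_weight Vout Vin summable_on ribbon_paths ls q m) \<and>
      integrable (jack_measure e h Vout Vin) (\<lambda>l. \<Prod>a<n. T_up e h l (ls ! a)) \<and>
      complex_of_real (LINT l|jack_measure e h Vout Vin. (\<Prod>a<n. T_up e h l (ls ! a))) =
        (\<Sum>q = 0..sum_list ls div 2. \<Sum>m = 0..sum_list ls.
           Y_coeff ls q m Vout Vin * complex_of_real h ^ q * complex_of_real e ^ m)) \<and>
     ((\<forall>g m. ribbon_weight Vout Vin summable_on connected_ribbon_paths ls g m) \<and>
      complex_of_real
        (joint_cumulant (jack_measure e h Vout Vin) n (\<lambda>a l. T_up e h l (ls ! a))) =
        (\<Sum>g | int g \<le> int (sum_list ls div 2) - int n + 1. \<Sum>m = 0..sum_list ls.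
           W_coeff ls g m Vout Vin * complex_of_real h ^ (n - 1 + g) * complex_of_real e ^ m))"
proof -
  have V: "cmod (Vout k) \<le> A * r ^ k" "cmod (Vin k) \<le> A * r ^ k" if "k \<ge> 1" for k
    using assms(6)[OF that] by auto
  interpret jack_spec e h A r Vout Vin
    by unfold_locales (use assms V in auto)
  have X: "X ls = (\<lambda>l. \<Prod>a<n. T_up e h l (ls ! a))" using assms(8) by (intro ext) (simp add: X_nth)
  have sub: "connected_ribbon_paths ls g m \<subseteq> Rib ls" for g m
    by (rule order_trans[OF _ ribbon_paths_Rib]) (auto simp: connected_ribbon_paths_def)
  have "ls \<noteq> []" using assms(7,8) by auto
  then show ?thesis
    using rw_summable[OF ribbon_paths_Rib[of ls]] rw_summable[OF sub]
      moment[of ls, unfolded X] infsum_cw_ribbon_paths[of ls]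
      cumulant[of ls] infsum_cw_connected[OF assms(8,7)] assms(8)
    by (intro conjI allI) auto
qed


end
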